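(* Let $u\in BV([0,T];X)$ be a local solution of the rate-independent system $(X,\mathcal E,\Psi_0)$. Then $u$ is a $BV$ solution of $(X,\mathcal E,\mathfrak p)$ if and only if at every jump time $t\in J_u$ the initial and final values $u(t_-)$ and $u(t_+)$ can be connected by an optimal transition curve $\vartheta^t\in\Theta(t;u(t_-),u(t_+))$, and there exists $r\in[0,1]$ such that $u(t)=\vartheta^t(r)$. Any optimal transition curve $\vartheta$ (parametrized on $[0,1]$) satisfies the contact condition $$(\dot\vartheta(r),-D\mathcal E_t(\vartheta(r)))\in\Sigma_{\mathfrak p}\quad\text{for a.a. }r\in(0,1).$$
   Context: Let $(X,\|\cdot\|_X)$ be a finite-dimensional real normed vector space with dual $X^*$ and pairing $\langle\cdot,\cdot\rangle$, and let $T>0$. $\Psi_0:X\to[0,+\infty)$ is a gauge: $\Psi_0(v)>0$ if $v\neq0$, $\Psi_0(v_1+v_2)\le\Psi_0(v_1)+\Psi_0(v_2)$, $\Psi_0(\lambda v)=\lambda\Psi_0(v)$ for all $\lambda\ge0$, $v,v_1,v_2\in X$. $K^*:=\{w\in X^*:\langle w,z\rangle\le\Psi_0(z)\ \forall z\in X\}$ and $\Psi_{0*}(w):=\sup_{v\ne0}\langle w,v\rangle/\Psi_0(v)$. The energy $\mathcal E\in C^1([0,T]\times X)$, written $\mathcal E_t(u)$, satisfies for some $C>0$ and all $(t,u)$: $\mathcal E_t(u)\ge -C$ and $|\partial_t\mathcal E_t(u)|\le C(1+\mathcal E_t(u)^+)$, with $(\cdot)^+$ the positive part; $D\mathcal E_t(u)\in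 X^*$ is the differential in $u$. Viscosity: $\Psi:X\to[0,+\infty)$ is convex, $\Psi(0)=0$, $\Psi(v)/\|v\|_X\to+\infty$ as $\|v\|_X\to+\infty$; for $\varepsilon>0$, $\Psi_\varepsilon(v):=\varepsilon^{-1}\Psi(\varepsilon v)$, and $\Psi_0(v)=\lim_{\varepsilon\downarrow0}\Psi_\varepsilon(v)$ for every $v$. The Legendre conjugate is $\Psi_\varepsilon^*=\varepsilon^{-1}\Psi^*$. The vanishing viscosity contact potential is $\mathfrak p(v,w):=\inf_{\varepsilon>0}\big(\Psi_\varepsilon(v)+\Psi_\varepsilon^*(w)\big)$, $v\in X$, $w\in X^*$. Its contact set is $\Sigma_{\mathfrak p}:=\{(v,w)\in X\times X^*:\mathfrak p(v,w)=\langle w,v\rangle\}$. BV functions: elements of $BV([0,T];X)$ are defined at every point and have finite pointwise total variation $\mathrm{Var}_{\Psi_0}(u;[0,T])$, where $\mathrm{Var}_{\Psi_0}(u;[a,b]):=\sup\{\sum_{m=1}^M\Psi_0(u(t_m)-u(t_{m-1})):a=t_0<\dots<t_M=b\}$. $u(t_\pm)$ are the right/left limits, with $u(0_-):=u(0)$, $u(T_+):=u(T)$; $J_u:=\{t\in[0,T]:u(t_-)\ne u(t)\text{ or }u(t)\neq u(t_+)\}$. The distributional derivative splits as $u'=u'_{\mathscr L}+u'_{\rm C}+u'_{J}$ (absolutely continuous, Cantor, jump part); $u'_{\rm co}:=u'_{\mathscr L}+u'_{\rm C}$ and $\mu:=\mathscr L^1+|u'_{\rm C}|$. Finsler cost: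 $\Delta_{\mathfrak p,\mathcal E}(t;u_0,u_1):=\inf\big\{\int_{r_0}^{r_1}\mathfrak p(\dot\vartheta(r),-D\mathcal E_t(\vartheta(r)))\,\mathrm dr:\ \vartheta\in AC([r_0,r_1];X),\ \vartheta(r_0)=u_0,\ \vartheta(r_1)=u_1\big\}$, and $\Delta_{\mathfrak p,\mathcal E}(t;u_-,u,u_+):=\Delta_{\mathfrak p,\mathcal E}(t;u_-,u)+\Delta_{\mathfrak p,\mathcal E}(t;u,u_+)$. Pseudo-total variation: $$\mathit{Var}_{\mathfrak p,\mathcal E}(u;[a,b]):=\int_a^b\Psi_0\Big(\frac{\mathrm d u'_{\rm co}}{\mathrm d\mu}\Big)\mathrm d\mu+\Delta_{\mathfrak p,\mathcal E}(a;u(a),u(a_+))+\Delta_{\mathfrak p,\mathcal E}(b;u(b_-),u(b))+\sum_{t\in J_u\cap(a,b)}\Delta_{\mathfrak p,\mathcal E}(t;u(t_-),u(t),u(t_+)).$$ Local solution of $(X,\mathcal E,\Psi_0)$: $u\in BV([0,T];X)$ with $-D\mathcal E_t(u(t))\in K^*$ for every $t\in[0,T]\setminus J_u$ and $\mathcal E_{t_1}(u(t_1))+\mathrm{Var}_{\Psi_0}(u;[t_0,t_1])\le\mathcal E_{t_0}(u(t_0))+\int_{t_0}^{t_1}\partial_t\mathcal E_t(u(t))\,\mathrm dt$ for all $0\le t_0<t_1\le T$. $BV$ solution of $(X,\mathcal E,\mathfrak p)$: $u\in BV([0,T];X)$ with $-D\mathcal E_t(u(t))\in K^*$ for a.a.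 $t\in[0,T]\setminus J_u$ and, for all $t\in[0,T]$, $\mathit{Var}_{\mathfrak p,\mathcal E}(u;[0,t])+\mathcal E_t(u(t))=\mathcal E_0(u(0))+\int_0^t\partial_t\mathcal E_s(u(s))\,\mathrm ds$. Optimal transitions: let $t\in[0,T]$, let $u_-,u_+\in X$ with $-D\mathcal E_t(u_-)\in K^*$ and $-D\mathcal E_t(u_+)\in K^*$, and let $-\infty\le r_0<r_1\le+\infty$. An absolutely continuous curve $\vartheta:[r_0,r_1]\to X$ with $\vartheta(r_0)=u_-$, $\vartheta(r_1)=u_+$ is an optimal $(\mathfrak p,\mathcal E_t)$-transition between $u_-$ and $u_+$ if: $\dot\vartheta(r)\ne0$ for a.a. $r\in(r_0,r_1)$; $\Psi_{0*}(-D\mathcal E_t(\vartheta(r)))\ge1$ for all $r\in[r_0,r_1]$; and $\mathcal E_t(u_-)-\mathcal E_t(u_+)=\Delta_{\mathfrak p,\mathcal E}(t;u_-,u_+)=\int_{r_0}^{r_1}\mathfrak p(\dot\vartheta(r),-D\mathcal E_t(\vartheta(r)))\,\mathrm dr$. $\Theta(t;u_-,u_+)$ denotes the (possibly empty) collection of such optimal transitions with normalized domain $[0,1]$ and constant Finsler velocity $\mathfrak p(\dot\vartheta(r),-D\mathcal E_t(\vartheta(r)))\equiv\mathcal E_t(u_-)-\mathcal E_t(u_+)$ for a.a. $r\in(0,1)$.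
   Formalization: The pseudo-total variation on the degenerate interval [0,0] is taken to be 0 (else no BV solution could jump at t=0), and optimal transitions are not required to have stable end points, since u(0) and u(T) may be unstable at a jump; for stable end points the notion is unchanged. *)

theory Defs
  imports "HOL-Analysis.Analysis"
begin

section \<open>Dissipation potentials\<close>

text \<open>The dual space is \<^typ>\<open>'a \<Rightarrow>\<^sub>L real\<close>, and the pairing is the application of such a functional.\<close>

definition gauge_potential :: "('a::real_normed_vector \<Rightarrow> real) \<Rightarrow> bool" where
  "gauge_potential \<Psi>0 \<longleftrightarrow>
     (\<forall>v. \<Psi>0 v \<ge> 0) \<and> (\<forall>v. v \<noteq> 0 \<longrightarrow> \<Psi>0 v > 0) \<and>
     (\<forall>v1 v2. \<Psi>0 (v1 + v2) \<le> \<Psi>0 v1 + \<Psi>0 v2) \<and>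
     (\<forall>c\<ge>0. \<forall>v. \<Psi>0 (c *\<^sub>R v) = c * \<Psi>0 v)"

definition stable_set :: "('a::real_normed_vector \<Rightarrow> real) \<Rightarrow> ('a \<Rightarrow>\<^sub>L real) set" where
  "stable_set \<Psi>0 = {w. \<forall>z. blinfun_apply w z \<le> \<Psi>0 z}"

definition dual_gauge :: "('a::real_normed_vector \<Rightarrow> real) \<Rightarrow> ('a \<Rightarrow>\<^sub>L real) \<Rightarrow> ereal" where
  "dual_gauge \<Psi>0 w = (SUP v\<in>{v. v \<noteq> 0}. ereal (blinfun_apply w v / \<Psi>0 v))"

definition viscous_potential :: "('a::real_normed_vector \<Rightarrow> real) \<Rightarrow> bool" where
  "viscous_potential \<Psi> \<longleftrightarrow>
     (\<forall>v. \<Psi> v \<ge> 0) \<and> convex_on UNIV \<Psi> \<and> \<Psi> 0 = 0 \<and>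
     filterlim (\<lambda>v. \<Psi> v / norm v) at_top at_infinity"

definition rescaled :: "('a::real_normed_vector \<Rightarrow> real) \<Rightarrow> real \<Rightarrow> 'a \<Rightarrow> real" where
  "rescaled \<Psi> \<epsilon> v = \<Psi> (\<epsilon> *\<^sub>R v) / \<epsilon>"

text \<open>The real supremum below is used only for functions of superlinear growth that are bounded
  from below, for which it is finite. The infimum in \<open>contact_potential\<close> is over nonnegative
  numbers whenever \<open>\<Psi>\<close> is such a potential.\<close>

definition legendre_conj :: "('a::real_normed_vector \<Rightarrow> real) \<Rightarrow> ('a \<Rightarrow>\<^sub>L real) \<Rightarrow> real" where
  "legendre_conj F w = (SUP v. blinfun_apply w v - F v)"

definition contact_potential ::
    "('a::real_normed_vector \<Rightarrow> real) \<Rightarrow> 'a \<Rightarrow> ('a \<Rightarrow>\<^sub>L real) \<Rightarrow> real" where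
  "contact_potential \<Psi> v w =
     (INF \<epsilon>\<in>{0<..}. rescaled \<Psi> \<epsilon> v + legendre_conj (rescaled \<Psi> \<epsilon>) w)"

definition contact_set ::
    "('a::real_normed_vector \<Rightarrow> ('a \<Rightarrow>\<^sub>L real) \<Rightarrow> real) \<Rightarrow> ('a \<times> ('a \<Rightarrow>\<^sub>L real)) set" where
  "contact_set p = {(v, w). p v w = blinfun_apply w v}"


section \<open>Energies\<close>

text \<open>The continuous functions \<open>dtE\<close> and \<open>DE\<close> are the partial derivative in time and the
  differential in space of \<open>E\<close>; they are determined by \<open>E\<close> on \<open>{0..T} \<times> UNIV\<close>.\<close>

definition C1_energy ::
    "real \<Rightarrow> (real \<Rightarrow> 'a::real_normed_vector \<Rightarrow> real) \<Rightarrow> (real \<Rightarrow> 'a \<Rightarrow> real) \<Rightarrow>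
     (real \<Rightarrow> 'a \<Rightarrow> ('a \<Rightarrow>\<^sub>L real)) \<Rightarrow> bool" where
  "C1_energy T E dtE DE \<longleftrightarrow>
     (\<forall>t\<in>{0..T}. \<forall>x. ((\<lambda>(s, y). E s y) has_derivative
         (\<lambda>(\<tau>, h). \<tau> * dtE t x + blinfun_apply (DE t x) h)) (at (t, x) within {0..T} \<times> UNIV)) \<and>
     continuous_on ({0..T} \<times> UNIV) (\<lambda>(t, x). dtE t x) \<and>
     continuous_on ({0..T} \<times> UNIV) (\<lambda>(t, x). DE t x)"

definition energy_bounds ::
    "real \<Rightarrow> (real \<Rightarrow> 'a \<Rightarrow> real) \<Rightarrow> (real \<Rightarrow> 'a \<Rightarrow> real) \<Rightarrow> bool" where
  "energy_bounds T E dtE \<longleftrightarrow>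
     (\<exists>C>0. \<forall>t\<in>{0..T}. \<forall>x. E t x \<ge> - C \<and> \<bar>dtE t x\<bar> \<le> C * (1 + max 0 (E t x)))"


section \<open>Functions of bounded variation\<close>

definition gauge_var ::
    "('a::real_normed_vector \<Rightarrow> real) \<Rightarrow> (real \<Rightarrow> 'a) \<Rightarrow> real \<Rightarrow> real \<Rightarrow> ennreal" where
  "gauge_var \<Psi>0 u a b =
     Sup {\<Sum>m<M. ennreal (\<Psi>0 (u (s (Suc m)) - u (s m))) | (s :: nat \<Rightarrow> real) M.
            s 0 = a \<and> s M = b \<and> (\<forall>m<M. s m < s (Suc m))}"

definition BV_fun :: "real \<Rightarrow> ('a::real_normed_vector \<Rightarrow> real) \<Rightarrow> (real \<Rightarrow> 'a) \<Rightarrow> bool" where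
  "BV_fun T \<Psi>0 u \<longleftrightarrow> gauge_var \<Psi>0 u 0 T < \<infinity>"

definition left_lim :: "(real \<Rightarrow> 'a::t2_space) \<Rightarrow> real \<Rightarrow> 'a" where
  "left_lim u t = (if t = 0 then u 0 else Lim (at_left t) u)"

definition right_lim :: "real \<Rightarrow> (real \<Rightarrow> 'a::t2_space) \<Rightarrow> real \<Rightarrow> 'a" where
  "right_lim T u t = (if t = T then u T else Lim (at_right t) u)"

definition jump_set :: "real \<Rightarrow> (real \<Rightarrow> 'a::t2_space) \<Rightarrow> real set" where
  "jump_set T u = {t\<in>{0..T}. left_lim u t \<noteq> u t \<or> u t \<noteq> right_lim T u t}"


subsection \<open>Vector measures\<close>

text \<open>A vector measure on the Borel sets of the real line is a countably additive set function;
  it is given the value 0 on all other sets.\<close>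

definition vector_measure :: "(real set \<Rightarrow> 'a::real_normed_vector) \<Rightarrow> bool" where
  "vector_measure \<nu> \<longleftrightarrow>
     (\<forall>A. A \<notin> sets borel \<longrightarrow> \<nu> A = 0) \<and>
     (\<forall>F :: nat \<Rightarrow> real set. range F \<subseteq> sets borel \<longrightarrow> disjoint_family F \<longrightarrow>
        (\<lambda>i. \<nu> (F i)) sums \<nu> (\<Union>i. F i))"

definition total_variation :: "(real set \<Rightarrow> 'a::real_normed_vector) \<Rightarrow> real set \<Rightarrow> ennreal" where
  "total_variation \<nu> A =
     (SUP P\<in>{P. finite P \<and> P \<subseteq> sets borel \<and> disjoint P \<and> \<Union>P = A}. \<Sum>B\<in>P. ennreal (norm (\<nu> B)))"

definition variation_measure :: "(real set \<Rightarrow> 'a::real_normed_vector) \<Rightarrow> real measure" where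
  "variation_measure \<nu> = measure_of UNIV (sets borel) (total_variation \<nu>)"

text \<open>The Radon--Nikodym density of \<open>\<nu>\<close> with respect to the positive measure \<open>M\<close>.\<close>

definition vector_density ::
    "(real set \<Rightarrow> 'a::{banach, second_countable_topology}) \<Rightarrow> real measure \<Rightarrow> real \<Rightarrow> 'a" where
  "vector_density \<nu> M =
     (SOME g. integrable M g \<and> (\<forall>A\<in>sets borel. \<nu> A = set_lebesgue_integral M A g))"

text \<open>The integral of a scalar function against \<open>\<nu>\<close> is defined by the polar decomposition of \<open>\<nu>\<close>.\<close>

definition vector_integral ::
    "(real set \<Rightarrow> 'a::{banach, second_countable_topology}) \<Rightarrow> (real \<Rightarrow> real) \<Rightarrow> 'a" where
  "vector_integral \<nu> \<phi> =
     (LINT x|variation_measure \<nu>. \<phi> x *\<^sub>R vector_density \<nu> (variation_measure \<nu>) x)"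


subsection \<open>The distributional derivative and its parts\<close>

definition test_function :: "real \<Rightarrow> (real \<Rightarrow> real) \<Rightarrow> bool" where
  "test_function T \<phi> \<longleftrightarrow>
     (\<forall>n x. (deriv ^^ n) \<phi> differentiable (at x)) \<and>
     (\<exists>a b. 0 < a \<and> b < T \<and> (\<forall>x. x \<notin> {a..b} \<longrightarrow> \<phi> x = 0))"

text \<open>The derivative on the open interval \<open>{0<..<T}\<close>, as a measure on the line that lives there.
  It does not see jumps of \<open>u\<close> at the two end points.\<close>

definition distributional_derivative ::
    "real \<Rightarrow> (real \<Rightarrow> 'a::{banach, second_countable_topology}) \<Rightarrow> (real set \<Rightarrow> 'a) \<Rightarrow> bool" where
  "distributional_derivative T u \<nu> \<longleftrightarrow>
     vector_measure \<nu> \<and>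
     (\<forall>A\<in>sets borel. \<nu> A = \<nu> (A \<inter> {0<..<T})) \<and>
     (\<forall>\<phi>. test_function T \<phi> \<longrightarrow>
        vector_integral \<nu> \<phi> = - (LINT t:{0..T}|lborel. deriv \<phi> t *\<^sub>R u t))"

text \<open>Splitting into an absolutely continuous part, a part that is singular but has no atoms
  (Cantor part), and a purely atomic part (jump part). The splitting is unique.\<close>

definition derivative_parts ::
    "real \<Rightarrow> (real \<Rightarrow> 'a::{banach, second_countable_topology}) \<Rightarrow>
     (real set \<Rightarrow> 'a) \<Rightarrow> (real set \<Rightarrow> 'a) \<Rightarrow> (real set \<Rightarrow> 'a) \<Rightarrow> bool" where
  "derivative_parts T u \<nu>L \<nu>C \<nu>J \<longleftrightarrow>
     vector_measure \<nu>L \<and> vector_measure \<nu>C \<and> vector_measure \<nu>J \<and>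
     distributional_derivative T u (\<lambda>A. \<nu>L A + \<nu>C A + \<nu>J A) \<and>
     (\<forall>A\<in>null_sets lborel. \<nu>L A = 0) \<and>
     (\<exists>N\<in>null_sets lborel. \<forall>A\<in>sets borel. \<nu>C A = \<nu>C (A \<inter> N)) \<and> (\<forall>x. \<nu>C {x} = 0) \<and>
     (\<exists>S. countable S \<and> (\<forall>A\<in>sets borel. \<nu>J A = \<nu>J (A \<inter> S)))"

definition deriv_parts ::
    "real \<Rightarrow> (real \<Rightarrow> 'a::{banach, second_countable_topology}) \<Rightarrow>
     (real set \<Rightarrow> 'a) \<times> (real set \<Rightarrow> 'a) \<times> (real set \<Rightarrow> 'a)" where
  "deriv_parts T u = (SOME (\<nu>L, \<nu>C, \<nu>J). derivative_parts T u \<nu>L \<nu>C \<nu>J)"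

definition cantor_part ::
    "real \<Rightarrow> (real \<Rightarrow> 'a::{banach, second_countable_topology}) \<Rightarrow> real set \<Rightarrow> 'a" where
  "cantor_part T u = (case deriv_parts T u of (\<nu>L, \<nu>C, \<nu>J) \<Rightarrow> \<nu>C)"

definition continuous_part ::
    "real \<Rightarrow> (real \<Rightarrow> 'a::{banach, second_countable_topology}) \<Rightarrow> real set \<Rightarrow> 'a" where
  "continuous_part T u = (case deriv_parts T u of (\<nu>L, \<nu>C, \<nu>J) \<Rightarrow> (\<lambda>A. \<nu>L A + \<nu>C A))"

definition diffuse_measure ::
    "real \<Rightarrow> (real \<Rightarrow> 'a::{banach, second_countable_topology}) \<Rightarrow> real measure" where
  "diffuse_measure T u = measure_of UNIV (sets borel)
     (\<lambda>A. emeasure lborel A + emeasure (variation_measure (cantor_part T u)) A)"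


section \<open>Finsler cost and pseudo-total variation\<close>

definition abs_cont_on :: "real \<Rightarrow> real \<Rightarrow> (real \<Rightarrow> 'a::real_normed_vector) \<Rightarrow> bool" where
  "abs_cont_on a b \<theta> \<longleftrightarrow>
     (\<forall>\<epsilon>>0. \<exists>\<delta>>0. \<forall>(n::nat) (l::nat \<Rightarrow> real) (r::nat \<Rightarrow> real).
        (\<forall>i<n. a \<le> l i \<and> l i \<le> r i \<and> r i \<le> b) \<longrightarrow>
        disjoint_family_on (\<lambda>i. {l i<..<r i}) {..<n} \<longrightarrow>
        (\<Sum>i<n. r i - l i) < \<delta> \<longrightarrow>
        (\<Sum>i<n. norm (\<theta> (r i) - \<theta> (l i))) < \<epsilon>)"

text \<open>\<open>p (\<theta>'(r), - DE t (\<theta>(r)))\<close>; at the null set of points where an absolutely continuous \<open>\<theta>\<close>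
  is not differentiable, \<^const>\<open>vector_derivative\<close> has an irrelevant value.\<close>

definition finsler_velocity ::
    "('a::real_normed_vector \<Rightarrow> ('a \<Rightarrow>\<^sub>L real) \<Rightarrow> real) \<Rightarrow> (real \<Rightarrow> 'a \<Rightarrow> ('a \<Rightarrow>\<^sub>L real)) \<Rightarrow>
     real \<Rightarrow> (real \<Rightarrow> 'a) \<Rightarrow> real \<Rightarrow> real" where
  "finsler_velocity p DE t \<theta> r = p (vector_derivative \<theta> (at r)) (- DE t (\<theta> r))"

definition finsler_length ::
    "('a::real_normed_vector \<Rightarrow> ('a \<Rightarrow>\<^sub>L real) \<Rightarrow> real) \<Rightarrow> (real \<Rightarrow> 'a \<Rightarrow> ('a \<Rightarrow>\<^sub>L real)) \<Rightarrow>
     real \<Rightarrow> real \<Rightarrow> real \<Rightarrow> (real \<Rightarrow> 'a) \<Rightarrow> ennreal" where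
  "finsler_length p DE t r0 r1 \<theta> =
     (\<integral>\<^sup>+r\<in>{r0..r1}. ennreal (finsler_velocity p DE t \<theta> r) \<partial>lborel)"

definition finsler_cost ::
    "('a::real_normed_vector \<Rightarrow> ('a \<Rightarrow>\<^sub>L real) \<Rightarrow> real) \<Rightarrow> (real \<Rightarrow> 'a \<Rightarrow> ('a \<Rightarrow>\<^sub>L real)) \<Rightarrow>
     real \<Rightarrow> 'a \<Rightarrow> 'a \<Rightarrow> ennreal" where
  "finsler_cost p DE t u0 u1 =
     Inf {finsler_length p DE t r0 r1 \<theta> | r0 r1 \<theta>.
            r0 < r1 \<and> abs_cont_on r0 r1 \<theta> \<and> \<theta> r0 = u0 \<and> \<theta> r1 = u1}"

text \<open>On a degenerate interval there is no variation. Inserting \<open>a = b = 0\<close> in the formula for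
  \<open>a < b\<close> would count the jump of \<open>u\<close> between \<open>u 0\<close> and its right limit, and the energy balance
  of a BV solution at the initial time would exclude a jump there.\<close>

definition pseudo_var ::
    "('a::{banach, second_countable_topology} \<Rightarrow> real) \<Rightarrow> ('a \<Rightarrow> ('a \<Rightarrow>\<^sub>L real) \<Rightarrow> real) \<Rightarrow>
     (real \<Rightarrow> 'a \<Rightarrow> ('a \<Rightarrow>\<^sub>L real)) \<Rightarrow> real \<Rightarrow> (real \<Rightarrow> 'a) \<Rightarrow> real \<Rightarrow> real \<Rightarrow> ennreal" where
  "pseudo_var \<Psi>0 p DE T u a b =
     (if a < b then
        (\<integral>\<^sup>+s\<in>{a..b}. ennreal (\<Psi>0 (vector_density (continuous_part T u) (diffuse_measure T u) s))
           \<partial>diffuse_measure T u)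
        + finsler_cost p DE a (u a) (right_lim T u a)
        + finsler_cost p DE b (left_lim u b) (u b)
        + (\<Sum>\<^sub>\<infinity>t\<in>jump_set T u \<inter> {a<..<b}.
             finsler_cost p DE t (left_lim u t) (u t) + finsler_cost p DE t (u t) (right_lim T u t))
      else 0)"


section \<open>Solutions and optimal transitions\<close>

definition local_solution ::
    "real \<Rightarrow> (real \<Rightarrow> 'a::real_normed_vector \<Rightarrow> real) \<Rightarrow> (real \<Rightarrow> 'a \<Rightarrow> real) \<Rightarrow>
     (real \<Rightarrow> 'a \<Rightarrow> ('a \<Rightarrow>\<^sub>L real)) \<Rightarrow> ('a \<Rightarrow> real) \<Rightarrow> (real \<Rightarrow> 'a) \<Rightarrow> bool" where
  "local_solution T E dtE DE \<Psi>0 u \<longleftrightarrow>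
     BV_fun T \<Psi>0 u \<and>
     (\<forall>t\<in>{0..T} - jump_set T u. - DE t (u t) \<in> stable_set \<Psi>0) \<and>
     (\<forall>t0 t1. 0 \<le> t0 \<longrightarrow> t0 < t1 \<longrightarrow> t1 \<le> T \<longrightarrow>
        ereal (E t1 (u t1)) + enn2ereal (gauge_var \<Psi>0 u t0 t1)
          \<le> ereal (E t0 (u t0) + (LINT t:{t0..t1}|lborel. dtE t (u t))))"

definition BV_solution ::
    "real \<Rightarrow> (real \<Rightarrow> 'a::{banach, second_countable_topology} \<Rightarrow> real) \<Rightarrow> (real \<Rightarrow> 'a \<Rightarrow> real) \<Rightarrow>
     (real \<Rightarrow> 'a \<Rightarrow> ('a \<Rightarrow>\<^sub>L real)) \<Rightarrow> ('a \<Rightarrow> real) \<Rightarrow> ('a \<Rightarrow> ('a \<Rightarrow>\<^sub>L real) \<Rightarrow> real) \<Rightarrow>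
     (real \<Rightarrow> 'a) \<Rightarrow> bool" where
  "BV_solution T E dtE DE \<Psi>0 p u \<longleftrightarrow>
     BV_fun T \<Psi>0 u \<and>
     (AE t in lborel. t \<in> {0..T} - jump_set T u \<longrightarrow> - DE t (u t) \<in> stable_set \<Psi>0) \<and>
     (\<forall>t\<in>{0..T}.
        enn2ereal (pseudo_var \<Psi>0 p DE T u 0 t) + ereal (E t (u t))
          = ereal (E 0 (u 0) + (LINT s:{0..t}|lborel. dtE s (u s))))"

text \<open>The definition does not require the end points \<open>um\<close> and \<open>up\<close> to be stable. In the cases of
  interest they are, with one exception: if a local solution jumps at \<open>t = 0\<close> or at \<open>t = T\<close>, then
  \<open>u 0 = left_lim u 0\<close> or \<open>u T = right_lim T u T\<close> may be unstable, and the same notion has to be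
  used there.\<close>

definition optimal_transition ::
    "(real \<Rightarrow> 'a::real_normed_vector \<Rightarrow> real) \<Rightarrow> (real \<Rightarrow> 'a \<Rightarrow> ('a \<Rightarrow>\<^sub>L real)) \<Rightarrow> ('a \<Rightarrow> real) \<Rightarrow>
     ('a \<Rightarrow> ('a \<Rightarrow>\<^sub>L real) \<Rightarrow> real) \<Rightarrow> real \<Rightarrow> 'a \<Rightarrow> 'a \<Rightarrow> real \<Rightarrow> real \<Rightarrow> (real \<Rightarrow> 'a) \<Rightarrow> bool" where
  "optimal_transition E DE \<Psi>0 p t um up r0 r1 \<theta> \<longleftrightarrow>
     r0 < r1 \<and> abs_cont_on r0 r1 \<theta> \<and> \<theta> r0 = um \<and> \<theta> r1 = up \<and>
     (AE r in lborel. r \<in> {r0<..<r1} \<longrightarrow> vector_derivative \<theta> (at r) \<noteq> 0) \<and>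
     (\<forall>r\<in>{r0..r1}. dual_gauge \<Psi>0 (- DE t (\<theta> r)) \<ge> 1) \<and>
     ereal (E t um - E t up) = enn2ereal (finsler_cost p DE t um up) \<and>
     finsler_cost p DE t um up = finsler_length p DE t r0 r1 \<theta>"

definition normalized_transitions ::
    "(real \<Rightarrow> 'a::real_normed_vector \<Rightarrow> real) \<Rightarrow> (real \<Rightarrow> 'a \<Rightarrow> ('a \<Rightarrow>\<^sub>L real)) \<Rightarrow> ('a \<Rightarrow> real) \<Rightarrow>
     ('a \<Rightarrow> ('a \<Rightarrow>\<^sub>L real) \<Rightarrow> real) \<Rightarrow> real \<Rightarrow> 'a \<Rightarrow> 'a \<Rightarrow> (real \<Rightarrow> 'a) set" where
  "normalized_transitions E DE \<Psi>0 p t um up =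
     {\<theta>. optimal_transition E DE \<Psi>0 p t um up 0 1 \<theta> \<and>
         (AE r in lborel. r \<in> {0<..<1} \<longrightarrow> finsler_velocity p DE t \<theta> r = E t um - E t up)}"

end

theory Submission
  imports Defs "HOL-Complex_Analysis.Great_Picard"
begin

text \<open>A local solution dissipates at least as much energy as its gauge variation, so the dissipated
  energy is a nondecreasing function of time whose right-continuous version defines a finite measure
  \<^term>\<open>V\<close> on the line. Off a countable set the energy identity, the chain rule and stability show
  that \<^term>\<open>V\<close> is the gauge of the diffuse derivative of \<^term>\<open>u\<close>: if \<^term>\<open>t\<close> is not a jump time
  and \<^term>\<open>s\<close> is close to \<^term>\<open>t\<close>, the stability inequality bounds the released energy from above
  by the gauge of the increment. The atoms of \<^term>\<open>V\<close> are the energies released in the jumps. So the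
  energy balance holds if and only if at each jump the Finsler costs from the left limit to
  \<^term>\<open>u t\<close> and from there to the right limit are equal to the energies released on the way,
  whereas they are always at least as large. Equality means that an optimal curve exists:
  minimizing curves, parametrized by their normalized cost, are equi-Lipschitz, their limit releases
  energy at constant rate, and a chain rule argument shows that this rate is its Finsler velocity.\<close>

section \<open>Finite-dimensional spaces and sublinear functions\<close>

text \<open>The space carries only a norm and a finite spanning set, so vector-valued facts
  (densities, derivatives, finite variation, measurability) are reduced to scalar ones through
  bounded coordinate functionals. Two obstacles shape the rest. Minimizing curves converge only
  uniformly, so their velocities are lost; minimality is therefore encoded in
  \<open>calibrated\<close>, whose clauses survive the passage to the limit, and derivatives are
  taken only afterwards. And \<open>u\<close> may jump on a dense set of times, so the comparison of
  released energy with the gauge of the increment holds only on one-sided neighbourhoods and has to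
  be glued by compactness; jumps inside small intervals contribute to both sides and cancel. The two
  directions are not symmetric: from the balance to the jumps it suffices that the terms of
  \<open>pseudo_var\<close> grow with time, followed by one-sided limits, while the converse needs
  the exact value of the diffuse dissipation. At the ends of the time interval only one half of a
  jump counts, since the other one-sided limit is \<open>u\<close> itself by convention.\<close>

lemma independent_coefficients_bound:
  fixes B :: "'a::real_normed_vector set"
  assumes "finite B" "independent B"
  shows "\<exists>C\<ge>0. \<forall>a. (\<Sum>b\<in>B. \<bar>a b\<bar>) \<le> C * norm (\<Sum>b\<in>B. a b *\<^sub>R b)"
  using assms
proof (induction B rule: finite_induct)
  case empty
  then show ?case by auto
next
  case (insert b B)
  have ind: "independent B" and b: "b \<notin> span B"
    using insert.prems insert.hyps(2) by (auto simp: independent_insert)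
  from insert.IH[OF ind] obtain C where C0: "C \<ge> 0"
    and C: "\<And>a. (\<Sum>b\<in>B. \<bar>a b\<bar>) \<le> C * norm (\<Sum>b\<in>B. a b *\<^sub>R b)" by blast
  \<comment> \<open>The span of \<open>B\<close> is closed: coefficients of combinations converging
    to \<open>b\<close> are Cauchy by the induction hypothesis, so \<open>b\<close> would lie in the
    span, against independence.\<close>
  have "\<exists>d>0. \<forall>a. d \<le> norm (b - (\<Sum>c\<in>B. a c *\<^sub>R c))"
  proof (rule ccontr)
    assume "\<not> ?thesis"
    then have "\<exists>a. norm (b - (\<Sum>c\<in>B. a c *\<^sub>R c)) < e" if "e > 0" for e
      using that by (meson not_le)
    then have "\<exists>a. norm (b - (\<Sum>c\<in>B. a c *\<^sub>R c)) < inverse (real (Suc n))" for n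
      by simp
    then obtain a where a: "\<And>n. norm (b - (\<Sum>c\<in>B. a n c *\<^sub>R c)) < inverse (real (Suc n))"
      by metis
    define y where "y n = (\<Sum>c\<in>B. a n c *\<^sub>R c)" for n
    have "(\<lambda>n. b - y n) \<longlonglongrightarrow> 0"
      by (rule Lim_null_comparison[OF _ LIMSEQ_inverse_real_of_nat])
         (use a in \<open>auto simp: y_def intro!: always_eventually less_imp_le\<close>)
    then have ylim: "y \<longlonglongrightarrow> b" using tendsto_diff[OF tendsto_const[of b], of "\<lambda>n. b - y n" 0] by simp
    have "\<exists>l. (\<lambda>n. a n c) \<longlonglongrightarrow> l" if "c \<in> B" for c
    proof -
      have "Cauchy (\<lambda>n. a n c)"
        unfolding Cauchy_def
      proof (intro allI impI)
        fix e :: real assume "e > 0"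
        have "Cauchy y" using ylim LIMSEQ_imp_Cauchy by blast
        moreover have "e / (C + 1) > 0" using \<open>e > 0\<close> C0 by simp
        ultimately obtain M where M: "\<And>m n. m \<ge> M \<Longrightarrow> n \<ge> M \<Longrightarrow> dist (y m) (y n) < e / (C+1)"
          unfolding Cauchy_def by meson
        show "\<exists>M. \<forall>m\<ge>M. \<forall>n\<ge>M. dist (a m c) (a n c) < e"
        proof (intro exI allI impI)
          fix m n assume "M \<le> m" "M \<le> n"
          have "\<bar>a m c - a n c\<bar> \<le> (\<Sum>c\<in>B. \<bar>a m c - a n c\<bar>)"
            using that insert.hyps(1) by (intro member_le_sum) auto
          also have "\<dots> \<le> C * norm (\<Sum>b\<in>B. (a m b - a n b) *\<^sub>R b)"
            using C[of "\<lambda>b. a m b - a n b"] by simp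
          also have "\<dots> = C * dist (y m) (y n)"
            by (simp add: y_def dist_norm scaleR_left_diff_distrib sum_subtractf)
          also have "\<dots> \<le> C * (e / (C+1))"
            using M[OF \<open>M \<le> m\<close> \<open>M \<le> n\<close>] C0 by (intro mult_left_mono) auto
          also have "\<dots> < e" using \<open>e > 0\<close> C0 by (simp add: divide_simps)
          finally show "dist (a m c) (a n c) < e" by (simp add: dist_real_def)
        qed
      qed
      then show ?thesis using Cauchy_convergent_iff convergent_def by blast
    qed
    then obtain l where l: "\<And>c. c \<in> B \<Longrightarrow> (\<lambda>n. a n c) \<longlonglongrightarrow> l c" by metis
    have "y \<longlonglongrightarrow> (\<Sum>c\<in>B. l c *\<^sub>R c)"
      unfolding y_def by (intro tendsto_sum tendsto_scaleR l tendsto_const)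
    with ylim have "b = (\<Sum>c\<in>B. l c *\<^sub>R c)" using LIMSEQ_unique by blast
    then have "b \<in> span B" by (simp add: span_sum span_scale span_base)
    with b show False by simp
  qed
  then obtain d where d: "d > 0" "\<And>a. d \<le> norm (b - (\<Sum>c\<in>B. a c *\<^sub>R c))" by blast
  \<comment> \<open>The distance \<open>d\<close> bounds the coefficient of \<open>b\<close> by
    \<open>norm x / d\<close>; what remains has norm at most
    \<open>norm x * (1 + norm b / d)\<close>, to which the induction hypothesis applies. The
    constant is the sum of the two bounds.\<close>
  show ?case
  proof (intro exI[of _ "1 / d + C * (1 + norm b / d)"] conjI allI)
    show "0 \<le> 1 / d + C * (1 + norm b / d)" using d C0 by simp
  next
    fix a :: "'a \<Rightarrow> real"
    define y where "y = (\<Sum>c\<in>B. a c *\<^sub>R c)"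
    define x where "x = a b *\<^sub>R b + y"
    have 1: "\<bar>a b\<bar> \<le> norm x / d"
    proof (cases "a b = 0")
      case False
      have "x = a b *\<^sub>R (b - (\<Sum>c\<in>B. (- a c / a b) *\<^sub>R c))"
        using False by (simp add: x_def y_def scaleR_right_distrib scaleR_sum_right sum_negf)
      then have "norm x = \<bar>a b\<bar> * norm (b - (\<Sum>c\<in>B. (- a c / a b) *\<^sub>R c))" by simp
      also have "\<dots> \<ge> \<bar>a b\<bar> * d" by (intro mult_left_mono d) auto
      finally show ?thesis using d by (simp add: field_simps)
    qed (use d in auto)
    have "norm y = norm (x - a b *\<^sub>R b)" by (simp add: x_def)
    also have "\<dots> \<le> norm x + \<bar>a b\<bar> * norm b" by (metis norm_scaleR norm_triangle_ineq4)
    also have "\<dots> \<le> norm x + (norm x / d) * norm b" using 1 by (intro add_left_mono mult_right_mono) auto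
    also have "\<dots> = norm x * (1 + norm b / d)" by (simp add: field_simps)
    finally have 2: "norm y \<le> norm x * (1 + norm b / d)" .
    have "(\<Sum>c\<in>insert b B. \<bar>a c\<bar>) = \<bar>a b\<bar> + (\<Sum>c\<in>B. \<bar>a c\<bar>)" using insert by simp
    also have "\<dots> \<le> norm x / d + C * norm y" using 1 C[of a] by (simp add: y_def)
    also have "\<dots> \<le> norm x / d + C * (norm x * (1 + norm b / d))"
      using 2 C0 by (intro add_left_mono mult_left_mono)
    also have "\<dots> = (1 / d + C * (1 + norm b / d)) * norm x" by (simp add: field_simps)
    finally show "(\<Sum>c\<in>insert b B. \<bar>a c\<bar>) \<le> (1 / d + C * (1 + norm b / d)) * norm (\<Sum>c\<in>insert b B. a c *\<^sub>R c)"
      using insert by (simp add: x_def y_def)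
  qed
qed

text \<open>The type has no preferred basis or inner product. Bounded coordinate functionals suffice
  to lift scalar theorems, so only these are recorded; independence is used up in their
  construction.\<close>

locale coordinates =
  fixes B :: "'a::{banach, second_countable_topology} set" and coord :: "'a \<Rightarrow> 'a \<Rightarrow> real"
  assumes finite_B: "finite B"
    and bounded_linear_coord: "\<And>b. b \<in> B \<Longrightarrow> bounded_linear (coord b)"
    and sum_coord: "\<And>x. (\<Sum>b\<in>B. coord b x *\<^sub>R b) = x"

lemma coordinates_exist:
  assumes "\<exists>B :: 'a::{banach, second_countable_topology} set. finite B \<and> span B = UNIV"
  shows "\<exists>(B :: 'a set) coord. coordinates B coord"
proof -
  from assms obtain B0 :: "'a set" where B0: "finite B0" "span B0 = UNIV" by blast
  obtain B where B: "B \<subseteq> B0" "independent B" "B0 \<subseteq> span B"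
    using maximal_independent_subset by metis
  have fin: "finite B" using B(1) B0(1) by (rule finite_subset)
  have sp: "span B = UNIV" using B B0 by (metis span_eq span_superset subset_trans top.extremum_uniqueI)
  from independent_coefficients_bound[OF fin B(2)] obtain C where C: "C \<ge> 0"
    "\<And>a. (\<Sum>b\<in>B. \<bar>a b\<bar>) \<le> C * norm (\<Sum>b\<in>B. a b *\<^sub>R b)" by blast
  have ex: "(\<Sum>b\<in>B. representation B x b *\<^sub>R b) = x" for x
    by (rule real_vector.sum_representation_eq) (use B fin sp in auto)
  have "coordinates B (\<lambda>b x. representation B x b)"
  proof (rule coordinates.intro)
    show "finite B" by fact
    show "(\<Sum>b\<in>B. representation B x b *\<^sub>R b) = x" for x by (rule ex)
    fix b assume b: "b \<in> B"
    show "bounded_linear (\<lambda>x. representation B x b)"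
    proof (rule bounded_linear_intro[where K=C])
      show "representation B (x + y) b = representation B x b + representation B y b" for x y
        using B sp by (simp add: real_vector.representation_add)
      show "representation B (r *\<^sub>R x) b = r *\<^sub>R representation B x b" for r x
        using B sp by (simp add: real_vector.representation_scale)
      show "norm (representation B x b) \<le> norm x * C" for x
      proof -
        have "\<bar>representation B x b\<bar> \<le> (\<Sum>b\<in>B. \<bar>representation B x b\<bar>)"
          using b fin by (intro member_le_sum) auto
        also have "\<dots> \<le> C * norm x" using C(2)[of "representation B x"] ex by simp
        finally show ?thesis by (simp add: mult.commute)
      qed
    qed
  qed
  then show ?thesis by blast
qed

section \<open>Sublinear functions, applied later to \<open>\<Psi>0\<close> and to \<open>p\<close>
  with its second argument fixed\<close>

definition sublinear :: "('a::real_vector \<Rightarrow> real) \<Rightarrow> bool" where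
  "sublinear \<phi> \<longleftrightarrow> (\<forall>x. 0 \<le> \<phi> x) \<and> (\<forall>x y. \<phi> (x + y) \<le> \<phi> x + \<phi> y) \<and> (\<forall>c\<ge>0. \<forall>x. \<phi> (c *\<^sub>R x) = c * \<phi> x)"

lemma sublinear_nonneg: "sublinear \<phi> \<Longrightarrow> 0 \<le> \<phi> x"
  and sublinear_add: "sublinear \<phi> \<Longrightarrow> \<phi> (x + y) \<le> \<phi> x + \<phi> y"
  and sublinear_scale: "sublinear \<phi> \<Longrightarrow> 0 \<le> c \<Longrightarrow> \<phi> (c *\<^sub>R x) = c * \<phi> x"
  by (auto simp: sublinear_def)

lemma sublinear_zero: "sublinear \<phi> \<Longrightarrow> \<phi> 0 = 0"
  using sublinear_scale[of \<phi> 0 0] by simp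

lemma sublinear_sum: "sublinear \<phi> \<Longrightarrow> \<phi> (\<Sum>i\<in>I. f i) \<le> (\<Sum>i\<in>I. \<phi> (f i))"
proof (induction I rule: infinite_finite_induct)
  case (insert i I)
  then show ?case using sublinear_add[of \<phi> "f i" "\<Sum>i\<in>I. f i"] by simp
qed (auto simp: sublinear_zero)

lemma sublinear_diff_le:
  assumes "sublinear \<phi>" "\<And>x. \<phi> x \<le> C * norm x"
  shows "\<phi> x \<le> \<phi> y + C * norm (x - y)"
  using sublinear_add[OF assms(1), of y "x - y"] assms(2)[of "x - y"] by simp

lemma sublinear_Lipschitz:
  assumes "sublinear \<phi>" "\<And>x. \<phi> x \<le> C * norm x"
  shows "\<bar>\<phi> x - \<phi> y\<bar> \<le> C * norm (x - y)"
  using sublinear_diff_le[OF assms, of x y] sublinear_diff_le[OF assms, of y x]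
  by (auto simp: norm_minus_commute abs_le_iff)

text \<open>Turns a Lipschitz constant of unknown sign into an error of \<open>e / 2\<close>; the
  \<open>+ 1\<close> keeps the quotient defined when \<open>C = 0\<close>.\<close>

lemma half_bound: "\<bar>C\<bar> * (e / (2 * (\<bar>C\<bar> + 1))) \<le> e / 2" if "e > 0" for C e :: real
proof -
  have "\<bar>C\<bar> * (e / (2 * (\<bar>C\<bar> + 1))) = (\<bar>C\<bar> / (\<bar>C\<bar> + 1)) * (e / 2)" by (simp add: field_simps)
  also have "\<dots> \<le> 1 * (e / 2)" using that by (intro mult_right_mono) auto
  finally show ?thesis by simp
qed

lemma sublinear_isCont:
  assumes "sublinear \<phi>" "\<And>x. \<phi> x \<le> C * norm x"
  shows "isCont \<phi> x"
  unfolding isCont_def LIM_def dist_norm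
proof (intro allI impI)
  fix e :: real assume e: "e > 0"
  have "norm (\<phi> y - \<phi> x) < e" if "norm (y - x) < e / (2 * (\<bar>C\<bar> + 1))" for y
  proof -
    have "C * norm (y - x) \<le> \<bar>C\<bar> * norm (y - x)" by (simp add: mult_right_mono)
    then have "norm (\<phi> y - \<phi> x) \<le> \<bar>C\<bar> * norm (y - x)"
      using sublinear_Lipschitz[OF assms, of y x] by simp
    also have "\<dots> \<le> \<bar>C\<bar> * (e / (2 * (\<bar>C\<bar> + 1)))" using that by (intro mult_left_mono) auto
    also have "\<dots> \<le> e / 2" by (rule half_bound[OF e])
    finally show ?thesis using e by simp
  qed
  then show "\<exists>s>0. \<forall>y. y \<noteq> x \<and> norm (y - x) < s \<longrightarrow> norm (\<phi> y - \<phi> x) < e"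
    using e by (intro exI[of _ "e / (2 * (\<bar>C\<bar> + 1))"]) auto
qed

lemma sublinear_continuous_on:
  assumes "sublinear \<phi>" "\<And>x. \<phi> x \<le> C * norm x"
  shows "continuous_on S \<phi>"
  using sublinear_isCont[OF assms] by (simp add: continuous_at_imp_continuous_on)

text \<open>Subadditivity reduces the bound to multiples of the spanning vectors. A negative
  multiple of \<open>b\<close> is a positive multiple of \<open>- b\<close>, so both
  \<open>\<phi> b\<close> and \<open>\<phi> (- b)\<close> enter the constant: there is no
  symmetry.\<close>

lemma (in coordinates) sublinear_bound:
  fixes \<phi> :: "'a \<Rightarrow> real"
  assumes "sublinear \<phi>"
  shows "\<exists>C>0. \<forall>x. \<phi> x \<le> C * norm x"
proof -
  have "\<exists>K>0. \<forall>x. norm (coord b x) \<le> norm x * K" if "b \<in> B" for b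
    using bounded_linear.pos_bounded[OF bounded_linear_coord[OF that]] .
  then obtain K where K: "\<And>b. b \<in> B \<Longrightarrow> K b > 0" "\<And>b x. b \<in> B \<Longrightarrow> norm (coord b x) \<le> norm x * K b"
    by metis
  define C where "C = 1 + (\<Sum>b\<in>B. K b * (\<phi> b + \<phi> (- b)))"
  have nn: "\<phi> x \<ge> 0" for x using assms sublinear_nonneg by blast
  have "\<phi> x \<le> C * norm x" for x
  proof -
    have one: "\<phi> (coord b x *\<^sub>R b) \<le> norm x * (K b * (\<phi> b + \<phi> (- b)))" if "b \<in> B" for b
    proof -
      have "\<phi> (coord b x *\<^sub>R b) \<le> \<bar>coord b x\<bar> * (\<phi> b + \<phi> (- b))"
      proof (cases "coord b x \<ge> 0")
        case True
        then show ?thesis using sublinear_scale[OF assms True, of b] nn by (simp add: distrib_left)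
      next
        case False
        then have "\<phi> (coord b x *\<^sub>R b) = \<bar>coord b x\<bar> * \<phi> (- b)"
          using sublinear_scale[OF assms, of "- coord b x" "- b"] by simp
        then show ?thesis using nn by (simp add: distrib_left)
      qed
      also have "\<dots> \<le> (norm x * K b) * (\<phi> b + \<phi> (- b))"
        using K(2)[OF that, of x] nn by (intro mult_right_mono) (auto simp: add_nonneg_nonneg)
      finally show ?thesis by (simp add: mult.assoc)
    qed
    have "\<phi> x = \<phi> (\<Sum>b\<in>B. coord b x *\<^sub>R b)" by (simp add: sum_coord)
    also have "\<dots> \<le> (\<Sum>b\<in>B. \<phi> (coord b x *\<^sub>R b))" by (rule sublinear_sum[OF assms])
    also have "\<dots> \<le> (\<Sum>b\<in>B. norm x * (K b * (\<phi> b + \<phi> (- b))))" by (rule sum_mono) (rule one)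
    also have "\<dots> = norm x * (\<Sum>b\<in>B. K b * (\<phi> b + \<phi> (- b)))" by (simp add: sum_distrib_left)
    also have "\<dots> \<le> C * norm x" by (simp add: C_def algebra_simps)
    finally show ?thesis .
  qed
  moreover have "C > 0"
    unfolding C_def using nn K(1)
    by (intro add_pos_nonneg sum_nonneg mult_nonneg_nonneg) (auto simp: less_imp_le)
  ultimately show ?thesis by blast
qed

text \<open>A positive minimum is attained on the unit sphere, which is compact by the Heine-Borel
  property; homogeneity extends the bound.\<close>

lemma sublinear_lower_bound:
  fixes \<phi> :: "'a::{real_normed_vector, heine_borel} \<Rightarrow> real"
  assumes \<phi>: "sublinear \<phi>" "\<And>x. \<phi> x \<le> C * norm x" and pos: "\<And>x. x \<noteq> 0 \<Longrightarrow> \<phi> x > 0"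
  shows "\<exists>c>0. \<forall>x. c * norm x \<le> \<phi> x"
proof (cases "\<exists>x :: 'a. x \<noteq> 0")
  \<comment> \<open>The trivial space has an empty unit sphere, on which no minimum can be
    taken.\<close>
  case False
  then have "1 * norm x \<le> \<phi> x" for x :: 'a using sublinear_nonneg[OF \<phi>(1)] by (metis mult_1 norm_zero)
  then show ?thesis using zero_less_one by blast
next
  case True
  then obtain x0 :: 'a where "x0 \<noteq> 0" by blast
  then have "x0 /\<^sub>R norm x0 \<in> sphere 0 1" by simp
  then have ne: "sphere (0::'a) 1 \<noteq> {}" by blast
  have "continuous_on (sphere 0 1) \<phi>" by (rule sublinear_continuous_on[OF \<phi>])
  moreover have "compact (sphere (0::'a) 1)"
  proof -
    have "sphere (0::'a) 1 = {x. norm x = 1}" by auto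
    moreover have "bounded {x::'a. norm x = 1}" by (intro boundedI[of _ 1]) simp
    moreover have "closed {x::'a. norm x = 1}" by (intro closed_Collect_eq continuous_intros)
    ultimately show ?thesis by (simp add: compact_eq_bounded_closed)
  qed
  ultimately
  obtain z where z: "z \<in> sphere 0 1" "\<And>x. x \<in> sphere 0 1 \<Longrightarrow> \<phi> z \<le> \<phi> x"
    using continuous_attains_inf[of "sphere 0 1" \<phi>] ne by metis
  have "\<phi> z * norm x \<le> \<phi> x" for x
  proof (cases "x = 0")
    case False
    have "\<phi> z \<le> \<phi> (x /\<^sub>R norm x)" using z(2) False by simp
    then have "\<phi> z * norm x \<le> norm x * \<phi> (x /\<^sub>R norm x)" by (simp add: mult.commute mult_left_mono)
    also have "\<dots> = \<phi> (norm x *\<^sub>R (x /\<^sub>R norm x))" by (subst sublinear_scale[OF \<phi>(1)]) auto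
    also have "\<dots> = \<phi> x" using False by simp
    finally show ?thesis .
  qed (simp add: sublinear_zero[OF \<phi>(1)])
  moreover have "\<phi> z > 0" using z(1) by (intro pos) auto
  ultimately show ?thesis by blast
qed

section \<open>Sublinear functions under the integral sign\<close>

lemma sublinear_integrable:
  fixes f :: "'b \<Rightarrow> 'a::{banach, second_countable_topology}"
  assumes \<phi>: "sublinear \<phi>" "\<And>x. \<phi> x \<le> C * norm x" and f: "integrable M f"
  shows "integrable M (\<lambda>x. \<phi> (f x))"
proof (rule Bochner_Integration.integrable_bound)
  show "integrable M (\<lambda>x. C * norm (f x))" using f by simp
  have [measurable]: "\<phi> \<in> borel_measurable borel"
    by (intro borel_measurable_continuous_onI sublinear_continuous_on[OF \<phi>])
  show "(\<lambda>x. \<phi> (f x)) \<in> borel_measurable M" using f by measurable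
  show "AE x in M. norm (\<phi> (f x)) \<le> norm (C * norm (f x))"
  proof (intro AE_I2)
    fix x
    show "norm (\<phi> (f x)) \<le> norm (C * norm (f x))"
      using \<phi>(2)[of "f x"] sublinear_nonneg[OF \<phi>(1), of "f x"] by simp
  qed
qed

text \<open>Applied with \<open>v\<close> the identity and with \<open>v\<close> a sublinear
  function, so that both sides of an integral inequality become sums over the same level sets. The
  condition \<open>v 0 = 0\<close> keeps the possibly infinite zero set of \<open>s\<close> out of
  the integral.\<close>

lemma simple_integrable_split:
  fixes s :: "'b \<Rightarrow> 'a::{banach, second_countable_topology}" and v :: "'a \<Rightarrow> 'c::{banach, second_countable_topology}"
  assumes s: "simple_function M s" "emeasure M {y \<in> space M. s y \<noteq> 0} \<noteq> \<infinity>" and v: "v 0 = 0"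
  shows "integrable M (\<lambda>x. v (s x))"
    "(LINT x|M. v (s x)) = (\<Sum>y\<in>s ` space M. measure M {x\<in>space M. s x = y} *\<^sub>R v y)"
proof -
  have vs: "simple_function M (\<lambda>x. v (s x))" using simple_function_compose2[OF s(1) s(1), of "\<lambda>a b. v a"] by simp
  have "emeasure M {y \<in> space M. v (s y) \<noteq> 0} \<le> emeasure M {y \<in> space M. s y \<noteq> 0}"
    using borel_measurable_simple_function[OF s(1)] by (intro emeasure_mono) (auto simp: v)
  then have b: "Bochner_Integration.simple_bochner_integrable M (\<lambda>x. v (s x))"
    using s(2) vs by (intro Bochner_Integration.simple_bochner_integrable.intros) (auto simp: top_unique)
  from has_bochner_integral_simple_bochner_integrable[OF b]
  have hb: "has_bochner_integral M (\<lambda>x. v (s x)) (Bochner_Integration.simple_bochner_integral M (\<lambda>x. v (s x)))" .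
  then show "integrable M (\<lambda>x. v (s x))" by (rule integrable.intros)
  have "Bochner_Integration.simple_bochner_integral M (\<lambda>x. v (s x)) = (\<Sum>y\<in>s ` space M. measure M {x\<in>space M. s x = y} *\<^sub>R v y)"
    by (rule simple_bochner_integral_partition[OF b s(1)]) auto
  with hb show "(LINT x|M. v (s x)) = (\<Sum>y\<in>s ` space M. measure M {x\<in>space M. s x = y} *\<^sub>R v y)"
    using has_bochner_integral_integral_eq by metis
qed

lemma simple_approximation_L1:
  fixes f :: "'b \<Rightarrow> 'a::{banach, second_countable_topology}"
  assumes f: "integrable M f" and e: "e > 0"
  obtains s where "simple_function M s" "emeasure M {y \<in> space M. s y \<noteq> 0} \<noteq> \<infinity>"
    "integrable M s" "(LINT x|M. norm (f x - s x)) < e"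
proof -
  obtain s where s: "\<And>i. simple_function M (s i)" "\<And>i. emeasure M {y \<in> space M. s i y \<noteq> 0} \<noteq> \<infinity>"
      "\<And>x. x \<in> space M \<Longrightarrow> (\<lambda>i. s i x) \<longlonglongrightarrow> f x"
      "\<And>x i. x \<in> space M \<Longrightarrow> norm (s i x) \<le> 2 * norm (f x)"
    using integrable_implies_simple_function_sequence[OF f] by blast
  have int: "integrable M (s i)" for i using simple_integrable_split(1)[OF s(1,2), of "\<lambda>x. x" i] by simp
  have "(\<lambda>i. LINT x|M. norm (f x - s i x)) \<longlonglongrightarrow> (LINT x|M. 0)"
  \<comment> \<open>The factor 3 is \<open>1 + 2\<close>: the approximants are bounded by
    \<open>2 * norm (f x)\<close>.\<close>
  proof (rule integral_dominated_convergence[where w="\<lambda>x. 3 * norm (f x)"])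
    show "AE x in M. (\<lambda>i. norm (f x - s i x)) \<longlonglongrightarrow> 0"
    proof (intro AE_I2)
      fix x assume "x \<in> space M"
      then have "(\<lambda>i. f x - s i x) \<longlonglongrightarrow> f x - f x" by (intro tendsto_diff s tendsto_const)
      then show "(\<lambda>i. norm (f x - s i x)) \<longlonglongrightarrow> 0" using tendsto_norm_zero by auto
    qed
    show "AE x in M. norm (norm (f x - s i x)) \<le> 3 * norm (f x)" for i
      using s(4) by (auto intro!: AE_I2) (smt (verit) norm_triangle_ineq4)
    show "(\<lambda>x. norm (f x - s i x)) \<in> borel_measurable M" for i
      using f int by measurable
  qed (use f in auto)
  then have "\<forall>\<^sub>F i in sequentially. (LINT x|M. norm (f x - s i x)) < e"
    using e by (simp add: order_tendsto_iff)
  then obtain i where "(LINT x|M. norm (f x - s i x)) < e"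
    by (auto simp: eventually_sequentially)
  then show ?thesis using that s(1,2) int by blast
qed

text \<open>Homogeneity replaces the normalization of the measure. For a simple function the
  inequality is subadditivity over its level sets; both sides are continuous in the mean by the
  Lipschitz bound for \<open>\<phi>\<close>.\<close>

lemma sublinear_Jensen:
  fixes f :: "'b \<Rightarrow> 'a::{banach, second_countable_topology}"
  assumes \<phi>: "sublinear \<phi>" "\<And>x. \<phi> x \<le> C * norm x" and f: "integrable M f"
  shows "\<phi> (LINT x|M. f x) \<le> (LINT x|M. \<phi> (f x))"
proof (rule field_le_epsilon)
  fix e :: real assume e: "e > 0"
  have C: "C * norm x \<le> \<bar>C\<bar> * norm x" for x :: 'a by (simp add: mult_right_mono)
  obtain s where s: "simple_function M s" "emeasure M {y \<in> space M. s y \<noteq> 0} \<noteq> \<infinity>"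
    "integrable M s" and d: "(LINT x|M. norm (f x - s x)) < e / (2 * (\<bar>C\<bar> + 1))"
    by (rule simple_approximation_L1[OF f, of "e / (2 * (\<bar>C\<bar> + 1))"]) (use e in \<open>simp add: add_nonneg_pos\<close>)
  let ?d = "LINT x|M. norm (f x - s x)"
  have diff: "integrable M (\<lambda>x. norm (f x - s x))" using f s by simp
  have "\<phi> (LINT x|M. f x) \<le> \<phi> (LINT x|M. s x) + C * norm ((LINT x|M. f x) - (LINT x|M. s x))"
    by (rule sublinear_diff_le[OF \<phi>])
  also have "norm ((LINT x|M. f x) - (LINT x|M. s x)) \<le> ?d"
    using integral_norm_bound[of M "\<lambda>x. f x - s x"] f s(3) by simp
  then have "C * norm ((LINT x|M. f x) - (LINT x|M. s x)) \<le> \<bar>C\<bar> * ?d"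
    by (intro order_trans[OF C] mult_left_mono) auto
  also have "\<phi> (LINT x|M. s x) \<le> (LINT x|M. \<phi> (s x))"
  proof -
    have "\<phi> (LINT x|M. s x) = \<phi> (\<Sum>y\<in>s ` space M. measure M {x\<in>space M. s x = y} *\<^sub>R y)"
      using simple_integrable_split(2)[OF s(1,2), of "\<lambda>x. x"] by simp
    also have "\<dots> \<le> (\<Sum>y\<in>s ` space M. measure M {x\<in>space M. s x = y} *\<^sub>R \<phi> y)"
      using sublinear_sum[OF \<phi>(1), of "\<lambda>y. measure M {x\<in>space M. s x = y} *\<^sub>R y"]
      by (simp add: sublinear_scale[OF \<phi>(1)])
    also have "\<dots> = (LINT x|M. \<phi> (s x))"
      using simple_integrable_split(2)[where v=\<phi>, OF s(1,2) sublinear_zero[OF \<phi>(1)]] by simp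
    finally show ?thesis .
  qed
  also have "(LINT x|M. \<phi> (s x)) \<le> (LINT x|M. \<phi> (f x) + \<bar>C\<bar> * norm (f x - s x))"
  proof (rule integral_mono)
    show "integrable M (\<lambda>x. \<phi> (s x))" by (rule sublinear_integrable[OF \<phi> s(3)])
    show "integrable M (\<lambda>x. \<phi> (f x) + \<bar>C\<bar> * norm (f x - s x))"
      using sublinear_integrable[OF \<phi> f] diff by simp
    show "\<phi> (s x) \<le> \<phi> (f x) + \<bar>C\<bar> * norm (f x - s x)" for x
      using sublinear_diff_le[OF \<phi>, of "s x" "f x"] C[of "f x - s x"] by (simp add: norm_minus_commute)
  qed
  also have "\<dots> = (LINT x|M. \<phi> (f x)) + \<bar>C\<bar> * ?d"
    using sublinear_integrable[OF \<phi> f] diff by simp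
  finally have "\<phi> (LINT x|M. f x) \<le> (LINT x|M. \<phi> (f x)) + 2 * (\<bar>C\<bar> * ?d)" by simp
  also have "\<bar>C\<bar> * ?d \<le> e / 2"
    using order_trans[OF mult_left_mono[OF less_imp_le[OF d] abs_ge_zero] half_bound[OF e]] .
  finally show "\<phi> (LINT x|M. f x) \<le> (LINT x|M. \<phi> (f x)) + e" by simp
qed

text \<open>The left side is the total \<open>\<phi>\<close>-variation of the vector measure with
  density \<open>g\<close>, and \<open>N\<close> dominates \<open>\<phi>\<close> of that measure set
  by set. Where an approximating simple function takes one value \<open>y\<close>,
  \<open>\<phi>\<close> of its integral is the measure of the level set times
  \<open>\<phi> y\<close>; exchanging it with \<open>g\<close> costs an error that is small in the
  mean.\<close>

lemma sublinear_integral_le_measure: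
  fixes g :: "'b \<Rightarrow> 'a::{banach, second_countable_topology}"
  assumes \<phi>: "sublinear \<phi>" "\<And>x. \<phi> x \<le> C * norm x" and g: "integrable M g"
    and N: "finite_measure N" "sets N = sets M"
    and le: "\<And>A. A \<in> sets M \<Longrightarrow> \<phi> (LINT x:A|M. g x) \<le> measure N A"
  shows "(LINT x|M. \<phi> (g x)) \<le> measure N (space N)"
proof (rule field_le_epsilon)
  interpret N: finite_measure N by fact
  have sp: "space N = space M" using N(2) by (rule sets_eq_imp_space_eq)
  fix e :: real assume e: "e > 0"
  have C: "C * norm x \<le> \<bar>C\<bar> * norm x" for x :: 'a by (simp add: mult_right_mono)
  obtain s where s: "simple_function M s" "emeasure M {y \<in> space M. s y \<noteq> 0} \<noteq> \<infinity>"
    "integrable M s" and d: "(LINT x|M. norm (g x - s x)) < e / (2 * (\<bar>C\<bar> + 1))"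
    by (rule simple_approximation_L1[OF g, of "e / (2 * (\<bar>C\<bar> + 1))"]) (use e in \<open>simp add: add_nonneg_pos\<close>)
  let ?d = "LINT x|M. norm (g x - s x)"
  have diff: "integrable M (\<lambda>x. norm (g x - s x))" using g s by simp
  have fin: "finite (s ` space M)" using s(1) by (rule simple_functionD)
  define A where "A y = {x\<in>space M. s x = y}" for y
  have A[measurable]: "A y \<in> sets M" for y
  proof -
    have "A y = s -` {y} \<inter> space M" by (auto simp: A_def)
    then show ?thesis using simple_functionD(2)[OF s(1), of "{y}"] by simp
  qed
  have piece: "measure M (A y) * \<phi> y \<le> measure N (A y) + \<bar>C\<bar> * (LINT x:A y|M. norm (g x - s x))" for y
  proof -
    have ig: "set_integrable M (A y) g" and ist: "set_integrable M (A y) s"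
      using g s A by (auto simp: set_integrable_def integrable_mult_indicator)
    have "(LINT x:A y|M. s x) = (LINT x:A y|M. y)"
      using A[of y] by (rule set_lebesgue_integral_cong) (simp add: A_def)
    also have "\<dots> = measure M (A y) *\<^sub>R y"
    \<comment> \<open>The zero level set may have infinite measure, but the integral of 0 over it
      still vanishes.\<close>
    proof (cases "y = 0")
      case False
      have "emeasure M (A y) \<le> emeasure M {x \<in> space M. s x \<noteq> 0}"
        using False s(3) by (intro emeasure_mono) (auto simp: A_def)
      then have "emeasure M (A y) < \<infinity>" using s(2) by (simp add: top.not_eq_extremum le_less_trans)
      then show ?thesis using A[of y] by (simp add: set_lebesgue_integral_def)
    qed (simp add: set_lebesgue_integral_def)
    finally have "measure M (A y) * \<phi> y = \<phi> (LINT x:A y|M. s x)"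
      by (simp add: sublinear_scale[OF \<phi>(1)])
    also have "\<dots> \<le> \<phi> (LINT x:A y|M. g x) + C * norm ((LINT x:A y|M. s x) - (LINT x:A y|M. g x))"
      by (rule sublinear_diff_le[OF \<phi>])
    also have "norm ((LINT x:A y|M. s x) - (LINT x:A y|M. g x)) \<le> (LINT x:A y|M. norm (g x - s x))"
    proof -
      have "norm ((LINT x:A y|M. s x) - (LINT x:A y|M. g x)) = norm (LINT x:A y|M. g x - s x)"
        using ig ist by (simp add: norm_minus_commute)
      also have "\<dots> \<le> (LINT x:A y|M. norm (g x - s x))"
        using ig ist by (intro set_integral_norm_bound) auto
      finally show ?thesis .
    qed
    then have "C * norm ((LINT x:A y|M. s x) - (LINT x:A y|M. g x)) \<le> \<bar>C\<bar> * (LINT x:A y|M. norm (g x - s x))"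
      by (intro order_trans[OF C] mult_left_mono) auto
    finally show ?thesis using le[OF A] by (meson add_right_mono order_trans add_mono order_refl)
  qed
  have "(LINT x|M. \<phi> (s x)) = (\<Sum>y\<in>s ` space M. measure M (A y) * \<phi> y)"
    using simple_integrable_split(2)[where v=\<phi>, OF s(1,2) sublinear_zero[OF \<phi>(1)]] by (simp add: A_def)
  also have "\<dots> \<le> (\<Sum>y\<in>s ` space M. measure N (A y) + \<bar>C\<bar> * (LINT x:A y|M. norm (g x - s x)))"
    by (rule sum_mono) (rule piece)
  also have "\<dots> = (\<Sum>y\<in>s ` space M. measure N (A y)) + \<bar>C\<bar> * (\<Sum>y\<in>s ` space M. LINT x:A y|M. norm (g x - s x))"
    by (simp add: sum.distrib sum_distrib_left)
  also have "(\<Sum>y\<in>s ` space M. measure N (A y)) = measure N (\<Union>y\<in>s ` space M. A y)"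
    using fin A by (intro N.finite_measure_finite_Union[symmetric]) (auto simp: N(2) disjoint_family_on_def A_def)
  also have "(\<Union>y\<in>s ` space M. A y) = space M" by (auto simp: A_def)
  also have "(\<Sum>y\<in>s ` space M. LINT x:A y|M. norm (g x - s x)) = ?d"
  proof -
    have "disjoint_family_on A (s ` space M)" by (auto simp: disjoint_family_on_def A_def)
    then have "(\<Sum>y\<in>s ` space M. LINT x:A y|M. norm (g x - s x)) = (LINT x:(\<Union>y\<in>s ` space M. A y)|M. norm (g x - s x))"
      using fin integrable_mult_indicator[OF A diff]
      by (intro set_integral_finite_Union[symmetric]) (auto simp: set_integrable_def)
    then show ?thesis unfolding \<open>(\<Union>y\<in>s ` space M. A y) = space M\<close> set_integral_space[OF diff] .
  qed
  finally have 1: "(LINT x|M. \<phi> (s x)) \<le> measure N (space N) + \<bar>C\<bar> * ?d" unfolding sp .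
  have "(LINT x|M. \<phi> (g x)) \<le> (LINT x|M. \<phi> (s x) + \<bar>C\<bar> * norm (g x - s x))"
  proof (rule integral_mono)
    show "integrable M (\<lambda>x. \<phi> (g x))" by (rule sublinear_integrable[OF \<phi> g])
    show "integrable M (\<lambda>x. \<phi> (s x) + \<bar>C\<bar> * norm (g x - s x))"
      using sublinear_integrable[OF \<phi> s(3)] diff by simp
    show "\<phi> (g x) \<le> \<phi> (s x) + \<bar>C\<bar> * norm (g x - s x)" for x
      using sublinear_diff_le[OF \<phi>, of "g x" "s x"] C[of "g x - s x"] by simp
  qed
  also have "\<dots> = (LINT x|M. \<phi> (s x)) + \<bar>C\<bar> * ?d"
    using sublinear_integrable[OF \<phi> s(3)] diff by simp
  also have "\<dots> \<le> measure N (space N) + 2 * (\<bar>C\<bar> * ?d)" using 1 by simp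
  also have "\<bar>C\<bar> * ?d \<le> e / 2"
    using order_trans[OF mult_left_mono[OF less_imp_le[OF d] abs_ge_zero] half_bound[OF e]] .
  finally show "(LINT x|M. \<phi> (g x)) \<le> measure N (space N) + e" by simp
qed

section \<open>The vanishing viscosity contact potential\<close>

locale potentials = coordinates B coord
  for B :: "'a::{banach, heine_borel, second_countable_topology} set" and coord +
  fixes \<Psi>0 \<Psi> :: "'a \<Rightarrow> real"
  assumes gauge: "gauge_potential \<Psi>0"
    and viscous: "viscous_potential \<Psi>"
    and vanishing_viscosity: "\<And>v. ((\<lambda>\<epsilon>. rescaled \<Psi> \<epsilon> v) \<longlongrightarrow> \<Psi>0 v) (at_right 0)"
begin

lemma gauge_sublinear: "sublinear \<Psi>0"
  using gauge by (auto simp: gauge_potential_def sublinear_def)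

lemma gauge_pos: "v \<noteq> 0 \<Longrightarrow> \<Psi>0 v > 0"
  using gauge by (auto simp: gauge_potential_def)

lemma gauge_bounds: "\<exists>c>0. \<exists>C>0. \<forall>v. c * norm v \<le> \<Psi>0 v \<and> \<Psi>0 v \<le> C * norm v"
proof -
  obtain C where C: "C > 0" "\<And>v. \<Psi>0 v \<le> C * norm v"
    using sublinear_bound[OF gauge_sublinear] by auto
  obtain c where "c > 0" "\<And>v. c * norm v \<le> \<Psi>0 v"
    using sublinear_lower_bound[OF gauge_sublinear C(2) gauge_pos] by auto
  with C show ?thesis by blast
qed

section \<open>Growth and continuity of the viscous potential and of its conjugate\<close>

lemma visc_nonneg: "\<Psi> v \<ge> 0" and visc_convex: "convex_on UNIV \<Psi>" and visc_zero: "\<Psi> 0 = 0"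
  using viscous by (auto simp: viscous_potential_def)

lemma visc_scale_le: "0 \<le> c \<Longrightarrow> c \<le> 1 \<Longrightarrow> \<Psi> (c *\<^sub>R v) \<le> c * \<Psi> v"
  using convex_onD[OF visc_convex, of "1 - c" v 0] by (simp add: visc_zero)

text \<open>For a convex function vanishing at 0, the quotient
  \<open>\<Psi> (\<epsilon> *\<^sub>R v) / \<epsilon>\<close> increases with
  \<open>\<epsilon>\<close>. Its limit at 0, the gauge, is therefore a lower bound for all
  rescalings.\<close>

lemma rescaled_mono:
  assumes "0 < \<epsilon>" "\<epsilon> \<le> \<epsilon>'"
  shows "rescaled \<Psi> \<epsilon> v \<le> rescaled \<Psi> \<epsilon>' v"
proof -
  have "\<Psi> (\<epsilon> *\<^sub>R v) = \<Psi> ((\<epsilon> / \<epsilon>') *\<^sub>R (\<epsilon>' *\<^sub>R v))" using assms by simp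
  also have "\<dots> \<le> (\<epsilon> / \<epsilon>') * \<Psi> (\<epsilon>' *\<^sub>R v)" using assms by (intro visc_scale_le) auto
  finally show ?thesis using assms by (simp add: rescaled_def field_simps)
qed

lemma gauge_le_rescaled:
  assumes "0 < \<epsilon>"
  shows "\<Psi>0 v \<le> rescaled \<Psi> \<epsilon> v"
proof (rule tendsto_upperbound[OF vanishing_viscosity])
  show "\<forall>\<^sub>F e in at_right 0. rescaled \<Psi> e v \<le> rescaled \<Psi> \<epsilon> v"
    using eventually_at_right_less[of 0] eventually_at_right_real[OF assms]
    by eventually_elim (auto intro: rescaled_mono)
qed simp

text \<open>Outside a ball the superlinear growth of \<open>\<Psi>\<close> beats every linear
  functional of norm at most \<open>K\<close>, and inside it the pairing is bounded. This makes the
  real supremum of the conjugate finite, locally uniformly in \<open>w\<close>.\<close>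

lemma legendre_bounded:
  assumes "K \<ge> 0"
  shows "\<exists>M. \<forall>w v. norm w \<le> K \<longrightarrow> blinfun_apply w v - \<Psi> v \<le> M"
proof -
  have "filterlim (\<lambda>v. \<Psi> v / norm v) at_top at_infinity"
    using viscous by (simp add: viscous_potential_def)
  then have "\<forall>\<^sub>F v in at_infinity. K \<le> \<Psi> v / norm v" by (simp add: filterlim_at_top)
  then obtain b where b: "\<And>v. b \<le> norm v \<Longrightarrow> K \<le> \<Psi> v / norm v" by (auto simp: eventually_at_infinity)
  have "blinfun_apply w v - \<Psi> v \<le> K * \<bar>b\<bar>" if w: "norm w \<le> K" for w v
  proof -
    have "blinfun_apply w v \<le> norm w * norm v" using norm_blinfun[of w v] by simp
    also have "\<dots> \<le> K * norm v" using w by (intro mult_right_mono) auto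
    finally have 1: "blinfun_apply w v \<le> K * norm v" .
    show ?thesis
    proof (cases "b \<le> norm v \<and> v \<noteq> 0")
      case True
      then have "K * norm v \<le> \<Psi> v" using b[of v] by (simp add: field_simps)
      then show ?thesis using 1 assms by (smt (verit) mult_nonneg_nonneg abs_ge_zero)
    next
      case False
      then have "norm v \<le> \<bar>b\<bar>" by auto
      then have "K * norm v \<le> K * \<bar>b\<bar>" using assms by (intro mult_left_mono)
      then show ?thesis using 1 visc_nonneg[of v] by linarith
    qed
  qed
  then show ?thesis by blast
qed

abbreviation visc_conj :: "('a \<Rightarrow>\<^sub>L real) \<Rightarrow> real" where "visc_conj \<equiv> legendre_conj \<Psi>"

lemma legendre_bdd: "bdd_above (range (\<lambda>v. blinfun_apply w v - \<Psi> v))"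
  using legendre_bounded[of "norm w"] by (auto simp: bdd_above_def)

lemma conj_upper: "blinfun_apply w v - \<Psi> v \<le> visc_conj w"
  unfolding legendre_conj_def by (rule cSUP_upper[OF UNIV_I legendre_bdd])

lemma conj_nonneg: "visc_conj w \<ge> 0"
  using conj_upper[of w 0] by (simp add: visc_zero)

lemma conj_convex: "convex_on UNIV visc_conj"
proof (rule convex_onI)
  fix t :: real and x y :: "'a \<Rightarrow>\<^sub>L real" assume t: "0 < t" "t < 1"
  show "visc_conj ((1 - t) *\<^sub>R x + t *\<^sub>R y) \<le> (1 - t) * visc_conj x + t * visc_conj y"
    unfolding legendre_conj_def[of \<Psi> "(1 - t) *\<^sub>R x + t *\<^sub>R y"]
  proof (rule cSUP_least)
    fix v
    have "blinfun_apply ((1 - t) *\<^sub>R x + t *\<^sub>R y) v - \<Psi> v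
        = (1 - t) * (blinfun_apply x v - \<Psi> v) + t * (blinfun_apply y v - \<Psi> v)"
      by (simp add: blinfun.add_left blinfun.diff_left blinfun.scaleR_left algebra_simps)
    also have "\<dots> \<le> (1 - t) * visc_conj x + t * visc_conj y"
      using t conj_upper by (intro add_mono mult_left_mono) auto
    finally show "blinfun_apply ((1 - t) *\<^sub>R x + t *\<^sub>R y) v - \<Psi> v \<le> (1 - t) * visc_conj x + t * visc_conj y" .
  qed simp
qed simp

text \<open>A convex function that is bounded near a point is continuous there. The domain is the
  dual space as a normed space; the local bound is the uniformity in \<open>w\<close> of
  \<open>legendre_bounded\<close>.\<close>

lemma conj_continuous: "continuous_on UNIV visc_conj"
proof -
  have "isCont visc_conj w" for w
  proof -
    obtain M where M: "\<And>w' v. norm w' \<le> norm w + 1 \<Longrightarrow> blinfun_apply w' v - \<Psi> v \<le> M"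
      using legendre_bounded[of "norm w + 1"] by auto
    have "continuous_on (ball w 1) visc_conj"
    proof (rule convex_on_bounded_continuous)
      show "convex_on (ball w 1) visc_conj" using conj_convex by (rule convex_on_subset) auto
      show "\<forall>x\<in>ball w 1. \<bar>visc_conj x\<bar> \<le> M"
      proof
        fix x assume "x \<in> ball w 1"
        then have "norm (x - w) < 1" by (simp add: dist_norm norm_minus_commute)
        then have "norm x \<le> norm w + 1" using norm_triangle_sub[of x w] by linarith
        then have "visc_conj x \<le> M" unfolding legendre_conj_def by (intro cSUP_least M) auto
        then show "\<bar>visc_conj x\<bar> \<le> M" using conj_nonneg[of x] by simp
      qed
    qed simp
    then show ?thesis by (simp add: continuous_on_eq_continuous_at)
  qed
  then show ?thesis by (simp add: continuous_at_imp_continuous_on)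
qed

text \<open>Each \<open>x\<close> is the average of \<open>n\<close> points on the coordinate axes,
  \<open>n\<close> being the number of spanning vectors. Convexity reduces the bound to segments
  through 0, where the values at the end points dominate.\<close>

lemma visc_bounded: "\<exists>M. \<forall>x. norm x \<le> K \<longrightarrow> \<Psi> x \<le> M"
proof (cases "B = {}")
  case True
  then have "x = 0" for x :: 'a using sum_coord[of x] by simp
  then show ?thesis by (metis order_refl)
next
  case False
  define n where "n = real (card B)"
  have n: "n > 0" using False finite_B by (simp add: n_def card_gt_0_iff)
  have "\<exists>k>0. \<forall>x. norm (coord b x) \<le> norm x * k" if "b \<in> B" for b
    using bounded_linear.pos_bounded[OF bounded_linear_coord[OF that]] .
  then obtain k where k: "\<And>b. b \<in> B \<Longrightarrow> k b > 0" "\<And>b x. b \<in> B \<Longrightarrow> norm (coord b x) \<le> norm x * k b"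
    by metis
  \<comment> \<open>\<open>L b\<close> bounds \<open>n * \<bar>coord b x\<bar>\<close> over the
    ball; the \<open>+ 1\<close> makes it positive also when \<open>K = 0\<close>.\<close>
  define L where "L b = n * ((\<bar>K\<bar> + 1) * k b)" for b
  have L: "L b > 0" if "b \<in> B" for b using k(1)[OF that] n by (simp add: L_def add_nonneg_pos)
  have "\<Psi> x \<le> (\<Sum>b\<in>B. (1 / n) * (\<Psi> (L b *\<^sub>R b) + \<Psi> (L b *\<^sub>R - b)))" if x: "norm x \<le> K" for x
  proof -
    have one: "\<Psi> ((n * coord b x) *\<^sub>R b) \<le> \<Psi> (L b *\<^sub>R b) + \<Psi> (L b *\<^sub>R - b)" if b: "b \<in> B" for b
    proof -
      have "norm x * k b \<le> (\<bar>K\<bar> + 1) * k b" using x k(1)[OF b] by (intro mult_right_mono) auto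
      then have "\<bar>coord b x\<bar> \<le> (\<bar>K\<bar> + 1) * k b" using k(2)[OF b, of x] by simp
      then have le: "n * \<bar>coord b x\<bar> \<le> L b" using n by (simp add: L_def)
      define c where "c = n * \<bar>coord b x\<bar> / L b"
      have c: "0 \<le> c" "c \<le> 1" using le L[OF b] n by (auto simp: c_def)
      have "(n * coord b x) *\<^sub>R b = c *\<^sub>R (L b *\<^sub>R b) \<or> (n * coord b x) *\<^sub>R b = c *\<^sub>R (L b *\<^sub>R - b)"
        using L[OF b] by (cases "coord b x \<ge> 0") (auto simp: c_def)
      then have "\<Psi> ((n * coord b x) *\<^sub>R b) \<le> c * \<Psi> (L b *\<^sub>R b) \<or> \<Psi> ((n * coord b x) *\<^sub>R b) \<le> c * \<Psi> (L b *\<^sub>R - b)"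
        using visc_scale_le[OF c] by metis
      moreover have "c * \<Psi> y \<le> \<Psi> y" for y using c visc_nonneg[of y] by (simp add: mult_left_le_one_le)
      ultimately show ?thesis using visc_nonneg by (smt (verit))
    qed
    have "x = (\<Sum>b\<in>B. (1 / n) *\<^sub>R ((n * coord b x) *\<^sub>R b))" using n sum_coord[of x] by simp
    then have "\<Psi> x = \<Psi> (\<Sum>b\<in>B. (1 / n) *\<^sub>R ((n * coord b x) *\<^sub>R b))" by metis
    also have "\<dots> \<le> (\<Sum>b\<in>B. (1 / n) * \<Psi> ((n * coord b x) *\<^sub>R b))"
      using n by (intro convex_on_sum[OF finite_B False visc_convex]) (auto simp: n_def)
    also have "\<dots> \<le> (\<Sum>b\<in>B. (1 / n) * (\<Psi> (L b *\<^sub>R b) + \<Psi> (L b *\<^sub>R - b)))"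
      using n one by (intro sum_mono mult_left_mono) auto
    finally show ?thesis .
  qed
  then show ?thesis by blast
qed

lemma visc_continuous: "continuous_on UNIV \<Psi>"
proof -
  have "isCont \<Psi> x" for x
  proof -
    obtain M where M: "\<And>y. norm y \<le> norm x + 1 \<Longrightarrow> \<Psi> y \<le> M"
      using visc_bounded[of "norm x + 1"] by auto
    have "continuous_on (ball x 1) \<Psi>"
    proof (rule convex_on_bounded_continuous)
      show "convex_on (ball x 1) \<Psi>" using visc_convex by (rule convex_on_subset) auto
      show "\<forall>y\<in>ball x 1. \<bar>\<Psi> y\<bar> \<le> M"
      proof
        fix y assume "y \<in> ball x 1"
        then have "norm (y - x) < 1" by (simp add: dist_norm norm_minus_commute)
        then have "norm y \<le> norm x + 1" using norm_triangle_sub[of y x] by linarith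
        then show "\<bar>\<Psi> y\<bar> \<le> M" using visc_nonneg[of y] M by simp
      qed
    qed simp
    then show ?thesis by (simp add: continuous_on_eq_continuous_at)
  qed
  then show ?thesis by (simp add: continuous_at_imp_continuous_on)
qed

text \<open>Substituting \<open>\<epsilon> *\<^sub>R v\<close> for \<open>v\<close> maps one
  supremum onto the other. After this, \<open>p\<close> depends on \<open>w\<close> only through the
  number \<open>visc_conj w\<close>.\<close>

lemma legendre_conj_rescaled:
  assumes e: "\<epsilon> > 0"
  shows "legendre_conj (rescaled \<Psi> \<epsilon>) w = visc_conj w / \<epsilon>"
proof (rule antisym)
  have le: "blinfun_apply w v - rescaled \<Psi> \<epsilon> v \<le> visc_conj w / \<epsilon>" for v
  proof -
    have "blinfun_apply w v - rescaled \<Psi> \<epsilon> v = (blinfun_apply w (\<epsilon> *\<^sub>R v) - \<Psi> (\<epsilon> *\<^sub>R v)) / \<epsilon>"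
      using e by (simp add: rescaled_def blinfun.scaleR_right field_simps)
    also have "\<dots> \<le> visc_conj w / \<epsilon>" using conj_upper e by (intro divide_right_mono) auto
    finally show ?thesis .
  qed
  show "legendre_conj (rescaled \<Psi> \<epsilon>) w \<le> visc_conj w / \<epsilon>"
    unfolding legendre_conj_def[of "rescaled \<Psi> \<epsilon>"] by (rule cSUP_least) (auto intro: le)
  have bdd: "bdd_above (range (\<lambda>v. blinfun_apply w v - rescaled \<Psi> \<epsilon> v))"
    using le by (auto simp: bdd_above_def)
  have "visc_conj w \<le> \<epsilon> * legendre_conj (rescaled \<Psi> \<epsilon>) w"
    unfolding legendre_conj_def[of \<Psi>]
  proof (rule cSUP_least)
    fix v
    have "blinfun_apply w v - \<Psi> v = \<epsilon> * (blinfun_apply w (v /\<^sub>R \<epsilon>) - rescaled \<Psi> \<epsilon> (v /\<^sub>R \<epsilon>))"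
      using e by (simp add: rescaled_def blinfun.scaleR_right field_simps)
    also have "\<dots> \<le> \<epsilon> * legendre_conj (rescaled \<Psi> \<epsilon>) w"
      unfolding legendre_conj_def using e by (intro mult_left_mono cSUP_upper bdd) auto
    finally show "blinfun_apply w v - \<Psi> v \<le> \<epsilon> * legendre_conj (rescaled \<Psi> \<epsilon>) w" .
  qed simp
  then show "visc_conj w / \<epsilon> \<le> legendre_conj (rescaled \<Psi> \<epsilon>) w" using e by (simp add: field_simps)
qed

section \<open>The contact potential: bounds, sublinearity, lower bounds near a dual point,
  measurability\<close>

abbreviation p :: "'a \<Rightarrow> ('a \<Rightarrow>\<^sub>L real) \<Rightarrow> real" where "p \<equiv> contact_potential \<Psi>"

lemma p_eq: "p v w = (INF \<epsilon>\<in>{0<..}. rescaled \<Psi> \<epsilon> v + visc_conj w / \<epsilon>)"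
  unfolding contact_potential_def by (intro INF_cong) (auto simp: legendre_conj_rescaled)

lemma p_bdd: "bdd_below ((\<lambda>\<epsilon>. rescaled \<Psi> \<epsilon> v + visc_conj w / \<epsilon>) ` {0<..})"
  by (intro bdd_belowI[of _ 0]) (auto simp: rescaled_def visc_nonneg conj_nonneg)

lemma p_upper: "\<epsilon> > 0 \<Longrightarrow> p v w \<le> rescaled \<Psi> \<epsilon> v + visc_conj w / \<epsilon>"
  unfolding p_eq by (rule cINF_lower[OF p_bdd]) simp

lemma p_greatest: "(\<And>\<epsilon>. \<epsilon> > 0 \<Longrightarrow> x \<le> rescaled \<Psi> \<epsilon> v + visc_conj w / \<epsilon>) \<Longrightarrow> x \<le> p v w"
  unfolding p_eq by (rule cINF_greatest) auto

lemma pairing_le_p: "blinfun_apply w v \<le> p v w"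
proof (rule p_greatest)
  fix \<epsilon> :: real assume e: "\<epsilon> > 0"
  have "\<epsilon> * blinfun_apply w v = blinfun_apply w (\<epsilon> *\<^sub>R v)" by (simp add: blinfun.scaleR_right)
  also have "\<dots> \<le> \<Psi> (\<epsilon> *\<^sub>R v) + visc_conj w" using conj_upper[of w "\<epsilon> *\<^sub>R v"] by simp
  finally show "blinfun_apply w v \<le> rescaled \<Psi> \<epsilon> v + visc_conj w / \<epsilon>"
    using e by (simp add: rescaled_def field_simps)
qed

lemma gauge_le_p: "\<Psi>0 v \<le> p v w"
  by (rule p_greatest) (smt (verit) gauge_le_rescaled conj_nonneg divide_nonneg_pos)

lemma p_nonneg: "0 \<le> p v w"
  using gauge_le_p[of v w] sublinear_nonneg[OF gauge_sublinear, of v] by linarith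

text \<open>The parameter \<open>c * \<epsilon>\<close> for \<open>v\<close> matches the parameter
  \<open>\<epsilon>\<close> for \<open>c *\<^sub>R v\<close>. The opposite inequality is the same
  one with \<open>1 / c\<close>.\<close>

lemma p_scale_ge:
  assumes c: "c > 0"
  shows "c * p v w \<le> p (c *\<^sub>R v) w"
proof (rule p_greatest)
  fix \<epsilon> :: real assume e: "\<epsilon> > 0"
  have "c * p v w \<le> c * (rescaled \<Psi> (c * \<epsilon>) v + visc_conj w / (c * \<epsilon>))"
    using c e by (intro mult_left_mono p_upper) auto
  also have "\<dots> = rescaled \<Psi> \<epsilon> (c *\<^sub>R v) + visc_conj w / \<epsilon>"
    using c e by (simp add: rescaled_def field_simps)
  finally show "c * p v w \<le> rescaled \<Psi> \<epsilon> (c *\<^sub>R v) + visc_conj w / \<epsilon>" .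
qed

lemma p_zero: "p 0 w = 0"
proof (rule antisym[OF _ p_nonneg])
  show "p 0 w \<le> 0"
  proof (rule field_le_epsilon)
    fix d :: real assume d: "d > 0"
    \<comment> \<open>A large parameter costs nothing at velocity 0 and makes the conjugate term
      smaller than \<open>d\<close>; the \<open>+ 1\<close> covers a vanishing conjugate.\<close>
    have "p 0 w \<le> rescaled \<Psi> ((visc_conj w + 1) / d) 0 + visc_conj w / ((visc_conj w + 1) / d)"
      using d conj_nonneg[of w] by (intro p_upper) auto
    also have "\<dots> = visc_conj w / (visc_conj w + 1) * d" using d by (simp add: rescaled_def visc_zero)
    also have "\<dots> \<le> 1 * d" using d conj_nonneg[of w] by (intro mult_right_mono) auto
    finally show "p 0 w \<le> 0 + d" by simp
  qed
qed

text \<open>The optimal parameter for a sum is the harmonic combination of the parameters of the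
  summands: then convexity of \<^term>\<open>\<Psi>\<close> applies with the matching weights.\<close>

lemma p_sublinear: "sublinear (\<lambda>v. p v w)"
  unfolding sublinear_def
proof (intro conjI allI impI)
  fix x y
  have "p (x + y) w \<le> (rescaled \<Psi> a x + visc_conj w / a) + (rescaled \<Psi> b y + visc_conj w / b)"
    if ab: "a > 0" "b > 0" for a b
  proof -
    define e where "e = a * b / (a + b)"
    have e: "e > 0" "1 / e = 1 / a + 1 / b" using ab by (auto simp: e_def field_simps)
    have ea: "e / a = b / (a + b)" "e / b = a / (a + b)" using ab by (auto simp: e_def)
    have "1 - e / b = e / a" using ab unfolding ea by (simp add: field_simps)
    moreover have "e *\<^sub>R (x + y) = (e / a) *\<^sub>R (a *\<^sub>R x) + (e / b) *\<^sub>R (b *\<^sub>R y)"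
      using ab by (simp add: scaleR_right_distrib)
    ultimately have "\<Psi> (e *\<^sub>R (x + y)) \<le> (e / a) * \<Psi> (a *\<^sub>R x) + (e / b) * \<Psi> (b *\<^sub>R y)"
      using convex_onD[OF visc_convex, of "e / b" "a *\<^sub>R x" "b *\<^sub>R y"] ab ea by simp
    then have "rescaled \<Psi> e (x + y) \<le> rescaled \<Psi> a x + rescaled \<Psi> b y"
      using e(1) by (simp add: rescaled_def field_simps)
    moreover have "visc_conj w / e = visc_conj w / a + visc_conj w / b"
      using e(2) by (metis (no_types, opaque_lifting) divide_inverse distrib_left inverse_eq_divide)
    ultimately show ?thesis using p_upper[OF e(1), of "x + y" w] by simp
  qed
  \<comment> \<open>The infima over \<open>b\<close> and over \<open>a\<close> are taken one after
    the other, each time with the other summand moved to the left side.\<close>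
  then have "p (x + y) w - (rescaled \<Psi> a x + visc_conj w / a) \<le> p y w" if "a > 0" for a
    using that by (intro p_greatest) (smt (verit))
  then have "p (x + y) w - p y w \<le> p x w"
    by (intro p_greatest) (smt (verit))
  then show "p (x + y) w \<le> p x w + p y w" by simp
next
  fix c :: real and x assume c: "0 \<le> c"
  show "p (c *\<^sub>R x) w = c * p x w"
  proof (cases "c = 0")
    case False
    then have c: "c > 0" using c by simp
    have "(1 / c) * p (c *\<^sub>R x) w \<le> p ((1 / c) *\<^sub>R (c *\<^sub>R x)) w" using c by (intro p_scale_ge) simp
    then have "p (c *\<^sub>R x) w \<le> c * p x w" using c by (simp add: field_simps)
    then show ?thesis using p_scale_ge[OF c, of x w] by simp
  qed (simp add: p_zero)
qed (rule p_nonneg)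

text \<open>The potential depends on \<^term>\<open>w\<close> only through \<^term>\<open>visc_conj w\<close>, on which its dependence is
  nondecreasing and concave; so lower semicontinuity of \<^term>\<open>visc_conj\<close> gives a lower bound that is
  uniform in the velocity.\<close>

lemma p_lower_near:
  assumes d: "0 < \<delta>" "\<delta> < 1"
  shows "\<exists>\<rho>>0. \<forall>w. norm (w - w0) < \<rho> \<longrightarrow> (\<forall>v. (1 - \<delta>) * p v w0 \<le> p v w)"
proof -
  have key: "(1 - \<delta>) * p v w0 \<le> p v w" if le: "(1 - \<delta>) * visc_conj w0 \<le> visc_conj w" for v w
  proof (rule p_greatest)
    fix \<epsilon> :: real assume e: "\<epsilon> > 0"
    have "(1 - \<delta>) * p v w0 \<le> (1 - \<delta>) * (rescaled \<Psi> \<epsilon> v + visc_conj w0 / \<epsilon>)"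
      using d e by (intro mult_left_mono p_upper) auto
    also have "\<dots> = (1 - \<delta>) * rescaled \<Psi> \<epsilon> v + ((1 - \<delta>) * visc_conj w0) / \<epsilon>" by (simp add: field_simps)
    also have "\<dots> \<le> 1 * rescaled \<Psi> \<epsilon> v + visc_conj w / \<epsilon>"
      using d e le visc_nonneg by (intro add_mono mult_right_mono divide_right_mono) (auto simp: rescaled_def)
    finally show "(1 - \<delta>) * p v w0 \<le> rescaled \<Psi> \<epsilon> v + visc_conj w / \<epsilon>" by simp
  qed
  have lim: "(visc_conj \<longlongrightarrow> visc_conj w0) (nhds w0)"
    using conj_continuous by (simp add: continuous_on_eq_continuous_at isCont_def tendsto_nhds_iff)
  have "\<forall>\<^sub>F w in nhds w0. (1 - \<delta>) * visc_conj w0 \<le> visc_conj w"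
  proof (cases "visc_conj w0 = 0")
    case True
    then show ?thesis by (simp add: conj_nonneg)
  next
    case False
    then have "(1 - \<delta>) * visc_conj w0 < visc_conj w0" using d conj_nonneg[of w0] by simp
    then have "\<forall>\<^sub>F w in nhds w0. (1 - \<delta>) * visc_conj w0 < visc_conj w" using lim by (simp add: order_tendsto_iff)
    then show ?thesis by eventually_elim simp
  qed
  then obtain \<rho> where "\<rho> > 0" "\<And>w. dist w w0 < \<rho> \<Longrightarrow> (1 - \<delta>) * visc_conj w0 \<le> visc_conj w"
    unfolding eventually_nhds_metric by blast
  then show ?thesis using key by (metis dist_norm)
qed

text \<open>A countable infimum of continuous expressions is measurable, which is needed along
  curves. A rational slightly below \<open>\<epsilon>\<close> does not raise the rescaled potential,
  and for \<open>a > 0\<close> the threshold \<open>\<epsilon> * (a / (a + \<eta>))\<close> is where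
  the conjugate term has grown by exactly \<open>\<eta>\<close>.\<close>

lemma p_eq_rat: "p v w = (INF q\<in>{q::rat. 0 < q}. rescaled \<Psi> (of_rat q) v + visc_conj w / of_rat q)"
proof (rule antisym)
  have bdd: "bdd_below ((\<lambda>q. rescaled \<Psi> (of_rat q) v + visc_conj w / of_rat q) ` {q::rat. 0 < q})"
    by (intro bdd_belowI[of _ 0]) (auto simp: rescaled_def visc_nonneg conj_nonneg)
  show "p v w \<le> (INF q\<in>{q::rat. 0 < q}. rescaled \<Psi> (of_rat q) v + visc_conj w / of_rat q)"
  proof (rule cINF_greatest)
    show "{q::rat. 0 < q} \<noteq> {}" using zero_less_one by blast
  qed (auto intro: p_upper)
  show "(INF q\<in>{q::rat. 0 < q}. rescaled \<Psi> (of_rat q) v + visc_conj w / of_rat q) \<le> p v w"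
  proof (rule p_greatest, rule field_le_epsilon)
    fix \<epsilon> \<eta> :: real assume e: "\<epsilon> > 0" and \<eta>: "\<eta> > 0"
    define a where "a = visc_conj w / \<epsilon>"
    have a: "a \<ge> 0" using e conj_nonneg by (simp add: a_def)
    have "\<epsilon> * (a / (a + \<eta>)) < \<epsilon> * 1" using e \<eta> a by (intro mult_strict_left_mono) auto
    then obtain q where q: "\<epsilon> * (a / (a + \<eta>)) < of_rat q" "of_rat q < \<epsilon>"
      using of_rat_dense[of "\<epsilon> * (a / (a + \<eta>))" \<epsilon>] by auto
    have "0 \<le> \<epsilon> * (a / (a + \<eta>))" using e a \<eta> by simp
    then have q0: "(0::real) < of_rat q" using q by linarith
    have "\<epsilon> * a < of_rat q * (a + \<eta>)" using q(1) a \<eta> by (simp add: field_simps)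
    then have "visc_conj w < of_rat q * (a + \<eta>)" using e by (simp add: a_def)
    then have "visc_conj w / of_rat q \<le> a + \<eta>" using q0 by (simp add: field_simps)
    moreover have "rescaled \<Psi> (of_rat q) v \<le> rescaled \<Psi> \<epsilon> v" using q q0 by (intro rescaled_mono) auto
    ultimately have "rescaled \<Psi> (of_rat q) v + visc_conj w / of_rat q \<le> rescaled \<Psi> \<epsilon> v + visc_conj w / \<epsilon> + \<eta>"
      by (simp add: a_def)
    moreover have "(INF q\<in>{q::rat. 0 < q}. rescaled \<Psi> (of_rat q) v + visc_conj w / of_rat q) \<le> rescaled \<Psi> (of_rat q) v + visc_conj w / of_rat q"
      using q0 by (intro cINF_lower bdd) simp
    ultimately show "(INF q\<in>{q::rat. 0 < q}. rescaled \<Psi> (of_rat q) v + visc_conj w / of_rat q) \<le> rescaled \<Psi> \<epsilon> v + visc_conj w / \<epsilon> + \<eta>"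
      by linarith
  qed
qed

lemma p_measurable:
  assumes [measurable]: "h \<in> borel_measurable M" and w[measurable]: "w \<in> borel_measurable M"
  shows "(\<lambda>x. p (h x) (w x)) \<in> borel_measurable M"
proof -
  have [measurable]: "\<Psi> \<in> borel_measurable borel" "visc_conj \<in> borel_measurable borel"
    by (intro borel_measurable_continuous_onI visc_continuous conj_continuous)+
  show ?thesis
    unfolding p_eq_rat rescaled_def
  proof (rule borel_measurable_cINF_real)
    show "countable {q::rat. 0 < q}" by auto
    fix q :: rat assume "q \<in> {q. 0 < q}"
    show "(\<lambda>x. \<Psi> (of_rat q *\<^sub>R h x) / of_rat q + visc_conj (w x) / of_rat q) \<in> borel_measurable M"
      by measurable
  qed
qed

end

section \<open>Absolutely continuous curves\<close>

text \<open>The \<^term>\<open>\<epsilon>\<close>-\<^term>\<open>\<delta>\<close> condition on the whole line. A curve on a compact interval is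
  extended by its boundary values.\<close>

definition abs_cont :: "(real \<Rightarrow> 'a::real_normed_vector) \<Rightarrow> bool" where
  "abs_cont f \<longleftrightarrow> (\<forall>\<epsilon>>0. \<exists>\<delta>>0. \<forall>(n::nat) l r. (\<forall>i<n. l i \<le> r i) \<longrightarrow>
      disjoint_family_on (\<lambda>i. {l i<..<r i}) {..<n} \<longrightarrow> (\<Sum>i<n. r i - l i) < \<delta> \<longrightarrow>
      (\<Sum>i<n. norm (f (r i) - f (l i))) < \<epsilon>)"

definition clip :: "real \<Rightarrow> real \<Rightarrow> real \<Rightarrow> real" where "clip a b x = max a (min b x)"

lemma abs_cont_clip:
  assumes ab: "a \<le> b" and ac: "abs_cont_on a b f"
  shows "abs_cont (\<lambda>x. f (clip a b x))"
  unfolding abs_cont_def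
proof (intro allI impI)
  fix e :: real assume "e > 0"
  then obtain d where d: "d > 0" "\<And>(n::nat) l r. (\<forall>i<n. a \<le> l i \<and> l i \<le> r i \<and> r i \<le> b) \<Longrightarrow>
     disjoint_family_on (\<lambda>i. {l i<..<r i}) {..<n} \<Longrightarrow> (\<Sum>i<n. r i - l i) < d \<Longrightarrow>
        (\<Sum>i<n. norm (f (r i) - f (l i))) < e"
    using ac unfolding abs_cont_on_def by meson
  have "(\<Sum>i<n. norm (f (clip a b (r i)) - f (clip a b (l i)))) < e"
    if lr: "\<forall>i<n. l i \<le> r i" and dis: "disjoint_family_on (\<lambda>i. {l i<..<r i}) {..<n}"
      and sm: "(\<Sum>i<n. r i - l i) < d" for n :: nat and l r
  proof (rule d(2))
    show "\<forall>i<n. a \<le> clip a b (l i) \<and> clip a b (l i) \<le> clip a b (r i) \<and> clip a b (r i) \<le> b"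
      using lr ab by (force simp: clip_def)
    show "disjoint_family_on (\<lambda>i. {clip a b (l i)<..<clip a b (r i)}) {..<n}"
      by (rule disjoint_family_on_bisimulation[OF dis]) (auto simp: clip_def max_def min_def split: if_splits)
    have "(\<Sum>i<n. clip a b (r i) - clip a b (l i)) \<le> (\<Sum>i<n. r i - l i)"
      using lr ab by (intro sum_mono) (auto simp: clip_def max_def min_def)
    then show "(\<Sum>i<n. clip a b (r i) - clip a b (l i)) < d" using sm by linarith
  qed
  then show "\<exists>\<delta>>0. \<forall>(n::nat) l r. (\<forall>i<n. l i \<le> r i) \<longrightarrow> disjoint_family_on (\<lambda>i. {l i<..<r i}) {..<n} \<longrightarrow>
      (\<Sum>i<n. r i - l i) < \<delta> \<longrightarrow> (\<Sum>i<n. norm (f (clip a b (r i)) - f (clip a b (l i)))) < e"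
    using d(1) by blast
qed

text \<open>The index type is arbitrary because later families are indexed by pairs and by the
  integers of a grid.\<close>

lemma abs_contD:
  fixes f :: "real \<Rightarrow> 'a::real_normed_vector"
  assumes "abs_cont f" "\<epsilon> > 0"
  shows "\<exists>\<delta>>0. \<forall>(K::'i set) l r. finite K \<longrightarrow> (\<forall>i\<in>K. l i \<le> r i) \<longrightarrow>
      disjoint_family_on (\<lambda>i. {l i<..<r i}) K \<longrightarrow> (\<Sum>i\<in>K. r i - l i) < \<delta> \<longrightarrow>
      (\<Sum>i\<in>K. norm (f (r i) - f (l i))) < \<epsilon>"
proof -
  obtain d where d: "d > 0" "\<And>(n::nat) l r. \<forall>i<n. l i \<le> r i \<Longrightarrow>
     disjoint_family_on (\<lambda>i. {l i<..<r i}) {..<n} \<Longrightarrow> (\<Sum>i<n. r i - l i) < d \<Longrightarrow>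
        (\<Sum>i<n. norm (f (r i) - f (l i))) < \<epsilon>"
    using assms unfolding abs_cont_def by meson
  have "(\<Sum>i\<in>K. norm (f (r i) - f (l i))) < \<epsilon>"
    if K: "finite K" "\<forall>i\<in>K. l i \<le> r i" "disjoint_family_on (\<lambda>i. {l i<..<r i}) K" "(\<Sum>i\<in>K. r i - l i) < d"
    for K :: "'i set" and l r
  proof -
    obtain h where h: "bij_betw h {..<card K} K"
      using ex_bij_betw_nat_finite[OF K(1)] by (auto simp: atLeast0LessThan)
    have hK: "h i \<in> K" if "i < card K" for i using h that by (auto simp: bij_betw_def)
    have inj: "inj_on h {..<card K}" using h by (simp add: bij_betw_def)
    have "(\<Sum>i<card K. norm (f ((r \<circ> h) i) - f ((l \<circ> h) i))) < \<epsilon>"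
    proof (rule d(2))
      show "\<forall>i<card K. (l \<circ> h) i \<le> (r \<circ> h) i" using K(2) hK by simp
      show "disjoint_family_on (\<lambda>i. {(l \<circ> h) i<..<(r \<circ> h) i}) {..<card K}"
        unfolding disjoint_family_on_def
      proof (intro ballI impI)
        fix i j assume ij: "i \<in> {..<card K}" "j \<in> {..<card K}" "i \<noteq> j"
        then have "h i \<noteq> h j" using inj by (auto simp: inj_on_def)
        moreover have "h i \<in> K" "h j \<in> K" using ij hK by auto
        ultimately have "{l (h i)<..<r (h i)} \<inter> {l (h j)<..<r (h j)} = {}"
          using K(3) unfolding disjoint_family_on_def by blast
        then show "{(l \<circ> h) i<..<(r \<circ> h) i} \<inter> {(l \<circ> h) j<..<(r \<circ> h) j} = {}" by simp
      qed
      show "(\<Sum>i<card K. (r \<circ> h) i - (l \<circ> h) i) < d"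
        using K(4) sum.reindex_bij_betw[OF h, of "\<lambda>i. r i - l i"] by simp
    qed
    then show ?thesis using sum.reindex_bij_betw[OF h, of "\<lambda>i. norm (f (r i) - f (l i))"] by simp
  qed
  then show ?thesis using d(1) by blast
qed

lemma abs_cont_add:
  assumes "abs_cont f" "abs_cont g"
  shows "abs_cont (\<lambda>x. f x + g x)"
  unfolding abs_cont_def
proof (intro allI impI)
  fix e :: real assume "e > 0"
  then have e: "e / 2 > 0" by simp
  obtain d1 where d1: "d1 > 0" "\<And>(n::nat) l r. \<forall>i<n. l i \<le> r i \<Longrightarrow>
     disjoint_family_on (\<lambda>i. {l i<..<r i}) {..<n} \<Longrightarrow> (\<Sum>i<n. r i - l i) < d1 \<Longrightarrow>
        (\<Sum>i<n. norm (f (r i) - f (l i))) < e / 2"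
    using assms(1) e unfolding abs_cont_def by meson
  obtain d2 where d2: "d2 > 0" "\<And>(n::nat) l r. \<forall>i<n. l i \<le> r i \<Longrightarrow>
     disjoint_family_on (\<lambda>i. {l i<..<r i}) {..<n} \<Longrightarrow> (\<Sum>i<n. r i - l i) < d2 \<Longrightarrow>
        (\<Sum>i<n. norm (g (r i) - g (l i))) < e / 2"
    using assms(2) e unfolding abs_cont_def by meson
  have "(\<Sum>i<n. norm (f (r i) + g (r i) - (f (l i) + g (l i)))) < e"
    if "\<forall>i<n. l i \<le> r i" "disjoint_family_on (\<lambda>i. {l i<..<r i}) {..<n}" "(\<Sum>i<n. r i - l i) < min d1 d2"
    for n :: nat and l r
  proof -
    have "(\<Sum>i<n. norm (f (r i) + g (r i) - (f (l i) + g (l i)))) \<le>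
      (\<Sum>i<n. norm (f (r i) - f (l i)) + norm (g (r i) - g (l i)))"
      by (intro sum_mono) (metis add_diff_add norm_triangle_ineq)
    also have "\<dots> < e"
      using d1(2)[of n l r] d2(2)[of n l r] that by (simp add: sum.distrib)
    finally show ?thesis .
  qed
  then show "\<exists>\<delta>>0. \<forall>(n::nat) l r. (\<forall>i<n. l i \<le> r i) \<longrightarrow> disjoint_family_on (\<lambda>i. {l i<..<r i}) {..<n} \<longrightarrow>
      (\<Sum>i<n. r i - l i) < \<delta> \<longrightarrow> (\<Sum>i<n. norm (f (r i) + g (r i) - (f (l i) + g (l i)))) < e"
    using d1(1) d2(1) by (intro exI[of _ "min d1 d2"]) auto
qed

text \<open>The Lipschitz bound is asked only along the curve, since the energy is Lipschitz merely
  on bounded sets.\<close>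

lemma abs_cont_Lipschitz_comp:
  fixes f :: "real \<Rightarrow> 'a::real_normed_vector" and g :: "'a \<Rightarrow> 'b::real_normed_vector"
  assumes "abs_cont f" and L: "\<And>x y. norm (g (f x) - g (f y)) \<le> L * norm (f x - f y)"
  shows "abs_cont (\<lambda>x. g (f x))"
  unfolding abs_cont_def
proof (intro allI impI)
  fix e :: real assume "e > 0"
  then have e: "e / (\<bar>L\<bar> + 1) > 0" by (simp add: add_nonneg_pos)
  obtain d where d: "d > 0" "\<And>(n::nat) l r. \<forall>i<n. l i \<le> r i \<Longrightarrow>
     disjoint_family_on (\<lambda>i. {l i<..<r i}) {..<n} \<Longrightarrow> (\<Sum>i<n. r i - l i) < d \<Longrightarrow>
        (\<Sum>i<n. norm (f (r i) - f (l i))) < e / (\<bar>L\<bar> + 1)"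
    using assms(1) e unfolding abs_cont_def by meson
  have "(\<Sum>i<n. norm (g (f (r i)) - g (f (l i)))) < e"
    if "\<forall>i<n. l i \<le> r i" "disjoint_family_on (\<lambda>i. {l i<..<r i}) {..<n}" "(\<Sum>i<n. r i - l i) < d"
    for n :: nat and l r
  proof -
    have "norm (g (f (r i)) - g (f (l i))) \<le> (\<bar>L\<bar> + 1) * norm (f (r i) - f (l i))" for i
      by (rule order_trans[OF L]) (intro mult_right_mono, auto)
    then have "(\<Sum>i<n. norm (g (f (r i)) - g (f (l i)))) \<le> (\<Sum>i<n. (\<bar>L\<bar> + 1) * norm (f (r i) - f (l i)))"
      by (intro sum_mono)
    also have "\<dots> = (\<bar>L\<bar> + 1) * (\<Sum>i<n. norm (f (r i) - f (l i)))" by (simp add: sum_distrib_left)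
    also have "\<dots> < (\<bar>L\<bar> + 1) * (e / (\<bar>L\<bar> + 1))"
      using d(2)[OF that] by (intro mult_strict_left_mono) auto
    also have "\<dots> = e"
      using nonzero_mult_div_cancel_left[of "\<bar>L\<bar> + 1" e] by (simp add: add_nonneg_eq_0_iff)
    finally show ?thesis .
  qed
  then show "\<exists>\<delta>>0. \<forall>(n::nat) l r. (\<forall>i<n. l i \<le> r i) \<longrightarrow> disjoint_family_on (\<lambda>i. {l i<..<r i}) {..<n} \<longrightarrow>
      (\<Sum>i<n. r i - l i) < \<delta> \<longrightarrow> (\<Sum>i<n. norm (g (f (r i)) - g (f (l i)))) < e"
    using d(1) by blast
qed

lemma abs_cont_imp_isCont:
  assumes "abs_cont f"
  shows "isCont f x"
  unfolding isCont_def LIM_def dist_norm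
proof (intro allI impI)
  fix e :: real assume e: "e > 0"
  obtain d where d: "d > 0" "\<And>(n::nat) l r. \<forall>i<n. l i \<le> r i \<Longrightarrow>
     disjoint_family_on (\<lambda>i. {l i<..<r i}) {..<n} \<Longrightarrow> (\<Sum>i<n. r i - l i) < d \<Longrightarrow>
        (\<Sum>i<n. norm (f (r i) - f (l i))) < e"
    using assms e unfolding abs_cont_def by meson
  have "norm (f y - f x) < e" if "norm (y - x) < d" for y
    using d(2)[of 1 "\<lambda>_. min x y" "\<lambda>_. max x y"] that
    by (cases "x \<le> y") (auto simp: disjoint_family_on_def norm_minus_commute min_def max_def)
  then show "\<exists>s>0. \<forall>y. y \<noteq> x \<and> norm (y - x) < s \<longrightarrow> norm (f y - f x) < e" using d(1) by blast
qed

subsection \<open>The variation of an absolutely continuous function\<close>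

text \<open>Gaps between the intervals are allowed, as in the families of \<open>abs_cont\<close>,
  and intervals may be degenerate, so that cutting at a point needs no bookkeeping.\<close>

definition var_sums :: "(real \<Rightarrow> 'a::real_normed_vector) \<Rightarrow> real \<Rightarrow> real \<Rightarrow> real set" where
  "var_sums f x y = {\<Sum>i<n. norm (f (r i) - f (l i)) | (n::nat) l r.
     (\<forall>i<n. x \<le> l i \<and> l i \<le> r i \<and> r i \<le> y) \<and> disjoint_family_on (\<lambda>i. {l i<..<r i}) {..<n}}"

definition vari :: "(real \<Rightarrow> 'a::real_normed_vector) \<Rightarrow> real \<Rightarrow> real \<Rightarrow> real" where
  "vari f x y = Sup (var_sums f x y)"

lemma zero_in_var_sums: "0 \<in> var_sums f x y"
  unfolding var_sums_def by (rule CollectI) (intro exI[of _ 0] exI[of _ "\<lambda>_. 0"], simp add: disjoint_family_on_def)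

text \<open>Minima and maxima of the end points with \<open>y\<close> cut all intervals at once. An
  interval on one side of \<open>y\<close> leaves a degenerate piece on the other side; one that
  straddles \<open>y\<close> is handled by the triangle inequality.\<close>

lemma var_sums_split:
  assumes s: "s \<in> var_sums f x z" and y: "x \<le> y" "y \<le> z"
  shows "\<exists>s1\<in>var_sums f x y. \<exists>s2\<in>var_sums f y z. s \<le> s1 + s2"
proof -
  from s obtain n :: nat and l r where lr: "\<forall>i<n. x \<le> l i \<and> l i \<le> r i \<and> r i \<le> z"
    and dis: "disjoint_family_on (\<lambda>i. {l i<..<r i}) {..<n}" and s_eq: "s = (\<Sum>i<n. norm (f (r i) - f (l i)))"
    unfolding var_sums_def by blast
  let ?s1 = "\<Sum>i<n. norm (f (min (r i) y) - f (min (l i) y))"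
  let ?s2 = "\<Sum>i<n. norm (f (max (r i) y) - f (max (l i) y))"
  have "?s1 \<in> var_sums f x y"
    unfolding var_sums_def
  proof (rule CollectI, intro exI conjI)
    show "\<forall>i<n. x \<le> min (l i) y \<and> min (l i) y \<le> min (r i) y \<and> min (r i) y \<le> y" using lr y by (auto simp: min_def)
    show "disjoint_family_on (\<lambda>i. {min (l i) y<..<min (r i) y}) {..<n}"
      by (rule disjoint_family_on_bisimulation[OF dis]) (auto simp: min_def split: if_splits)
  qed simp
  moreover have "?s2 \<in> var_sums f y z"
    unfolding var_sums_def
  proof (rule CollectI, intro exI conjI)
    show "\<forall>i<n. y \<le> max (l i) y \<and> max (l i) y \<le> max (r i) y \<and> max (r i) y \<le> z" using lr y by (auto simp: max_def)
    show "disjoint_family_on (\<lambda>i. {max (l i) y<..<max (r i) y}) {..<n}"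
      by (rule disjoint_family_on_bisimulation[OF dis]) (auto simp: max_def split: if_splits)
  qed simp
  moreover have "s \<le> ?s1 + ?s2"
    unfolding s_eq sum.distrib[symmetric]
  proof (rule sum_mono)
    fix i assume "i \<in> {..<n}"
    then have le: "l i \<le> r i" using lr by simp
    consider "r i \<le> y" | "y \<le> l i" | "l i < y" "y < r i" by linarith
    then show "norm (f (r i) - f (l i)) \<le> norm (f (min (r i) y) - f (min (l i) y)) + norm (f (max (r i) y) - f (max (l i) y))"
    proof cases
      case 3
      then show ?thesis using norm_triangle_ineq[of "f y - f (l i)" "f (r i) - f y"] by (simp add: min_def max_def)
    qed (use le in \<open>auto simp: min_def max_def\<close>)
  qed
  ultimately show ?thesis by blast
qed

lemma var_sums_append:
  assumes s: "s \<in> var_sums f x y" and yz: "x \<le> y" "y \<le> z"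
  shows "s + norm (f z - f y) \<in> var_sums f x z"
proof -
  from s obtain n :: nat and l r where lr: "\<forall>i<n. x \<le> l i \<and> l i \<le> r i \<and> r i \<le> y"
    and dis: "disjoint_family_on (\<lambda>i. {l i<..<r i}) {..<n}" and s_eq: "s = (\<Sum>i<n. norm (f (r i) - f (l i)))"
    unfolding var_sums_def by blast
  define l' where "l' i = (if i < n then l i else y)" for i
  define r' where "r' i = (if i < n then r i else z)" for i
  have "s + norm (f z - f y) = (\<Sum>i<Suc n. norm (f (r' i) - f (l' i)))" by (simp add: s_eq l'_def r'_def)
  moreover have "\<forall>i<Suc n. x \<le> l' i \<and> l' i \<le> r' i \<and> r' i \<le> z" using lr yz by (auto simp: l'_def r'_def)
  moreover have "disjoint_family_on (\<lambda>i. {l' i<..<r' i}) {..<Suc n}"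
    unfolding disjoint_family_on_def
  proof (intro ballI impI)
    fix i j assume "i \<in> {..<Suc n}" "j \<in> {..<Suc n}" "i \<noteq> j"
    then consider "i < n" "j < n" | "i = n" "j < n" | "i < n" "j = n" by force
    then show "{l' i<..<r' i} \<inter> {l' j<..<r' j} = {}"
    proof cases
      case 1
      then show ?thesis using dis \<open>i \<noteq> j\<close> by (simp add: disjoint_family_on_def l'_def r'_def)
    next
      case 2
      then have "r j \<le> y" using lr by simp
      then show ?thesis using 2 by (auto simp: l'_def r'_def)
    next
      case 3
      then have "r i \<le> y" using lr by simp
      then show ?thesis using 3 by (auto simp: l'_def r'_def)
    qed
  qed
  ultimately show ?thesis unfolding var_sums_def by blast
qed

lemma disjoint_intervals_length:
  fixes l r :: "'i \<Rightarrow> real"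
  assumes "finite K" "disjoint_family_on (\<lambda>i. {l i<..<r i}) K" "\<And>i. i \<in> K \<Longrightarrow> a \<le> l i \<and> l i \<le> r i \<and> r i \<le> b" "a \<le> b"
  shows "(\<Sum>i\<in>K. r i - l i) \<le> b - a"
proof -
  have "(\<Sum>i\<in>K. r i - l i) = (\<Sum>i\<in>K. measure lborel {l i<..<r i})"
    using assms by (intro sum.cong) auto
  also have "\<dots> = measure lborel (\<Union>i\<in>K. {l i<..<r i})"
    using assms by (intro measure_finite_Union[symmetric]) auto
  also have "\<dots> \<le> measure lborel {a..b}"
  proof (rule measure_mono_fmeasurable)
    show "(\<Union>i\<in>K. {l i<..<r i}) \<subseteq> {a..b}" using assms(3) by force
    show "(\<Union>i\<in>K. {l i<..<r i}) \<in> sets lborel" using assms(1) by auto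
    show "{a..b} \<in> fmeasurable lborel" using assms(4) by (simp add: fmeasurable_def)
  qed
  finally show ?thesis using assms by simp
qed

context
  fixes f :: "real \<Rightarrow> 'a::real_normed_vector"
  assumes ac: "abs_cont f"
begin

text \<open>On short intervals absolute continuity with tolerance 1 bounds all sums by 1; the
  Bolzano induction adds such bounds up over a compact interval.\<close>

lemma var_sums_bdd:
  assumes "x \<le> y"
  shows "bdd_above (var_sums f x y)"
  using assms
proof (induction rule: Bolzano)
  case (trans a b c)
  from trans(1,2) obtain M1 M2 where M: "\<And>s. s \<in> var_sums f a b \<Longrightarrow> s \<le> M1" "\<And>s. s \<in> var_sums f b c \<Longrightarrow> s \<le> M2"
    unfolding bdd_above_def by blast
  have "s \<le> M1 + M2" if "s \<in> var_sums f a c" for s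
    using var_sums_split[OF that trans(3,4)] M by force
  then show ?case unfolding bdd_above_def by blast
next
  case (local x)
  obtain d where d: "d > 0" "\<And>(n::nat) l r. \<forall>i<n. l i \<le> r i \<Longrightarrow>
     disjoint_family_on (\<lambda>i. {l i<..<r i}) {..<n} \<Longrightarrow> (\<Sum>i<n. r i - l i) < d \<Longrightarrow>
        (\<Sum>i<n. norm (f (r i) - f (l i))) < 1"
    using ac zero_less_one unfolding abs_cont_def by meson
  have "s \<le> 1" if ab: "a \<le> x" "x \<le> b" "b - a < d" and s: "s \<in> var_sums f a b" for a b s
  proof -
    from s obtain n :: nat and l r where lr: "\<forall>i<n. a \<le> l i \<and> l i \<le> r i \<and> r i \<le> b"
      and dis: "disjoint_family_on (\<lambda>i. {l i<..<r i}) {..<n}" and s_eq: "s = (\<Sum>i<n. norm (f (r i) - f (l i)))"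
      unfolding var_sums_def by blast
    have "(\<Sum>i<n. r i - l i) \<le> b - a" using lr dis ab by (intro disjoint_intervals_length) auto
    then show ?thesis using d(2)[of n l r] lr dis ab(3) unfolding s_eq by force
  qed
  then show ?case using d(1) unfolding bdd_above_def by blast
qed

lemma vari_upper: "s \<in> var_sums f x y \<Longrightarrow> x \<le> y \<Longrightarrow> s \<le> vari f x y"
  unfolding vari_def by (rule cSup_upper[OF _ var_sums_bdd])

lemma vari_least: "(\<And>s. s \<in> var_sums f x y \<Longrightarrow> s \<le> c) \<Longrightarrow> vari f x y \<le> c"
  unfolding vari_def using zero_in_var_sums[of f x y] by (intro cSup_least) auto

text \<open>Source of the Jordan decomposition: for real \<open>f\<close> it makes both
  \<open>vari f a\<close> and its sum with \<open>f\<close> nondecreasing.\<close>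

lemma vari_append:
  assumes "x \<le> y" "y \<le> z"
  shows "vari f x y + norm (f z - f y) \<le> vari f x z"
proof -
  have "vari f x y \<le> vari f x z - norm (f z - f y)"
    using vari_upper[OF var_sums_append[OF _ assms]] assms by (intro vari_least) (simp add: le_diff_eq)
  then show ?thesis by simp
qed

lemma vari_split:
  assumes "x \<le> y" "y \<le> z"
  shows "vari f x z \<le> vari f x y + vari f y z"
proof (rule vari_least)
  fix s assume "s \<in> var_sums f x z"
  from var_sums_split[OF this assms] obtain s1 s2 where "s1 \<in> var_sums f x y" "s2 \<in> var_sums f y z" "s \<le> s1 + s2"
    by blast
  then show "s \<le> vari f x y + vari f y z"
    using vari_upper[of s1 x y] vari_upper[of s2 y z] assms by linarith
qed

text \<open>Near-optimal families inside the given intervals merge into one disjoint family, indexed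
  by pairs, of no larger total length. Absolute continuity of \<open>f\<close> is applied to it with
  half the tolerance; each of the \<open>n\<close> choices gives away
  \<open>e / (2 * n)\<close>.\<close>

lemma abs_cont_vari: "abs_cont (\<lambda>x. vari f a (clip a b x))" if ab: "a \<le> b"
  unfolding abs_cont_def
proof (intro allI impI)
  fix e :: real assume e: "e > 0"
  obtain d where d: "d > 0" "\<And>(K::(nat \<times> nat) set) l r. finite K \<Longrightarrow> \<forall>i\<in>K. l i \<le> r i \<Longrightarrow>
      disjoint_family_on (\<lambda>i. {l i<..<r i}) K \<Longrightarrow> (\<Sum>i\<in>K. r i - l i) < d \<Longrightarrow>
      (\<Sum>i\<in>K. norm (f (r i) - f (l i))) < e / 2"
    using abs_contD[OF ac, of "e / 2", where 'i="nat \<times> nat"] e by auto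
  have "(\<Sum>i<n. norm (vari f a (clip a b (r i)) - vari f a (clip a b (l i)))) < e"
    if lr: "\<forall>i<n. l i \<le> r i" and dis: "disjoint_family_on (\<lambda>i. {l i<..<r i}) {..<n}"
      and sm: "(\<Sum>i<n. r i - l i) < d" for n :: nat and l r
  proof (cases "n = 0")
    case False
    define L where "L i = clip a b (l i)" for i
    define R where "R i = clip a b (r i)" for i
    have LR: "a \<le> L i" "L i \<le> R i" "R i \<le> b" if "i < n" for i
      using lr that ab by (auto simp: L_def R_def clip_def)
    have len: "(\<Sum>i<n. R i - L i) \<le> (\<Sum>i<n. r i - l i)"
      using lr ab by (intro sum_mono) (auto simp: L_def R_def clip_def max_def min_def)
    have dis': "disjoint_family_on (\<lambda>i. {L i<..<R i}) {..<n}"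
      by (rule disjoint_family_on_bisimulation[OF dis])
        (auto simp: L_def R_def clip_def max_def min_def split: if_splits)
    have "\<exists>s\<in>var_sums f (L i) (R i). vari f (L i) (R i) < s + e / (2 * n)" if "i < n" for i
    proof -
      have "vari f (L i) (R i) - e / (2 * n) < Sup (var_sums f (L i) (R i))"
        using e False by (simp add: vari_def)
      then obtain s where "s \<in> var_sums f (L i) (R i)" "vari f (L i) (R i) - e / (2 * n) < s"
        using less_cSupD[of "var_sums f (L i) (R i)"] zero_in_var_sums[of f "L i" "R i"] by auto
      then show ?thesis by (intro bexI[of _ s]) auto
    qed
    then obtain s where s: "\<And>i. i < n \<Longrightarrow> s i \<in> var_sums f (L i) (R i)"
      "\<And>i. i < n \<Longrightarrow> vari f (L i) (R i) < s i + e / (2 * n)" by metis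
    define Q where "Q i m x y \<longleftrightarrow> (\<forall>j<m. L i \<le> x j \<and> x j \<le> y j \<and> y j \<le> R i) \<and>
        disjoint_family_on (\<lambda>j. {x j<..<y j}) {..<m} \<and> s i = (\<Sum>j<m. norm (f (y j) - f (x j)))"
      for i and m :: nat and x y
    have "\<exists>m x y. Q i m x y" if "i < n" for i
      using s(1)[OF that] unfolding var_sums_def Q_def by blast
    then obtain m x y where Q: "\<And>i. i < n \<Longrightarrow> Q i (m i) (x i) (y i)" by metis
    have xy: "L i \<le> x i j \<and> x i j \<le> y i j \<and> y i j \<le> R i" if "i < n" "j < m i" for i j
      using Q[OF that(1)] that(2) by (simp add: Q_def)
    have xyd: "disjoint_family_on (\<lambda>j. {x i j<..<y i j}) {..<m i}"
      and s_eq: "s i = (\<Sum>j<m i. norm (f (y i j) - f (x i j)))" if "i < n" for i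
      using Q[OF that] by (simp_all add: Q_def)
    define K where "K = Sigma {..<n} (\<lambda>i. {..<m i})"
    have "(\<Sum>k\<in>K. norm (f (y (fst k) (snd k)) - f (x (fst k) (snd k)))) < e / 2"
    proof (rule d(2))
      show "finite K" by (simp add: K_def)
      show "\<forall>i\<in>K. x (fst i) (snd i) \<le> y (fst i) (snd i)" using xy by (auto simp: K_def)
      show "disjoint_family_on (\<lambda>i. {x (fst i) (snd i)<..<y (fst i) (snd i)}) K"
        unfolding disjoint_family_on_def
      proof (intro ballI impI)
        fix k k' assume k: "k \<in> K" "k' \<in> K" "k \<noteq> k'"
        obtain i j i' j' where kk: "k = (i, j)" "k' = (i', j')" by fastforce
        then have b: "i < n" "j < m i" "i' < n" "j' < m i'" using k by (auto simp: K_def)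
        show "{x (fst k) (snd k)<..<y (fst k) (snd k)} \<inter> {x (fst k') (snd k')<..<y (fst k') (snd k')} = {}"
        proof (cases "i = i'")
          case True
          then have "j \<noteq> j'" using k kk by simp
          then show ?thesis using xyd[OF b(1)] b kk True unfolding disjoint_family_on_def by auto
        next
          case False
          then have "{L i<..<R i} \<inter> {L i'<..<R i'} = {}" using dis' b unfolding disjoint_family_on_def by auto
          moreover have "{x i j<..<y i j} \<subseteq> {L i<..<R i}" "{x i' j'<..<y i' j'} \<subseteq> {L i'<..<R i'}"
            using xy[OF b(1,2)] xy[OF b(3,4)] by auto
          ultimately show ?thesis unfolding kk fst_conv snd_conv by blast
        qed
      qed
      have "(\<Sum>i\<in>K. y (fst i) (snd i) - x (fst i) (snd i)) = (\<Sum>i<n. \<Sum>j<m i. y i j - x i j)"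
        unfolding K_def by (subst sum.Sigma) (auto simp: case_prod_beta)
      also have "\<dots> \<le> (\<Sum>i<n. R i - L i)"
        using xy xyd LR by (intro sum_mono disjoint_intervals_length) auto
      finally show "(\<Sum>i\<in>K. y (fst i) (snd i) - x (fst i) (snd i)) < d" using len sm by linarith
    qed
    also have "(\<Sum>k\<in>K. norm (f (y (fst k) (snd k)) - f (x (fst k) (snd k)))) = (\<Sum>i<n. s i)"
    proof -
      have "(\<Sum>i<n. s i) = (\<Sum>i<n. \<Sum>j<m i. norm (f (y i j) - f (x i j)))" using s_eq by (intro sum.cong) auto
      also have "\<dots> = (\<Sum>k\<in>K. norm (f (y (fst k) (snd k)) - f (x (fst k) (snd k))))"
        unfolding K_def by (subst sum.Sigma) (auto simp: case_prod_beta)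
      finally show ?thesis ..
    qed
    finally have ss: "(\<Sum>i<n. s i) < e / 2" .
    have "(\<Sum>i<n. norm (vari f a (R i) - vari f a (L i))) \<le> (\<Sum>i<n. s i + e / (2 * n))"
    proof (rule sum_mono)
      fix i assume "i \<in> {..<n}"
      then have i: "i < n" by simp
      have "vari f a (L i) \<le> vari f a (R i)"
        using vari_append[OF LR(1,2)[OF i]] by (smt (verit) norm_ge_zero)
      moreover have "vari f a (R i) \<le> vari f a (L i) + vari f (L i) (R i)" using LR[OF i] by (intro vari_split)
      ultimately show "norm (vari f a (R i) - vari f a (L i)) \<le> s i + e / (2 * n)" using s(2)[OF i] by simp
    qed
    also have "\<dots> = (\<Sum>i<n. s i) + e / 2" using False by (simp add: sum.distrib)
    finally show ?thesis using ss by (simp add: L_def R_def)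
  qed (use e in simp)
  then show "\<exists>\<delta>>0. \<forall>(n::nat) l r. (\<forall>i<n. l i \<le> r i) \<longrightarrow> disjoint_family_on (\<lambda>i. {l i<..<r i}) {..<n} \<longrightarrow>
      (\<Sum>i<n. r i - l i) < \<delta> \<longrightarrow> (\<Sum>i<n. norm (vari f a (clip a b (r i)) - vari f a (clip a b (l i)))) < e"
    using d(1) by blast
qed

end


subsection \<open>Covering compact sets by grid intervals\<close>

abbreviation cell :: "real \<Rightarrow> int \<Rightarrow> real set" where
  "cell h j \<equiv> {of_int j * h<..(of_int j + 1) * h}"

lemma cell_disjoint:
  assumes "h > 0"
  shows "disjoint_family_on (cell h) J"
proof -
  have "cell h i \<inter> cell h j = {}" if "i < j" for i j
  proof -
    have "(of_int i + 1) * h \<le> of_int j * h" using assms that by (intro mult_right_mono) auto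
    then show ?thesis by auto
  qed
  then show ?thesis unfolding disjoint_family_on_def by (metis Int_commute linorder_cases)
qed

text \<open>Half-open cells of one grid are disjoint, and their Stieltjes measures are increments;
  this links measures of sets with increments. A mesh below the distance from \<open>K\<close> to
  the complement of \<open>U\<close> keeps every cell that meets \<open>K\<close> inside
  \<open>U\<close>.\<close>

lemma compact_grid_cover:
  fixes K U :: "real set"
  assumes "compact K" "open U" "K \<subseteq> U"
  obtains h J where "h > 0" "finite J" "K \<subseteq> (\<Union>j\<in>J. cell h j)" "(\<Union>j\<in>J. cell h j) \<subseteq> U"
proof -
  obtain e where e: "e > 0" "(\<Union>x\<in>K. ball x e) \<subseteq> U"
    using compact_subset_open_imp_ball_epsilon_subset[OF assms] by blast
  obtain b where b: "\<And>x. x \<in> K \<Longrightarrow> \<bar>x\<bar> \<le> b"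
    using compact_imp_bounded[OF assms(1)] by (auto simp: bounded_iff)
  define h where "h = e / 2"
  have h: "h > 0" using e by (simp add: h_def)
  define J where "J = {j. cell h j \<inter> K \<noteq> {}}"
  have "J \<subseteq> {\<lfloor>- b / h\<rfloor> - 1..\<lceil>b / h\<rceil>}"
  proof
    fix j assume "j \<in> J"
    then obtain x where x: "x \<in> K" "of_int j * h < x" "x \<le> (of_int j + 1) * h" by (auto simp: J_def)
    then have "of_int j * h < b" "- b \<le> (of_int j + 1) * h" using b[OF x(1)] by linarith+
    then have "of_int j < b / h" "- b / h \<le> of_int j + 1"
      using h by (simp_all only: pos_less_divide_eq pos_divide_le_eq)
    then show "j \<in> {\<lfloor>- b / h\<rfloor> - 1..\<lceil>b / h\<rceil>}" by (simp; linarith)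
  qed
  then have "finite J" using finite_subset by blast
  moreover have "K \<subseteq> (\<Union>j\<in>J. cell h j)"
  proof
    fix x assume x: "x \<in> K"
    \<comment> \<open>Rounding up and subtracting 1 respects cells that are open on the left and
      closed on the right.\<close>
    define j where "j = \<lceil>x / h\<rceil> - 1"
    have "of_int j < x / h" "x / h \<le> of_int j + 1" unfolding j_def by linarith+
    then have "x \<in> cell h j" using h by (auto simp: field_simps)
    with x have "j \<in> J" by (auto simp only: J_def)
    with \<open>x \<in> cell h j\<close> show "x \<in> (\<Union>j\<in>J. cell h j)" by (rule UN_I[rotated])
  qed
  moreover have "(\<Union>j\<in>J. cell h j) \<subseteq> U"
  proof
    fix y assume "y \<in> (\<Union>j\<in>J. cell h j)"
    then obtain j where "j \<in> J" and jy: "y \<in> cell h j" by (rule UN_E)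
    then obtain x where jx: "y \<in> cell h j" "x \<in> cell h j" "x \<in> K" unfolding J_def by blast
    have "(of_int j + 1) * h = of_int j * h + h" by (simp add: algebra_simps)
    then have "\<bar>y - x\<bar> < h" using jx(1,2) by auto
    then have "\<bar>x - y\<bar> < e" using e(1) unfolding h_def by linarith
    then have "y \<in> ball x e" by (simp add: dist_real_def)
    then show "y \<in> U" using e(2) jx(3) by blast
  qed
  ultimately show thesis using that h by blast
qed

subsection \<open>Densities of monotone absolutely continuous functions\<close>

lemma finite_interval_measure:
  fixes F :: "real \<Rightarrow> real"
  assumes mono: "\<And>x y. x \<le> y \<Longrightarrow> F x \<le> F y" and rc: "\<And>x. continuous (at_right x) F"
    and lo: "\<And>x. lo \<le> F x" and hi: "\<And>x. F x \<le> hi"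
  shows "finite_measure (interval_measure F)"
proof (rule finite_measureI)
  let ?A = "\<lambda>n::nat. {- real n<..real n}"
  have "(\<Union>n. ?A n) = UNIV"
  proof -
    have "\<exists>n::nat. - real n < x \<and> x \<le> real n" for x
      using reals_Archimedean2[of "\<bar>x\<bar>"] by (metis abs_less_iff less_imp_le minus_less_iff)
    then show ?thesis by auto
  qed
  moreover have "(SUP n. emeasure (interval_measure F) (?A n)) = emeasure (interval_measure F) (\<Union>n. ?A n)"
    by (rule SUP_emeasure_incseq) (auto simp: incseq_def)
  moreover have "(SUP n. emeasure (interval_measure F) (?A n)) \<le> ennreal (hi - lo)"
  proof (rule SUP_least)
    fix n
    have "emeasure (interval_measure F) (?A n) = ennreal (F (real n) - F (- real n))"
      by (rule emeasure_interval_measure_Ioc[OF _ mono rc]) simp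
    then show "emeasure (interval_measure F) (?A n) \<le> ennreal (hi - lo)"
      using lo[of "- real n"] hi[of "real n"] by (simp add: ennreal_leI)
  qed
  ultimately have "emeasure (interval_measure F) UNIV \<le> ennreal (hi - lo)" by simp
  then show "emeasure (interval_measure F) (space (interval_measure F)) \<noteq> \<infinity>"
    by (auto simp: top_unique)
qed

text \<open>A Lebesgue null set lies in an open set of small length. Compact subsets of the latter
  are covered by finitely many disjoint cells of small total length, whose increments of
  \<open>F\<close> add up to less than \<open>e\<close>; inner regularity passes from compact sets
  to the open set.\<close>

lemma interval_measure_abs_cont:
  fixes F :: "real \<Rightarrow> real"
  assumes mono: "\<And>x y. x \<le> y \<Longrightarrow> F x \<le> F y" and ac: "abs_cont F"
    and lo: "\<And>x. lo \<le> F x" and hi: "\<And>x. F x \<le> hi"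
  shows "absolutely_continuous lborel (interval_measure F)"
  unfolding absolutely_continuous_def
proof
  have rc: "continuous (at_right x) F" for x
    using abs_cont_imp_isCont[OF ac] continuous_at_imp_continuous_within by blast
  interpret finite_measure "interval_measure F" by (rule finite_interval_measure[OF mono rc lo hi])
  fix A :: "real set" assume A: "A \<in> null_sets lborel"
  then have [measurable]: "A \<in> sets borel" by auto
  have small: "emeasure (interval_measure F) A \<le> ennreal e" if e: "e > 0" for e
  proof -
    obtain d where d: "d > 0" "\<And>(J::int set) l r. finite J \<Longrightarrow> \<forall>i\<in>J. l i \<le> r i \<Longrightarrow>
        disjoint_family_on (\<lambda>i. {l i<..<r i}) J \<Longrightarrow> (\<Sum>i\<in>J. r i - l i) < d \<Longrightarrow>
        (\<Sum>i\<in>J. norm (F (r i) - F (l i))) < e"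
      using abs_contD[OF ac e, where 'i=int] by auto
    obtain U where U: "open U" "A \<subseteq> U" "emeasure lborel (U - A) < ennreal d"
      using outer_regular_lborel[of A d] d(1) by auto
    have "emeasure lborel U \<le> emeasure lborel (U - A) + emeasure lborel A"
      using U by (intro order_trans[OF emeasure_mono emeasure_subadditive]) auto
    then have Ud: "emeasure lborel U < ennreal d" using U(3) null_setsD1[OF A] by (simp add: le_less_trans)
    have "emeasure (interval_measure F) K \<le> ennreal e" if K: "compact K" "K \<subseteq> U" for K
    proof -
      obtain h J where hJ: "h > 0" "finite J" "K \<subseteq> (\<Union>j\<in>J. cell h j)" "(\<Union>j\<in>J. cell h j) \<subseteq> U"
        by (rule compact_grid_cover[OF K(1) U(1) K(2)])
      note dis = cell_disjoint[OF hJ(1), of J]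
      have jle: "of_int j * h \<le> (of_int j + 1) * h" for j :: int using hJ(1) by (intro mult_right_mono) auto
      have "(\<Sum>j\<in>J. ennreal ((of_int j + 1) * h - of_int j * h)) = (\<Sum>j\<in>J. emeasure lborel (cell h j))"
        using jle by (intro sum.cong) auto
      also have "\<dots> = emeasure lborel (\<Union>j\<in>J. cell h j)"
        using hJ(2) dis by (intro sum_emeasure) auto
      also have "\<dots> \<le> emeasure lborel U" using hJ(4) U(1) by (intro emeasure_mono) auto
      also have "\<dots> < ennreal d" by (rule Ud)
      finally have len: "(\<Sum>j\<in>J. (of_int j + 1) * h - of_int j * h) < d"
        using jle d(1) by (subst (asm) sum_ennreal) (auto simp: ennreal_less_iff sum_nonneg)
      have "emeasure (interval_measure F) K \<le> emeasure (interval_measure F) (\<Union>j\<in>J. cell h j)"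
        using hJ(2,3) by (intro emeasure_mono) auto
      also have "\<dots> = (\<Sum>j\<in>J. emeasure (interval_measure F) (cell h j))"
        using hJ(2) dis by (intro sum_emeasure[symmetric]) auto
      also have "\<dots> = (\<Sum>j\<in>J. ennreal (norm (F ((of_int j + 1) * h) - F (of_int j * h))))"
        using emeasure_interval_measure_Ioc[OF jle mono rc] mono[OF jle] by (intro sum.cong) auto
      also have "\<dots> = ennreal (\<Sum>j\<in>J. norm (F ((of_int j + 1) * h) - F (of_int j * h)))"
        by (rule sum_ennreal) simp
      also have "\<dots> \<le> ennreal e"
      proof (rule ennreal_leI, rule less_imp_le, rule d(2))
        show "disjoint_family_on (\<lambda>j. {of_int j * h<..<(of_int j + 1) * h}) J"
          by (rule disjoint_family_on_bisimulation[OF dis]) force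
      qed (use hJ jle len in auto)
      finally show ?thesis .
    qed
    then have "(SUP K\<in>{K. K \<subseteq> U \<and> compact K}. emeasure (interval_measure F) K) \<le> ennreal e"
      by (intro SUP_least) auto
    then have "emeasure (interval_measure F) U \<le> ennreal e"
      using U(1) emeasure_finite by (subst inner_regular) auto
    moreover have "emeasure (interval_measure F) A \<le> emeasure (interval_measure F) U"
      using U by (intro emeasure_mono) auto
    ultimately show ?thesis by (rule order_trans[rotated])
  qed
  have "emeasure (interval_measure F) A \<le> 0"
  proof (rule ennreal_le_epsilon)
    fix e :: real assume "0 < e"
    then show "emeasure (interval_measure F) A \<le> 0 + ennreal e" using small by simp
  qed
  then show "A \<in> null_sets (interval_measure F)" by (auto simp: null_sets_def)
qed

lemma mono_abs_cont_density:
  fixes F :: "real \<Rightarrow> real"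
  assumes mono: "\<And>x y. x \<le> y \<Longrightarrow> F x \<le> F y" and ac: "abs_cont F"
    and lo: "\<And>x. lo \<le> F x" and hi: "\<And>x. F x \<le> hi"
  shows "\<exists>h::real\<Rightarrow>real. integrable lborel h \<and> (\<forall>x y. x \<le> y \<longrightarrow> F y - F x = (LINT r:{x..y}|lborel. h r))"
proof -
  have rc: "continuous (at_right x) F" for x
    using abs_cont_imp_isCont[OF ac] continuous_at_imp_continuous_within by blast
  interpret finite_measure "interval_measure F" by (rule finite_interval_measure[OF mono rc lo hi])
  obtain f where f[measurable]: "f \<in> borel_measurable lborel" and df: "density lborel f = interval_measure F"
    using sigma_finite_measure.Radon_Nikodym[OF sigma_finite_lborel interval_measure_abs_cont[OF mono ac lo hi]] by auto
  have "(\<integral>\<^sup>+x. f x \<partial>lborel) = emeasure (density lborel f) UNIV" by (simp add: emeasure_density)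
  also have "\<dots> < \<infinity>" using emeasure_finite[of UNIV] by (simp add: df less_top[symmetric])
  finally have fin: "(\<integral>\<^sup>+x. f x \<partial>lborel) < \<infinity>" .
  then have ae: "AE x in lborel. f x \<noteq> \<infinity>" by (intro nn_integral_PInf_AE) auto
  define h where "h x = enn2real (f x)" for x
  have h_nonneg: "0 \<le> h x" for x by (simp add: h_def)
  have [measurable]: "h \<in> borel_measurable lborel" by (simp add: h_def[abs_def])
  have ae': "AE x in lborel. ennreal (h x) = f x" using ae by (auto simp: h_def top.not_eq_extremum)
  then have nh: "(\<integral>\<^sup>+x. ennreal (h x) \<partial>lborel) = (\<integral>\<^sup>+x. f x \<partial>lborel)" by (rule nn_integral_cong_AE)
  have int: "integrable lborel h"
    using fin nh by (intro integrableI_nonneg) (auto simp: h_def)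
  have "F y - F x = (LINT r:{x..y}|lborel. h r)" if xy: "x \<le> y" for x y
  proof -
    have "ennreal (F y - F x) = emeasure (density lborel f) {x<..y}"
      using emeasure_interval_measure_Ioc[OF xy mono rc] by (simp add: df)
    also have "\<dots> = (\<integral>\<^sup>+r. f r * indicator {x<..y} r \<partial>lborel)" by (simp add: emeasure_density)
    also have "\<dots> = (\<integral>\<^sup>+r. ennreal (indicator {x..y} r *\<^sub>R h r) \<partial>lborel)"
    proof (rule nn_integral_cong_AE)
      have "AE r in lborel. r \<noteq> x" using AE_lborel_singleton by auto
      then show "AE r in lborel. f r * indicator {x<..y} r = ennreal (indicator {x..y} r *\<^sub>R h r)"
        using ae' by eventually_elim (auto simp: indicator_def)
    qed
    also have "\<dots> = ennreal (LINT r:{x..y}|lborel. h r)"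
      unfolding set_lebesgue_integral_def using int
      by (intro nn_integral_eq_integral integrable_mult_indicator) (auto intro!: AE_I2 simp: h_nonneg)
    finally have "ennreal (F y - F x) = ennreal (LINT r:{x..y}|lborel. h r)" .
    moreover have "0 \<le> (LINT r:{x..y}|lborel. h r)"
      unfolding set_lebesgue_integral_def by (intro integral_nonneg_AE) (auto simp: h_def)
    ultimately show ?thesis using mono[OF xy] by simp
  qed
  with int show ?thesis by blast
qed

section \<open>Lebesgue differentiation and the velocity of an absolutely continuous curve\<close>

lemma integrable_imp_set_integrable:
  fixes f :: "'b \<Rightarrow> 'a::{banach, second_countable_topology}"
  shows "integrable M f \<Longrightarrow> A \<in> sets M \<Longrightarrow> set_integrable M A f"
  unfolding set_integrable_def by (rule integrable_mult_indicator)

lemma Lebesgue_differentiation_right: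
  fixes h F :: "real \<Rightarrow> real"
  assumes h: "integrable lborel h" and F: "\<And>x y. x \<le> y \<Longrightarrow> F y - F x = (LINT r:{x..y}|lborel. h r)"
  shows "\<exists>N. negligible N \<and> (\<forall>x. x \<notin> N \<longrightarrow> ((\<lambda>y. (F y - F x) / (y - x)) \<longlongrightarrow> h x) (at_right x))"
proof -
  have si: "set_integrable lborel {a..b} h" for a b
    using h unfolding set_integrable_def by (intro integrable_mult_indicator) auto
  obtain N where N: "negligible N" "\<And>x e. \<lbrakk>x \<notin> N; 0 < e\<rbrakk> \<Longrightarrow> \<exists>d>0. \<forall>k. 0 < k \<and> k < d \<longrightarrow>
       norm (integral (cbox x (x + k *\<^sub>R One)) h /\<^sub>R k ^ DIM(real) - h x) < e"
    using integrable_ccontinuous_explicit[of h] set_borel_integral_eq_integral(1)[OF si] by (metis cbox_interval)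
  have "((\<lambda>y. (F y - F x) / (y - x)) \<longlongrightarrow> h x) (at_right x)" if x: "x \<notin> N" for x
  proof (rule tendstoI)
    fix e :: real assume "e > 0"
    then obtain d where d: "d > 0" "\<And>k. 0 < k \<Longrightarrow> k < d \<Longrightarrow> norm (integral (cbox x (x + k *\<^sub>R One)) h /\<^sub>R k ^ DIM(real) - h x) < e"
      using N(2)[OF x] by blast
    have "dist ((F y - F x) / (y - x)) (h x) < e" if y: "x < y" "y < x + d" for y
    proof -
      have "F y - F x = integral (cbox x (x + (y - x) *\<^sub>R One)) h"
        using F[of x y] y set_borel_integral_eq_integral(2)[OF si, of x y] by simp
      then show ?thesis using d(2)[of "y - x"] y by (simp add: dist_real_def divide_inverse mult.commute)
    qed
    then show "\<forall>\<^sub>F y in at_right x. dist ((F y - F x) / (y - x)) (h x) < e"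
      unfolding eventually_at_right[OF less_add_one] using d(1) by (intro exI[of _ "x + d"]) auto
  qed
  with N(1) show ?thesis by blast
qed

text \<open>The preceding lemma rests on averages over intervals that start at \<open>x\<close>, so
  it gives right difference quotients only; the left ones follow by reflecting the line.\<close>

lemma Lebesgue_differentiation:
  fixes h F :: "real \<Rightarrow> real"
  assumes h: "integrable lborel h" and F: "\<And>x y. x \<le> y \<Longrightarrow> F y - F x = (LINT r:{x..y}|lborel. h r)"
  shows "AE x in lborel. (F has_real_derivative h x) (at x)"
proof -
  obtain N1 where N1: "negligible N1" "\<And>x. x \<notin> N1 \<Longrightarrow> ((\<lambda>y. (F y - F x) / (y - x)) \<longlongrightarrow> h x) (at_right x)"
    using Lebesgue_differentiation_right[OF assms] by blast
  define F' where "F' x = - F (- x)" for x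
  define h' where "h' x = h (- x)" for x
  have h': "integrable lborel h'"
    unfolding h'_def using lborel_integrable_real_affine[OF h, of "-1" 0] by simp
  have F': "F' y - F' x = (LINT r:{x..y}|lborel. h' r)" if "x \<le> y" for x y
  proof -
    have "F' y - F' x = (LINT r:{-y..-x}|lborel. h r)" using F[of "-y" "-x"] that by (simp add: F'_def)
    also have "\<dots> = (LINT r:{r. - r \<in> {-y..-x}}|lborel. h (- r))" by (rule set_integral_reflect)
    also have "{r. - r \<in> {-y..-x}} = {x..y}" by auto
    finally show ?thesis by (simp add: h'_def)
  qed
  obtain N2 where N2: "negligible N2" "\<And>x. x \<notin> N2 \<Longrightarrow> ((\<lambda>y. (F' y - F' x) / (y - x)) \<longlongrightarrow> h' x) (at_right x)"
    using Lebesgue_differentiation_right[OF h' F'] by blast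
  have neg: "negligible (N1 \<union> uminus ` N2)"
    using N1(1) negligible_differentiable_image_negligible[OF order_refl N2(1), of uminus]
    by (auto intro: negligible_Un derivative_intros)
  have der: "(F has_real_derivative h x) (at x)" if x: "x \<notin> N1 \<union> uminus ` N2" for x
  proof -
    have "- x \<notin> N2" using x by force
    from N2(2)[OF this] have "((\<lambda>y. (F' (- y) - F' (- x)) / (- y - - x)) \<longlongrightarrow> h' (- x)) (at_left x)"
      unfolding at_left_minus[of x] by (simp add: filterlim_filtermap add.commute)
    moreover have "(F' (- y) - F' (- x)) / (- y - - x) = (F y - F x) / (y - x)" for y
      unfolding F'_def by (simp add: divide_simps) (simp add: algebra_simps)
    ultimately have "((\<lambda>y. (F y - F x) / (y - x)) \<longlongrightarrow> h x) (at_left x)" by (simp add: h'_def)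
    moreover have "((\<lambda>y. (F y - F x) / (y - x)) \<longlongrightarrow> h x) (at_right x)" using N1(2) x by blast
    ultimately show ?thesis unfolding has_field_derivative_iff by (rule filterlim_split_at)
  qed
  have "AE x in lebesgue. x \<notin> N1 \<union> uminus ` N2"
    using neg by (intro AE_not_in) (simp add: negligible_iff_null_sets)
  then have "AE x in lborel. x \<notin> N1 \<union> uminus ` N2" by (simp only: AE_completion_iff)
  then show ?thesis by eventually_elim (rule der)
qed

text \<open>\<open>f\<close> is the difference of \<open>f + v\<close> and its variation function
  \<open>v\<close>, both monotone and absolutely continuous. Constancy outside
  \<open>{a..b}\<close>, expressed by \<open>clip\<close>, makes them bounded.\<close>

lemma abs_cont_real_density:
  fixes f :: "real \<Rightarrow> real"
  assumes ac: "abs_cont f" and ab: "a \<le> b" and cl: "\<And>x. f x = f (clip a b x)"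
  shows "\<exists>h::real\<Rightarrow>real. integrable lborel h \<and> (\<forall>x y. x \<le> y \<longrightarrow> f y - f x = (LINT r:{x..y}|lborel. h r))"
proof -
  define v where "v x = vari f a (clip a b x)" for x
  have v_ac: "abs_cont v" unfolding v_def by (rule abs_cont_vari[OF ac ab])
  have inc: "\<bar>f y - f x\<bar> \<le> v y - v x" if "x \<le> y" for x y
  proof -
    have "a \<le> clip a b x" "clip a b x \<le> clip a b y" using that ab by (auto simp: clip_def)
    from vari_append[OF ac this] show ?thesis by (simp add: v_def cl[of x] cl[of y])
  qed
  have mv: "v x \<le> v y" and mf: "f x + v x \<le> f y + v y" if "x \<le> y" for x y using inc[OF that] by linarith+
  have cv: "v x = v (clip a b x)" for x by (simp add: v_def clip_def max_def min_def)
  have c: "a \<le> clip a b x" "clip a b x \<le> b" for x using ab by (auto simp: clip_def)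
  have "v a \<le> v x" "v x \<le> v b" "f a + v a \<le> f x + v x" "f x + v x \<le> f b + v b" for x
    using mv[OF c(1)] mv[OF c(2)] mf[OF c(1)] mf[OF c(2)] unfolding cv[of x] cl[of x] by blast+
  note bd = this
  obtain h1 :: "real \<Rightarrow> real" where h1: "integrable lborel h1" "\<And>x y. x \<le> y \<Longrightarrow> v y - v x = (LINT r:{x..y}|lborel. h1 r)"
    using mono_abs_cont_density[OF mv v_ac bd(1,2)] by blast
  obtain h2 :: "real \<Rightarrow> real" where h2: "integrable lborel h2"
      "\<And>x y. x \<le> y \<Longrightarrow> (f y + v y) - (f x + v x) = (LINT r:{x..y}|lborel. h2 r)"
    using mono_abs_cont_density[OF mf abs_cont_add[OF ac v_ac] bd(3,4)] by blast
  have "f y - f x = (LINT r:{x..y}|lborel. h2 r - h1 r)" if "x \<le> y" for x y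
    using h1(2)[OF that] h2(2)[OF that]
      set_integral_diff(2)[OF integrable_imp_set_integrable[OF h2(1)] integrable_imp_set_integrable[OF h1(1)], of "{x..y}"]
    by simp
  then show ?thesis using h1(1) h2(1) by (intro exI[of _ "\<lambda>r. h2 r - h1 r"]) auto
qed

text \<open>Scalar densities of the coordinates are assembled into a vector. Extending the curve by
  its boundary values changes neither increments inside \<open>{a..b}\<close> nor derivatives at
  interior points.\<close>

lemma (in coordinates) abs_cont_on_derivative:
  fixes \<theta> :: "real \<Rightarrow> 'a"
  assumes ab: "a < b" and ac: "abs_cont_on a b \<theta>"
  shows "\<exists>h. integrable lborel h \<and> (AE r in lborel. r \<in> {a<..<b} \<longrightarrow> (\<theta> has_vector_derivative h r) (at r)) \<and>
    (\<forall>x y. a \<le> x \<longrightarrow> x \<le> y \<longrightarrow> y \<le> b \<longrightarrow> \<theta> y - \<theta> x = (LINT r:{x..y}|lborel. h r))"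
proof -
  define f where "f x = \<theta> (clip a b x)" for x
  have f_ac: "abs_cont f" unfolding f_def using ab ac by (intro abs_cont_clip) auto
  have f_cl: "f x = f (clip a b x)" for x by (simp add: f_def clip_def max_def min_def)
  have f_eq: "f x = \<theta> x" if "a \<le> x" "x \<le> b" for x using that by (simp add: f_def clip_def)
  have "\<exists>h::real\<Rightarrow>real. integrable lborel h \<and> (\<forall>x y. x \<le> y \<longrightarrow> coord b' (f y) - coord b' (f x) = (LINT r:{x..y}|lborel. h r))"
    if b': "b' \<in> B" for b'
  proof (rule abs_cont_real_density)
    interpret bounded_linear "coord b'" by (rule bounded_linear_coord[OF b'])
    obtain K where K: "\<And>x. norm (coord b' x) \<le> norm x * K" using bounded by blast
    show "abs_cont (\<lambda>x. coord b' (f x))"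
      by (rule abs_cont_Lipschitz_comp[OF f_ac, where L=K]) (metis K diff mult.commute)
    show "a \<le> b" using ab by simp
    show "coord b' (f x) = coord b' (f (clip a b x))" for x by (rule arg_cong[OF f_cl])
  qed
  then obtain h :: "'a \<Rightarrow> real \<Rightarrow> real" where h: "\<And>c. c \<in> B \<Longrightarrow> integrable lborel (h c)"
    "\<And>c x y. c \<in> B \<Longrightarrow> x \<le> y \<Longrightarrow> coord c (f y) - coord c (f x) = (LINT r:{x..y}|lborel. h c r)" by metis
  define H where "H r = (\<Sum>c\<in>B. h c r *\<^sub>R c)" for r
  have Hint: "integrable lborel H" unfolding H_def using h(1) by (intro Bochner_Integration.integrable_sum) auto
  have "AE r in lborel. \<forall>c\<in>B. ((\<lambda>x. coord c (f x)) has_real_derivative h c r) (at r)"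
    using Lebesgue_differentiation[OF h] finite_B by (intro AE_finite_allI) auto
  then have der: "AE r in lborel. r \<in> {a<..<b} \<longrightarrow> (\<theta> has_vector_derivative H r) (at r)"
  proof eventually_elim
    case (elim r)
    have "((\<lambda>x. \<Sum>c\<in>B. coord c (f x) *\<^sub>R c) has_vector_derivative H r) (at r)"
      unfolding H_def
      by (intro has_vector_derivative_sum) (use elim in \<open>auto intro!: derivative_eq_intros\<close>)
    then have fd: "(f has_vector_derivative H r) (at r)" by (simp add: sum_coord)
    show ?case
    proof
      assume r: "r \<in> {a<..<b}"
      show "(\<theta> has_vector_derivative H r) (at r)"
        by (rule has_vector_derivative_transform_within_open[OF fd, of "{a<..<b}"]) (use r f_eq in auto)
    qed
  qed
  have "\<theta> y - \<theta> x = (LINT r:{x..y}|lborel. H r)" if xy: "a \<le> x" "x \<le> y" "y \<le> b" for x y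
  proof -
    have si: "integrable lborel (\<lambda>r. indicator {x..y} r *\<^sub>R h c r)" if "c \<in> B" for c
      using h(1)[OF that] by (intro integrable_mult_indicator) auto
    have "(LINT r:{x..y}|lborel. H r) = (LINT r|lborel. (\<Sum>c\<in>B. (indicator {x..y} r *\<^sub>R h c r) *\<^sub>R c))"
      unfolding set_lebesgue_integral_def H_def by (simp add: scaleR_sum_right)
    also have "\<dots> = (\<Sum>c\<in>B. (LINT r:{x..y}|lborel. h c r) *\<^sub>R c)"
      unfolding set_lebesgue_integral_def using si by (subst Bochner_Integration.integral_sum) auto
    also have "\<dots> = (\<Sum>c\<in>B. (coord c (f y) - coord c (f x)) *\<^sub>R c)"
      using h(2) xy by (intro sum.cong) auto
    also have "\<dots> = f y - f x" by (simp add: scaleR_left_diff_distrib sum_subtractf sum_coord)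
    finally show ?thesis using f_eq xy by simp
  qed
  with Hint der show ?thesis by blast
qed

section \<open>Vector measures\<close>

context
  fixes \<nu> :: "real set \<Rightarrow> 'a::real_normed_vector"
  assumes vm: "vector_measure \<nu>"
begin

lemma vm_outside: "A \<notin> sets borel \<Longrightarrow> \<nu> A = 0"
  using vm by (simp add: vector_measure_def)

lemma vm_sums: "range F \<subseteq> sets borel \<Longrightarrow> disjoint_family F \<Longrightarrow> (\<lambda>i::nat. \<nu> (F i)) sums \<nu> (\<Union>i. F i)"
  using vm by (simp add: vector_measure_def)

lemma vm_empty: "\<nu> {} = 0"
proof -
  have "(\<lambda>i::nat. \<nu> {}) sums \<nu> (\<Union>i::nat. {})" by (rule vm_sums) (auto simp: disjoint_family_on_def)
  then have "(\<lambda>i::nat. \<nu> {}) \<longlonglongrightarrow> 0" using summable_LIMSEQ_zero sums_summable by blast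
  then show ?thesis by (simp add: LIMSEQ_const_iff)
qed

lemma vm_Un:
  assumes "A \<in> sets borel" "C \<in> sets borel" "A \<inter> C = {}"
  shows "\<nu> (A \<union> C) = \<nu> A + \<nu> C"
proof -
  have "(\<lambda>i. \<nu> (binaryset A C i)) sums \<nu> (\<Union>i. binaryset A C i)"
    using assms by (intro vm_sums) (auto simp: binaryset_def disjoint_family_on_def)
  moreover have "(\<lambda>i. \<nu> (binaryset A C i)) sums (\<nu> A + \<nu> C)"
    by (rule binaryset_sums) (rule vm_empty)
  ultimately show ?thesis using sums_unique2 UN_binaryset_eq by metis
qed

lemma vm_Diff:
  assumes "A \<in> sets borel" "C \<in> sets borel" "A \<subseteq> C"
  shows "\<nu> (C - A) = \<nu> C - \<nu> A"
proof -
  have "C = A \<union> (C - A)" using assms by auto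
  then have "\<nu> C = \<nu> A + \<nu> (C - A)" using vm_Un[of A "C - A"] assms by (metis Diff_disjoint sets.Diff)
  then show ?thesis by simp
qed

lemma vm_finite_UN:
  assumes "finite I" "\<And>i. i \<in> I \<Longrightarrow> F i \<in> sets borel" "disjoint_family_on F I"
  shows "\<nu> (\<Union>i\<in>I. F i) = (\<Sum>i\<in>I. \<nu> (F i))"
  using assms
proof (induction I rule: finite_induct)
  case (insert i I)
  have "\<nu> (F i \<union> (\<Union>i\<in>I. F i)) = \<nu> (F i) + \<nu> (\<Union>i\<in>I. F i)"
    using insert.prems insert.hyps by (intro vm_Un) (auto simp: disjoint_family_on_def)
  moreover have "disjoint_family_on F I" using insert.prems(2) by (rule disjoint_family_on_mono[rotated]) auto
  ultimately show ?case using insert by simp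
qed (simp add: vm_empty)

lemma vm_incseq:
  assumes "range A \<subseteq> sets borel" "incseq A"
  shows "(\<lambda>n::nat. \<nu> (A n)) \<longlonglongrightarrow> \<nu> (\<Union>n. A n)"
proof -
  have bor: "A i \<in> sets borel" for i using assms(1) by auto
  have "(\<lambda>i. \<nu> (disjointed A i)) sums \<nu> (\<Union>i. disjointed A i)"
    using assms(1) by (intro vm_sums disjoint_family_disjointed sets.range_disjointed_sets)
  then have "(\<lambda>n. \<Sum>i<n. \<nu> (disjointed A i)) \<longlonglongrightarrow> \<nu> (\<Union>n. A n)" by (simp add: sums_def UN_disjointed_eq)
  then have "(\<lambda>n. \<Sum>i<Suc n. \<nu> (disjointed A i)) \<longlonglongrightarrow> \<nu> (\<Union>n. A n)" by (rule LIMSEQ_Suc)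
  moreover have "(\<Sum>i<Suc n. \<nu> (disjointed A i)) = \<nu> (A n)" for n
  proof (induction n)
    case (Suc n)
    have "disjointed A (Suc n) = A (Suc n) - A n"
      using assms(2) by (rule disjointed_mono)
    then have "\<nu> (disjointed A (Suc n)) = \<nu> (A (Suc n)) - \<nu> (A n)"
      using vm_Diff[OF bor bor] assms(2) by (simp add: incseq_SucD)
    then show ?case using Suc.IH by simp
  qed (simp add: disjointed_def)
  ultimately show ?thesis by simp
qed

subsection \<open>The variation measure\<close>

lemma norm_le_variation: "A \<in> sets borel \<Longrightarrow> ennreal (norm (\<nu> A)) \<le> total_variation \<nu> A"
  unfolding total_variation_def by (rule SUP_upper2[of "{A}"]) auto

lemma variation_least:
  assumes "\<And>P. finite P \<Longrightarrow> P \<subseteq> sets borel \<Longrightarrow> disjoint P \<Longrightarrow> \<Union>P = A \<Longrightarrow> (\<Sum>C\<in>P. ennreal (norm (\<nu> C))) \<le> x"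
  shows "total_variation \<nu> A \<le> x"
  unfolding total_variation_def using assms by (intro SUP_least) auto

lemma variation_superadditive:
  assumes A: "A \<in> sets borel" "C \<in> sets borel" "A \<inter> C = {}"
  shows "total_variation \<nu> A + total_variation \<nu> C \<le> total_variation \<nu> (A \<union> C)"
proof -
  define parts where "parts X = {P. finite P \<and> P \<subseteq> sets borel \<and> disjoint P \<and> \<Union>P = X}" for X :: "real set"
  define s where "s P = (\<Sum>C\<in>P. ennreal (norm (\<nu> C)))" for P
  have TV: "total_variation \<nu> X = (SUP P\<in>parts X. s P)" for X
    by (simp add: total_variation_def parts_def s_def)
  have ne: "parts X \<noteq> {}" if "X \<in> sets borel" for X
    using that unfolding parts_def by (intro ex_in_conv[THEN iffD1] exI[of _ "{X}"]) auto
  have "s P + s Q \<le> total_variation \<nu> (A \<union> C)" if P: "P \<in> parts A" and Q: "Q \<in> parts C" for P Q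
  proof -
    \<comment> \<open>Partitions of disjoint sets can share only the empty block, whose measure is
      0.\<close>
    have "P \<inter> Q \<subseteq> {{}}" using P Q A(3) unfolding parts_def by blast
    then have z: "s (P \<inter> Q) = 0" unfolding s_def by (intro sum.neutral) (auto simp: vm_empty)
    have "s P + s Q = s (P \<union> Q) + s (P \<inter> Q)"
      using P Q unfolding s_def parts_def by (intro sum.union_inter[symmetric]) auto
    also have "\<dots> = s (P \<union> Q)" by (simp add: z)
    also have "\<dots> \<le> (SUP R\<in>parts (A \<union> C). s R)"
    proof (rule SUP_upper)
      have "disjoint (P \<union> Q)"
        using P Q A(3) unfolding parts_def by (intro disjoint_union) auto
      then show "P \<union> Q \<in> parts (A \<union> C)" using P Q unfolding parts_def by auto
    qed
    finally show ?thesis by (simp add: TV)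
  qed
  then have "(SUP P\<in>parts A. s P + s Q) \<le> total_variation \<nu> (A \<union> C)" if "Q \<in> parts C" for Q
    using that by (intro SUP_least) auto
  then have "total_variation \<nu> A + s Q \<le> total_variation \<nu> (A \<union> C)" if "Q \<in> parts C" for Q
    using that ne[OF A(1)] by (simp add: TV ennreal_SUP_add_left)
  then have "(SUP Q\<in>parts C. total_variation \<nu> A + s Q) \<le> total_variation \<nu> (A \<union> C)"
    by (intro SUP_least) auto
  then show ?thesis using ne[OF A(2)] by (simp add: TV[of C] ennreal_SUP_add_right)
qed

lemma variation_mono:
  assumes "A \<in> sets borel" "C \<in> sets borel" "A \<subseteq> C"
  shows "total_variation \<nu> A \<le> total_variation \<nu> C"
proof -
  have "total_variation \<nu> A \<le> total_variation \<nu> A + total_variation \<nu> (C - A)" by simp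
  also have "\<dots> \<le> total_variation \<nu> (A \<union> (C - A))" using assms by (intro variation_superadditive) auto
  also have "A \<union> (C - A) = C" using assms by auto
  finally show ?thesis .
qed

lemma variation_empty: "total_variation \<nu> {} = 0"
proof -
  have "total_variation \<nu> {} \<le> 0"
  proof (rule variation_least)
    fix P :: "real set set" assume "\<Union>P = {}"
    then have "\<forall>C\<in>P. ennreal (norm (\<nu> C)) = 0" by (auto simp: vm_empty)
    then have "(\<Sum>C\<in>P. ennreal (norm (\<nu> C))) = 0" by (rule sum.neutral)
    then show "(\<Sum>C\<in>P. ennreal (norm (\<nu> C))) \<le> 0" by (rule eq_refl)
  qed
  then show ?thesis by simp
qed

lemma variation_sum_le:
  assumes "finite I" "\<And>i. i \<in> I \<Longrightarrow> F i \<in> sets borel" "disjoint_family_on F I"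
  shows "(\<Sum>i\<in>I. total_variation \<nu> (F i)) \<le> total_variation \<nu> (\<Union>i\<in>I. F i)"
  using assms
proof (induction I rule: finite_induct)
  case (insert i I)
  have d: "disjoint_family_on F I" using insert.prems(2) by (rule disjoint_family_on_mono[rotated]) auto
  have "(\<Sum>i\<in>insert i I. total_variation \<nu> (F i)) \<le> total_variation \<nu> (F i) + total_variation \<nu> (\<Union>i\<in>I. F i)"
    using insert d by (auto intro: add_left_mono)
  also have "\<dots> \<le> total_variation \<nu> (F i \<union> (\<Union>i\<in>I. F i))"
    using insert.prems insert.hyps by (intro variation_superadditive) (auto simp: disjoint_family_on_def)
  finally show ?case by simp
qed (simp add: variation_empty)

lemma norm_sums_le_suminf:
  fixes f :: "nat \<Rightarrow> 'b::real_normed_vector"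
  assumes "f sums s"
  shows "ennreal (norm s) \<le> (\<Sum>i. ennreal (norm (f i)))"
proof (rule tendsto_upperbound)
  have "(\<lambda>n. \<Sum>i<n. f i) \<longlonglongrightarrow> s" using assms by (simp add: sums_def)
  then show "(\<lambda>n. ennreal (norm (\<Sum>i<n. f i))) \<longlonglongrightarrow> ennreal (norm s)" by (intro tendsto_ennrealI tendsto_norm)
  have "ennreal (norm (\<Sum>i<n. f i)) \<le> (\<Sum>i. ennreal (norm (f i)))" for n
  proof -
    have "ennreal (norm (\<Sum>i<n. f i)) \<le> ennreal (\<Sum>i<n. norm (f i))" by (intro ennreal_leI norm_sum)
    also have "\<dots> = (\<Sum>i<n. ennreal (norm (f i)))" by simp
    also have "\<dots> \<le> (\<Sum>i. ennreal (norm (f i)))" by (rule sum_le_suminf) auto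
    finally show ?thesis .
  qed
  then show "\<forall>\<^sub>F n in sequentially. ennreal (norm (\<Sum>i<n. f i)) \<le> (\<Sum>i. ennreal (norm (f i)))" by simp
qed simp

text \<open>One inequality is finite superadditivity with monotonicity. For the other, every block
  of a partition of the union is cut along the sets \<open>F i\<close>; for fixed \<open>i\<close>
  the pieces partition \<open>F i\<close>, so their norms add up to at most its variation.\<close>

lemma variation_countably_additive:
  assumes F: "range F \<subseteq> sets borel" "disjoint_family (F :: nat \<Rightarrow> real set)"
  shows "(\<Sum>i. total_variation \<nu> (F i)) = total_variation \<nu> (\<Union>i. F i)"
proof (rule antisym)
  have Fb: "F i \<in> sets borel" for i using F(1) by auto
  show "(\<Sum>i. total_variation \<nu> (F i)) \<le> total_variation \<nu> (\<Union>i. F i)"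
  proof (rule suminf_le_const)
    fix n
    have "(\<Sum>i<n. total_variation \<nu> (F i)) \<le> total_variation \<nu> (\<Union>i<n. F i)"
      using F(2) by (intro variation_sum_le Fb) (auto intro: disjoint_family_on_mono)
    also have "\<dots> \<le> total_variation \<nu> (\<Union>i. F i)" using Fb by (intro variation_mono) auto
    finally show "(\<Sum>i<n. total_variation \<nu> (F i)) \<le> total_variation \<nu> (\<Union>i. F i)" .
  qed simp
  show "total_variation \<nu> (\<Union>i. F i) \<le> (\<Sum>i. total_variation \<nu> (F i))"
  proof (rule variation_least)
    fix P assume P: "finite P" "P \<subseteq> sets borel" "disjoint P" "\<Union>P = (\<Union>i. F i)"
    have "(\<Sum>C\<in>P. ennreal (norm (\<nu> C))) \<le> (\<Sum>C\<in>P. \<Sum>i. ennreal (norm (\<nu> (C \<inter> F i))))"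
    proof (rule sum_mono)
      fix C assume C: "C \<in> P"
      have "disjoint_family (\<lambda>i. C \<inter> F i)" using F(2) unfolding disjoint_family_on_def by blast
      then have "(\<lambda>i. \<nu> (C \<inter> F i)) sums \<nu> (\<Union>i. C \<inter> F i)"
        using C P(2) Fb by (intro vm_sums) auto
      moreover have "(\<Union>i. C \<inter> F i) = C" using C P(4) by blast
      ultimately show "ennreal (norm (\<nu> C)) \<le> (\<Sum>i. ennreal (norm (\<nu> (C \<inter> F i))))"
        using norm_sums_le_suminf by metis
    qed
    also have "\<dots> = (\<Sum>i. \<Sum>C\<in>P. ennreal (norm (\<nu> (C \<inter> F i))))" by (rule suminf_sum[symmetric]) simp
    also have "\<dots> \<le> (\<Sum>i. total_variation \<nu> (F i))"
    proof (intro suminf_le allI)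
      fix i
      have dis: "disjoint_family_on (\<lambda>C. C \<inter> F i) P"
        using P(3) unfolding disjoint_family_on_def disjoint_def by blast
      have "(\<Sum>C\<in>P. ennreal (norm (\<nu> (C \<inter> F i)))) \<le> (\<Sum>C\<in>P. total_variation \<nu> (C \<inter> F i))"
        using P(2) Fb by (intro sum_mono norm_le_variation) auto
      also have "\<dots> \<le> total_variation \<nu> (\<Union>C\<in>P. C \<inter> F i)"
        using P(1,2) Fb dis by (intro variation_sum_le) auto
      also have "(\<Union>C\<in>P. C \<inter> F i) = F i" using P(4) by blast
      finally show "(\<Sum>C\<in>P. ennreal (norm (\<nu> (C \<inter> F i)))) \<le> total_variation \<nu> (F i)" .
    qed simp_all
    finally show "(\<Sum>C\<in>P. ennreal (norm (\<nu> C))) \<le> (\<Sum>i. total_variation \<nu> (F i))" .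
  qed
qed

lemma sets_variation_measure [simp]: "sets (variation_measure \<nu>) = sets borel"
  by (simp add: variation_measure_def sets.sigma_sets_eq[of borel, simplified])

lemma space_variation_measure [simp]: "space (variation_measure \<nu>) = UNIV"
  by (simp add: variation_measure_def)

lemma emeasure_variation_measure:
  assumes "A \<in> sets borel"
  shows "emeasure (variation_measure \<nu>) A = total_variation \<nu> A"
proof (rule emeasure_measure_of[OF variation_measure_def])
  show "sets borel \<subseteq> Pow (UNIV :: real set)" by simp
  show "A \<in> sets (variation_measure \<nu>)" using assms by simp
  show "positive (sets (variation_measure \<nu>)) (total_variation \<nu>)"
    by (simp add: positive_def variation_empty)
  show "countably_additive (sets (variation_measure \<nu>)) (total_variation \<nu>)"
    using variation_countably_additive by (auto intro!: countably_additiveI)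
qed

lemma variation_null:
  assumes "\<And>C. C \<in> sets borel \<Longrightarrow> C \<subseteq> A \<Longrightarrow> \<nu> C = 0"
  shows "total_variation \<nu> A = 0"
proof -
  have "total_variation \<nu> A \<le> 0"
  proof (rule variation_least)
    fix P assume P: "P \<subseteq> sets borel" "\<Union>P = A"
    have "\<forall>C\<in>P. ennreal (norm (\<nu> C)) = 0"
    proof
      fix C assume "C \<in> P"
      then have "\<nu> C = 0" using P by (intro assms) auto
      then show "ennreal (norm (\<nu> C)) = 0" by simp
    qed
    then have "(\<Sum>C\<in>P. ennreal (norm (\<nu> C))) = 0" by (rule sum.neutral)
    then show "(\<Sum>C\<in>P. ennreal (norm (\<nu> C))) \<le> 0" by (rule eq_refl)
  qed
  then show ?thesis by simp
qed

end

section \<open>Finite-dimensional vector measures have finite variation\<close>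

text \<open>A set of infinite variation contains a subset of infinite variation whose complement has
  measure of modulus more than one; iterating this would contradict countable additivity.\<close>

lemma real_variation_split:
  fixes \<nu> :: "real set \<Rightarrow> real"
  assumes vm: "vector_measure \<nu>" and A: "A \<in> sets borel" "total_variation \<nu> A = \<infinity>"
  shows "\<exists>C\<in>sets borel. C \<subseteq> A \<and> total_variation \<nu> C = \<infinity> \<and> 1 < \<bar>\<nu> (A - C)\<bar>"
proof -
  \<comment> \<open>The unions of the nonnegative and of the negative blocks together exceed
    \<open>x\<close> in modulus, so one of them exceeds \<open>\<bar>\<nu> A\<bar> + 1\<close>. Then
    both it and its complement in \<open>A\<close> have measure of modulus above 1, and whichever
    has infinite variation can be kept.\<close>
  define x where "x = 2 * (\<bar>\<nu> A\<bar> + 1)"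
  have "ennreal x < total_variation \<nu> A" using A(2) by (simp add: less_top[symmetric])
  then obtain P where P: "finite P" "P \<subseteq> sets borel" "disjoint P" "\<Union>P = A"
      and "ennreal x < (\<Sum>C\<in>P. ennreal (norm (\<nu> C)))"
    unfolding total_variation_def less_SUP_iff by blast
  moreover have "0 \<le> x" by (simp add: x_def)
  ultimately have big: "x < (\<Sum>C\<in>P. \<bar>\<nu> C\<bar>)" by (simp add: ennreal_less_iff)
  define Q where "Q = {C\<in>P. \<nu> C \<ge> 0}"
  have sub: "\<nu> (\<Union>R) = (\<Sum>C\<in>R. \<nu> C)" if "R \<subseteq> P" for R
  proof -
    have "disjoint_family_on (\<lambda>C. C) R" using P(3) that unfolding disjoint_family_on_def disjoint_def by blast
    then show ?thesis using vm_finite_UN[OF vm, of R "\<lambda>C. C"] P that by (auto dest: finite_subset)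
  qed
  have "(\<Sum>C\<in>P. \<bar>\<nu> C\<bar>) = (\<Sum>C\<in>Q. \<bar>\<nu> C\<bar>) + (\<Sum>C\<in>P - Q. \<bar>\<nu> C\<bar>)"
    using P(1) by (subst sum.subset_diff[of Q P]) (auto simp: Q_def)
  also have "(\<Sum>C\<in>Q. \<bar>\<nu> C\<bar>) = \<nu> (\<Union>Q)" by (subst sub) (auto simp: Q_def)
  also have "(\<Sum>C\<in>P - Q. \<bar>\<nu> C\<bar>) = - \<nu> (\<Union>(P - Q))"
    by (subst sub) (auto simp: Q_def sum_negf[symmetric] intro!: sum.cong)
  finally have "x < \<nu> (\<Union>Q) - \<nu> (\<Union>(P - Q))" using big by simp
  have "\<bar>\<nu> A\<bar> + 1 < \<bar>\<nu> (\<Union>Q)\<bar> \<or> \<bar>\<nu> A\<bar> + 1 < \<bar>\<nu> (\<Union>(P - Q))\<bar>"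
  proof (rule ccontr)
    assume "\<not> ?thesis"
    then have "\<bar>\<nu> (\<Union>Q)\<bar> \<le> \<bar>\<nu> A\<bar> + 1" "\<bar>\<nu> (\<Union>(P - Q))\<bar> \<le> \<bar>\<nu> A\<bar> + 1" by (simp_all add: not_less)
    then show False
      using \<open>x < \<nu> (\<Union>Q) - \<nu> (\<Union>(P - Q))\<close> abs_ge_self[of "\<nu> (\<Union>Q)"] abs_ge_minus_self[of "\<nu> (\<Union>(P - Q))"]
      unfolding x_def by argo
  qed
  moreover have "Q \<subseteq> P" "P - Q \<subseteq> P" by (auto simp: Q_def)
  ultimately have "\<exists>R\<subseteq>P. \<bar>\<nu> A\<bar> + 1 < \<bar>\<nu> (\<Union>R)\<bar>" by blast
  then obtain R where R: "R \<subseteq> P" "\<bar>\<nu> A\<bar> + 1 < \<bar>\<nu> (\<Union>R)\<bar>" by blast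
  define C where "C = \<Union>R"
  have C: "C \<in> sets borel" "C \<subseteq> A"
    using R(1) P by (auto simp: C_def intro!: sets.finite_Union dest: finite_subset)
  have "\<nu> (A - C) = \<nu> A - \<nu> C" by (rule vm_Diff[OF vm C(1) A(1) C(2)])
  then have 1: "1 < \<bar>\<nu> C\<bar>" "1 < \<bar>\<nu> (A - C)\<bar>" using R(2) by (auto simp: C_def)
  have "total_variation \<nu> A = total_variation \<nu> C + total_variation \<nu> (A - C)"
  proof -
    have "emeasure (variation_measure \<nu>) A = emeasure (variation_measure \<nu>) C + emeasure (variation_measure \<nu>) (A - C)"
      using C A(1) vm by (subst plus_emeasure) (auto simp: sets_variation_measure Un_absorb1)
    then show ?thesis using C(1) A(1) by (simp add: emeasure_variation_measure[OF vm])
  qed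
  then have "total_variation \<nu> C + total_variation \<nu> (A - C) = \<infinity>" using A(2) by simp
  then consider "total_variation \<nu> C = \<infinity>" | "total_variation \<nu> (A - C) = \<infinity>"
    by (auto simp: ennreal_add_eq_top)
  then show ?thesis
  proof cases
    case 1
    then show ?thesis using C \<open>1 < \<bar>\<nu> (A - C)\<bar>\<close> by blast
  next
    case 2
    moreover have "A - (A - C) = C" using C(2) by blast
    ultimately show ?thesis using C A(1) \<open>1 < \<bar>\<nu> C\<bar>\<close> by (intro bexI[of _ "A - C"]) auto
  qed
qed

lemma real_variation_finite:
  fixes \<nu> :: "real set \<Rightarrow> real"
  assumes vm: "vector_measure \<nu>"
  shows "total_variation \<nu> UNIV < \<infinity>"
proof (rule ccontr)
  assume "\<not> ?thesis"
  then have inf: "total_variation \<nu> UNIV = \<infinity>" by (simp add: less_top[symmetric])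
  have "\<exists>A. \<forall>n::nat. (A n \<in> sets borel \<and> total_variation \<nu> (A n) = \<infinity>) \<and> (A (Suc n) \<subseteq> A n \<and> 1 < \<bar>\<nu> (A n - A (Suc n))\<bar>)"
  proof (rule dependent_nat_choice[where P="\<lambda>_ A. A \<in> sets borel \<and> total_variation \<nu> A = \<infinity>"
        and Q="\<lambda>_ A C. C \<subseteq> A \<and> 1 < \<bar>\<nu> (A - C)\<bar>"])
    show "\<exists>A. A \<in> sets borel \<and> total_variation \<nu> A = \<infinity>" by (rule exI[of _ UNIV]) (simp add: inf)
    fix A and n :: nat assume "A \<in> sets borel \<and> total_variation \<nu> A = \<infinity>"
    then show "\<exists>C. (C \<in> sets borel \<and> total_variation \<nu> C = \<infinity>) \<and> C \<subseteq> A \<and> 1 < \<bar>\<nu> (A - C)\<bar>"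
      using real_variation_split[OF vm, of A] by blast
  qed
  then obtain A where A: "\<And>n::nat. A n \<in> sets borel" "\<And>n. A (Suc n) \<subseteq> A n" "\<And>n. 1 < \<bar>\<nu> (A n - A (Suc n))\<bar>" by blast
  define D where "D n = A n - A (Suc n)" for n
  have dec: "A m \<subseteq> A n" if "n \<le> m" for m n using A(2) that by (rule lift_Suc_antimono_le)
  have "disjoint_family D"
    unfolding disjoint_family_on_def
  proof (intro ballI impI)
    fix i j :: nat assume "i \<noteq> j"
    then consider "Suc i \<le> j" | "Suc j \<le> i" by linarith
    then show "D i \<inter> D j = {}" using dec unfolding D_def by cases blast+
  qed
  moreover have "range D \<subseteq> sets borel" using A(1) by (auto simp: D_def)
  ultimately have "(\<lambda>i. \<nu> (D i)) sums \<nu> (\<Union>i. D i)" by (intro vm_sums[OF vm])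
  then have "(\<lambda>i. \<nu> (D i)) \<longlonglongrightarrow> 0" using summable_LIMSEQ_zero sums_summable by blast
  then have "\<forall>\<^sub>F i in sequentially. \<bar>\<nu> (D i)\<bar> < 1"
    using tendstoD[of "\<lambda>i. \<nu> (D i)" 0 sequentially 1] by (simp add: dist_real_def)
  then obtain i where "\<bar>\<nu> (D i)\<bar> < 1" by (auto simp: eventually_sequentially)
  then show False using A(3)[of i] by (simp add: D_def)
qed

lemma vm_bounded_linear_comp:
  assumes vm: "vector_measure \<nu>" and f: "bounded_linear f"
  shows "vector_measure (\<lambda>A. f (\<nu> A))"
proof -
  interpret bounded_linear f by fact
  show ?thesis
    unfolding vector_measure_def
    using vm_outside[OF vm] vm_sums[OF vm] sums by (auto simp: zero)
qed

context coordinates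
begin

lemma variation_finite:
  fixes \<nu> :: "real set \<Rightarrow> 'a"
  assumes vm: "vector_measure \<nu>"
  shows "finite_measure (variation_measure \<nu>)"
proof (rule finite_measureI)
  have vmc: "vector_measure (\<lambda>A. coord b (\<nu> A))" if "b \<in> B" for b
    by (rule vm_bounded_linear_comp[OF vm bounded_linear_coord[OF that]])
  have "total_variation \<nu> UNIV \<le> (\<Sum>b\<in>B. ennreal (norm b) * total_variation (\<lambda>A. coord b (\<nu> A)) UNIV)"
  proof (rule variation_least[OF vm])
    fix P :: "real set set" assume P: "finite P" "P \<subseteq> sets borel" "disjoint P" "\<Union>P = UNIV"
    have "(\<Sum>C\<in>P. ennreal (norm (\<nu> C))) \<le> (\<Sum>C\<in>P. \<Sum>b\<in>B. ennreal (norm b) * ennreal (norm (coord b (\<nu> C))))"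
    proof (rule sum_mono)
      fix C
      have "norm (\<nu> C) = norm (\<Sum>b\<in>B. coord b (\<nu> C) *\<^sub>R b)" by (simp add: sum_coord)
      also have "\<dots> \<le> (\<Sum>b\<in>B. norm (coord b (\<nu> C) *\<^sub>R b))" by (rule norm_sum)
      finally have "ennreal (norm (\<nu> C)) \<le> ennreal (\<Sum>b\<in>B. norm b * norm (coord b (\<nu> C)))"
        by (intro ennreal_leI) (simp add: mult.commute)
      also have "\<dots> = (\<Sum>b\<in>B. ennreal (norm b) * ennreal (norm (coord b (\<nu> C))))"
        by (simp add: sum_ennreal[symmetric] ennreal_mult del: sum_ennreal)
      finally show "ennreal (norm (\<nu> C)) \<le> (\<Sum>b\<in>B. ennreal (norm b) * ennreal (norm (coord b (\<nu> C))))" .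
    qed
    also have "\<dots> = (\<Sum>b\<in>B. ennreal (norm b) * (\<Sum>C\<in>P. ennreal (norm (coord b (\<nu> C)))))"
      by (subst sum.swap) (simp add: sum_distrib_left del: sum_ennreal)
    also have "\<dots> \<le> (\<Sum>b\<in>B. ennreal (norm b) * total_variation (\<lambda>A. coord b (\<nu> A)) UNIV)"
      unfolding total_variation_def using P by (intro sum_mono mult_left_mono SUP_upper) auto
    finally show "(\<Sum>C\<in>P. ennreal (norm (\<nu> C))) \<le> (\<Sum>b\<in>B. ennreal (norm b) * total_variation (\<lambda>A. coord b (\<nu> A)) UNIV)" .
  qed
  also have "\<dots> < \<infinity>"
    using finite_B real_variation_finite[OF vmc] by (auto simp: ennreal_mult_less_top)
  finally show "emeasure (variation_measure \<nu>) (space (variation_measure \<nu>)) \<noteq> \<infinity>"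
    by (simp add: emeasure_variation_measure[OF vm] space_variation_measure[OF vm])
qed

end

section \<open>Radon-Nikodym densities of real and vector measures\<close>

lemma finite_measure_real_density:
  assumes M: "sigma_finite_measure M" and N: "finite_measure N" "sets N = sets M" "absolutely_continuous M N"
  shows "\<exists>h::_ \<Rightarrow> real. integrable M h \<and> (\<forall>A\<in>sets M. measure N A = (LINT x:A|M. h x))"
proof -
  interpret N: finite_measure N by fact
  have sp: "space N = space M" using N(2) by (rule sets_eq_imp_space_eq)
  obtain f where f[measurable]: "f \<in> borel_measurable M" and df: "density M f = N"
    using sigma_finite_measure.Radon_Nikodym[OF M N(3,2)] by auto
  have "(\<integral>\<^sup>+x. f x \<partial>M) = emeasure (density M f) (space M)" by (simp add: emeasure_density cong: nn_integral_cong)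
  also have "\<dots> < \<infinity>" using N.emeasure_finite[of "space M"] by (simp add: df less_top[symmetric])
  finally have fin: "(\<integral>\<^sup>+x. f x \<partial>M) < \<infinity>" .
  then have ae: "AE x in M. f x \<noteq> \<infinity>" by (intro nn_integral_PInf_AE) auto
  define h where "h x = enn2real (f x)" for x
  have h_nonneg: "0 \<le> h x" for x by (simp add: h_def)
  have [measurable]: "h \<in> borel_measurable M" by (simp add: h_def[abs_def])
  have ae': "AE x in M. ennreal (h x) = f x" using ae by (auto simp: h_def top.not_eq_extremum)
  then have nh: "(\<integral>\<^sup>+x. ennreal (h x) \<partial>M) = (\<integral>\<^sup>+x. f x \<partial>M)" by (rule nn_integral_cong_AE)
  have int: "integrable M h" using fin nh by (intro integrableI_nonneg) (auto simp: h_nonneg)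
  have "measure N A = (LINT x:A|M. h x)" if A[measurable]: "A \<in> sets M" for A
  proof -
    have "ennreal (measure N A) = emeasure (density M f) A" by (simp add: df N.emeasure_eq_measure)
    also have "\<dots> = (\<integral>\<^sup>+x. f x * indicator A x \<partial>M)" by (simp add: emeasure_density)
    also have "\<dots> = (\<integral>\<^sup>+x. ennreal (indicator A x *\<^sub>R h x) \<partial>M)"
      by (rule nn_integral_cong_AE) (use ae' in \<open>eventually_elim, auto simp: indicator_def\<close>)
    also have "\<dots> = ennreal (LINT x:A|M. h x)"
      unfolding set_lebesgue_integral_def using int
      by (intro nn_integral_eq_integral integrable_mult_indicator) (auto intro!: AE_I2 simp: h_nonneg)
    finally have "ennreal (measure N A) = ennreal (LINT x:A|M. h x)" .
    moreover have "0 \<le> (LINT x:A|M. h x)"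
      unfolding set_lebesgue_integral_def by (intro integral_nonneg_AE) (simp add: h_nonneg)
    ultimately show ?thesis by simp
  qed
  with int show ?thesis by blast
qed

text \<open>\<open>\<nu>\<close> plus its variation and the variation itself are finite positive
  measures, absolutely continuous with respect to \<open>M\<close>; \<open>\<nu>\<close> is their
  difference.\<close>

lemma real_vector_measure_density:
  fixes \<nu> :: "real set \<Rightarrow> real"
  assumes vm: "vector_measure \<nu>" and M: "sigma_finite_measure M" "sets M = sets borel"
    and ac: "\<And>A. A \<in> sets borel \<Longrightarrow> emeasure M A = 0 \<Longrightarrow> \<nu> A = 0"
  shows "\<exists>h::real \<Rightarrow> real. integrable M h \<and> (\<forall>A\<in>sets borel. \<nu> A = (LINT x:A|M. h x))"
proof -
  let ?N = "variation_measure \<nu>"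
  have TV: "emeasure ?N A = total_variation \<nu> A" if "A \<in> sets borel" for A
    using vm that by (rule emeasure_variation_measure)
  have setsN: "sets ?N = sets borel" and spN: "space ?N = UNIV"
    using vm by (simp_all add: sets_variation_measure space_variation_measure)
  interpret N: finite_measure ?N
    by (rule finite_measureI) (use TV[of UNIV] real_variation_finite[OF vm] spN in auto)
  define m where "m A = \<nu> A + measure ?N A" for A
  have nu_le: "\<bar>\<nu> A\<bar> \<le> measure ?N A" if "A \<in> sets borel" for A
  proof -
    have "ennreal \<bar>\<nu> A\<bar> \<le> ennreal (measure ?N A)"
      using norm_le_variation[OF vm that] unfolding TV[OF that, symmetric] N.emeasure_eq_measure by simp
    then show ?thesis by (simp only: ennreal_le_iff[OF measure_nonneg])
  qed
  have m_nonneg: "0 \<le> m A" if "A \<in> sets borel" for A using nu_le[OF that] by (simp add: m_def)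
  define N2 where "N2 = measure_of UNIV (sets borel) (\<lambda>A. ennreal (m A))"
  have setsN2: "sets N2 = sets borel" and spN2: "space N2 = UNIV"
    by (simp_all add: N2_def sets.sigma_sets_eq[of borel, simplified])
  have N2: "emeasure N2 A = ennreal (m A)" if A: "A \<in> sets borel" for A
  proof (rule emeasure_measure_of[OF N2_def])
    show "positive (sets N2) (\<lambda>A. ennreal (m A))"
      by (simp add: positive_def m_def vm_empty[OF vm])
    show "countably_additive (sets N2) (\<lambda>A. ennreal (m A))"
    proof (rule countably_additiveI)
      fix F :: "nat \<Rightarrow> real set" assume F: "range F \<subseteq> sets N2" "disjoint_family F"
      then have b: "F i \<in> sets borel" for i using setsN2 by auto
      have "(\<lambda>i. \<nu> (F i)) sums \<nu> (\<Union>i. F i)" using F setsN2 by (intro vm_sums[OF vm]) auto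
      moreover have "(\<lambda>i. measure ?N (F i)) sums measure ?N (\<Union>i. F i)"
        using F setsN2 setsN by (intro N.finite_measure_UNION) auto
      ultimately have "(\<lambda>i. m (F i)) sums m (\<Union>i. F i)" unfolding m_def by (rule sums_add)
      then show "(\<Sum>i. ennreal (m (F i))) = ennreal (m (\<Union>i. F i))"
        using m_nonneg[OF b] by (intro suminf_ennreal_eq) auto
    qed
  qed (use A setsN2 in auto)
  have fin2: "finite_measure N2" by (rule finite_measureI) (simp add: spN2 N2)
  have meas2: "measure N2 A = m A" if "A \<in> sets borel" for A
    using N2[OF that] m_nonneg[OF that] by (simp add: measure_def)
  have acN: "emeasure ?N A = 0" if "A \<in> null_sets M" for A
  proof -
    have A: "A \<in> sets borel" using that M(2) by (auto simp: null_sets_def)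
    have "\<nu> C = 0" if C: "C \<in> sets borel" "C \<subseteq> A" for C
    proof (rule ac[OF C(1)])
      have "emeasure M C \<le> emeasure M A" using C A M(2) by (intro emeasure_mono) auto
      then show "emeasure M C = 0" using \<open>A \<in> null_sets M\<close> by (simp add: null_sets_def)
    qed
    then show ?thesis using TV[OF A] variation_null[OF vm] by simp
  qed
  have ac1: "absolutely_continuous M ?N"
    unfolding absolutely_continuous_def
  proof
    fix A assume A: "A \<in> null_sets M"
    then have "A \<in> sets ?N" using M(2) setsN by (auto simp: null_sets_def)
    then show "A \<in> null_sets ?N" using acN[OF A] by (simp add: null_sets_def)
  qed
  have ac2: "absolutely_continuous M N2"
    unfolding absolutely_continuous_def
  proof
    fix A assume A: "A \<in> null_sets M"
    then have b: "A \<in> sets borel" and z: "emeasure M A = 0" using M(2) by (auto simp: null_sets_def)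
    have "m A = 0" using ac[OF b z] acN[OF A] by (simp add: m_def measure_def)
    then show "A \<in> null_sets N2" using b setsN2 N2[OF b] by (simp add: null_sets_def)
  qed
  obtain h1 where h1: "integrable M h1" "\<And>A. A \<in> sets M \<Longrightarrow> measure ?N A = (LINT x:A|M. h1 x)"
    using finite_measure_real_density[OF M(1) N.finite_measure_axioms _ ac1] M(2) setsN by auto
  obtain h2 where h2: "integrable M h2" "\<And>A. A \<in> sets M \<Longrightarrow> measure N2 A = (LINT x:A|M. h2 x)"
    using finite_measure_real_density[OF M(1) fin2 _ ac2] M(2) setsN2 by auto
  have "\<nu> A = (LINT x:A|M. h2 x - h1 x)" if A: "A \<in> sets borel" for A
  proof -
    have AM: "A \<in> sets M" using A M(2) by simp
    have "\<nu> A = measure N2 A - measure ?N A" using meas2[OF A] by (simp add: m_def)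
    then show ?thesis
      using h1(2)[OF AM] h2(2)[OF AM]
        set_integral_diff(2)[OF integrable_imp_set_integrable[OF h2(1) AM] integrable_imp_set_integrable[OF h1(1) AM]]
      by simp
  qed
  then show ?thesis using h1(1) h2(1) by (intro exI[of _ "\<lambda>x. h2 x - h1 x"]) auto
qed

context coordinates
begin

text \<open>Justifies the choice in \<open>vector_density\<close>: a density exists coordinate by
  coordinate, so the selected one has the defining properties.\<close>

lemma vector_measure_density:
  fixes \<nu> :: "real set \<Rightarrow> 'a"
  assumes vm: "vector_measure \<nu>" and M: "sigma_finite_measure M" "sets M = sets borel"
    and ac: "\<And>A. A \<in> sets borel \<Longrightarrow> emeasure M A = 0 \<Longrightarrow> \<nu> A = 0"
  shows "integrable M (vector_density \<nu> M)"
    and "A \<in> sets borel \<Longrightarrow> \<nu> A = (LINT x:A|M. vector_density \<nu> M x)"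
proof -
  have "\<exists>h::real \<Rightarrow> real. integrable M h \<and> (\<forall>A\<in>sets borel. coord b (\<nu> A) = (LINT x:A|M. h x))" if "b \<in> B" for b
  proof (rule real_vector_measure_density[OF vm_bounded_linear_comp[OF vm bounded_linear_coord[OF that]] M])
    interpret bounded_linear "coord b" by (rule bounded_linear_coord[OF that])
    show "coord b (\<nu> A) = 0" if "A \<in> sets borel" "emeasure M A = 0" for A using ac[OF that] by (simp add: zero)
  qed
  then obtain h :: "'a \<Rightarrow> real \<Rightarrow> real" where h: "\<And>b. b \<in> B \<Longrightarrow> integrable M (h b)"
      "\<And>b A. b \<in> B \<Longrightarrow> A \<in> sets borel \<Longrightarrow> coord b (\<nu> A) = (LINT x:A|M. h b x)" by metis
  define g where "g x = (\<Sum>b\<in>B. h b x *\<^sub>R b)" for x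
  have gi: "integrable M g" unfolding g_def using h(1) by (intro Bochner_Integration.integrable_sum) auto
  have "\<nu> A = (LINT x:A|M. g x)" if A: "A \<in> sets borel" for A
  proof -
    have si: "integrable M (\<lambda>x. indicator A x *\<^sub>R h b x)" if "b \<in> B" for b
      using h(1)[OF that] A M(2) by (intro integrable_mult_indicator) auto
    have "(LINT x:A|M. g x) = (LINT x|M. (\<Sum>b\<in>B. (indicator A x *\<^sub>R h b x) *\<^sub>R b))"
      unfolding set_lebesgue_integral_def g_def by (simp add: scaleR_sum_right)
    also have "\<dots> = (\<Sum>b\<in>B. (LINT x:A|M. h b x) *\<^sub>R b)"
      unfolding set_lebesgue_integral_def using si by (subst Bochner_Integration.integral_sum) auto
    also have "\<dots> = (\<Sum>b\<in>B. coord b (\<nu> A) *\<^sub>R b)" using h(2) A by (intro sum.cong) auto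
    also have "\<dots> = \<nu> A" by (rule sum_coord)
    finally show ?thesis by simp
  qed
  with gi have "\<exists>g. integrable M g \<and> (\<forall>A\<in>sets borel. \<nu> A = set_lebesgue_integral M A g)" by blast
  from someI_ex[OF this] show "integrable M (vector_density \<nu> M)"
    and "A \<in> sets borel \<Longrightarrow> \<nu> A = (LINT x:A|M. vector_density \<nu> M x)"
    unfolding vector_density_def by blast+
qed

lemma variation_density:
  fixes \<nu> :: "real set \<Rightarrow> 'a"
  assumes vm: "vector_measure \<nu>"
  shows "integrable (variation_measure \<nu>) (vector_density \<nu> (variation_measure \<nu>))"
    and "A \<in> sets borel \<Longrightarrow> \<nu> A = (LINT x:A|variation_measure \<nu>. vector_density \<nu> (variation_measure \<nu>) x)"
proof -
  interpret finite_measure "variation_measure \<nu>" by (rule variation_finite[OF vm])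
  have ac: "\<nu> A = 0" if "A \<in> sets borel" "emeasure (variation_measure \<nu>) A = 0" for A
    using norm_le_variation[OF vm that(1)] that by (simp add: emeasure_variation_measure[OF vm])
  note vd = vector_measure_density[OF vm sigma_finite_measure_axioms sets_variation_measure[OF vm] ac]
  show "integrable (variation_measure \<nu>) (vector_density \<nu> (variation_measure \<nu>))" by (rule vd(1))
  show "A \<in> sets borel \<Longrightarrow> \<nu> A = (LINT x:A|variation_measure \<nu>. vector_density \<nu> (variation_measure \<nu>) x)"
    by (rule vd(2))
qed

end

subsection \<open>Operations on vector measures\<close>

text \<open>The total values agree by exhausting the line with bounded intervals, so the sets on
  which the measures agree form a Dynkin class; open intervals are a generator stable under
  intersection.\<close>

lemma vm_eqI:
  assumes vm: "vector_measure \<nu>" "vector_measure \<nu>'" and eq: "\<And>a b. \<nu> {a<..<b} = \<nu>' {a<..<b}"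
  shows "\<nu> = \<nu>'"
proof
  fix A
  show "\<nu> A = \<nu>' A"
  proof (cases "A \<in> sets borel")
    case False
    then show ?thesis using vm_outside[OF vm(1)] vm_outside[OF vm(2)] by simp
  next
    case True
    define G :: "real set set" where "G = range (\<lambda>(a, b). {a<..<b})"
    have "(\<lambda>n. \<nu> {- real n<..<real n}) \<longlonglongrightarrow> \<nu> (\<Union>n. {- real n<..<real n})"
      by (rule vm_incseq[OF vm(1)]) (auto simp: incseq_def)
    moreover have "(\<lambda>n. \<nu> {- real n<..<real n}) \<longlonglongrightarrow> \<nu>' (\<Union>n. {- real n<..<real n})"
      unfolding eq by (rule vm_incseq[OF vm(2)]) (auto simp: incseq_def)
    ultimately have "\<nu> (\<Union>n. {- real n<..<real n}) = \<nu>' (\<Union>n. {- real n<..<real n})"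
      using LIMSEQ_unique by blast
    moreover have "(\<Union>n. {- real n<..<real n}) = UNIV"
    proof -
      have "\<exists>n. - real n < x \<and> x < real n" for x
        using reals_Archimedean2[of "\<bar>x\<bar>"] by (metis abs_less_iff minus_less_iff)
      then show ?thesis by auto
    qed
    ultimately have total: "\<nu> UNIV = \<nu>' UNIV" by simp
    have bor: "sets borel = sigma_sets UNIV G"
    proof -
      have box: "(\<lambda>(a, b). box a b) = (\<lambda>(a, b). {a<..<b::real})" by (auto simp: box_real)
      have "borel = sigma UNIV G" unfolding G_def box[symmetric] by (rule borel_eq_box)
      then have "sets borel = sets (sigma UNIV G)" by (rule arg_cong)
      then show ?thesis by (simp only: sets_measure_of[of G UNIV] top_greatest Pow_UNIV)
    qed
    have "Int_stable G"
      unfolding Int_stable_def G_def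
    proof (intro ballI)
      fix a b assume "a \<in> range (\<lambda>(a, b). {a<..<b::real})" "b \<in> range (\<lambda>(a, b). {a<..<b::real})"
      then obtain x y z w where "a = {x<..<y}" "b = {z<..<w}" by auto
      then have "a \<inter> b = {max x z<..<min y w}" by auto
      then show "a \<inter> b \<in> range (\<lambda>(a, b). {a<..<b})" by auto
    qed
    moreover have "G \<subseteq> Pow UNIV" by simp
    moreover have "A \<in> sigma_sets UNIV G" using True bor by simp
    ultimately show ?thesis
    proof (induction rule: sigma_sets_induct_disjoint)
      case (basic A)
      then show ?case using eq by (auto simp: G_def)
    next
      case empty
      then show ?case using vm_empty[OF vm(1)] vm_empty[OF vm(2)] by simp
    next
      case (compl A)
      then have "A \<in> sets borel" using bor by simp
      then show ?case using vm_Diff[OF vm(1), of A UNIV] vm_Diff[OF vm(2), of A UNIV] compl total by simp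
    next
      case (union A)
      then have "range A \<subseteq> sets borel" using bor by auto
      then have "(\<lambda>i. \<nu> (A i)) sums \<nu> (\<Union>i. A i)" "(\<lambda>i. \<nu>' (A i)) sums \<nu>' (\<Union>i. A i)"
        using vm_sums[OF vm(1) _ union(1)] vm_sums[OF vm(2) _ union(1)] by blast+
      moreover have "(\<lambda>i. \<nu> (A i)) = (\<lambda>i. \<nu>' (A i))" using union by auto
      ultimately show ?case using sums_unique2 by metis
    qed
  qed
qed

lemma vm_add:
  assumes "vector_measure \<nu>" "vector_measure \<nu>'"
  shows "vector_measure (\<lambda>A. \<nu> A + \<nu>' A)"
  unfolding vector_measure_def
  using vm_outside[OF assms(1)] vm_outside[OF assms(2)] vm_sums[OF assms(1)] vm_sums[OF assms(2)]
  by (auto intro: sums_add)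

text \<open>The value 0 off the Borel sets is forced by \<open>vector_measure\<close>:
  \<open>A \<inter> R\<close> may be Borel although \<open>A\<close> is not.\<close>

definition vm_restrict :: "real set \<Rightarrow> (real set \<Rightarrow> 'a::real_normed_vector) \<Rightarrow> real set \<Rightarrow> 'a" where
  "vm_restrict R \<nu> A = (if A \<in> sets borel then \<nu> (A \<inter> R) else 0)"

lemma vm_restrict:
  assumes vm: "vector_measure \<nu>" and R: "R \<in> sets borel"
  shows "vector_measure (vm_restrict R \<nu>)"
  unfolding vector_measure_def
proof (intro conjI allI impI)
  fix F :: "nat \<Rightarrow> real set" assume F: "range F \<subseteq> sets borel" "disjoint_family F"
  have "disjoint_family (\<lambda>i. F i \<inter> R)" using F(2) unfolding disjoint_family_on_def by blast
  then have "(\<lambda>i. \<nu> (F i \<inter> R)) sums \<nu> (\<Union>i. F i \<inter> R)" using F(1) R by (intro vm_sums[OF vm]) auto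
  moreover have "(\<Union>i. F i \<inter> R) = (\<Union>i. F i) \<inter> R" by blast
  moreover have "F i \<in> sets borel" for i using F(1) by auto
  moreover have "(\<Union>i. F i) \<in> sets borel" using F(1) by auto
  ultimately show "(\<lambda>i. vm_restrict R \<nu> (F i)) sums vm_restrict R \<nu> (\<Union>i. F i)"
    by (simp add: vm_restrict_def)
qed (simp add: vm_restrict_def)

subsection \<open>Smooth test functions\<close>

text \<open>The derivatives of \<^term>\<open>exp (- 1 / s)\<close> are linear combinations of these functions.\<close>

definition flat :: "nat \<Rightarrow> real \<Rightarrow> real" where
  "flat k s = (if s > 0 then (1 / s) ^ k * exp (- (1 / s)) else 0)"

text \<open>Away from 0 this is the product and chain rule; at 0 both one-sided difference quotients
  tend to 0, since the exponential beats every power.\<close>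

lemma DERIV_flat: "(flat k has_real_derivative (flat (k + 2) s - real k * flat (k + 1) s)) (at s)"
proof (cases "s = 0")
  case True
  have "((\<lambda>x::real. x ^ (k + 1) / exp x) \<longlongrightarrow> 0) at_top" by (rule tendsto_power_div_exp_0)
  then have "((\<lambda>x::real. inverse x ^ (k + 1) / exp (inverse x)) \<longlongrightarrow> 0) (at_right 0)"
    by (rule filterlim_compose) (rule filterlim_inverse_at_top_right)
  then have "((\<lambda>h. (flat k h - flat k 0) / (h - 0)) \<longlongrightarrow> 0) (at_right 0)"
  proof (rule Lim_transform_eventually)
    show "\<forall>\<^sub>F x in at_right 0. inverse x ^ (k + 1) / exp (inverse x) = (flat k x - flat k 0) / (x - 0)"
      using eventually_at_right_less[of 0]
      by eventually_elim (simp add: flat_def exp_minus field_simps)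
  qed
  moreover have "((\<lambda>h. (flat k h - flat k 0) / (h - 0)) \<longlongrightarrow> 0) (at_left 0)"
  proof (rule Lim_transform_eventually[OF tendsto_const])
    have "\<forall>\<^sub>F x::real in at_left 0. x < 0" by (simp add: eventually_at_filter)
    then show "\<forall>\<^sub>F x in at_left 0. 0 = (flat k x - flat k 0) / (x - 0)"
      by eventually_elim (simp add: flat_def)
  qed
  ultimately have "((\<lambda>h. (flat k h - flat k 0) / (h - 0)) \<longlongrightarrow> 0) (at 0)" by (intro filterlim_split_at)
  then show ?thesis using True by (simp add: has_field_derivative_iff flat_def)
next
  case False
  then consider "s > 0" | "s < 0" by linarith
  then show ?thesis
  proof cases
    case 1
    have i: "((\<lambda>s. 1 / s) has_real_derivative - ((1 / s) ^ 2)) (at s)"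
      using 1 by (auto intro!: derivative_eq_intros simp: power2_eq_square)
    have "((\<lambda>s. (1 / s) ^ k * exp (- (1 / s))) has_real_derivative (flat (k + 2) s - real k * flat (k + 1) s)) (at s)"
      by (rule DERIV_cong[OF DERIV_mult[OF DERIV_power[OF i] DERIV_chain2[OF DERIV_exp DERIV_minus[OF i]]]])
        (use 1 in \<open>cases k; simp add: flat_def power2_eq_square algebra_simps\<close>)
    then show ?thesis
      by (rule has_field_derivative_transform_within_open[of _ _ _ "{0<..}"]) (use 1 in \<open>auto simp: flat_def\<close>)
  next
    case 2
    have "((\<lambda>_. 0) has_real_derivative (flat (k + 2) s - real k * flat (k + 1) s)) (at s)"
      using 2 by (simp add: flat_def)
    then show ?thesis
      by (rule has_field_derivative_transform_within_open[of _ _ _ "{..<0}"]) (use 2 in \<open>auto simp: flat_def\<close>)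
  qed
qed

text \<open>A class that contains the bump functions and is closed under differentiation, so that a
  single derivative formula settles all orders.\<close>

inductive flat_span :: "real poly \<Rightarrow> (real \<Rightarrow> real) \<Rightarrow> bool" for q where
  base: "flat_span q (\<lambda>x. poly r x * flat k (poly q x))"
| add: "flat_span q f \<Longrightarrow> flat_span q g \<Longrightarrow> flat_span q (\<lambda>x. f x + g x)"

lemma flat_span_DERIV:
  "flat_span q f \<Longrightarrow> \<exists>f'. flat_span q f' \<and> (\<forall>x. (f has_real_derivative f' x) (at x))"
proof (induction rule: flat_span.induct)
  case (base r k)
  let ?f' = "\<lambda>x. (poly (pderiv r) x * flat k (poly q x) + poly (r * pderiv q) x * flat (k + 2) (poly q x))
      + poly (smult (- real k) (r * pderiv q)) x * flat (k + 1) (poly q x)"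
  have "flat_span q ?f'" by (intro flat_span.intros)
  moreover have "((\<lambda>x. poly r x * flat k (poly q x)) has_real_derivative ?f' x) (at x)" for x
    by (rule DERIV_cong[OF DERIV_mult[OF poly_DERIV DERIV_chain2[OF DERIV_flat poly_DERIV]]])
      (simp add: algebra_simps)
  ultimately show ?case by blast
next
  case (add f g)
  then obtain f' g' where "flat_span q f'" "\<And>x. (f has_real_derivative f' x) (at x)"
      "flat_span q g'" "\<And>x. (g has_real_derivative g' x) (at x)" by blast
  then show ?case by (intro exI[of _ "\<lambda>x. f' x + g' x"]) (auto intro: flat_span.add DERIV_add)
qed

lemma flat_span_smooth:
  assumes "flat_span q f"
  shows "flat_span q ((deriv ^^ n) f)" "(deriv ^^ n) f differentiable (at x)"
proof -
  have step: "flat_span q (deriv g) \<and> (\<forall>x. g differentiable (at x))" if "flat_span q g" for g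
  proof -
    obtain g' where g': "flat_span q g'" "\<And>x. (g has_real_derivative g' x) (at x)"
      using flat_span_DERIV[OF \<open>flat_span q g\<close>] by blast
    have "deriv g = g'" using DERIV_imp_deriv[OF g'(2)] by auto
    then show ?thesis using g' real_differentiable_def by blast
  qed
  show 1: "flat_span q ((deriv ^^ n) f)" for n
    by (induction n) (use assms step in auto)
  show "(deriv ^^ n) f differentiable (at x)" using step[OF 1[of n]] by blast
qed

text \<open>The functions are \<open>exp (- 1 / ((n + 1) * (x - a) * (b - x)))\<close> on the
  interval and 0 outside; the growing factor drives the exponent to 0 at every interior
  point.\<close>

lemma test_functions_indicator:
  assumes ab: "0 < a" "a < b" "b < T"
  obtains \<phi> :: "nat \<Rightarrow> real \<Rightarrow> real" where "\<And>n. test_function T (\<phi> n)"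
    "\<And>n x. \<bar>\<phi> n x\<bar> \<le> 1" "\<And>x. (\<lambda>n. \<phi> n x) \<longlonglongrightarrow> indicator {a<..<b} x"
proof
  define \<phi> where "\<phi> n x = flat 0 (real (Suc n) * ((x - a) * (b - x)))" for n x
  have pos: "0 < (x - a) * (b - x) \<longleftrightarrow> x \<in> {a<..<b}" for x
    using ab by (auto simp: zero_less_mult_iff)
  have out: "\<phi> n x = 0" if "x \<notin> {a<..<b}" for n x
    using that pos[of x] by (simp add: \<phi>_def flat_def zero_less_mult_iff)
  show "test_function T (\<phi> n)" for n
    unfolding test_function_def
  proof (intro conjI allI)
    define q where "q = smult (real (Suc n)) ([:- a, 1:] * [:b, - 1:])"
    have "\<phi> n = (\<lambda>x. poly 1 x * flat 0 (poly q x))"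
      by (auto simp: \<phi>_def q_def algebra_simps intro!: ext arg_cong[where f="flat 0"])
    then have "flat_span q (\<phi> n)" using flat_span.base[of q 1 0] by simp
    then show "(deriv ^^ m) (\<phi> n) differentiable (at x)" for m x by (rule flat_span_smooth)
    show "\<exists>a b. 0 < a \<and> b < T \<and> (\<forall>x. x \<notin> {a..b} \<longrightarrow> \<phi> n x = 0)"
      using ab out by (intro exI[of _ a] exI[of _ b]) auto
  qed
  show "\<bar>\<phi> n x\<bar> \<le> 1" for n x by (simp add: \<phi>_def flat_def)
  show "(\<lambda>n. \<phi> n x) \<longlonglongrightarrow> indicator {a<..<b} x" for x
  proof (cases "x \<in> {a<..<b}")
    case True
    define c where "c = (x - a) * (b - x)"
    have c: "c > 0" using True pos[of x] by (simp add: c_def)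
    have eq: "\<phi> n x = exp (- (inverse (real (Suc n)) * inverse c))" for n
      using c by (simp add: \<phi>_def flat_def c_def[symmetric] inverse_eq_divide del: of_nat_Suc)
    have "(\<lambda>n. exp (- (inverse (real (Suc n)) * inverse c))) \<longlonglongrightarrow> exp (- (0 * inverse c))"
      by (intro tendsto_intros LIMSEQ_inverse_real_of_nat)
    then show ?thesis using True unfolding eq by simp
  next
    case False
    then show ?thesis using out by simp
  qed
qed

subsection \<open>The distributional derivative\<close>

context coordinates
begin

lemma vector_integral_tendsto:
  fixes \<nu> :: "real set \<Rightarrow> 'a"
  assumes vm: "vector_measure \<nu>" and \<phi>: "\<And>n. \<phi> n \<in> borel_measurable borel" "\<And>n x. \<bar>\<phi> n x\<bar> \<le> 1"
    and lim: "\<And>x. (\<lambda>n::nat. \<phi> n x) \<longlonglongrightarrow> indicator A x" and A: "A \<in> sets borel"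
  shows "(\<lambda>n. vector_integral \<nu> (\<phi> n)) \<longlonglongrightarrow> \<nu> A"
proof -
  let ?N = "variation_measure \<nu>" and ?g = "vector_density \<nu> (variation_measure \<nu>)"
  have sN: "sets ?N = sets borel" using vm by simp
  note g = variation_density[OF vm]
  have [measurable]: "?g \<in> borel_measurable ?N" using g(1) by auto
  have [measurable]: "\<phi> n \<in> borel_measurable ?N" for n using \<phi>(1) measurable_cong_sets[OF sN refl] by blast
  have "(\<lambda>n. LINT x|?N. \<phi> n x *\<^sub>R ?g x) \<longlonglongrightarrow> (LINT x|?N. indicator A x *\<^sub>R ?g x)"
  proof (rule integral_dominated_convergence[where w="\<lambda>x. norm (?g x)"])
    show "(\<lambda>x. indicator A x *\<^sub>R ?g x) \<in> borel_measurable ?N" using A sN by measurable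
    show "integrable ?N (\<lambda>x. norm (?g x))" using g(1) by simp
    show "AE x in ?N. (\<lambda>n. \<phi> n x *\<^sub>R ?g x) \<longlonglongrightarrow> indicator A x *\<^sub>R ?g x"
      by (intro AE_I2 tendsto_scaleR lim tendsto_const)
    show "AE x in ?N. norm (\<phi> n x *\<^sub>R ?g x) \<le> norm (?g x)" for n
      using \<phi>(2) by (intro AE_I2) (simp add: mult_left_le_one_le)
  qed measurable
  then show ?thesis using g(2)[OF A] by (simp add: vector_integral_def set_lebesgue_integral_def)
qed

lemma test_function_measurable:
  assumes "test_function T \<phi>"
  shows "\<phi> \<in> borel_measurable borel"
proof (rule borel_measurable_continuous_onI, rule continuous_at_imp_continuous_on, rule ballI)
  fix x
  have "(deriv ^^ 0) \<phi> differentiable (at x)" using assms unfolding test_function_def by blast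
  then show "isCont \<phi> x" by (simp add: differentiable_imp_continuous_within)
qed

text \<open>Test functions converging boundedly to an indicator determine the value on an open
  interval whose closure lies in \<open>{0<..<T}\<close>; exhaustion by such intervals reaches all
  open intervals.\<close>

lemma distributional_derivative_unique:
  fixes \<nu> \<nu>' :: "real set \<Rightarrow> 'a"
  assumes d: "distributional_derivative T u \<nu>" "distributional_derivative T u \<nu>'"
  shows "\<nu> = \<nu>'"
proof (rule vm_eqI)
  show vm: "vector_measure \<nu>" "vector_measure \<nu>'" using d by (auto simp: distributional_derivative_def)
  have inner: "\<nu> {a<..<b} = \<nu>' {a<..<b}" if ab: "0 < a" "b < T" for a b
  proof (cases "a < b")
    case True
    obtain \<phi> :: "nat \<Rightarrow> real \<Rightarrow> real" where \<phi>: "\<And>n. test_function T (\<phi> n)"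
      "\<And>n x. \<bar>\<phi> n x\<bar> \<le> 1" "\<And>x. (\<lambda>n. \<phi> n x) \<longlonglongrightarrow> indicator {a<..<b} x"
      using test_functions_indicator[OF ab(1) True ab(2)] by blast
    have "(\<lambda>n. vector_integral \<nu> (\<phi> n)) \<longlonglongrightarrow> \<nu> {a<..<b}"
      by (intro vector_integral_tendsto vm \<phi> test_function_measurable[OF \<phi>(1)]) auto
    moreover have "(\<lambda>n. vector_integral \<nu>' (\<phi> n)) \<longlonglongrightarrow> \<nu>' {a<..<b}"
      by (intro vector_integral_tendsto vm \<phi> test_function_measurable[OF \<phi>(1)]) auto
    moreover have "vector_integral \<nu> (\<phi> n) = vector_integral \<nu>' (\<phi> n)" for n
      using d \<phi>(1)[of n] unfolding distributional_derivative_def by simp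
    ultimately show ?thesis using LIMSEQ_unique by simp
  next
    case False
    then show ?thesis using vm_empty[OF vm(1)] vm_empty[OF vm(2)] by simp
  qed
  show "\<nu> {a<..<b} = \<nu>' {a<..<b}" for a b
  proof -
    define x where "x = max a 0"
    define y where "y = min b T"
    define I where "I n = {x + inverse (real (Suc n))<..<y - inverse (real (Suc n))}" for n
    have inc: "incseq I"
      unfolding incseq_Suc_iff I_def
    proof (intro allI subsetI)
      fix n z assume "z \<in> {x + inverse (real (Suc n))<..<y - inverse (real (Suc n))}"
      moreover have "inverse (real (Suc (Suc n))) \<le> inverse (real (Suc n))" by (intro le_imp_inverse_le) auto
      ultimately show "z \<in> {x + inverse (real (Suc (Suc n)))<..<y - inverse (real (Suc (Suc n)))}"
        unfolding greaterThanLessThan_iff by linarith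
    qed
    have U: "(\<Union>n. I n) = {x<..<y}"
    proof (intro set_eqI iffI)
      fix z assume "z \<in> (\<Union>n. I n)"
      then obtain n where "z \<in> I n" by blast
      moreover have "0 < inverse (real (Suc n))" by simp
      ultimately show "z \<in> {x<..<y}" unfolding I_def greaterThanLessThan_iff by linarith
    next
      fix z assume z: "z \<in> {x<..<y}"
      then obtain n where "inverse (real (Suc n)) < min (z - x) (y - z)"
        using reals_Archimedean[of "min (z - x) (y - z)"] by auto
      then have "z \<in> I n" unfolding I_def by (auto simp del: of_nat_Suc)
      then show "z \<in> (\<Union>n. I n)" by blast
    qed
    have "\<nu> (I n) = \<nu>' (I n)" for n
    proof -
      have "0 < inverse (real (Suc n))" by simp
      then have "0 < x + inverse (real (Suc n))" "y - inverse (real (Suc n)) < T"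
        unfolding x_def y_def by linarith+
      then show ?thesis unfolding I_def by (rule inner)
    qed
    moreover have "range I \<subseteq> sets borel" by (auto simp: I_def)
    then have "(\<lambda>n. \<nu> (I n)) \<longlonglongrightarrow> \<nu> (\<Union>n. I n)" "(\<lambda>n. \<nu>' (I n)) \<longlonglongrightarrow> \<nu>' (\<Union>n. I n)"
      using inc vm by (auto intro: vm_incseq)
    ultimately have "\<nu> {x<..<y} = \<nu>' {x<..<y}" unfolding U using LIMSEQ_unique by simp
    moreover have I: "{a<..<b} \<inter> {0<..<T} = {x<..<y}" by (auto simp: x_def y_def)
    moreover have "\<nu> A = \<nu> (A \<inter> {0<..<T})" "\<nu>' A = \<nu>' (A \<inter> {0<..<T})" if "A \<in> sets borel" for A
      using d that unfolding distributional_derivative_def by blast+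
    from this[of "{a<..<b}"] have "\<nu> {a<..<b} = \<nu> {x<..<y}" "\<nu>' {a<..<b} = \<nu>' {x<..<y}"
      unfolding I by simp_all
    ultimately show ?thesis by (simp only:)
  qed
qed

text \<open>Fubini on the half plane \<open>x < y\<close>, with \<open>- \<phi> x\<close> written as
  the integral of \<open>deriv \<phi>\<close> over \<open>{x<..}\<close>. Integrating in
  \<open>x\<close> instead produces the distribution function of \<open>\<nu>\<close>.\<close>

lemma vector_integral_by_parts:
  fixes \<nu> :: "real set \<Rightarrow> 'a"
  assumes vm: "vector_measure \<nu>" and \<phi>: "test_function T \<phi>"
  shows "integrable lborel (\<lambda>y. deriv \<phi> y *\<^sub>R \<nu> {..<y})"
    and "vector_integral \<nu> \<phi> = - (LINT y|lborel. deriv \<phi> y *\<^sub>R \<nu> {..<y})"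
    and "integrable lborel (deriv \<phi>)" and "(LINT y|lborel. deriv \<phi> y) = 0"
    and "\<And>y. y \<notin> {0<..<T} \<Longrightarrow> deriv \<phi> y = 0"
proof -
  let ?N = "variation_measure \<nu>" and ?g = "vector_density \<nu> (variation_measure \<nu>)"
  have sN: "sets ?N = sets borel" and spN: "space ?N = UNIV" using vm by simp_all
  interpret N: finite_measure ?N by (rule variation_finite[OF vm])
  interpret P: pair_sigma_finite ?N lborel ..
  note g = variation_density[OF vm]
  have gN[measurable]: "?g \<in> borel_measurable ?N" using g(1) by auto
  obtain \<alpha> \<beta> where ab: "0 < \<alpha>" "\<beta> < T" and out: "\<And>x. x \<notin> {\<alpha>..\<beta>} \<Longrightarrow> \<phi> x = 0"
    using \<phi> unfolding test_function_def by blast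
  have d0: "\<phi> differentiable (at x)" and d1: "deriv \<phi> differentiable (at x)" for x
    using \<phi> unfolding test_function_def by (metis funpow_0, metis funpow_0 funpow.simps(2) comp_apply)
  have der: "(\<phi> has_real_derivative deriv \<phi> x) (at x)" for x
    using d0[of x] by (simp add: DERIV_deriv_iff_real_differentiable)
  have cont: "isCont (deriv \<phi>) x" for x using d1 differentiable_imp_continuous_within by blast
  have out': "deriv \<phi> x = 0" if "x \<notin> {\<alpha>..\<beta>}" for x
  proof -
    have "((\<lambda>_. 0) has_real_derivative 0) (at x)" by simp
    then have "(\<phi> has_real_derivative 0) (at x)"
      by (rule has_field_derivative_transform_within_open[of _ _ _ "- {\<alpha>..\<beta>}"]) (use that out in auto)
    then show ?thesis by (rule DERIV_imp_deriv)
  qed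
  show "deriv \<phi> y = 0" if "y \<notin> {0<..<T}" for y using out' that ab by auto
  have [measurable]: "deriv \<phi> \<in> borel_measurable borel"
    using cont by (intro borel_measurable_continuous_onI continuous_at_imp_continuous_on) auto
  have di: "integrable lborel (deriv \<phi>)"
  proof -
    have "integrable lborel (\<lambda>x. deriv \<phi> x * indicator {\<alpha>..\<beta>} x)"
      by (rule borel_integrable_atLeastAtMost) (rule cont)
    moreover have "(\<lambda>x. deriv \<phi> x * indicator {\<alpha>..\<beta>} x) = deriv \<phi>" using out' by (auto simp: indicator_def fun_eq_iff)
    ultimately show ?thesis by simp
  qed
  then show "integrable lborel (deriv \<phi>)" .
  have tail: "(LINT y|lborel. indicator {x<..} y * deriv \<phi> y) = - \<phi> x" for x
  proof -
    define R where "R = max x \<beta> + 1"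
    have R: "x \<le> R" "\<beta> < R" by (auto simp: R_def)
    have "(LINT y|lborel. indicator {x<..} y * deriv \<phi> y) = (LINT y|lborel. deriv \<phi> y * indicator {x..R} y)"
    proof (rule integral_cong_AE)
      have "AE y in lborel. y \<noteq> x" using AE_lborel_singleton by auto
      then show "AE y in lborel. indicator {x<..} y * deriv \<phi> y = deriv \<phi> y * indicator {x..R} y"
        by eventually_elim (use R out' in \<open>auto simp: indicator_def\<close>)
    qed measurable
    also have "\<dots> = \<phi> R - \<phi> x" using R der cont by (intro integral_FTC_Icc_real) auto
    also have "\<phi> R = 0" using out R by simp
    finally show ?thesis by simp
  qed
  show "(LINT y|lborel. deriv \<phi> y) = 0"
  proof -
    define x where "x = \<alpha> - 1"
    have "(LINT y|lborel. deriv \<phi> y) = (LINT y|lborel. indicator {x<..} y * deriv \<phi> y)"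
    proof (intro Bochner_Integration.integral_cong refl)
      fix y
      show "deriv \<phi> y = indicator {x<..} y * deriv \<phi> y"
      proof (cases "x < y")
        case False
        then have "y < \<alpha>" unfolding x_def by linarith
        then show ?thesis using out'[of y] by simp
      qed simp
    qed
    then show ?thesis unfolding tail using out[of x] by (simp add: x_def)
  qed
  define f where "f x y = (indicator {x<..} y * deriv \<phi> y) *\<^sub>R ?g x" for x y
  have fm[measurable]: "case_prod f \<in> borel_measurable (?N \<Otimes>\<^sub>M lborel)"
  proof -
    have [measurable_cong]: "sets ?N = sets borel" by (rule sN)
    have "(\<lambda>p. (indicator {p. fst p < snd p} p * deriv \<phi> (snd p)) *\<^sub>R ?g (fst p)) \<in> borel_measurable (?N \<Otimes>\<^sub>M lborel)"
      by measurable
    moreover have "case_prod f = (\<lambda>p. (indicator {p. fst p < snd p} p * deriv \<phi> (snd p)) *\<^sub>R ?g (fst p))"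
      by (auto simp: f_def fun_eq_iff indicator_def)
    ultimately show ?thesis by simp
  qed
  have fi: "integrable (?N \<Otimes>\<^sub>M lborel) (case_prod f)"
  proof (rule Bochner_Integration.integrable_bound)
    show "integrable (?N \<Otimes>\<^sub>M lborel) (\<lambda>(x, y). norm (?g x) * norm (deriv \<phi> y))"
    proof (rule P.Fubini_integrable)
      show "(\<lambda>(x, y). norm (?g x) * norm (deriv \<phi> y)) \<in> borel_measurable (?N \<Otimes>\<^sub>M lborel)" by measurable
      show "integrable ?N (\<lambda>x. LINT y|lborel. norm (case (x, y) of (x, y) \<Rightarrow> norm (?g x) * norm (deriv \<phi> y)))"
        using g(1) by (simp add: abs_mult)
      show "AE x in ?N. integrable lborel (\<lambda>y. case (x, y) of (x, y) \<Rightarrow> norm (?g x) * norm (deriv \<phi> y))"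
        using di by (intro AE_I2) simp
    qed
    show "AE z in ?N \<Otimes>\<^sub>M lborel. norm (case_prod f z) \<le> norm (case z of (x, y) \<Rightarrow> norm (?g x) * norm (deriv \<phi> y))"
      by (intro AE_I2) (auto simp: f_def indicator_def mult.commute)
  qed (rule fm)
  have inner1: "(LINT x|?N. f x y) = deriv \<phi> y *\<^sub>R \<nu> {..<y}" for y
  proof -
    have "(LINT x|?N. f x y) = (LINT x|?N. deriv \<phi> y *\<^sub>R (indicator {..<y} x *\<^sub>R ?g x))"
      by (intro Bochner_Integration.integral_cong) (auto simp: f_def indicator_def)
    also have "\<dots> = deriv \<phi> y *\<^sub>R (LINT x:{..<y}|?N. ?g x)"
      unfolding set_lebesgue_integral_def by (rule integral_scaleR_right)
    also have "\<dots> = deriv \<phi> y *\<^sub>R \<nu> {..<y}" using g(2)[of "{..<y}"] by simp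
    finally show ?thesis .
  qed
  have inner2: "(LINT y|lborel. f x y) = - (\<phi> x *\<^sub>R ?g x)" for x
  proof -
    have "(LINT y|lborel. f x y) = (LINT y|lborel. indicator {x<..} y * deriv \<phi> y) *\<^sub>R ?g x"
      unfolding f_def using di by (intro integral_scaleR_left) (auto intro!: integrable_real_mult_indicator simp: mult.commute)
    then show ?thesis by (simp add: tail)
  qed
  show "integrable lborel (\<lambda>y. deriv \<phi> y *\<^sub>R \<nu> {..<y})"
    using P.integrable_snd[OF fi] unfolding inner1 .
  have "(LINT y|lborel. deriv \<phi> y *\<^sub>R \<nu> {..<y}) = (LINT x|?N. - (\<phi> x *\<^sub>R ?g x))"
    using P.Fubini_integral[OF fi] unfolding inner1 inner2 .
  then show "vector_integral \<nu> \<phi> = - (LINT y|lborel. deriv \<phi> y *\<^sub>R \<nu> {..<y})"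
    by (simp add: vector_integral_def)
qed

subsection \<open>Existence of the derivative and of its decomposition\<close>

text \<open>Each coordinate of \<open>U\<close> becomes monotone after adding a multiple of
  \<open>F\<close>, and so defines a Stieltjes measure; subtracting the multiple of the measure of
  \<open>F\<close> leaves the coordinate of \<open>\<nu>\<close>. Right continuity of
  \<open>U\<close> is inherited from \<open>F\<close> through the majorization.\<close>

lemma stieltjes_vector_measure:
  fixes U :: "real \<Rightarrow> 'a"
  assumes mono: "\<And>x y. x \<le> y \<Longrightarrow> F x \<le> F y" and rc: "\<And>x. continuous (at_right x) F"
    and lo: "\<And>x. lo \<le> F x" and hi: "\<And>x. F x \<le> hi"
    and U: "\<And>x y. x \<le> y \<Longrightarrow> norm (U y - U x) \<le> F y - F x"
  shows "\<exists>\<nu>. vector_measure \<nu> \<and> (\<forall>a b. a \<le> b \<longrightarrow> \<nu> {a<..b} = U b - U a)"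
proof -
  have "\<exists>k>0. \<forall>x. norm (coord b x) \<le> norm x * k" if "b \<in> B" for b
    using bounded_linear.pos_bounded[OF bounded_linear_coord[OF that]] .
  then obtain K where K: "\<And>b. b \<in> B \<Longrightarrow> K b > 0" "\<And>b x. b \<in> B \<Longrightarrow> norm (coord b x) \<le> norm x * K b"
    by metis
  define G where "G c x = K c * F x + coord c (U x)" for c x
  have coord_diff: "\<bar>coord c (U y) - coord c (U x)\<bar> \<le> K c * (F y - F x)" if c: "c \<in> B" and xy: "x \<le> y" for c x y
  proof -
    interpret bounded_linear "coord c" by (rule bounded_linear_coord[OF c])
    have "\<bar>coord c (U y) - coord c (U x)\<bar> \<le> norm (U y - U x) * K c" using K(2)[OF c, of "U y - U x"] by (simp add: diff)
    also have "\<dots> \<le> (F y - F x) * K c" using U[OF xy] K(1)[OF c] by (intro mult_right_mono) auto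
    finally show ?thesis by (simp add: mult.commute)
  qed
  have G_mono: "G c x \<le> G c y" if "c \<in> B" "x \<le> y" for c x y
    using coord_diff[OF that] by (simp add: G_def algebra_simps abs_le_iff)
  have U_rc: "(U \<longlongrightarrow> U x) (at_right x)" for x
  proof -
    have "((\<lambda>y. F y - F x) \<longlongrightarrow> 0) (at_right x)"
      using rc[of x] by (simp add: continuous_within LIM_zero)
    moreover have "\<forall>\<^sub>F y in at_right x. norm (U y - U x) \<le> F y - F x"
      using eventually_at_right_less[of x] by eventually_elim (simp add: U)
    ultimately have "((\<lambda>y. U y - U x) \<longlongrightarrow> 0) (at_right x)" by (rule Lim_null_comparison[rotated])
    then show ?thesis by (rule LIM_zero_cancel)
  qed
  have G_rc: "continuous (at_right x) (G c)" if c: "c \<in> B" for c x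
    unfolding G_def continuous_within
    using rc[of x] unfolding continuous_within
    by (intro tendsto_intros bounded_linear.tendsto[OF bounded_linear_coord[OF c]] U_rc)
  have G_bd: "\<bar>G c x\<bar> \<le> K c * (\<bar>lo\<bar> + \<bar>hi\<bar>) + \<bar>coord c (U 0)\<bar> + K c * (hi - lo)" if c: "c \<in> B" for c x
  proof -
    have "\<bar>F x\<bar> \<le> \<bar>lo\<bar> + \<bar>hi\<bar>" using lo[of x] hi[of x] by linarith
    then have "K c * \<bar>F x\<bar> \<le> K c * (\<bar>lo\<bar> + \<bar>hi\<bar>)" using K(1)[OF c] by simp
    moreover have "\<bar>coord c (U x) - coord c (U 0)\<bar> \<le> K c * (hi - lo)"
    proof (cases "0 \<le> x")
      case True
      have "K c * (F x - F 0) \<le> K c * (hi - lo)" using lo[of 0] hi[of x] K(1)[OF c] by (intro mult_left_mono) auto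
      then show ?thesis using coord_diff[OF c True] by linarith
    next
      case False
      have "K c * (F 0 - F x) \<le> K c * (hi - lo)" using lo[of x] hi[of 0] K(1)[OF c] by (intro mult_left_mono) auto
      then show ?thesis using coord_diff[OF c, of x 0] False by linarith
    qed
    moreover have "\<bar>G c x\<bar> \<le> K c * \<bar>F x\<bar> + \<bar>coord c (U x)\<bar>"
      unfolding G_def using K(1)[OF c] by (intro order_trans[OF abs_triangle_ineq]) (simp add: abs_mult)
    ultimately show ?thesis by linarith
  qed
  let ?V = "interval_measure F"
  interpret V: finite_measure ?V by (rule finite_interval_measure[OF mono rc lo hi])
  have Gfin: "finite_measure (interval_measure (G c))" if "c \<in> B" for c
  proof (rule finite_interval_measure[OF G_mono[OF that] G_rc[OF that]])
    define X where "X = K c * (\<bar>lo\<bar> + \<bar>hi\<bar>) + \<bar>coord c (U 0)\<bar> + K c * (hi - lo)"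
    show "- X \<le> G c x" "G c x \<le> X" for x
      using G_bd[OF that, of x] unfolding X_def[symmetric] by linarith+
  qed
  define \<nu> where "\<nu> A = (if A \<in> sets borel then \<Sum>c\<in>B. (measure (interval_measure (G c)) A - K c * measure ?V A) *\<^sub>R c else 0)" for A
  have "vector_measure \<nu>"
    unfolding vector_measure_def
  proof (intro conjI allI impI)
    fix F' :: "nat \<Rightarrow> real set" assume F': "range F' \<subseteq> sets borel" "disjoint_family F'"
    have b: "F' i \<in> sets borel" "(\<Union>i. F' i) \<in> sets borel" for i using F'(1) by auto
    have "(\<lambda>i. \<Sum>c\<in>B. (measure (interval_measure (G c)) (F' i) - K c * measure ?V (F' i)) *\<^sub>R c) sums
      (\<Sum>c\<in>B. (measure (interval_measure (G c)) (\<Union>i. F' i) - K c * measure ?V (\<Union>i. F' i)) *\<^sub>R c)"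
    proof (intro sums_sum sums_scaleR_left sums_diff sums_mult)
      fix c assume "c \<in> B"
      then interpret m: finite_measure "interval_measure (G c)" by (rule Gfin)
      show "(\<lambda>i. measure (interval_measure (G c)) (F' i)) sums measure (interval_measure (G c)) (\<Union>i. F' i)"
        using F' by (intro m.finite_measure_UNION) auto
      show "(\<lambda>i. measure ?V (F' i)) sums measure ?V (\<Union>i. F' i)"
        using F' by (intro V.finite_measure_UNION) auto
    qed
    then show "(\<lambda>i. \<nu> (F' i)) sums \<nu> (\<Union>i. F' i)" using b by (simp add: \<nu>_def)
  qed (simp add: \<nu>_def)
  moreover have "\<nu> {a<..b} = U b - U a" if "a \<le> b" for a b
  proof -
    have "\<nu> {a<..b} = (\<Sum>c\<in>B. ((G c b - G c a) - K c * (F b - F a)) *\<^sub>R c)"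
      unfolding \<nu>_def using that G_mono G_rc
      by (auto intro!: sum.cong simp: measure_interval_measure_Ioc mono rc)
    also have "\<dots> = (\<Sum>c\<in>B. coord c (U b) *\<^sub>R c - coord c (U a) *\<^sub>R c)"
      by (intro sum.cong) (auto simp: G_def algebra_simps)
    also have "\<dots> = U b - U a" by (simp add: sum_subtractf sum_coord)
    finally show ?thesis .
  qed
  ultimately show ?thesis by blast
qed

lemma variation_measure_null:
  fixes \<nu> :: "real set \<Rightarrow> 'a"
  assumes "vector_measure \<nu>" "A \<in> sets borel" "emeasure (variation_measure \<nu>) A = 0"
  shows "\<nu> A = 0"
  using norm_le_variation[OF assms(1,2)] assms by (simp add: emeasure_variation_measure)

lemma variation_atoms:
  fixes \<nu> :: "real set \<Rightarrow> 'a"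
  assumes vm: "vector_measure \<nu>"
  shows "countable {x. emeasure (variation_measure \<nu>) {x} \<noteq> 0}"
proof -
  interpret finite_measure "variation_measure \<nu>" by (rule variation_finite[OF vm])
  show ?thesis using countable_support by (simp add: emeasure_eq_measure)
qed

text \<open>Integration by parts with the distribution function of the restricted measure. Inside
  the interval this is \<open>U y - U 0\<close> except at countably many atoms, and
  \<open>U 0\<close> drops out because \<open>deriv \<phi>\<close> has integral 0.\<close>

lemma distributional_derivative_exists:
  fixes u U :: "real \<Rightarrow> 'a"
  assumes vm: "vector_measure \<nu>" and \<nu>: "\<And>a b. a \<le> b \<Longrightarrow> \<nu> {a<..b} = U b - U a"
    and uU: "AE y in lborel. y \<in> {0<..<T} \<longrightarrow> u y = U y"
    and um: "(\<lambda>y. indicator {0..T} y *\<^sub>R u y) \<in> borel_measurable borel"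
  shows "distributional_derivative T u (vm_restrict {0<..<T} \<nu>)"
  unfolding distributional_derivative_def
proof (intro conjI ballI allI impI)
  let ?\<nu> = "vm_restrict {0<..<T} \<nu>"
  show vm': "vector_measure ?\<nu>" by (rule vm_restrict[OF vm]) simp
  show "?\<nu> A = ?\<nu> (A \<inter> {0<..<T})" if "A \<in> sets borel" for A using that by (simp add: vm_restrict_def Int_assoc)
  fix \<phi> assume \<phi>: "test_function T \<phi>"
  note parts = vector_integral_by_parts[OF vm' \<phi>]
  have "AE y in lborel. y \<notin> {x. emeasure (variation_measure \<nu>) {x} \<noteq> 0}"
    by (rule AE_not_in) (rule countable_imp_null_set_lborel[OF variation_atoms[OF vm]])
  then have ae: "AE y in lborel. deriv \<phi> y *\<^sub>R ?\<nu> {..<y} =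
      indicator {0..T} y *\<^sub>R (deriv \<phi> y *\<^sub>R u y) - deriv \<phi> y *\<^sub>R U 0"
    using uU
  proof eventually_elim
    case (elim y)
    show ?case
    proof (cases "y \<in> {0<..<T}")
      case True
      then have "{..<y} \<inter> {0<..<T} = {0<..<y}" by auto
      moreover have "\<nu> {y} = 0" using elim by (intro variation_measure_null[OF vm]) auto
      moreover have "{0<..<y} \<union> {y} = {0<..y}" using True by auto
      ultimately have "?\<nu> {..<y} = U y - U 0"
        using vm_Un[OF vm, of "{0<..<y}" "{y}"] \<nu>[of 0 y] True by (simp add: vm_restrict_def)
      then show ?thesis using elim True by (simp add: scaleR_right_diff_distrib)
    next
      case False
      then show ?thesis using parts(5) by simp
    qed
  qed
  have dm[measurable]: "deriv \<phi> \<in> borel_measurable borel" using parts(3) by auto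
  have um': "(\<lambda>y. indicator {0..T} y *\<^sub>R (deriv \<phi> y *\<^sub>R u y)) \<in> borel_measurable lborel"
  proof -
    have "(\<lambda>y. deriv \<phi> y *\<^sub>R (indicator {0..T} y *\<^sub>R u y)) \<in> borel_measurable borel"
      by (rule borel_measurable_scaleR[OF dm um])
    then show ?thesis by (simp add: mult.commute)
  qed
  have i2: "integrable lborel (\<lambda>y. deriv \<phi> y *\<^sub>R U 0)" using parts(3) by simp
  have "integrable lborel (\<lambda>y. deriv \<phi> y *\<^sub>R ?\<nu> {..<y} + deriv \<phi> y *\<^sub>R U 0)"
    using parts(1) i2 by simp
  then have i1: "integrable lborel (\<lambda>y. indicator {0..T} y *\<^sub>R (deriv \<phi> y *\<^sub>R u y))"
    by (rule integrable_cong_AE_imp) (use um' ae in auto)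
  have "(LINT y|lborel. deriv \<phi> y *\<^sub>R ?\<nu> {..<y}) =
      (LINT y|lborel. indicator {0..T} y *\<^sub>R (deriv \<phi> y *\<^sub>R u y) - deriv \<phi> y *\<^sub>R U 0)"
    by (rule integral_cong_AE) (use parts(1) i1 i2 ae in auto)
  also have "\<dots> = (LINT y|lborel. indicator {0..T} y *\<^sub>R (deriv \<phi> y *\<^sub>R u y)) - (LINT y|lborel. deriv \<phi> y) *\<^sub>R U 0"
    using i1 i2 parts(3) by simp
  finally show "vector_integral ?\<nu> \<phi> = - (LINT t:{0..T}|lborel. deriv \<phi> t *\<^sub>R u t)"
    unfolding parts(2) parts(4) by (simp add: set_lebesgue_integral_def)
qed

text \<open>Lebesgue decomposition through the variation measure: \<open>N\<close> is a Lebesgue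
  null set of maximal variation and \<open>S\<close> is the countable set of atoms. The parts are
  the restrictions to the complement of both, to \<open>N - S\<close> and to
  \<open>S\<close>.\<close>

lemma derivative_parts_exist:
  fixes \<nu> :: "real set \<Rightarrow> 'a"
  assumes dd: "distributional_derivative T u \<nu>"
  shows "\<exists>\<nu>L \<nu>C \<nu>J. derivative_parts T u \<nu>L \<nu>C \<nu>J"
proof -
  have vm: "vector_measure \<nu>" using dd by (simp add: distributional_derivative_def)
  let ?M = "variation_measure \<nu>"
  have sM: "sets ?M = sets borel" and spM: "space ?M = UNIV" using vm by simp_all
  interpret finite_measure ?M by (rule variation_finite[OF vm])
  have lb: "A \<in> sets ?M" if "A \<in> null_sets lborel" for A
    using null_setsD2[OF that] by (simp only: sM sets_lborel)
  define s where "s = (SUP A\<in>null_sets lborel. measure ?M A)"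
  have bdd: "bdd_above (measure ?M ` null_sets lborel)"
    by (rule bdd_aboveI2) (rule bounded_measure)
  have ne: "null_sets (lborel :: real measure) \<noteq> {}" by auto
  have "\<exists>A\<in>null_sets lborel. s - inverse (real (Suc n)) < measure ?M A" for n
    unfolding s_def less_cSUP_iff[OF ne bdd, symmetric] by simp
  then obtain A where A: "\<And>n. A n \<in> null_sets lborel" "\<And>n. s - inverse (real (Suc n)) < measure ?M (A n)"
    by metis
  define N where "N = (\<Union>n. A n)"
  have N: "N \<in> null_sets lborel" unfolding N_def using A(1) by (intro null_sets_UN)
  have sN: "s \<le> measure ?M N"
  proof (rule field_le_epsilon)
    fix e :: real assume "e > 0"
    then obtain n where "inverse (real (Suc n)) < e" using reals_Archimedean by blast
    moreover have "measure ?M (A n) \<le> measure ?M N"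
      unfolding N_def using lb[OF N] lb[OF A(1)] by (intro finite_measure_mono) (auto simp: N_def)
    ultimately show "s \<le> measure ?M N + e" using A(2)[of n] by linarith
  qed
  \<comment> \<open>Maximality of \<open>N\<close>: a null set charging its complement could be
    added to it.\<close>
  have off_N: "emeasure ?M (C - N) = 0" if C: "C \<in> null_sets lborel" for C
  proof -
    have "measure ?M (N \<union> C) \<le> s" unfolding s_def using bdd C N by (intro cSUP_upper) auto
    moreover have "measure ?M (N \<union> C) = measure ?M N + measure ?M (C - N)"
      using finite_measure_Union[of N "C - N"] lb[OF C] lb[OF N] by auto
    ultimately have "measure ?M (C - N) = 0" using sN measure_nonneg[of ?M "C - N"] by linarith
    then show ?thesis by (simp add: emeasure_eq_measure)
  qed
  define S where "S = {x. emeasure ?M {x} \<noteq> 0}"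
  have S: "countable S" unfolding S_def by (rule variation_atoms[OF vm])
  have bor[measurable]: "S \<in> sets borel" "N \<in> sets borel"
    using sets.countable[OF _ S, of borel] null_setsD2[OF N] by simp_all
  let ?L = "vm_restrict (- (N \<union> S)) \<nu>" and ?C = "vm_restrict (N - S) \<nu>" and ?J = "vm_restrict S \<nu>"
  have sum: "(\<lambda>A. ?L A + ?C A + ?J A) = \<nu>"
  proof
    fix A
    show "?L A + ?C A + ?J A = \<nu> A"
    proof (cases "A \<in> sets borel")
      case True
      have "A = ((A \<inter> - (N \<union> S)) \<union> (A \<inter> (N - S))) \<union> (A \<inter> S)" by blast
      then have "\<nu> A = \<nu> ((A \<inter> - (N \<union> S)) \<union> (A \<inter> (N - S))) + \<nu> (A \<inter> S)"
        using vm_Un[OF vm, of "(A \<inter> - (N \<union> S)) \<union> (A \<inter> (N - S))" "A \<inter> S"] True bor by auto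
      also have "\<nu> ((A \<inter> - (N \<union> S)) \<union> (A \<inter> (N - S))) = \<nu> (A \<inter> - (N \<union> S)) + \<nu> (A \<inter> (N - S))"
        using True bor by (intro vm_Un[OF vm]) auto
      finally show ?thesis using True by (simp add: vm_restrict_def)
    qed (simp add: vm_restrict_def vm_outside[OF vm])
  qed
  have "derivative_parts T u ?L ?C ?J"
    unfolding derivative_parts_def sum
  proof (intro conjI)
    show "vector_measure ?L" "vector_measure ?C" "vector_measure ?J"
      using bor by (auto intro!: vm_restrict vm)
    show "distributional_derivative T u \<nu>" by (rule dd)
    show "\<forall>A\<in>null_sets lborel. ?L A = 0"
    proof
      fix A :: "real set" assume A: "A \<in> null_sets lborel"
      have Ab: "A \<in> sets borel" using null_setsD2[OF A] by simp
      have "emeasure ?M (A \<inter> - (N \<union> S)) \<le> emeasure ?M (A - N)"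
      proof (rule emeasure_mono)
        show "A \<inter> - (N \<union> S) \<subseteq> A - N" by blast
        show "A - N \<in> sets ?M" unfolding sM using Ab bor by simp
      qed
      then have "emeasure ?M (A \<inter> - (N \<union> S)) = 0" using off_N[OF A] by simp
      moreover have "A \<inter> - (N \<union> S) \<in> sets borel" using Ab bor by simp
      ultimately have "\<nu> (A \<inter> - (N \<union> S)) = 0" by (intro variation_measure_null[OF vm])
      then show "?L A = 0" by (simp add: vm_restrict_def)
    qed
    show "\<exists>N\<in>null_sets lborel. \<forall>A\<in>sets borel. ?C A = ?C (A \<inter> N)"
    proof (intro bexI[OF _ N] ballI)
      fix A :: "real set" assume "A \<in> sets borel"
      moreover have "A \<inter> N \<inter> (N - S) = A \<inter> (N - S)" by blast
      ultimately show "?C A = ?C (A \<inter> N)" using bor by (simp add: vm_restrict_def)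
    qed
    show "\<forall>x. ?C {x} = 0"
    proof
      fix x
      show "?C {x} = 0"
      proof (cases "x \<in> N - S")
        case True
        then have "emeasure ?M {x} = 0" by (simp add: S_def)
        then have "\<nu> {x} = 0" by (intro variation_measure_null[OF vm]) simp
        then show ?thesis using True by (simp add: vm_restrict_def)
      qed (simp add: vm_restrict_def vm_empty[OF vm])
    qed
    show "\<exists>S. countable S \<and> (\<forall>A\<in>sets borel. ?J A = ?J (A \<inter> S))"
      using S bor by (intro exI[of _ S]) (simp add: vm_restrict_def Int_assoc)
  qed
  then show ?thesis by blast
qed

text \<open>The parts come from a choice, so they are known only through their defining properties;
  their total is identified with \<open>\<nu>\<close> by uniqueness of the distributional
  derivative.\<close>

lemma deriv_parts:
  fixes \<nu> :: "real set \<Rightarrow> 'a"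
  assumes dd: "distributional_derivative T u \<nu>"
  obtains \<nu>L \<nu>C \<nu>J where "derivative_parts T u \<nu>L \<nu>C \<nu>J" "cantor_part T u = \<nu>C"
    "continuous_part T u = (\<lambda>A. \<nu>L A + \<nu>C A)" "\<And>A. \<nu>L A + \<nu>C A + \<nu>J A = \<nu> A"
proof -
  have "\<exists>z. case z of (\<nu>L, \<nu>C, \<nu>J) \<Rightarrow> derivative_parts T u \<nu>L \<nu>C \<nu>J"
    using derivative_parts_exist[OF dd] by auto
  from someI_ex[OF this] have *: "case deriv_parts T u of (\<nu>L, \<nu>C, \<nu>J) \<Rightarrow> derivative_parts T u \<nu>L \<nu>C \<nu>J"
    unfolding deriv_parts_def .
  obtain \<nu>L \<nu>C \<nu>J where z: "deriv_parts T u = (\<nu>L, \<nu>C, \<nu>J)" by (cases "deriv_parts T u") auto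
  have d: "derivative_parts T u \<nu>L \<nu>C \<nu>J" using * z by simp
  then have "distributional_derivative T u (\<lambda>A. \<nu>L A + \<nu>C A + \<nu>J A)" by (simp add: derivative_parts_def)
  then have "(\<lambda>A. \<nu>L A + \<nu>C A + \<nu>J A) = \<nu>" using dd by (rule distributional_derivative_unique)
  then have "\<nu>L A + \<nu>C A + \<nu>J A = \<nu> A" for A by (rule fun_cong)
  then show thesis using that[OF d] z by (simp add: cantor_part_def continuous_part_def)
qed

text \<open>Borel sets are approximated by finite disjoint unions of half-open intervals.\<close>

lemma sublinear_vm_le_interval_measure:
  fixes \<nu> :: "real set \<Rightarrow> 'a"
  assumes vm: "vector_measure \<nu>"
    and mono: "\<And>x y. x \<le> y \<Longrightarrow> F x \<le> F y" and rc: "\<And>x. continuous (at_right x) F"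
    and lo: "\<And>x. lo \<le> F x" and hi: "\<And>x. F x \<le> hi"
    and \<phi>: "sublinear \<phi>" "\<And>x. \<phi> x \<le> C * norm x"
    and le: "\<And>a b. a \<le> b \<Longrightarrow> \<phi> (\<nu> {a<..b}) \<le> F b - F a" and A: "A \<in> sets borel"
  shows "\<phi> (\<nu> A) \<le> measure (interval_measure F) A"
proof (rule field_le_epsilon)
  let ?V = "interval_measure F" and ?M = "variation_measure \<nu>"
  interpret V: finite_measure ?V by (rule finite_interval_measure[OF mono rc lo hi])
  interpret M: finite_measure ?M by (rule variation_finite[OF vm])
  have sM: "sets ?M = sets borel" using vm by simp
  fix e :: real assume e: "e > 0"
  \<comment> \<open>The error consists of \<open>2 * d\<close> for the distance between
    \<open>\<nu> A\<close> and \<open>\<nu> W\<close>, multiplied by the Lipschitz constant of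
    \<open>\<phi>\<close>, and of \<open>d\<close> for the Stieltjes measure.\<close>
  define d where "d = e / (2 * \<bar>C\<bar> + 1)"
  have d: "d > 0" using e by (simp add: d_def add_nonneg_pos)
  have outer: "\<exists>U. open U \<and> A \<subseteq> U \<and> measure N U < measure N A + d"
    if "finite_measure N" "sets N = sets borel" for N :: "real measure"
  proof -
    interpret N: finite_measure N by fact
    have "emeasure N A = (INF U\<in>{U. A \<subseteq> U \<and> open U}. emeasure N U)"
      by (rule outer_regular) (use that A in auto)
    moreover have "emeasure N A < ennreal (measure N A + d)"
      unfolding N.emeasure_eq_measure using d by (simp add: ennreal_less_iff)
    ultimately have "(INF U\<in>{U. A \<subseteq> U \<and> open U}. emeasure N U) < ennreal (measure N A + d)" by simp
    then obtain U where "A \<subseteq> U" "open U" "emeasure N U < ennreal (measure N A + d)"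
      unfolding INF_less_iff by blast
    then show ?thesis by (auto simp: N.emeasure_eq_measure ennreal_less_iff)
  qed
  obtain U1 where U1: "open U1" "A \<subseteq> U1" "measure ?V U1 < measure ?V A + d"
    using outer[OF V.finite_measure_axioms] by auto
  obtain U2 where U2: "open U2" "A \<subseteq> U2" "measure ?M U2 < measure ?M A + d"
    using outer[OF M.finite_measure_axioms sM] by auto
  have ir: "emeasure ?M A = (SUP K\<in>{K. K \<subseteq> A \<and> compact K}. emeasure ?M K)"
    by (rule inner_regular) (use sM A in auto)
  have "\<exists>K. compact K \<and> K \<subseteq> A \<and> measure ?M A < measure ?M K + d"
  proof (rule ccontr)
    assume "\<not> ?thesis"
    then have n': "\<not> measure ?M A < measure ?M K + d" if "compact K" "K \<subseteq> A" for K
      using that by blast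
    have "(SUP K\<in>{K. K \<subseteq> A \<and> compact K}. emeasure ?M K) \<le> ennreal (max 0 (measure ?M A - d))"
    proof (rule SUP_least)
      fix K assume "K \<in> {K. K \<subseteq> A \<and> compact K}"
      then have "measure ?M K \<le> measure ?M A - d" using n'[of K] by simp
      then show "emeasure ?M K \<le> ennreal (max 0 (measure ?M A - d))"
        unfolding M.emeasure_eq_measure by (intro ennreal_leI) simp
    qed
    then have "emeasure ?M A \<le> ennreal (max 0 (measure ?M A - d))" unfolding ir .
    then have "measure ?M A \<le> max 0 (measure ?M A - d)"
      unfolding M.emeasure_eq_measure by simp
    then have "measure ?M A = 0" using d measure_nonneg[of ?M A] by linarith
    then show False using n'[of "{}"] d by simp
  qed
 then obtain K where K: "compact K" "K \<subseteq> A" "measure ?M A < measure ?M K + d" by blast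
  define U where "U = U1 \<inter> U2"
  have U: "open U" "A \<subseteq> U" using U1 U2 by (auto simp: U_def)
  have "K \<subseteq> U" using K(2) U(2) by blast
  from compact_grid_cover[OF K(1) U(1) this] obtain h J where hJ: "h > 0" "finite J"
    "K \<subseteq> (\<Union>j\<in>J. cell h j)" "(\<Union>j\<in>J. cell h j) \<subseteq> U" by blast
  define W where "W = (\<Union>j\<in>J. cell h j)"
  note dis = cell_disjoint[OF hJ(1), of J]
  have Wb: "W \<in> sets borel" using hJ(2) by (auto simp: W_def)
  have jle: "of_int j * h \<le> (of_int j + 1) * h" for j :: int using hJ(1) by (intro mult_right_mono) auto
  have "\<phi> (\<nu> W) \<le> measure ?V W"
  proof -
    have "\<phi> (\<nu> W) = \<phi> (\<Sum>j\<in>J. \<nu> (cell h j))"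
      unfolding W_def using hJ(2) dis by (subst vm_finite_UN[OF vm]) auto
    also have "\<dots> \<le> (\<Sum>j\<in>J. \<phi> (\<nu> (cell h j)))" by (rule sublinear_sum[OF \<phi>(1)])
    also have "\<dots> \<le> (\<Sum>j\<in>J. measure ?V (cell h j))"
      using le[OF jle] by (intro sum_mono) (simp add: measure_interval_measure_Ioc[OF jle mono rc])
    also have "\<dots> = measure ?V W"
      unfolding W_def using hJ(2) dis by (intro V.finite_measure_finite_Union[symmetric]) auto
    finally show ?thesis .
  qed
  also have "\<dots> \<le> measure ?V U1"
    using hJ(4) U1(1) Wb by (intro V.finite_measure_mono) (auto simp: U_def W_def)
  also note U1(3)
  finally have W_le: "\<phi> (\<nu> W) < measure ?V A + d" .
  \<comment> \<open>Both \<open>A\<close> and \<open>W\<close> contain \<open>K\<close> and lie in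
    \<open>U2\<close>, so their symmetric difference has small variation.\<close>
  have "norm (\<nu> A - \<nu> W) \<le> 2 * d"
  proof -
    have eqs: "\<nu> (A - W) = \<nu> A - \<nu> (A \<inter> W)" "\<nu> (W - A) = \<nu> W - \<nu> (A \<inter> W)"
    proof -
      have "A - A \<inter> W = A - W" "W - A \<inter> W = W - A" by blast+
      then show "\<nu> (A - W) = \<nu> A - \<nu> (A \<inter> W)" "\<nu> (W - A) = \<nu> W - \<nu> (A \<inter> W)"
        using vm_Diff[OF vm, of "A \<inter> W" A] vm_Diff[OF vm, of "A \<inter> W" W] A Wb by simp_all
    qed
    have n: "norm (\<nu> X) \<le> measure ?M X" if "X \<in> sets borel" for X
    proof -
      have "ennreal (norm (\<nu> X)) \<le> ennreal (measure ?M X)"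
        using norm_le_variation[OF vm that]
        unfolding emeasure_variation_measure[OF vm that, symmetric] M.emeasure_eq_measure .
      then show ?thesis by (simp only: ennreal_le_iff[OF measure_nonneg])
    qed
    have "norm (\<nu> A - \<nu> W) = norm (\<nu> (A - W) - \<nu> (W - A))" by (simp add: eqs)
    also have "\<dots> \<le> norm (\<nu> (A - W)) + norm (\<nu> (W - A))" by (rule norm_triangle_ineq4)
    also have "\<dots> \<le> measure ?M (A - W) + measure ?M (W - A)" using A Wb by (intro add_mono n) auto
    also have "\<dots> \<le> measure ?M (A - K) + measure ?M (U2 - A)"
      using A Wb hJ(3,4) K(1) U2(1) sM
      by (intro add_mono M.finite_measure_mono) (auto simp: U_def W_def compact_imp_closed)
    also have "measure ?M (A - K) = measure ?M A - measure ?M K"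
      using A K sM by (intro M.finite_measure_Diff) (auto simp: compact_imp_closed)
    also have "measure ?M (U2 - A) = measure ?M U2 - measure ?M A"
      using A U2 sM by (intro M.finite_measure_Diff) auto
    finally show ?thesis using K(3) U2(3) by linarith
  qed
  then have "C * norm (\<nu> A - \<nu> W) \<le> \<bar>C\<bar> * (2 * d)"
    using mult_mono[of C "\<bar>C\<bar>" "norm (\<nu> A - \<nu> W)" "2 * d"] by simp
  then have "\<phi> (\<nu> A) \<le> \<phi> (\<nu> W) + \<bar>C\<bar> * (2 * d)"
    using sublinear_diff_le[OF \<phi>, of "\<nu> A" "\<nu> W"] by linarith
  then have "\<phi> (\<nu> A) \<le> measure ?V A + (2 * \<bar>C\<bar> + 1) * d" using W_le by (simp add: algebra_simps)
  also have "(2 * \<bar>C\<bar> + 1) * d = e"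
    unfolding d_def using nonzero_mult_div_cancel_left[of "2 * \<bar>C\<bar> + 1" e] by (simp add: add_nonneg_eq_0_iff)
  finally show "\<phi> (\<nu> A) \<le> measure ?V A + e" .
qed

end

section \<open>Finsler cost and optimal transitions\<close>

lemma AE_lborel_exists_in_interval:
  fixes a b :: real
  assumes "AE x in lborel. x \<in> {a<..<b} \<longrightarrow> P x" "a < b"
  shows "\<exists>x\<in>{a<..<b}. P x"
proof (rule ccontr)
  assume "\<not> ?thesis"
  then have "AE x in lborel. x \<notin> {a<..<b}" using assms(1) by auto
  then have "{a<..<b} \<in> null_sets lborel" by (simp add: AE_iff_null_sets)
  then have "emeasure lborel {a<..<b} = 0" by auto
  then show False using assms(2) by simp
qed

locale energy_slice = potentials B coord \<Psi>0 \<Psi>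
  for B :: "'a::{banach, heine_borel, second_countable_topology} set" and coord \<Psi>0 \<Psi> +
  fixes E :: "real \<Rightarrow> 'a \<Rightarrow> real" and DE :: "real \<Rightarrow> 'a \<Rightarrow> ('a \<Rightarrow>\<^sub>L real)" and t :: real
  assumes E_deriv: "\<And>x. (E t has_derivative blinfun_apply (DE t x)) (at x)"
    and DE_cont: "continuous_on UNIV (DE t)"
begin

lemma E_cont: "continuous_on UNIV (E t)"
  using E_deriv has_derivative_continuous by (intro continuous_at_imp_continuous_on) blast

lemma E_Lipschitz: "\<exists>L. \<forall>x y. norm x \<le> R \<longrightarrow> norm y \<le> R \<longrightarrow> \<bar>E t x - E t y\<bar> \<le> L * norm (x - y)"
proof -
  have "compact (cball (0::'a) R)" by (simp add: compact_eq_bounded_closed)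
  then have "compact (DE t ` cball 0 R)"
    by (intro compact_continuous_image continuous_on_subset[OF DE_cont]) auto
  from compact_imp_bounded[OF this] obtain L where "\<forall>y\<in>DE t ` cball 0 R. norm y \<le> L"
    unfolding bounded_iff by blast
  then have L: "norm (DE t x) \<le> L" if "x \<in> cball 0 R" for x using that by blast
  have "norm (E t x - E t y) \<le> L * norm (x - y)" if "norm x \<le> R" "norm y \<le> R" for x y
  proof (rule differentiable_bound[where S="cball 0 R" and f'="\<lambda>x. blinfun_apply (DE t x)"])
    show "(E t has_derivative blinfun_apply (DE t x)) (at x within cball 0 R)" for x
      using E_deriv has_derivative_at_withinI by blast
    show "onorm (blinfun_apply (DE t x)) \<le> L" if "x \<in> cball 0 R" for x
      using L[OF that] by (simp add: norm_blinfun.rep_eq)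
  qed (use that in auto)
  then show ?thesis by auto
qed

text \<open>The measurable data attached to an absolutely continuous curve: \<^term>\<open>h\<close> is its velocity and
  \<^term>\<open>W\<close> is the continuous extension of \<^term>\<open>\<lambda>r. - DE t (\<theta> r)\<close> to the line.\<close>

definition curve_data :: "real \<Rightarrow> real \<Rightarrow> (real \<Rightarrow> 'a) \<Rightarrow> (real \<Rightarrow> 'a) \<Rightarrow> (real \<Rightarrow> ('a \<Rightarrow>\<^sub>L real)) \<Rightarrow> bool" where
  "curve_data a b \<theta> h W \<longleftrightarrow>
     integrable lborel h \<and> (\<lambda>r. p (h r) (W r)) \<in> borel_measurable lborel \<and>
     (\<forall>r\<in>{a..b}. W r = - DE t (\<theta> r)) \<and>
     (AE r in lborel. r \<in> {a<..<b} \<longrightarrow> (\<theta> has_vector_derivative h r) (at r)) \<and>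
     (\<forall>x y. a \<le> x \<longrightarrow> x \<le> y \<longrightarrow> y \<le> b \<longrightarrow> \<theta> y - \<theta> x = (LINT r:{x..y}|lborel. h r)) \<and>
     (\<forall>x y. a \<le> x \<longrightarrow> x \<le> y \<longrightarrow> y \<le> b \<longrightarrow> set_integrable lborel {x..y} (\<lambda>r. blinfun_apply (W r) (h r)) \<and>
        E t (\<theta> x) - E t (\<theta> y) = (LINT r:{x..y}|lborel. blinfun_apply (W r) (h r)))"

text \<open>The energy is Lipschitz on a ball containing the compact image of the curve, so its
  composition with the curve is absolutely continuous. The density of the composition is identified
  with the pairing by the chain rule wherever both derivatives exist.\<close>

lemma curve_data_exists:
  assumes ab: "a < b" and ac: "abs_cont_on a b \<theta>"
  shows "\<exists>h W. curve_data a b \<theta> h W"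
proof -
  obtain h where h: "integrable lborel h"
      "AE r in lborel. r \<in> {a<..<b} \<longrightarrow> (\<theta> has_vector_derivative h r) (at r)"
      "\<And>x y. a \<le> x \<Longrightarrow> x \<le> y \<Longrightarrow> y \<le> b \<Longrightarrow> \<theta> y - \<theta> x = (LINT r:{x..y}|lborel. h r)"
    using abs_cont_on_derivative[OF ab ac] by blast
  define f where "f x = \<theta> (clip a b x)" for x
  have f_ac: "abs_cont f" unfolding f_def using ab ac by (intro abs_cont_clip) auto
  have f_cl: "f x = f (clip a b x)" for x by (simp add: f_def clip_def max_def min_def)
  have f_eq: "f x = \<theta> x" if "a \<le> x" "x \<le> b" for x using that by (simp add: f_def clip_def)
  have f_cont: "continuous_on UNIV f"
    by (intro continuous_at_imp_continuous_on) (auto intro: abs_cont_imp_isCont[OF f_ac])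
  define W where "W r = - DE t (f r)" for r
  have W_cont: "continuous_on UNIV W"
    unfolding W_def by (intro continuous_on_minus continuous_on_compose2[OF DE_cont f_cont]) auto
  have [measurable]: "W \<in> borel_measurable lborel"
    using borel_measurable_continuous_onI[OF W_cont] by simp
  have [measurable]: "h \<in> borel_measurable lborel" using h(1) by auto
  have meas: "(\<lambda>r. p (h r) (W r)) \<in> borel_measurable lborel" by (rule p_measurable) measurable
  have "compact (f ` {a..b})" by (intro compact_continuous_image continuous_on_subset[OF f_cont]) auto
  from compact_imp_bounded[OF this] obtain R where "\<forall>y\<in>f ` {a..b}. norm y \<le> R"
    unfolding bounded_iff by blast
  then have R: "norm (f x) \<le> R" if "x \<in> {a..b}" for x using that by blast
  have R': "norm (f x) \<le> R" for x using R[of "clip a b x"] f_cl[of x] ab by (simp add: clip_def)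
  obtain L where L: "\<And>x y. norm x \<le> R \<Longrightarrow> norm y \<le> R \<Longrightarrow> \<bar>E t x - E t y\<bar> \<le> L * norm (x - y)"
    using E_Lipschitz by blast
  have Ef_ac: "abs_cont (\<lambda>x. E t (f x))"
    by (rule abs_cont_Lipschitz_comp[OF f_ac, where L=L]) (simp add: L R')
  obtain k :: "real \<Rightarrow> real" where k: "integrable lborel k"
      "\<And>x y. x \<le> y \<Longrightarrow> E t (f y) - E t (f x) = (LINT r:{x..y}|lborel. k r)"
    using abs_cont_real_density[OF Ef_ac, of a b] ab f_cl by (metis less_imp_le)
  have dk: "AE r in lborel. ((\<lambda>x. E t (f x)) has_real_derivative k r) (at r)"
    by (rule Lebesgue_differentiation[OF k(1)]) (rule k(2))
  have kd: "AE r in lborel. r \<in> {a<..<b} \<longrightarrow> k r = - blinfun_apply (W r) (h r)"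
    using dk h(2)
  proof eventually_elim
    case (elim r)
    show ?case
    proof
      assume r: "r \<in> {a<..<b}"
      then have "(\<theta> has_vector_derivative h r) (at r)" using elim by blast
      then have "(f has_vector_derivative h r) (at r)"
        by (rule has_vector_derivative_transform_within_open[of _ _ _ "{a<..<b}"]) (use r f_eq in auto)
      then have "((E t \<circ> f) has_derivative (blinfun_apply (DE t (f r)) \<circ> (\<lambda>x. x *\<^sub>R h r))) (at r)"
        unfolding has_vector_derivative_def by (intro diff_chain_at E_deriv)
      then have "((\<lambda>x. E t (f x)) has_real_derivative blinfun_apply (DE t (f r)) (h r)) (at r)"
        unfolding has_field_derivative_def by (simp add: comp_def blinfun.scaleR_right mult_commute_abs)
      then have "blinfun_apply (DE t (f r)) (h r) = k r" using elim DERIV_unique by blast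
      then show "k r = - blinfun_apply (W r) (h r)" by (simp add: W_def blinfun.minus_left)
    qed
  qed
  have endpoints: "AE r in lborel. r \<noteq> a \<and> r \<noteq> b" using AE_lborel_singleton by auto
  have Wh: "set_integrable lborel {x..y} (\<lambda>r. blinfun_apply (W r) (h r)) \<and>
        E t (\<theta> x) - E t (\<theta> y) = (LINT r:{x..y}|lborel. blinfun_apply (W r) (h r))"
    if xy: "a \<le> x" "x \<le> y" "y \<le> b" for x y
  proof -
    have ae: "AE r in lborel. indicator {x..y} r *\<^sub>R (- k r) = indicator {x..y} r *\<^sub>R blinfun_apply (W r) (h r)"
      using kd endpoints by eventually_elim (use xy in \<open>auto simp: indicator_def\<close>)
    \<comment> \<open>In coordinates the pairing is a finite sum of products of measurable
      functions, since evaluating \<open>W r\<close> at a fixed vector is continuous in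
      \<open>r\<close>.\<close>
    have bm: "(\<lambda>r. blinfun_apply (W r) (h r)) \<in> borel_measurable lborel"
    proof -
      have "blinfun_apply (W r) (h r) = (\<Sum>c\<in>B. coord c (h r) * blinfun_apply (W r) c)" for r
        by (subst sum_coord[of "h r", symmetric]) (simp only: blinfun.sum_right blinfun.scaleR_right real_scaleR_def)
      moreover have "(\<lambda>r. \<Sum>c\<in>B. coord c (h r) * blinfun_apply (W r) c) \<in> borel_measurable lborel"
      proof (intro borel_measurable_sum borel_measurable_times)
        fix c assume c: "c \<in> B"
        have [measurable]: "coord c \<in> borel_measurable borel"
          by (intro borel_measurable_continuous_onI linear_continuous_on bounded_linear_coord c)
        show "(\<lambda>r. coord c (h r)) \<in> borel_measurable lborel" by measurable
        have "(\<lambda>r. blinfun_apply (W r) c) \<in> borel_measurable borel"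
          by (intro borel_measurable_continuous_onI continuous_intros W_cont)
        then show "(\<lambda>r. blinfun_apply (W r) c) \<in> borel_measurable lborel" by simp
      qed
      ultimately show ?thesis by simp
    qed
    have ki: "integrable lborel (\<lambda>r. indicator {x..y} r *\<^sub>R (- k r))"
      using k(1) by (intro integrable_mult_indicator) auto
    have si: "set_integrable lborel {x..y} (\<lambda>r. blinfun_apply (W r) (h r))"
      unfolding set_integrable_def
      by (rule integrable_cong_AE_imp[OF ki]) (use bm ae in \<open>auto simp del: real_scaleR_def\<close>)
    have "E t (\<theta> x) - E t (\<theta> y) = - (E t (f y) - E t (f x))" using f_eq xy by simp
    also have "\<dots> = (LINT r|lborel. indicator {x..y} r *\<^sub>R (- k r))"
      by (simp add: k(2)[OF xy(2)] set_lebesgue_integral_def)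
    also have "\<dots> = (LINT r:{x..y}|lborel. blinfun_apply (W r) (h r))"
      unfolding set_lebesgue_integral_def
      by (rule integral_cong_AE) (use bm ae ki in \<open>auto simp del: real_scaleR_def\<close>)
    finally show ?thesis using si by blast
  qed
  have "W r = - DE t (\<theta> r)" if "r \<in> {a..b}" for r using that f_eq by (simp add: W_def)
  then show ?thesis using h meas Wh unfolding curve_data_def by blast
qed

section \<open>Length, energy drop and displacement along a single curve\<close>

context
  fixes a b :: real and \<theta> :: "real \<Rightarrow> 'a" and h W
  assumes ab: "a < b" and cd: "curve_data a b \<theta> h W"
begin

lemma curve_measurable: "(\<lambda>r. p (h r) (W r)) \<in> borel_measurable lborel"
  and curve_integrable: "integrable lborel h"
  and curve_W: "r \<in> {a..b} \<Longrightarrow> W r = - DE t (\<theta> r)"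
  and curve_deriv: "AE r in lborel. r \<in> {a<..<b} \<longrightarrow> (\<theta> has_vector_derivative h r) (at r)"
  and curve_diff: "a \<le> x \<Longrightarrow> x \<le> y \<Longrightarrow> y \<le> b \<Longrightarrow> \<theta> y - \<theta> x = (LINT r:{x..y}|lborel. h r)"
  and curve_pairing_integrable: "a \<le> x \<Longrightarrow> x \<le> y \<Longrightarrow> y \<le> b \<Longrightarrow> set_integrable lborel {x..y} (\<lambda>r. blinfun_apply (W r) (h r))"
  and curve_energy: "a \<le> x \<Longrightarrow> x \<le> y \<Longrightarrow> y \<le> b \<Longrightarrow>
    E t (\<theta> x) - E t (\<theta> y) = (LINT r:{x..y}|lborel. blinfun_apply (W r) (h r))"
  using cd unfolding curve_data_def by blast+

lemma curve_velocity: "AE r in lborel. r \<in> {a<..<b} \<longrightarrow> finsler_velocity p DE t \<theta> r = p (h r) (W r)"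
  using curve_deriv by eventually_elim (auto simp: finsler_velocity_def vector_derivative_at curve_W)

lemma curve_length:
  assumes "a \<le> x" "x \<le> y" "y \<le> b"
  shows "finsler_length p DE t x y \<theta> = (\<integral>\<^sup>+r\<in>{x..y}. ennreal (p (h r) (W r)) \<partial>lborel)"
  unfolding finsler_length_def
proof (rule nn_integral_cong_AE)
  have "AE r in lborel. r \<noteq> a \<and> r \<noteq> b" using AE_lborel_singleton by auto
  then show "AE r in lborel. ennreal (finsler_velocity p DE t \<theta> r) * indicator {x..y} r =
      ennreal (p (h r) (W r)) * indicator {x..y} r"
    using curve_velocity by eventually_elim (use assms in \<open>auto simp: indicator_def\<close>)
qed

lemma curve_length_add:
  assumes "a \<le> x" "x \<le> y" "y \<le> z" "z \<le> b"
  shows "finsler_length p DE t x z \<theta> = finsler_length p DE t x y \<theta> + finsler_length p DE t y z \<theta>"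
proof -
  note [measurable] = curve_measurable
  have "finsler_length p DE t x z \<theta> = (\<integral>\<^sup>+r. ennreal (p (h r) (W r)) * indicator {x..y} r + ennreal (p (h r) (W r)) * indicator {y..z} r \<partial>lborel)"
    unfolding curve_length[OF assms(1) order_trans[OF assms(2,3)] assms(4)]
  proof (rule nn_integral_cong_AE)
    have "AE r in lborel. r \<noteq> y" using AE_lborel_singleton by auto
    then show "AE r in lborel. ennreal (p (h r) (W r)) * indicator {x..z} r =
       ennreal (p (h r) (W r)) * indicator {x..y} r + ennreal (p (h r) (W r)) * indicator {y..z} r"
      by eventually_elim (use assms in \<open>auto simp: indicator_def\<close>)
  qed
  also have "\<dots> = finsler_length p DE t x y \<theta> + finsler_length p DE t y z \<theta>"
    using assms by (simp add: curve_length nn_integral_add)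
  finally show ?thesis .
qed

context
  assumes fin: "finsler_length p DE t a b \<theta> < \<infinity>"
begin

lemma curve_p_integrable:
  assumes "a \<le> x" "x \<le> y" "y \<le> b"
  shows "set_integrable lborel {x..y} (\<lambda>r. p (h r) (W r))"
proof -
  note [measurable] = curve_measurable
  have "(\<integral>\<^sup>+r. ennreal (norm (indicator {a..b} r *\<^sub>R p (h r) (W r))) \<partial>lborel) = finsler_length p DE t a b \<theta>"
    using ab by (auto simp: curve_length p_nonneg indicator_def intro!: nn_integral_cong)
  then have "set_integrable lborel {a..b} (\<lambda>r. p (h r) (W r))"
    unfolding set_integrable_def using fin by (intro integrableI_bounded) auto
  then show ?thesis by (rule set_integrable_subset) (use assms in auto)
qed

lemma curve_length_LINT:
  assumes "a \<le> x" "x \<le> y" "y \<le> b"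
  shows "finsler_length p DE t x y \<theta> = ennreal (LINT r:{x..y}|lborel. p (h r) (W r))"
proof -
  have "finsler_length p DE t x y \<theta> = (\<integral>\<^sup>+r. ennreal (indicator {x..y} r *\<^sub>R p (h r) (W r)) \<partial>lborel)"
    unfolding curve_length[OF assms] by (intro nn_integral_cong) (auto simp: indicator_def)
  also have "\<dots> = ennreal (LINT r:{x..y}|lborel. p (h r) (W r))"
    unfolding set_lebesgue_integral_def
    using curve_p_integrable[OF assms] unfolding set_integrable_def
    by (intro nn_integral_eq_integral) (auto simp: p_nonneg)
  finally show ?thesis .
qed

lemma curve_energy_le:
  assumes "a \<le> x" "x \<le> y" "y \<le> b"
  shows "E t (\<theta> x) - E t (\<theta> y) \<le> (LINT r:{x..y}|lborel. p (h r) (W r))"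
  unfolding curve_energy[OF assms]
  by (intro set_integral_mono curve_pairing_integrable curve_p_integrable assms pairing_le_p)

lemma curve_norm_le:
  assumes "a \<le> x" "x \<le> y" "y \<le> b" and c: "\<And>v. c * norm v \<le> \<Psi>0 v" "c > 0"
  shows "c * norm (\<theta> y - \<theta> x) \<le> (LINT r:{x..y}|lborel. p (h r) (W r))"
proof -
  have si: "set_integrable lborel {x..y} h" by (intro integrable_imp_set_integrable curve_integrable) auto
  have "c * norm (\<theta> y - \<theta> x) \<le> c * (LINT r:{x..y}|lborel. norm (h r))"
    unfolding curve_diff[OF assms(1-3)] using c(2) si
    by (intro mult_left_mono set_integral_norm_bound) auto
  also have "\<dots> = (LINT r:{x..y}|lborel. c * norm (h r))" by simp
  also have "\<dots> \<le> (LINT r:{x..y}|lborel. p (h r) (W r))"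
    using si c(1) gauge_le_p by (intro set_integral_mono curve_p_integrable assms)
      (auto intro: order_trans set_integrable_norm)
  finally show ?thesis .
qed

text \<open>With the dual variable frozen at \<open>w0\<close> the integrand is a sublinear function
  of the velocity, so Jensen applies; the factor \<open>d\<close> pays for the freezing.\<close>

lemma curve_frozen_le:
  assumes xy: "a \<le> x" "x \<le> y" "y \<le> b"
    and le: "\<And>r v. r \<in> {x..y} \<Longrightarrow> d * p v w0 \<le> p v (W r)" and d: "d > 0"
  shows "d * p (\<theta> y - \<theta> x) w0 \<le> (LINT r:{x..y}|lborel. p (h r) (W r))"
proof -
  obtain C where C: "C > 0" "\<And>v. p v w0 \<le> C * norm v" using sublinear_bound[OF p_sublinear] by blast
  have si: "set_integrable lborel {x..y} h" by (intro integrable_imp_set_integrable curve_integrable) auto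
  then have i: "integrable lborel (\<lambda>r. indicator {x..y} r *\<^sub>R h r)" by (simp add: set_integrable_def)
  have "p (\<theta> y - \<theta> x) w0 \<le> (LINT r|lborel. p (indicator {x..y} r *\<^sub>R h r) w0)"
    unfolding curve_diff[OF xy] set_lebesgue_integral_def
    by (rule sublinear_Jensen[where \<phi>="\<lambda>v. p v w0", OF p_sublinear C(2) i])
  also have "\<dots> = (LINT r:{x..y}|lborel. p (h r) w0)"
    unfolding set_lebesgue_integral_def
    by (intro Bochner_Integration.integral_cong) (auto simp: indicator_def p_zero)
  finally have "d * p (\<theta> y - \<theta> x) w0 \<le> d * (LINT r:{x..y}|lborel. p (h r) w0)" using d by simp
  also have "\<dots> = (LINT r:{x..y}|lborel. d * p (h r) w0)" by simp
  also have "\<dots> \<le> (LINT r:{x..y}|lborel. p (h r) (W r))"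
  proof (intro set_integral_mono curve_p_integrable xy le)
    have "integrable lborel (\<lambda>r. p (indicator {x..y} r *\<^sub>R h r) w0)"
      by (rule sublinear_integrable[where \<phi>="\<lambda>v. p v w0", OF p_sublinear C(2) i])
    moreover have "(\<lambda>r. p (indicator {x..y} r *\<^sub>R h r) w0) = (\<lambda>r. indicator {x..y} r *\<^sub>R p (h r) w0)"
      by (auto simp: indicator_def p_zero)
    ultimately show "set_integrable lborel {x..y} (\<lambda>r. d * p (h r) w0)"
      by (simp add: set_integrable_def mult.left_commute)
  qed
  finally show ?thesis .
qed

end

lemma curve_energy_le_length:
  assumes "a \<le> x" "x \<le> y" "y \<le> b" "finsler_length p DE t a b \<theta> < \<infinity>"
  shows "ennreal (E t (\<theta> x) - E t (\<theta> y)) \<le> finsler_length p DE t x y \<theta>"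
  using curve_energy_le[OF assms(4,1-3)] curve_length_LINT[OF assms(4,1-3)] by (simp add: ennreal_leI)

text \<open>The difference between \<open>p\<close> and the pairing is nonnegative; equality of
  energy drop and length says that its integral is 0.\<close>

lemma curve_contact:
  assumes eq: "ereal (E t (\<theta> a) - E t (\<theta> b)) = enn2ereal (finsler_length p DE t a b \<theta>)"
  shows "AE r in lborel. r \<in> {a<..<b} \<longrightarrow> p (h r) (W r) = blinfun_apply (W r) (h r)"
proof -
  have fin: "finsler_length p DE t a b \<theta> < \<infinity>"
    using eq by (metis ereal_infty_less(1) infinity_ennreal_def less_top enn2ereal_top ereal.distinct(1) PInfty_neq_ereal(1))
  note ab' = order_refl less_imp_le[OF ab] order_refl
  let ?q = "\<lambda>r. p (h r) (W r)" and ?w = "\<lambda>r. blinfun_apply (W r) (h r)"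
  note qi = curve_p_integrable[OF fin ab'] and wi = curve_pairing_integrable[OF ab']
  have nn: "0 \<le> (LINT r:{a..b}|lborel. ?q r)"
    unfolding set_lebesgue_integral_def by (intro integral_nonneg_AE) (auto simp: p_nonneg)
  have "E t (\<theta> a) - E t (\<theta> b) = (LINT r:{a..b}|lborel. ?q r)"
    using eq nn unfolding curve_length_LINT[OF fin ab'] by (simp add: enn2ereal_ennreal)
  then have "(LINT r:{a..b}|lborel. ?q r - ?w r) = 0"
    using curve_energy[OF ab'] by (simp add: set_integral_diff(2)[OF qi wi])
  then have "AE r in lborel. indicator {a..b} r *\<^sub>R (?q r - ?w r) = 0"
    using set_integral_diff(1)[OF qi wi] pairing_le_p unfolding set_lebesgue_integral_def set_integrable_def
    by (subst (asm) integral_nonneg_eq_0_iff_AE) (auto simp: indicator_def)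
  then show ?thesis by eventually_elim (auto simp: indicator_def)
qed

end

section \<open>The Finsler cost as an infimum of lengths\<close>

lemma cost_greatest:
  assumes "\<And>a b \<theta>. a < b \<Longrightarrow> abs_cont_on a b \<theta> \<Longrightarrow> \<theta> a = u0 \<Longrightarrow> \<theta> b = u1 \<Longrightarrow>
    finsler_length p DE t a b \<theta> < \<infinity> \<Longrightarrow> x \<le> finsler_length p DE t a b \<theta>"
  shows "x \<le> finsler_cost p DE t u0 u1"
  unfolding finsler_cost_def
proof (rule Inf_greatest)
  fix y assume "y \<in> {finsler_length p DE t r0 r1 \<theta> | r0 r1 \<theta>. r0 < r1 \<and> abs_cont_on r0 r1 \<theta> \<and> \<theta> r0 = u0 \<and> \<theta> r1 = u1}"
  then obtain a b \<theta> where y: "y = finsler_length p DE t a b \<theta>" "a < b" "abs_cont_on a b \<theta>" "\<theta> a = u0" "\<theta> b = u1"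
    by blast
  show "x \<le> y"
  proof (cases "finsler_length p DE t a b \<theta> < \<infinity>")
    case True
    then show ?thesis using assms y by blast
  next
    case False
    then have "y = top" using y(1) by (simp add: less_top[symmetric])
    then show ?thesis by simp
  qed
qed

lemma cost_le_length:
  "a < b \<Longrightarrow> abs_cont_on a b \<theta> \<Longrightarrow> finsler_cost p DE t (\<theta> a) (\<theta> b) \<le> finsler_length p DE t a b \<theta>"
  unfolding finsler_cost_def by (intro Inf_lower) blast

lemma energy_le_cost: "ennreal (E t u0 - E t u1) \<le> finsler_cost p DE t u0 u1"
proof (rule cost_greatest)
  fix a b \<theta> assume *: "a < b" "abs_cont_on a b \<theta>" "\<theta> a = u0" "\<theta> b = u1" "finsler_length p DE t a b \<theta> < \<infinity>"
  obtain h W where "curve_data a b \<theta> h W" using curve_data_exists[OF *(1,2)] by blast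
  from curve_energy_le_length[OF *(1) this, of a b] * show "ennreal (E t u0 - E t u1) \<le> finsler_length p DE t a b \<theta>"
    by simp
qed

text \<open>The potential dominates the gauge, hence a multiple of the norm of the velocity. So
  moving between different states has a positive cost.\<close>

lemma norm_le_cost:
  assumes c: "\<And>v. c * norm v \<le> \<Psi>0 v" "c > 0"
  shows "ennreal (c * norm (u1 - u0)) \<le> finsler_cost p DE t u0 u1"
proof (rule cost_greatest)
  fix a b \<theta> assume *: "a < b" "abs_cont_on a b \<theta>" "\<theta> a = u0" "\<theta> b = u1" "finsler_length p DE t a b \<theta> < \<infinity>"
  obtain h W where cd: "curve_data a b \<theta> h W" using curve_data_exists[OF *(1,2)] by blast
  have "c * norm (\<theta> b - \<theta> a) \<le> (LINT r:{a..b}|lborel. p (h r) (W r))"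
    by (rule curve_norm_le[OF *(1) cd *(5) _ _ _ c]) (use *(1) in auto)
  then show "ennreal (c * norm (u1 - u0)) \<le> finsler_length p DE t a b \<theta>"
    using curve_length_LINT[OF *(1) cd *(5), of a b] * by (simp add: ennreal_leI)
qed

lemma cost_refl: "finsler_cost p DE t x x = 0"
proof -
  have "abs_cont_on 0 1 (\<lambda>_::real. x)" by (auto simp: abs_cont_on_def intro: zero_less_one)
  then have "finsler_cost p DE t x x \<le> finsler_length p DE t 0 1 (\<lambda>_. x)"
    using cost_le_length[of 0 1 "\<lambda>_. x"] by simp
  also have "\<dots> = 0" by (simp add: finsler_length_def finsler_velocity_def vector_derivative_const_at p_zero)
  finally show ?thesis by simp
qed

text \<open>On both subintervals the drop is at most the length; as the two inequalities add up to
  an equality, each is an equality, and the cost lies between drop and length. The cases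
  \<open>r = 0\<close> and \<open>r = 1\<close> are separate because competitors live on
  nondegenerate intervals.\<close>

lemma cost_through_point:
  assumes eq: "ereal (E t (\<theta> 0) - E t (\<theta> 1)) = enn2ereal (finsler_length p DE t 0 1 \<theta>)"
    and ac: "abs_cont_on 0 1 \<theta>" and r: "r \<in> {0..1}"
  shows "finsler_cost p DE t (\<theta> 0) (\<theta> r) = ennreal (E t (\<theta> 0) - E t (\<theta> r))"
    and "finsler_cost p DE t (\<theta> r) (\<theta> 1) = ennreal (E t (\<theta> r) - E t (\<theta> 1))"
    and "E t (\<theta> r) \<le> E t (\<theta> 0)" and "E t (\<theta> 1) \<le> E t (\<theta> r)"
proof -
  obtain h W where cd: "curve_data 0 1 \<theta> h W" using curve_data_exists[OF _ ac] by auto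
  note cd' = zero_less_one cd
  have fin: "finsler_length p DE t 0 1 \<theta> < \<infinity>"
    using eq by (metis infinity_ennreal_def less_top enn2ereal_top ereal.distinct(1) infinity_ereal_def)
  define A where "A = (LINT s:{0..r}|lborel. p (h s) (W s))"
  define C where "C = (LINT s:{r..1}|lborel. p (h s) (W s))"
  have nn: "A \<ge> 0" "C \<ge> 0" unfolding A_def C_def set_lebesgue_integral_def
    by (intro integral_nonneg_AE; simp add: p_nonneg)+
  have LA: "finsler_length p DE t 0 r \<theta> = ennreal A" and LC: "finsler_length p DE t r 1 \<theta> = ennreal C"
    unfolding A_def C_def by (rule curve_length_LINT[OF cd' fin]; use r in simp)+
  have "finsler_length p DE t 0 1 \<theta> = ennreal A + ennreal C"
    using curve_length_add[OF cd', of 0 r 1] r LA LC by simp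
  then have sum: "E t (\<theta> 0) - E t (\<theta> 1) = A + C"
    using eq nn by (simp add: ennreal_plus[symmetric] enn2ereal_ennreal del: ennreal_plus)
  have le: "E t (\<theta> 0) - E t (\<theta> r) \<le> A" "E t (\<theta> r) - E t (\<theta> 1) \<le> C"
    unfolding A_def C_def by (rule curve_energy_le[OF cd' fin]; use r in simp)+
  then have eqs: "E t (\<theta> 0) - E t (\<theta> r) = A" "E t (\<theta> r) - E t (\<theta> 1) = C" using sum by linarith+
  then show "E t (\<theta> r) \<le> E t (\<theta> 0)" "E t (\<theta> 1) \<le> E t (\<theta> r)" using nn by linarith+
  have sub: "abs_cont_on x y \<theta>" if "0 \<le> x" "y \<le> 1" for x y
    using ac unfolding abs_cont_on_def by (meson order_trans that)
  show "finsler_cost p DE t (\<theta> 0) (\<theta> r) = ennreal (E t (\<theta> 0) - E t (\<theta> r))"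
  proof (cases "r = 0")
    case False
    then have "finsler_cost p DE t (\<theta> 0) (\<theta> r) \<le> ennreal A"
      using cost_le_length[of 0 r \<theta>] LA r sub[of 0 r] by simp
    then show ?thesis using energy_le_cost[of "\<theta> 0" "\<theta> r"] eqs by simp
  qed (simp add: cost_refl)
  show "finsler_cost p DE t (\<theta> r) (\<theta> 1) = ennreal (E t (\<theta> r) - E t (\<theta> 1))"
  proof (cases "r = 1")
    case False
    then have "finsler_cost p DE t (\<theta> r) (\<theta> 1) \<le> ennreal C"
      using cost_le_length[of r 1 \<theta>] LC r sub[of r 1] by simp
    then show ?thesis using energy_le_cost[of "\<theta> r" "\<theta> 1"] eqs by simp
  qed (simp add: cost_refl)
qed

section \<open>Existence of curves that attain the cost\<close>

text \<open>Parametrizing a curve by its normalized cost turns all integral estimates into pointwise ones,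
  which are inherited by uniform limits.\<close>

lemma reparametrize:
  assumes c: "\<And>v. c * norm v \<le> \<Psi>0 v" "c > 0"
    and ab: "a < b" and ac: "abs_cont_on a b \<theta>"
    and len: "finsler_length p DE t a b \<theta> = ennreal l" and l: "l > 0"
  shows "\<exists>\<eta>. \<eta> 0 = \<theta> a \<and> \<eta> 1 = \<theta> b \<and> (\<forall>\<sigma> \<tau>. 0 \<le> \<sigma> \<longrightarrow> \<sigma> < \<tau> \<longrightarrow> \<tau> \<le> 1 \<longrightarrow>
      c * norm (\<eta> \<tau> - \<eta> \<sigma>) \<le> l * (\<tau> - \<sigma>) \<and> E t (\<eta> \<sigma>) - E t (\<eta> \<tau>) \<le> l * (\<tau> - \<sigma>) \<and>
      (\<forall>w0 d. d > 0 \<longrightarrow> (\<forall>\<rho>\<in>{\<sigma>..\<tau>}. \<forall>v. d * p v w0 \<le> p v (- DE t (\<eta> \<rho>))) \<longrightarrow>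
         d * p (\<eta> \<tau> - \<eta> \<sigma>) w0 \<le> l * (\<tau> - \<sigma>)))"
proof -
  obtain h W where cd: "curve_data a b \<theta> h W" using curve_data_exists[OF ab ac] by blast
  have fin: "finsler_length p DE t a b \<theta> < \<infinity>" by (simp add: len)
  define q where "q r = p (h r) (W r)" for r
  define S where "S x = integral {a..x} q" for x
  have qint: "q integrable_on {x..y}" and q_eq: "(LINT r:{x..y}|lborel. p (h r) (W r)) = integral {x..y} q"
    if "a \<le> x" "x \<le> y" "y \<le> b" for x y
    using set_borel_integral_eq_integral[OF curve_p_integrable[OF ab cd fin that]]
    by (simp_all add: q_def[abs_def])
  have S_diff: "(LINT r:{x..y}|lborel. p (h r) (W r)) = S y - S x" if "a \<le> x" "x \<le> y" "y \<le> b" for x y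
    using Henstock_Kurzweil_Integration.integral_combine[OF that(1,2) qint[of a y]] that
    by (simp add: q_eq S_def)
  have S_mono: "S x \<le> S y" if "a \<le> x" "x \<le> y" "y \<le> b" for x y
  proof -
    have "0 \<le> (LINT r:{x..y}|lborel. p (h r) (W r))"
      unfolding set_lebesgue_integral_def by (intro integral_nonneg_AE) (simp add: p_nonneg)
    then show ?thesis using S_diff[OF that] by simp
  qed
  have Sa: "S a = 0" by (simp add: S_def)
  have Sb: "S b = l"
  proof -
    have "ennreal (S b) = ennreal l"
      using curve_length_LINT[OF ab cd fin, of a b] S_diff[of a b] ab len Sa by simp
    then show ?thesis using S_mono[of a b] ab Sa l by simp
  qed
  have S_cont: "continuous_on {a..b} S"
    unfolding S_def using ab by (intro indefinite_integral_continuous_1 qint) auto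
  \<comment> \<open>\<open>S\<close> may be constant on an interval, but there the curve stands
    still; so every choice of a preimage under \<open>S\<close> yields the same point.\<close>
  have same: "\<theta> x = \<theta> y" if "a \<le> x" "x \<le> b" "a \<le> y" "y \<le> b" "S x = S y" for x y
    using that
  proof (induction x y rule: linorder_wlog)
    case (le x y)
    then have "c * norm (\<theta> y - \<theta> x) \<le> 0"
      using curve_norm_le[OF ab cd fin _ _ _ c, of x y] S_diff[of x y] by simp
    then show ?case using c(2) by (simp add: mult_le_0_iff)
  qed auto
  have "\<exists>x. a \<le> x \<and> x \<le> b \<and> S x = l * \<sigma>" if "0 \<le> \<sigma>" "\<sigma> \<le> 1" for \<sigma>
    using IVT'[of S a "l * \<sigma>" b] S_cont ab that l Sa Sb by auto
  then obtain X where X: "\<And>\<sigma>. 0 \<le> \<sigma> \<Longrightarrow> \<sigma> \<le> 1 \<Longrightarrow> a \<le> X \<sigma> \<and> X \<sigma> \<le> b \<and> S (X \<sigma>) = l * \<sigma>" by metis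
  define \<eta> where "\<eta> \<sigma> = \<theta> (X \<sigma>)" for \<sigma>
  have "\<eta> 0 = \<theta> a" unfolding \<eta>_def using X[of 0] ab Sa by (intro same) auto
  moreover have "\<eta> 1 = \<theta> b" unfolding \<eta>_def using X[of 1] ab Sb by (intro same) auto
  moreover have "c * norm (\<eta> \<tau> - \<eta> \<sigma>) \<le> l * (\<tau> - \<sigma>) \<and> E t (\<eta> \<sigma>) - E t (\<eta> \<tau>) \<le> l * (\<tau> - \<sigma>) \<and>
      (\<forall>w0 d. d > 0 \<longrightarrow> (\<forall>\<rho>\<in>{\<sigma>..\<tau>}. \<forall>v. d * p v w0 \<le> p v (- DE t (\<eta> \<rho>))) \<longrightarrow>
         d * p (\<eta> \<tau> - \<eta> \<sigma>) w0 \<le> l * (\<tau> - \<sigma>))" if st: "0 \<le> \<sigma>" "\<sigma> < \<tau>" "\<tau> \<le> 1" for \<sigma> \<tau>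
  proof -
    note Xs = X[of \<sigma>] and Xt = X[of \<tau>]
    have lt: "X \<sigma> < X \<tau>"
    proof (rule ccontr)
      assume "\<not> X \<sigma> < X \<tau>"
      then have "l * \<tau> \<le> l * \<sigma>" using S_mono[of "X \<tau>" "X \<sigma>"] Xs Xt st by auto
      then show False using st l by simp
    qed
    have xy: "a \<le> X \<sigma>" "X \<sigma> \<le> X \<tau>" "X \<tau> \<le> b" using Xs Xt st lt by auto
    have val: "(LINT r:{X \<sigma>..X \<tau>}|lborel. p (h r) (W r)) = l * (\<tau> - \<sigma>)"
      using S_diff[OF xy] Xs Xt st by (simp add: algebra_simps)
    have 1: "c * norm (\<eta> \<tau> - \<eta> \<sigma>) \<le> l * (\<tau> - \<sigma>)"
      using curve_norm_le[OF ab cd fin xy c] by (simp add: val \<eta>_def)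
    have 2: "E t (\<eta> \<sigma>) - E t (\<eta> \<tau>) \<le> l * (\<tau> - \<sigma>)"
      using curve_energy_le[OF ab cd fin xy] by (simp add: val \<eta>_def)
    have 3: "d * p (\<eta> \<tau> - \<eta> \<sigma>) w0 \<le> l * (\<tau> - \<sigma>)"
      if d: "d > 0" and le: "\<And>\<rho> v. \<rho> \<in> {\<sigma>..\<tau>} \<Longrightarrow> d * p v w0 \<le> p v (- DE t (\<eta> \<rho>))" for w0 d
      unfolding val[symmetric] \<eta>_def
    proof (rule curve_frozen_le[OF ab cd fin xy _ d])
      fix r v assume r: "r \<in> {X \<sigma>..X \<tau>}"
      \<comment> \<open>The point \<open>\<theta> r\<close> is \<open>\<eta> \<rho>\<close>, so a
        lower bound on \<open>p\<close> assumed along \<open>\<eta>\<close> holds along the original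
        curve as well.\<close>
      define \<rho> where "\<rho> = S r / l"
      have "l * \<sigma> \<le> S r" "S r \<le> l * \<tau>"
        using S_mono[of "X \<sigma>" r] S_mono[of r "X \<tau>"] r xy Xs Xt st by auto
      then have \<rho>: "\<rho> \<in> {\<sigma>..\<tau>}" using l by (auto simp: \<rho>_def field_simps)
      then have "0 \<le> \<rho>" "\<rho> \<le> 1" using st by auto
      then have "a \<le> X \<rho> \<and> X \<rho> \<le> b \<and> S (X \<rho>) = S r" using X[of \<rho>] l by (simp add: \<rho>_def)
      then have "\<eta> \<rho> = \<theta> r" unfolding \<eta>_def using r xy by (intro same) auto
      then show "d * p v w0 \<le> p v (W r)" using le[OF \<rho>] curve_W[OF ab cd, of r] r xy by simp
    qed
    from 1 2 3 show ?thesis by blast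
  qed
  ultimately show ?thesis by blast
qed

text \<open>A pointwise description of the curves that are parametrized by the energy they release: the
  last clause says that their Finsler speed is at most \<^term>\<open>l\<close>, without mentioning derivatives.\<close>

definition calibrated :: "(real \<Rightarrow> 'a) \<Rightarrow> real \<Rightarrow> bool" where
  "calibrated \<eta> l \<longleftrightarrow>
     (\<exists>L. \<forall>\<sigma> \<tau>. 0 \<le> \<sigma> \<longrightarrow> \<sigma> \<le> \<tau> \<longrightarrow> \<tau> \<le> 1 \<longrightarrow> norm (\<eta> \<tau> - \<eta> \<sigma>) \<le> L * (\<tau> - \<sigma>)) \<and>
     (\<forall>\<sigma> \<tau>. 0 \<le> \<sigma> \<longrightarrow> \<sigma> \<le> \<tau> \<longrightarrow> \<tau> \<le> 1 \<longrightarrow> E t (\<eta> \<sigma>) - E t (\<eta> \<tau>) = l * (\<tau> - \<sigma>)) \<and>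
     (\<forall>\<alpha> d. 0 \<le> \<alpha> \<longrightarrow> \<alpha> < 1 \<longrightarrow> 0 < d \<longrightarrow> d < 1 \<longrightarrow>
        (\<exists>\<beta>>\<alpha>. \<forall>\<tau>. \<alpha> < \<tau> \<longrightarrow> \<tau> < \<beta> \<longrightarrow> \<tau> \<le> 1 \<longrightarrow> d * p (\<eta> \<tau> - \<eta> \<alpha>) (- DE t (\<eta> \<alpha>)) \<le> l * (\<tau> - \<alpha>)))"

lemma calibrated_exists:
  assumes cost: "finsler_cost p DE t u0 u1 \<le> ennreal (E t u0 - E t u1)" and ne: "u0 \<noteq> u1"
  shows "E t u0 - E t u1 > 0 \<and> (\<exists>\<eta>. calibrated \<eta> (E t u0 - E t u1) \<and> \<eta> 0 = u0 \<and> \<eta> 1 = u1)"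
proof -
  obtain c where c: "c > 0" "\<And>v. c * norm v \<le> \<Psi>0 v" using gauge_bounds by auto
  define l where "l = E t u0 - E t u1"
  \<comment> \<open>Truncation by \<open>ennreal\<close> is harmless: a negative drop would make the
    cost 0, against its positive lower bound.\<close>
  have "0 < ennreal (c * norm (u1 - u0))" using c ne by simp
  also have "\<dots> \<le> ennreal l" using norm_le_cost[OF c(2,1)] cost unfolding l_def by (rule order_trans)
  finally have l: "l > 0" by simp
  have "\<exists>a b \<theta>. a < b \<and> abs_cont_on a b \<theta> \<and> \<theta> a = u0 \<and> \<theta> b = u1 \<and>
      finsler_length p DE t a b \<theta> < ennreal (l + 1 / (real n + 1))" for n :: nat
  proof -
    have "finsler_cost p DE t u0 u1 < ennreal (l + 1 / (real n + 1))"
      using l by (intro le_less_trans[OF cost]) (simp add: l_def[symmetric] ennreal_less_iff)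
    then show ?thesis unfolding finsler_cost_def Inf_less_iff by blast
  qed
  then obtain a b \<theta> where \<theta>: "\<And>n. a n < b n" "\<And>n. abs_cont_on (a n) (b n) (\<theta> n)" "\<And>n. \<theta> n (a n) = u0"
      "\<And>n. \<theta> n (b n) = u1" "\<And>n::nat. finsler_length p DE t (a n) (b n) (\<theta> n) < ennreal (l + 1 / (real n + 1))"
    by metis
  have "\<exists>k. finsler_length p DE t (a n) (b n) (\<theta> n) = ennreal k \<and> l \<le> k \<and> k \<le> l + 1 / (real n + 1)" for n
  proof -
    have "finsler_length p DE t (a n) (b n) (\<theta> n) < \<infinity>" using \<theta>(5)[of n] by (rule less_trans) simp
    then obtain k where k: "k \<ge> 0" "finsler_length p DE t (a n) (b n) (\<theta> n) = ennreal k"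
      by (metis ennreal_enn2real enn2real_nonneg infinity_ennreal_def)
    have "finsler_cost p DE t u0 u1 \<le> ennreal k"
      using cost_le_length[OF \<theta>(1,2)[of n]] \<theta>(3,4)[of n] k by simp
    then have "ennreal l \<le> ennreal k" unfolding l_def by (rule order_trans[OF energy_le_cost])
    have "ennreal k < ennreal (l + 1 / (real n + 1))" using \<theta>(5)[of n] unfolding k(2) .
    then have "k < l + 1 / (real n + 1)" using ennreal_less_iff[OF k(1)] by blast
    moreover have "l \<le> k" using \<open>ennreal l \<le> ennreal k\<close> k(1) by simp
    ultimately show ?thesis using k(2) by (intro exI[of _ k]) simp
  qed
  then obtain k where k: "\<And>n. finsler_length p DE t (a n) (b n) (\<theta> n) = ennreal (k n)"
      "\<And>n. l \<le> k n" "\<And>n. k n \<le> l + 1 / (real n + 1)" by metis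
  have k_lim: "k \<longlonglongrightarrow> l"
  proof (rule tendsto_sandwich)
    show "\<forall>\<^sub>F n in sequentially. l \<le> k n" "\<forall>\<^sub>F n in sequentially. k n \<le> l + 1 / (real n + 1)"
      using k by (auto intro: always_eventually)
    have "(\<lambda>n. l + 1 / real (Suc n)) \<longlonglongrightarrow> l + 0"
      by (intro tendsto_add tendsto_const LIMSEQ_inverse_real_of_nat[unfolded inverse_eq_divide])
    then show "(\<lambda>n. l + 1 / (real n + 1)) \<longlonglongrightarrow> l" by (simp add: add.commute)
  qed simp
  have "k n > 0" for n using k(2)[of n] l by linarith
  then have "\<exists>\<eta>. \<eta> 0 = u0 \<and> \<eta> 1 = u1 \<and> (\<forall>\<sigma> \<tau>. 0 \<le> \<sigma> \<longrightarrow> \<sigma> < \<tau> \<longrightarrow> \<tau> \<le> 1 \<longrightarrow>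
      c * norm (\<eta> \<tau> - \<eta> \<sigma>) \<le> k n * (\<tau> - \<sigma>) \<and> E t (\<eta> \<sigma>) - E t (\<eta> \<tau>) \<le> k n * (\<tau> - \<sigma>) \<and>
      (\<forall>w0 d. d > 0 \<longrightarrow> (\<forall>\<rho>\<in>{\<sigma>..\<tau>}. \<forall>v. d * p v w0 \<le> p v (- DE t (\<eta> \<rho>))) \<longrightarrow>
         d * p (\<eta> \<tau> - \<eta> \<sigma>) w0 \<le> k n * (\<tau> - \<sigma>)))" for n
    using reparametrize[OF c(2,1) \<theta>(1,2) k(1)] \<theta>(3,4) by metis
  then obtain \<eta> where \<eta>0: "\<And>n. \<eta> n 0 = u0" and \<eta>1: "\<And>n. \<eta> n 1 = u1"
    and \<eta>: "\<And>n \<sigma> \<tau>. 0 \<le> \<sigma> \<Longrightarrow> \<sigma> < \<tau> \<Longrightarrow> \<tau> \<le> 1 \<Longrightarrow>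
      c * norm (\<eta> n \<tau> - \<eta> n \<sigma>) \<le> k n * (\<tau> - \<sigma>) \<and> E t (\<eta> n \<sigma>) - E t (\<eta> n \<tau>) \<le> k n * (\<tau> - \<sigma>) \<and>
      (\<forall>w0 d. d > 0 \<longrightarrow> (\<forall>\<rho>\<in>{\<sigma>..\<tau>}. \<forall>v. d * p v w0 \<le> p v (- DE t (\<eta> n \<rho>))) \<longrightarrow>
         d * p (\<eta> n \<tau> - \<eta> n \<sigma>) w0 \<le> k n * (\<tau> - \<sigma>))" by metis
  define L where "L = (l + 1) / c"
  have L: "L > 0" using l c by (simp add: L_def)
  have k1: "k n \<le> l + 1" for n using k(3)[of n] by (smt (verit) divide_le_eq_1 of_nat_0_le_iff)
  have Lip: "norm (\<eta> n \<tau> - \<eta> n \<sigma>) \<le> L * \<bar>\<tau> - \<sigma>\<bar>" if "\<sigma> \<in> {0..1}" "\<tau> \<in> {0..1}" for n \<sigma> \<tau>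
    using that
  proof (induction \<sigma> \<tau> rule: linorder_wlog)
    case (le \<sigma> \<tau>)
    show ?case
    proof (cases "\<sigma> = \<tau>")
      case False
      then have "c * norm (\<eta> n \<tau> - \<eta> n \<sigma>) \<le> k n * (\<tau> - \<sigma>)" using \<eta>[of \<sigma> \<tau> n] le by auto
      also have "\<dots> \<le> (l + 1) * (\<tau> - \<sigma>)" using k1 le by (intro mult_right_mono) auto
      finally show ?thesis using le c(1) by (simp add: L_def field_simps)
    qed simp
  qed (simp add: norm_minus_commute abs_minus_commute)
  obtain g s where g_cont: "continuous_on {0..1} g" and s: "strict_mono (s :: nat \<Rightarrow> nat)"
    and unif: "\<And>e. 0 < e \<Longrightarrow> \<exists>N. \<forall>n x. n \<ge> N \<and> x \<in> {0..1} \<longrightarrow> norm (\<eta> (s n) x - g x) < e"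
  proof (rule Arzela_Ascoli[of "{0..1::real}" \<eta> "norm u0 + L"])
    show "norm (\<eta> n x) \<le> norm u0 + L" if "x \<in> {0..1}" for n x
    proof -
      have "norm (\<eta> n x - \<eta> n 0) \<le> L * \<bar>x - 0\<bar>" using that by (intro Lip) auto
      also have "\<dots> \<le> L" using that L by (simp add: mult_left_le)
      finally show ?thesis using norm_triangle_sub[of "\<eta> n x" u0] by (simp add: \<eta>0)
    qed
    show "\<exists>d>0. \<forall>n y. y \<in> {0..1} \<and> norm (x - y) < d \<longrightarrow> norm (\<eta> n x - \<eta> n y) < e"
      if "x \<in> {0..1}" "0 < e" for x e
    proof (intro exI[of _ "e / L"] conjI allI impI)
      show "e / L > 0" using that L by simp
      fix n y assume y: "y \<in> {0..1} \<and> norm (x - y) < e / L"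
      have "norm (\<eta> n x - \<eta> n y) \<le> L * \<bar>x - y\<bar>" using y that by (intro Lip) auto
      also have "\<dots> < e" using y L by (simp add: field_simps)
      finally show "norm (\<eta> n x - \<eta> n y) < e" .
    qed
  qed auto
  have lim: "(\<lambda>n. \<eta> (s n) x) \<longlonglongrightarrow> g x" if "x \<in> {0..1}" for x
    using unif that unfolding LIMSEQ_def dist_norm by meson
  have ks: "(\<lambda>n. k (s n)) \<longlonglongrightarrow> l" using LIMSEQ_subseq_LIMSEQ[OF k_lim s] by (simp add: comp_def)
  have g0: "g 0 = u0" and g1: "g 1 = u1"
    using lim[of 0] lim[of 1] by (simp_all add: \<eta>0 \<eta>1 LIMSEQ_const_iff)
  have g_norm: "c * norm (g \<tau> - g \<sigma>) \<le> l * (\<tau> - \<sigma>)" if st: "0 \<le> \<sigma>" "\<sigma> < \<tau>" "\<tau> \<le> 1" for \<sigma> \<tau>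
  proof (rule LIMSEQ_le)
    show "(\<lambda>n. c * norm (\<eta> (s n) \<tau> - \<eta> (s n) \<sigma>)) \<longlonglongrightarrow> c * norm (g \<tau> - g \<sigma>)"
      using st by (intro tendsto_intros lim) auto
    show "(\<lambda>n. k (s n) * (\<tau> - \<sigma>)) \<longlonglongrightarrow> l * (\<tau> - \<sigma>)" by (intro tendsto_intros ks)
  qed (use \<eta>[OF st] in blast)
  have g_le: "E t (g \<sigma>) - E t (g \<tau>) \<le> l * (\<tau> - \<sigma>)" if st: "0 \<le> \<sigma>" "\<sigma> \<le> \<tau>" "\<tau> \<le> 1" for \<sigma> \<tau>
  proof (cases "\<sigma> = \<tau>")
    case False
    then have st: "0 \<le> \<sigma>" "\<sigma> < \<tau>" "\<tau> \<le> 1" using that by auto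
    show ?thesis
    proof (rule LIMSEQ_le)
      have "(\<lambda>n. E t (\<eta> (s n) x)) \<longlonglongrightarrow> E t (g x)" if "x \<in> {0..1}" for x
        using E_cont continuous_on_tendsto_compose[OF E_cont lim[OF that]] by simp
      then show "(\<lambda>n. E t (\<eta> (s n) \<sigma>) - E t (\<eta> (s n) \<tau>)) \<longlonglongrightarrow> E t (g \<sigma>) - E t (g \<tau>)"
        using st by (intro tendsto_diff) auto
      show "(\<lambda>n. k (s n) * (\<tau> - \<sigma>)) \<longlonglongrightarrow> l * (\<tau> - \<sigma>)" by (intro tendsto_intros ks)
    qed (use \<eta>[OF st] in blast)
  qed simp
  have g_eq: "E t (g \<sigma>) - E t (g \<tau>) = l * (\<tau> - \<sigma>)" if st: "0 \<le> \<sigma>" "\<sigma> \<le> \<tau>" "\<tau> \<le> 1" for \<sigma> \<tau>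
  proof -
    have "E t (g 0) - E t (g \<sigma>) \<le> l * \<sigma>" "E t (g \<tau>) - E t (g 1) \<le> l * (1 - \<tau>)"
      using g_le[of 0 \<sigma>] g_le[of \<tau> 1] st by auto
    moreover have "E t (g 0) - E t (g 1) = l" by (simp add: g0 g1 l_def)
    moreover have "l * \<sigma> + l * (\<tau> - \<sigma>) + l * (1 - \<tau>) = l" by (simp add: algebra_simps)
    ultimately show ?thesis using g_le[OF st] by linarith
  qed
  have g_p: "\<exists>\<beta>>\<alpha>. \<forall>\<tau>. \<alpha> < \<tau> \<longrightarrow> \<tau> < \<beta> \<longrightarrow> \<tau> \<le> 1 \<longrightarrow> d * p (g \<tau> - g \<alpha>) (- DE t (g \<alpha>)) \<le> l * (\<tau> - \<alpha>)"
    if \<alpha>: "0 \<le> \<alpha>" "\<alpha> < 1" and d: "0 < d" "d < 1" for \<alpha> d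
  proof -
    let ?w = "- DE t (g \<alpha>)"
    obtain r where r: "r > 0" "\<And>w v. norm (w - ?w) < r \<Longrightarrow> d * p v ?w \<le> p v w"
      using p_lower_near[of "1 - d" ?w] d by auto
    have "isCont (DE t) (g \<alpha>)" using DE_cont by (simp add: continuous_on_eq_continuous_at)
    then obtain \<kappa> where \<kappa>: "\<kappa> > 0" "\<And>x. norm (x - g \<alpha>) < \<kappa> \<Longrightarrow> norm (DE t x - DE t (g \<alpha>)) < r"
      unfolding isCont_def LIM_def dist_norm using r(1) by (metis diff_self norm_zero)
    obtain N where N: "\<And>n x. n \<ge> N \<Longrightarrow> x \<in> {0..1} \<Longrightarrow> norm (\<eta> (s n) x - g x) < \<kappa> / 2"
      using unif[of "\<kappa> / 2"] \<kappa>(1) by auto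
    \<comment> \<open>Within this time the limit curve, of speed at most \<open>l / c\<close>, moves
      by less than \<open>\<kappa> / 2\<close>; the approximants add another
      \<open>\<kappa> / 2\<close>, so their dual values stay in the ball of radius
      \<open>r\<close>.\<close>
    show ?thesis
    proof (intro exI[of _ "\<alpha> + \<kappa> * c / (2 * l)"] conjI allI impI)
      show "\<alpha> < \<alpha> + \<kappa> * c / (2 * l)" using \<kappa>(1) c(1) l by simp
      fix \<tau> assume \<tau>: "\<alpha> < \<tau>" "\<tau> < \<alpha> + \<kappa> * c / (2 * l)" "\<tau> \<le> 1"
      have near: "d * p v ?w \<le> p v (- DE t (\<eta> (s n) \<rho>))" if n: "n \<ge> N" and \<rho>: "\<rho> \<in> {\<alpha>..\<tau>}" for n \<rho> v
      proof (rule r(2))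
        have "c * norm (g \<rho> - g \<alpha>) \<le> l * (\<rho> - \<alpha>)"
          using g_norm[of \<alpha> \<rho>] \<rho> \<tau> \<alpha> by (cases "\<alpha> = \<rho>") auto
        also have "\<dots> < l * (\<kappa> * c / (2 * l))" using \<rho> \<tau> l by (intro mult_strict_left_mono) auto
        finally have "norm (g \<rho> - g \<alpha>) < \<kappa> / 2" using l c(1) by (simp add: field_simps)
        moreover have "norm (\<eta> (s n) \<rho> - g \<rho>) < \<kappa> / 2" using N[OF n] \<rho> \<tau> \<alpha> by auto
        ultimately have "norm (\<eta> (s n) \<rho> - g \<alpha>) < \<kappa>"
          using norm_triangle_ineq[of "\<eta> (s n) \<rho> - g \<rho>" "g \<rho> - g \<alpha>"] by simp
        from \<kappa>(2)[OF this] show "norm (- DE t (\<eta> (s n) \<rho>) - ?w) < r" by (simp add: norm_minus_commute)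
      qed
      obtain C where C: "C > 0" "\<And>v. p v ?w \<le> C * norm v" using sublinear_bound[OF p_sublinear] by blast
      show "d * p (g \<tau> - g \<alpha>) ?w \<le> l * (\<tau> - \<alpha>)"
      proof (rule LIMSEQ_le)
        have "isCont (\<lambda>v. p v ?w) (g \<tau> - g \<alpha>)" by (rule sublinear_isCont[OF p_sublinear C(2)])
        moreover have "(\<lambda>n. \<eta> (s n) \<tau> - \<eta> (s n) \<alpha>) \<longlonglongrightarrow> g \<tau> - g \<alpha>"
          using \<tau> \<alpha> by (intro tendsto_diff lim) auto
        ultimately have "(\<lambda>n. p (\<eta> (s n) \<tau> - \<eta> (s n) \<alpha>) ?w) \<longlonglongrightarrow> p (g \<tau> - g \<alpha>) ?w"
          by (rule isCont_tendsto_compose)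
        then show "(\<lambda>n. d * p (\<eta> (s n) \<tau> - \<eta> (s n) \<alpha>) ?w) \<longlonglongrightarrow> d * p (g \<tau> - g \<alpha>) ?w"
          by (intro tendsto_intros)
        show "(\<lambda>n. k (s n) * (\<tau> - \<alpha>)) \<longlonglongrightarrow> l * (\<tau> - \<alpha>)" by (intro tendsto_intros ks)
        have "d * p (\<eta> (s n) \<tau> - \<eta> (s n) \<alpha>) ?w \<le> k (s n) * (\<tau> - \<alpha>)" if "n \<ge> N" for n
          using \<eta>[OF \<alpha>(1) \<tau>(1,3), of "s n"] d near[OF that] by blast
        then show "\<exists>N. \<forall>n\<ge>N. d * p (\<eta> (s n) \<tau> - \<eta> (s n) \<alpha>) ?w \<le> k (s n) * (\<tau> - \<alpha>)" by blast
      qed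
    qed
  qed
  have "norm (g \<tau> - g \<sigma>) \<le> (l / c) * (\<tau> - \<sigma>)" if "0 \<le> \<sigma>" "\<sigma> \<le> \<tau>" "\<tau> \<le> 1" for \<sigma> \<tau>
    using g_norm[of \<sigma> \<tau>] that c(1) by (cases "\<sigma> = \<tau>") (auto simp: field_simps)
  then have "calibrated g l" unfolding calibrated_def using g_eq g_p by blast
  then show ?thesis using l g0 g1 unfolding l_def by blast
qed

text \<open>With \<open>m\<close> strictly between the dual gauge and 1, the gap
  \<open>(1 - m) * \<Psi>0 v\<close> absorbs a perturbation of \<open>w\<close>, by the lower bound
  of the gauge. This openness later turns information at almost every time into information at every
  time.\<close>

lemma dual_gauge_lt_one:
  assumes "dual_gauge \<Psi>0 w < 1"
  shows "\<exists>k>0. \<forall>w'. norm (w' - w) < k \<longrightarrow> (\<forall>v. v \<noteq> 0 \<longrightarrow> blinfun_apply w' v < \<Psi>0 v)"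
proof -
  obtain c where c: "c > 0" "\<And>v. c * norm v \<le> \<Psi>0 v" using gauge_bounds by auto
  obtain m where m: "dual_gauge \<Psi>0 w < ereal m" "ereal m < 1" using ereal_dense2[OF assms] by blast
  have m1: "m < 1" using m(2) by simp
  have wm: "blinfun_apply w v \<le> m * \<Psi>0 v" if "v \<noteq> 0" for v
  proof -
    have "ereal (blinfun_apply w v / \<Psi>0 v) \<le> dual_gauge \<Psi>0 w"
      unfolding dual_gauge_def using that by (intro SUP_upper) simp
    then have "ereal (blinfun_apply w v / \<Psi>0 v) \<le> ereal m" using m(1) by (meson less_imp_le order_trans)
    then show ?thesis using gauge_pos[OF that] by (simp add: field_simps)
  qed
  have "blinfun_apply w' v < \<Psi>0 v" if w': "norm (w' - w) < (1 - m) * c" and v: "v \<noteq> 0" for w' v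
  proof -
    have "blinfun_apply w' v = blinfun_apply w v + blinfun_apply (w' - w) v" by (simp add: blinfun.diff_left)
    also have "blinfun_apply (w' - w) v \<le> norm (w' - w) * norm v" using norm_blinfun[of "w' - w" v] by simp
    also have "\<dots> < (1 - m) * c * norm v" using w' v by (intro mult_strict_right_mono) auto
    also have "\<dots> \<le> (1 - m) * \<Psi>0 v" using c(2)[of v] m1 by (simp add: mult.assoc)
    also have "blinfun_apply w v \<le> m * \<Psi>0 v" by (rule wm[OF v])
    finally show ?thesis by (simp add: algebra_simps)
  qed
  moreover have "(1 - m) * c > 0" using m1 c by simp
  ultimately show ?thesis by blast
qed

text \<open>Energy falls at rate \<open>l\<close>, so the pairing is \<open>l\<close> by the chain
  rule. Dividing the last clause of \<open>calibrated\<close> by the time step gives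
  \<open>d * p \<le> l\<close> for all \<open>d < 1\<close>, hence \<open>p \<le> l\<close>, and the
  pairing never exceeds \<open>p\<close>.\<close>

lemma calibrated_velocity:
  assumes cal: "calibrated \<eta> l" and \<alpha>: "0 < \<alpha>" "\<alpha> < 1" and v: "(\<eta> has_vector_derivative v) (at \<alpha>)"
  shows "p v (- DE t (\<eta> \<alpha>)) = l" "blinfun_apply (- DE t (\<eta> \<alpha>)) v = l"
proof -
  let ?w = "- DE t (\<eta> \<alpha>)"
  have "((E t \<circ> \<eta>) has_derivative (blinfun_apply (DE t (\<eta> \<alpha>)) \<circ> (\<lambda>x. x *\<^sub>R v))) (at \<alpha>)"
    using v unfolding has_vector_derivative_def by (intro diff_chain_at E_deriv)
  then have d1: "((\<lambda>x. E t (\<eta> x)) has_real_derivative blinfun_apply (DE t (\<eta> \<alpha>)) v) (at \<alpha>)"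
    unfolding has_field_derivative_def by (simp add: comp_def blinfun.scaleR_right mult_commute_abs)
  have "((\<lambda>x. E t (\<eta> 0) - l * x) has_real_derivative - l) (at \<alpha>)"
    by (auto intro!: derivative_eq_intros)
  then have "((\<lambda>x. E t (\<eta> x)) has_real_derivative - l) (at \<alpha>)"
  proof (rule has_field_derivative_transform_within_open[of _ _ _ "{0<..<1}"])
    fix x :: real assume "x \<in> {0<..<1}"
    then have "E t (\<eta> 0) - E t (\<eta> x) = l * (x - 0)" using cal unfolding calibrated_def by auto
    then show "E t (\<eta> 0) - l * x = E t (\<eta> x)" by simp
  qed (use \<alpha> in auto)
  then have "blinfun_apply (DE t (\<eta> \<alpha>)) v = - l" using d1 DERIV_unique by blast
  then show wv: "blinfun_apply ?w v = l" by (simp add: blinfun.minus_left)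
  obtain C where C: "C > 0" "\<And>v. p v ?w \<le> C * norm v" using sublinear_bound[OF p_sublinear] by blast
  have lim: "((\<lambda>\<tau>. p ((\<eta> \<tau> - \<eta> \<alpha>) /\<^sub>R (\<tau> - \<alpha>)) ?w) \<longlongrightarrow> p v ?w) (at_right \<alpha>)"
  proof -
    have "((\<lambda>\<tau>. (\<eta> \<tau> - \<eta> \<alpha>) /\<^sub>R (\<tau> - \<alpha>)) \<longlongrightarrow> v) (at \<alpha>)"
    proof -
      have "((\<lambda>\<tau>. ((\<eta> \<tau> - \<eta> \<alpha>) - (\<tau> - \<alpha>) *\<^sub>R v) /\<^sub>R norm (\<tau> - \<alpha>)) \<longlongrightarrow> 0) (at \<alpha>)"
        using v unfolding has_vector_derivative_def has_derivative_at_within by simp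
      then have "((\<lambda>\<tau>. norm (((\<eta> \<tau> - \<eta> \<alpha>) - (\<tau> - \<alpha>) *\<^sub>R v) /\<^sub>R norm (\<tau> - \<alpha>))) \<longlongrightarrow> 0) (at \<alpha>)"
        by (rule tendsto_norm_zero)
      then have "((\<lambda>\<tau>. norm ((\<eta> \<tau> - \<eta> \<alpha>) /\<^sub>R (\<tau> - \<alpha>) - v)) \<longlongrightarrow> 0) (at \<alpha>)"
      proof (rule Lim_transform_eventually)
        show "\<forall>\<^sub>F \<tau> in at \<alpha>. norm (((\<eta> \<tau> - \<eta> \<alpha>) - (\<tau> - \<alpha>) *\<^sub>R v) /\<^sub>R norm (\<tau> - \<alpha>)) = norm ((\<eta> \<tau> - \<eta> \<alpha>) /\<^sub>R (\<tau> - \<alpha>) - v)"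
          unfolding eventually_at_filter
        proof (intro always_eventually allI impI)
          fix \<tau> assume "\<tau> \<noteq> \<alpha>"
          then have "(\<eta> \<tau> - \<eta> \<alpha>) /\<^sub>R (\<tau> - \<alpha>) - v = ((\<eta> \<tau> - \<eta> \<alpha>) - (\<tau> - \<alpha>) *\<^sub>R v) /\<^sub>R (\<tau> - \<alpha>)"
            by (simp add: scaleR_right_diff_distrib)
          then show "norm (((\<eta> \<tau> - \<eta> \<alpha>) - (\<tau> - \<alpha>) *\<^sub>R v) /\<^sub>R norm (\<tau> - \<alpha>)) = norm ((\<eta> \<tau> - \<eta> \<alpha>) /\<^sub>R (\<tau> - \<alpha>) - v)"
            by simp
        qed
      qed
      then show ?thesis using Lim_null tendsto_norm_zero_iff by blast
    qed
    then have "((\<lambda>\<tau>. (\<eta> \<tau> - \<eta> \<alpha>) /\<^sub>R (\<tau> - \<alpha>)) \<longlongrightarrow> v) (at_right \<alpha>)"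
      by (rule tendsto_mono[rotated]) (simp add: at_le)
    then show ?thesis by (rule isCont_tendsto_compose[OF sublinear_isCont[OF p_sublinear C(2)]])
  qed
  have "d * p v ?w \<le> l" if d: "0 < d" "d < 1" for d
  proof -
    from cal \<alpha> d obtain \<beta> where \<beta>: "\<beta> > \<alpha>" "\<And>\<tau>. \<alpha> < \<tau> \<Longrightarrow> \<tau> < \<beta> \<Longrightarrow> \<tau> \<le> 1 \<Longrightarrow> d * p (\<eta> \<tau> - \<eta> \<alpha>) ?w \<le> l * (\<tau> - \<alpha>)"
      unfolding calibrated_def by (metis less_imp_le)
    show ?thesis
    proof (rule tendsto_upperbound)
      show "((\<lambda>\<tau>. d * p ((\<eta> \<tau> - \<eta> \<alpha>) /\<^sub>R (\<tau> - \<alpha>)) ?w) \<longlongrightarrow> d * p v ?w) (at_right \<alpha>)"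
        by (intro tendsto_intros lim)
      have "d * p ((\<eta> \<tau> - \<eta> \<alpha>) /\<^sub>R (\<tau> - \<alpha>)) ?w \<le> l" if \<tau>: "\<alpha> < \<tau>" "\<tau> < min \<beta> 1" for \<tau>
      proof -
        have "p ((\<eta> \<tau> - \<eta> \<alpha>) /\<^sub>R (\<tau> - \<alpha>)) ?w = (1 / (\<tau> - \<alpha>)) * p (\<eta> \<tau> - \<eta> \<alpha>) ?w"
          using sublinear_scale[OF p_sublinear, of "1 / (\<tau> - \<alpha>)" "\<eta> \<tau> - \<eta> \<alpha>" ?w] \<tau> by (simp add: inverse_eq_divide)
        then have "d * p ((\<eta> \<tau> - \<eta> \<alpha>) /\<^sub>R (\<tau> - \<alpha>)) ?w = (d * p (\<eta> \<tau> - \<eta> \<alpha>) ?w) / (\<tau> - \<alpha>)" by simp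
        also have "\<dots> \<le> l" using \<beta>(2)[of \<tau>] \<tau> by (simp add: pos_divide_le_eq)
        finally show ?thesis .
      qed
      then show "\<forall>\<^sub>F \<tau> in at_right \<alpha>. d * p ((\<eta> \<tau> - \<eta> \<alpha>) /\<^sub>R (\<tau> - \<alpha>)) ?w \<le> l"
        unfolding eventually_at_right[OF \<open>\<alpha> < 1\<close>] using \<beta>(1) \<alpha> by (intro exI[of _ "min \<beta> 1"]) auto
    qed simp
  qed
  then have "p v ?w \<le> l" using field_le_mult_one_interval[of "p v ?w" l] by blast
  then show "p v ?w = l" using pairing_le_p[of ?w v] wv by simp
qed

lemma calibrated_imp_transition:
  assumes cal: "calibrated \<eta> l" and l: "l > 0" and ends: "\<eta> 0 = u0" "\<eta> 1 = u1"
  shows "\<eta> \<in> normalized_transitions E DE \<Psi>0 p t u0 u1"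
proof -
  from cal obtain L where L: "\<And>\<sigma> \<tau>. 0 \<le> \<sigma> \<Longrightarrow> \<sigma> \<le> \<tau> \<Longrightarrow> \<tau> \<le> 1 \<Longrightarrow> norm (\<eta> \<tau> - \<eta> \<sigma>) \<le> L * (\<tau> - \<sigma>)"
    unfolding calibrated_def by blast
  have El: "E t u0 - E t u1 = l" using cal ends unfolding calibrated_def by (metis diff_zero mult.right_neutral order_refl zero_le_one)
  have ac: "abs_cont_on 0 1 \<eta>"
    unfolding abs_cont_on_def
  proof (intro allI impI)
    fix e :: real assume e: "e > 0"
    have "(\<Sum>i<n. norm (\<eta> (r i) - \<eta> (m i))) < e"
      if r: "\<forall>i<n. 0 \<le> m i \<and> m i \<le> r i \<and> r i \<le> 1" and sm: "(\<Sum>i<n. r i - m i) < e / (\<bar>L\<bar> + 1)" for n :: nat and m r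
    proof -
      have "norm (\<eta> (r i) - \<eta> (m i)) \<le> (\<bar>L\<bar> + 1) * (r i - m i)" if "i < n" for i
      proof (rule order_trans)
        show "norm (\<eta> (r i) - \<eta> (m i)) \<le> L * (r i - m i)" using r that by (intro L) auto
        show "L * (r i - m i) \<le> (\<bar>L\<bar> + 1) * (r i - m i)" using r that by (intro mult_right_mono) auto
      qed
      then have "(\<Sum>i<n. norm (\<eta> (r i) - \<eta> (m i))) \<le> (\<Sum>i<n. (\<bar>L\<bar> + 1) * (r i - m i))" by (intro sum_mono) auto
      also have "\<dots> = (\<bar>L\<bar> + 1) * (\<Sum>i<n. r i - m i)" by (simp add: sum_distrib_left)
      also have "\<dots> < (\<bar>L\<bar> + 1) * (e / (\<bar>L\<bar> + 1))" using sm by (intro mult_strict_left_mono) auto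
      also have "\<dots> = e" using nonzero_mult_div_cancel_left[of "\<bar>L\<bar> + 1" e] by (simp add: add_nonneg_eq_0_iff)
      finally show ?thesis .
    qed
    then show "\<exists>\<delta>>0. \<forall>(n::nat) l r. (\<forall>i<n. 0 \<le> l i \<and> l i \<le> r i \<and> r i \<le> 1) \<longrightarrow>
        disjoint_family_on (\<lambda>i. {l i<..<r i}) {..<n} \<longrightarrow> (\<Sum>i<n. r i - l i) < \<delta> \<longrightarrow>
        (\<Sum>i<n. norm (\<eta> (r i) - \<eta> (l i))) < e"
      using e by (intro exI[of _ "e / (\<bar>L\<bar> + 1)"]) (auto simp: add_nonneg_pos)
  qed
  obtain h where h: "AE r in lborel. r \<in> {0<..<1} \<longrightarrow> (\<eta> has_vector_derivative h r) (at r)"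
    using abs_cont_on_derivative[OF zero_less_one ac] by blast
  have good: "AE r in lborel. r \<in> {0<..<1} \<longrightarrow> vector_derivative \<eta> (at r) \<noteq> 0 \<and> finsler_velocity p DE t \<eta> r = l \<and>
      p (vector_derivative \<eta> (at r)) (- DE t (\<eta> r)) = blinfun_apply (- DE t (\<eta> r)) (vector_derivative \<eta> (at r))"
    using h
  proof eventually_elim
    case (elim r)
    show ?case
    proof
      assume r: "r \<in> {0<..<1}"
      then have hr: "(\<eta> has_vector_derivative h r) (at r)" using elim by blast
      note vel = calibrated_velocity[OF cal _ _ hr]
      have "h r \<noteq> 0" using vel(2) r l by force
      then show "vector_derivative \<eta> (at r) \<noteq> 0 \<and> finsler_velocity p DE t \<eta> r = l \<and>
        p (vector_derivative \<eta> (at r)) (- DE t (\<eta> r)) = blinfun_apply (- DE t (\<eta> r)) (vector_derivative \<eta> (at r))"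
        using vel r by (simp add: finsler_velocity_def vector_derivative_at[OF hr])
    qed
  qed
  have endpoints: "AE r in lborel. r \<noteq> 0 \<and> r \<noteq> (1::real)" using AE_lborel_singleton by auto
  have len: "finsler_length p DE t 0 1 \<eta> = ennreal l"
  proof -
    have "finsler_length p DE t 0 1 \<eta> = (\<integral>\<^sup>+r. ennreal l * indicator {0..1::real} r \<partial>lborel)"
      unfolding finsler_length_def
      by (rule nn_integral_cong_AE) (use good endpoints in \<open>eventually_elim, auto simp: indicator_def\<close>)
    also have "\<dots> = ennreal l" by (simp add: nn_integral_cmult)
    finally show ?thesis .
  qed
  have cost: "finsler_cost p DE t u0 u1 = ennreal l"
    using cost_le_length[OF zero_less_one ac] energy_le_cost[of u0 u1] by (simp add: ends len El)
  have cont: "continuous_on {0..1} \<eta>"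
  proof (rule continuous_onI)
    fix x e :: real assume x: "x \<in> {0..1}" and e: "e > 0"
    have "dist (\<eta> y) (\<eta> x) \<le> e" if y: "y \<in> {0..1}" "dist y x < e / (\<bar>L\<bar> + 1)" for y
    proof -
      have "norm (\<eta> y - \<eta> x) \<le> \<bar>L\<bar> * \<bar>y - x\<bar>"
      proof (rule order_trans)
        show "norm (\<eta> y - \<eta> x) \<le> L * \<bar>y - x\<bar>"
          using L[of x y] L[of y x] x y by (cases "x \<le> y") (auto simp: norm_minus_commute)
        show "L * \<bar>y - x\<bar> \<le> \<bar>L\<bar> * \<bar>y - x\<bar>" by (intro mult_right_mono) auto
      qed
      also have "\<dots> \<le> (\<bar>L\<bar> + 1) * \<bar>y - x\<bar>" by (intro mult_right_mono) auto
      also have "\<dots> \<le> (\<bar>L\<bar> + 1) * (e / (\<bar>L\<bar> + 1))" using y by (intro mult_left_mono) (auto simp: dist_real_def)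
      also have "\<dots> = e" using nonzero_mult_div_cancel_left[of "\<bar>L\<bar> + 1" e] by (simp add: add_nonneg_eq_0_iff)
      finally show ?thesis by (simp add: dist_norm)
    qed
    then show "\<exists>d>0. \<forall>x'\<in>{0..1}. dist x' x < d \<longrightarrow> dist (\<eta> x') (\<eta> x) \<le> e"
      using e by (intro exI[of _ "e / (\<bar>L\<bar> + 1)"]) (auto simp: add_nonneg_pos)
  qed
  \<comment> \<open>Contact forces the pairing to reach the gauge at almost every time. A dual gauge
    below 1 at \<open>r\<close> would give the strict opposite inequality, for all nonzero
    velocities, on an interval around \<open>r\<close>.\<close>
  have dual: "dual_gauge \<Psi>0 (- DE t (\<eta> r)) \<ge> 1" if r: "r \<in> {0..1}" for r
  proof (rule ccontr)
    assume "\<not> ?thesis"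
    then obtain k where k: "k > 0" "\<And>w' v. norm (w' - - DE t (\<eta> r)) < k \<Longrightarrow> v \<noteq> 0 \<Longrightarrow> blinfun_apply w' v < \<Psi>0 v"
      using dual_gauge_lt_one[of "- DE t (\<eta> r)"] by (auto simp: not_le)
    have "continuous_on {0..1} (\<lambda>x. - DE t (\<eta> x))"
      by (intro continuous_on_minus continuous_on_compose2[OF DE_cont cont]) auto
    then obtain d where d: "d > 0" "\<And>x. x \<in> {0..1} \<Longrightarrow> dist x r < d \<Longrightarrow> dist (- DE t (\<eta> x)) (- DE t (\<eta> r)) < k"
      using r k(1) unfolding continuous_on_iff by meson
    obtain x where x: "x \<in> {max 0 (r - d)<..<min 1 (r + d)}" and
      px: "vector_derivative \<eta> (at x) \<noteq> 0 \<and> p (vector_derivative \<eta> (at x)) (- DE t (\<eta> x)) = blinfun_apply (- DE t (\<eta> x)) (vector_derivative \<eta> (at x))"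
    proof -
      have "\<exists>x\<in>{max 0 (r - d)<..<min 1 (r + d)}. vector_derivative \<eta> (at x) \<noteq> 0 \<and> p (vector_derivative \<eta> (at x)) (- DE t (\<eta> x)) = blinfun_apply (- DE t (\<eta> x)) (vector_derivative \<eta> (at x))"
        by (rule AE_lborel_exists_in_interval) (use good r d in \<open>auto elim!: eventually_mono\<close>)
      then show thesis using that by blast
    qed
    have "norm (- DE t (\<eta> x) - - DE t (\<eta> r)) < k"
      using d(2)[of x] x unfolding dist_norm by (auto simp: abs_less_iff)
    then have "blinfun_apply (- DE t (\<eta> x)) (vector_derivative \<eta> (at x)) < \<Psi>0 (vector_derivative \<eta> (at x))"
      using k(2) px by blast
    then show False using px gauge_le_p[of "vector_derivative \<eta> (at x)" "- DE t (\<eta> x)"] by linarith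
  qed
  have "AE r in lborel. r \<in> {0<..<1} \<longrightarrow> vector_derivative \<eta> (at r) \<noteq> 0"
    using good by eventually_elim blast
  moreover have "AE r in lborel. r \<in> {0<..<1} \<longrightarrow> finsler_velocity p DE t \<eta> r = E t u0 - E t u1"
    using good by eventually_elim (simp add: El)
  ultimately show ?thesis
    unfolding normalized_transitions_def optimal_transition_def
    using ac ends dual cost len l El by (simp add: enn2ereal_ennreal)
qed

text \<open>The break point \<open>s\<close> allots parameter length in proportion to the released
  energies, so that both legs run at the common rate \<open>l1 + l2\<close>.\<close>

lemma calibrated_concat:
  assumes c1: "calibrated \<eta>1 l1" "l1 > 0" and c2: "calibrated \<eta>2 l2" "l2 > 0" and mid: "\<eta>1 1 = \<eta>2 0"
  defines "s \<equiv> l1 / (l1 + l2)"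
  defines "\<theta> \<equiv> \<lambda>r. if r \<le> s then \<eta>1 (r / s) else \<eta>2 ((r - s) / (1 - s))"
  shows "calibrated \<theta> (l1 + l2)" "\<theta> 0 = \<eta>1 0" "\<theta> 1 = \<eta>2 1" "\<theta> s = \<eta>1 1" "0 < s" "s < 1"
proof -
  have s: "0 < s" "s < 1" using c1(2) c2(2) by (auto simp: s_def)
  then show "0 < s" "s < 1" by auto
  show "\<theta> 0 = \<eta>1 0" "\<theta> s = \<eta>1 1" "\<theta> 1 = \<eta>2 1" using s by (auto simp: \<theta>_def)
  have l1: "l1 / s = l1 + l2" and l2: "l2 / (1 - s) = l1 + l2"
    using c1(2) c2(2) by (auto simp: s_def field_simps)
  have left: "\<theta> r = \<eta>1 (r / s)" if "r \<le> s" for r using that by (simp add: \<theta>_def)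
  have right: "\<theta> r = \<eta>2 ((r - s) / (1 - s))" if "s \<le> r" for r
    using that s mid by (cases "r = s") (auto simp: \<theta>_def)
  have bl: "0 \<le> r / s" "r / s \<le> 1" if "0 \<le> r" "r \<le> s" for r using that s by auto
  have br: "0 \<le> (r - s) / (1 - s)" "(r - s) / (1 - s) \<le> 1" if "s \<le> r" "r \<le> 1" for r using that s by auto
  obtain L1 where L1: "\<And>\<sigma> \<tau>. 0 \<le> \<sigma> \<Longrightarrow> \<sigma> \<le> \<tau> \<Longrightarrow> \<tau> \<le> 1 \<Longrightarrow> norm (\<eta>1 \<tau> - \<eta>1 \<sigma>) \<le> L1 * (\<tau> - \<sigma>)"
    using c1 unfolding calibrated_def by blast
  obtain L2 where L2: "\<And>\<sigma> \<tau>. 0 \<le> \<sigma> \<Longrightarrow> \<sigma> \<le> \<tau> \<Longrightarrow> \<tau> \<le> 1 \<Longrightarrow> norm (\<eta>2 \<tau> - \<eta>2 \<sigma>) \<le> L2 * (\<tau> - \<sigma>)"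
    using c2 unfolding calibrated_def by blast
  have E1: "E t (\<eta>1 \<sigma>) - E t (\<eta>1 \<tau>) = l1 * (\<tau> - \<sigma>)" if "0 \<le> \<sigma>" "\<sigma> \<le> \<tau>" "\<tau> \<le> 1" for \<sigma> \<tau>
    using c1 that unfolding calibrated_def by blast
  have E2: "E t (\<eta>2 \<sigma>) - E t (\<eta>2 \<tau>) = l2 * (\<tau> - \<sigma>)" if "0 \<le> \<sigma>" "\<sigma> \<le> \<tau>" "\<tau> \<le> 1" for \<sigma> \<tau>
    using c2 that unfolding calibrated_def by blast
  define L where "L = max (L1 / s) (L2 / (1 - s))"
  have nl: "norm (\<theta> \<tau> - \<theta> \<sigma>) \<le> L * (\<tau> - \<sigma>)" if st: "0 \<le> \<sigma>" "\<sigma> \<le> \<tau>" "\<tau> \<le> s" for \<sigma> \<tau>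
  proof -
    have "norm (\<theta> \<tau> - \<theta> \<sigma>) \<le> L1 * (\<tau> / s - \<sigma> / s)"
      using L1[of "\<sigma> / s" "\<tau> / s"] bl[of \<sigma>] bl[of \<tau>] st s left[of \<sigma>] left[of \<tau>] by (simp add: divide_right_mono)
    also have "\<dots> = (L1 / s) * (\<tau> - \<sigma>)" by (simp add: field_simps diff_divide_distrib)
    also have "\<dots> \<le> L * (\<tau> - \<sigma>)" using st by (intro mult_right_mono) (auto simp: L_def)
    finally show ?thesis .
  qed
  have nr: "norm (\<theta> \<tau> - \<theta> \<sigma>) \<le> L * (\<tau> - \<sigma>)" if st: "s \<le> \<sigma>" "\<sigma> \<le> \<tau>" "\<tau> \<le> 1" for \<sigma> \<tau>
  proof -
    have "norm (\<theta> \<tau> - \<theta> \<sigma>) \<le> L2 * ((\<tau> - s) / (1 - s) - (\<sigma> - s) / (1 - s))"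
      using L2[of "(\<sigma> - s) / (1 - s)" "(\<tau> - s) / (1 - s)"] br[of \<sigma>] br[of \<tau>] st s right[of \<sigma>] right[of \<tau>]
      by (simp add: divide_right_mono)
    also have "\<dots> = (L2 / (1 - s)) * (\<tau> - \<sigma>)" by (simp add: diff_divide_distrib[symmetric])
    also have "\<dots> \<le> L * (\<tau> - \<sigma>)" using st by (intro mult_right_mono) (auto simp: L_def)
    finally show ?thesis .
  qed
  have el: "E t (\<theta> \<sigma>) - E t (\<theta> \<tau>) = (l1 + l2) * (\<tau> - \<sigma>)" if st: "0 \<le> \<sigma>" "\<sigma> \<le> \<tau>" "\<tau> \<le> s" for \<sigma> \<tau>
  proof -
    have "E t (\<theta> \<sigma>) - E t (\<theta> \<tau>) = l1 * (\<tau> / s - \<sigma> / s)"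
      using E1[of "\<sigma> / s" "\<tau> / s"] bl[of \<sigma>] bl[of \<tau>] st s left[of \<sigma>] left[of \<tau>] by (simp add: divide_right_mono)
    also have "\<dots> = (l1 / s) * (\<tau> - \<sigma>)" by (simp add: field_simps diff_divide_distrib)
    finally show ?thesis by (simp add: l1)
  qed
  have er: "E t (\<theta> \<sigma>) - E t (\<theta> \<tau>) = (l1 + l2) * (\<tau> - \<sigma>)" if st: "s \<le> \<sigma>" "\<sigma> \<le> \<tau>" "\<tau> \<le> 1" for \<sigma> \<tau>
  proof -
    have "E t (\<theta> \<sigma>) - E t (\<theta> \<tau>) = l2 * ((\<tau> - s) / (1 - s) - (\<sigma> - s) / (1 - s))"
      using E2[of "(\<sigma> - s) / (1 - s)" "(\<tau> - s) / (1 - s)"] br[of \<sigma>] br[of \<tau>] st s right[of \<sigma>] right[of \<tau>]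
      by (simp add: divide_right_mono)
    also have "\<dots> = (l2 / (1 - s)) * (\<tau> - \<sigma>)" by (simp add: diff_divide_distrib[symmetric])
    finally show ?thesis by (simp add: l2)
  qed
  have P1: "norm (\<theta> \<tau> - \<theta> \<sigma>) \<le> L * (\<tau> - \<sigma>)" if st: "0 \<le> \<sigma>" "\<sigma> \<le> \<tau>" "\<tau> \<le> 1" for \<sigma> \<tau>
  proof -
    consider "\<tau> \<le> s" | "s \<le> \<sigma>" | "\<sigma> \<le> s" "s \<le> \<tau>" by linarith
    then show ?thesis
    proof cases
      case 3
      then have "norm (\<theta> s - \<theta> \<sigma>) \<le> L * (s - \<sigma>)" "norm (\<theta> \<tau> - \<theta> s) \<le> L * (\<tau> - s)" using nl nr st s by auto
      moreover have "L * (\<tau> - \<sigma>) = L * (s - \<sigma>) + L * (\<tau> - s)" by (simp add: algebra_simps)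
      ultimately show ?thesis using norm_triangle_ineq[of "\<theta> s - \<theta> \<sigma>" "\<theta> \<tau> - \<theta> s"] by simp
    qed (use nl nr st in auto)
  qed
  have P2: "E t (\<theta> \<sigma>) - E t (\<theta> \<tau>) = (l1 + l2) * (\<tau> - \<sigma>)" if st: "0 \<le> \<sigma>" "\<sigma> \<le> \<tau>" "\<tau> \<le> 1" for \<sigma> \<tau>
  proof -
    consider "\<tau> \<le> s" | "s \<le> \<sigma>" | "\<sigma> \<le> s" "s \<le> \<tau>" by linarith
    then show ?thesis
    proof cases
      case 3
      then have "E t (\<theta> \<sigma>) - E t (\<theta> s) = (l1 + l2) * (s - \<sigma>)" "E t (\<theta> s) - E t (\<theta> \<tau>) = (l1 + l2) * (\<tau> - s)"
        using el er st s by auto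
      moreover have "(l1 + l2) * (\<tau> - \<sigma>) = (l1 + l2) * (s - \<sigma>) + (l1 + l2) * (\<tau> - s)" by (simp add: algebra_simps)
      ultimately show ?thesis by linarith
    qed (use el er st in auto)
  qed
  have P3: "\<exists>\<beta>>\<alpha>. \<forall>\<tau>. \<alpha> < \<tau> \<longrightarrow> \<tau> < \<beta> \<longrightarrow> \<tau> \<le> 1 \<longrightarrow> d * p (\<theta> \<tau> - \<theta> \<alpha>) (- DE t (\<theta> \<alpha>)) \<le> (l1 + l2) * (\<tau> - \<alpha>)"
    if \<alpha>: "0 \<le> \<alpha>" "\<alpha> < 1" and d: "0 < d" "d < 1" for \<alpha> d
  proof (cases "\<alpha> < s")
    case True
    then have "0 \<le> \<alpha> / s" "\<alpha> / s < 1" using \<alpha> s by auto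
    then obtain \<beta> where \<beta>: "\<beta> > \<alpha> / s" "\<And>\<tau>. \<alpha> / s < \<tau> \<Longrightarrow> \<tau> < \<beta> \<Longrightarrow> \<tau> \<le> 1 \<Longrightarrow>
        d * p (\<eta>1 \<tau> - \<eta>1 (\<alpha> / s)) (- DE t (\<eta>1 (\<alpha> / s))) \<le> l1 * (\<tau> - \<alpha> / s)"
      using c1(1) d unfolding calibrated_def by blast
    have "d * p (\<theta> \<tau> - \<theta> \<alpha>) (- DE t (\<theta> \<alpha>)) \<le> (l1 + l2) * (\<tau> - \<alpha>)" if \<tau>: "\<alpha> < \<tau>" "\<tau> < min s (s * \<beta>)" for \<tau>
    proof -
      have "d * p (\<theta> \<tau> - \<theta> \<alpha>) (- DE t (\<theta> \<alpha>)) \<le> l1 * (\<tau> / s - \<alpha> / s)"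
        using \<beta>(2)[of "\<tau> / s"] \<tau> s True left[of \<tau>] left[of \<alpha>] by (auto simp: divide_strict_right_mono field_simps)
      also have "\<dots> = (l1 / s) * (\<tau> - \<alpha>)" by (simp add: diff_divide_distrib right_diff_distrib)
      finally show ?thesis by (simp add: l1)
    qed
    moreover have "\<alpha> < min s (s * \<beta>)" using True \<beta>(1) s by (simp add: field_simps)
    ultimately show ?thesis by blast
  next
    \<comment> \<open>The last clause of \<open>calibrated\<close> looks forward and includes the
      initial parameter, so at \<open>\<alpha> = s\<close> it comes from the second leg
      alone.\<close>
    case False
    let ?f = "\<lambda>r. (r - s) / (1 - s)"
    have "0 \<le> ?f \<alpha>" "?f \<alpha> < 1" using False \<alpha> s by auto
    then obtain \<beta> where \<beta>: "\<beta> > ?f \<alpha>" "\<And>\<tau>. ?f \<alpha> < \<tau> \<Longrightarrow> \<tau> < \<beta> \<Longrightarrow> \<tau> \<le> 1 \<Longrightarrow>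
        d * p (\<eta>2 \<tau> - \<eta>2 (?f \<alpha>)) (- DE t (\<eta>2 (?f \<alpha>))) \<le> l2 * (\<tau> - ?f \<alpha>)"
      using c2(1) d unfolding calibrated_def by blast
    have "d * p (\<theta> \<tau> - \<theta> \<alpha>) (- DE t (\<theta> \<alpha>)) \<le> (l1 + l2) * (\<tau> - \<alpha>)" if \<tau>: "\<alpha> < \<tau>" "\<tau> < s + (1 - s) * \<beta>" "\<tau> \<le> 1" for \<tau>
    proof -
      have "?f \<alpha> < ?f \<tau>" using \<tau>(1) s by (simp add: divide_strict_right_mono)
      moreover have "?f \<tau> < \<beta>" using \<tau>(2) s by (simp add: field_simps)
      moreover have "?f \<tau> \<le> 1" using \<tau>(3) s by simp
      ultimately have "d * p (\<theta> \<tau> - \<theta> \<alpha>) (- DE t (\<theta> \<alpha>)) \<le> l2 * (?f \<tau> - ?f \<alpha>)"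
        using \<beta>(2)[of "?f \<tau>"] \<tau> False right[of \<tau>] right[of \<alpha>] by simp
      also have "\<dots> = (l2 / (1 - s)) * (\<tau> - \<alpha>)" by (simp add: diff_divide_distrib[symmetric])
      finally show ?thesis by (simp add: l2)
    qed
    moreover have "\<alpha> < s + (1 - s) * \<beta>" using \<beta>(1) s by (simp add: field_simps)
    ultimately show ?thesis by blast
  qed
  show "calibrated \<theta> (l1 + l2)" unfolding calibrated_def using P1 P2 P3 by blast
qed

text \<open>A leg with coinciding end points is dropped, since it would have rate 0 and a transition
  must have nonzero velocity almost everywhere; two legs are joined only if both move.\<close>

lemma transition_through_point:
  assumes c1: "finsler_cost p DE t u0 u \<le> ennreal (E t u0 - E t u)"
    and c2: "finsler_cost p DE t u u1 \<le> ennreal (E t u - E t u1)" and ne: "u0 \<noteq> u \<or> u \<noteq> u1"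
  shows "\<exists>\<theta>\<in>normalized_transitions E DE \<Psi>0 p t u0 u1. \<exists>r\<in>{0..1}. u = \<theta> r"
proof -
  have calm: "(\<exists>\<eta>. calibrated \<eta> (E t x - E t y) \<and> \<eta> 0 = x \<and> \<eta> 1 = y) \<and> E t x - E t y > 0"
    if "finsler_cost p DE t x y \<le> ennreal (E t x - E t y)" "x \<noteq> y" for x y
    using calibrated_exists[OF that] by blast
  consider "u0 = u" "u \<noteq> u1" | "u0 \<noteq> u" "u = u1" | "u0 \<noteq> u" "u \<noteq> u1" using ne by blast
  then show ?thesis
  proof cases
    case 1
    then obtain \<eta> where "calibrated \<eta> (E t u - E t u1)" "\<eta> 0 = u" "\<eta> 1 = u1" "E t u - E t u1 > 0"
      using calm[OF c2] by blast
    then show ?thesis using calibrated_imp_transition 1 by (metis atLeastAtMost_iff order_refl zero_le_one)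
  next
    case 2
    then obtain \<eta> where "calibrated \<eta> (E t u0 - E t u)" "\<eta> 0 = u0" "\<eta> 1 = u" "E t u0 - E t u > 0"
      using calm[OF c1] by blast
    then show ?thesis using calibrated_imp_transition 2 by (metis atLeastAtMost_iff order_refl zero_le_one)
  next
    case 3
    obtain \<eta>1 where \<eta>1: "calibrated \<eta>1 (E t u0 - E t u)" "\<eta>1 0 = u0" "\<eta>1 1 = u" "E t u0 - E t u > 0"
      using calm[OF c1] 3 by blast
    obtain \<eta>2 where \<eta>2: "calibrated \<eta>2 (E t u - E t u1)" "\<eta>2 0 = u" "\<eta>2 1 = u1" "E t u - E t u1 > 0"
      using calm[OF c2] 3 by blast
    have mid: "\<eta>1 1 = \<eta>2 0" using \<eta>1 \<eta>2 by simp
    note cc = calibrated_concat[OF \<eta>1(1,4) \<eta>2(1,4) mid]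
    let ?s = "(E t u0 - E t u) / ((E t u0 - E t u) + (E t u - E t u1))"
    let ?\<theta> = "\<lambda>r. if r \<le> ?s then \<eta>1 (r / ?s) else \<eta>2 ((r - ?s) / (1 - ?s))"
    have "?\<theta> \<in> normalized_transitions E DE \<Psi>0 p t u0 u1"
      by (rule calibrated_imp_transition[OF cc(1)]) (use cc(2,3) \<eta>1 \<eta>2 in auto)
    moreover have "u = ?\<theta> ?s" using cc(4) \<eta>1(3) by simp
    moreover have "?s \<in> {0..1}" using cc(5,6) by simp
    ultimately show ?thesis by (intro bexI[of _ ?\<theta>] bexI[of _ ?s])
  qed
qed

lemma optimal_transition_contact:
  assumes opt: "optimal_transition E DE \<Psi>0 p t um up 0 1 \<theta>"
  shows "AE r in lborel. r \<in> {0<..<1} \<longrightarrow> (vector_derivative \<theta> (at r), - DE t (\<theta> r)) \<in> contact_set p"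
proof -
  have ac: "abs_cont_on 0 1 \<theta>" and ends: "\<theta> 0 = um" "\<theta> 1 = up"
    and eq: "ereal (E t (\<theta> 0) - E t (\<theta> 1)) = enn2ereal (finsler_length p DE t 0 1 \<theta>)"
    using opt by (auto simp: optimal_transition_def)
  obtain h W where cd: "curve_data 0 1 \<theta> h W" using curve_data_exists[OF zero_less_one ac] by blast
  show ?thesis
    using curve_contact[OF zero_less_one cd eq] curve_deriv[OF zero_less_one cd]
    by eventually_elim (auto simp: contact_set_def vector_derivative_at curve_W[OF zero_less_one cd])
qed

end

section \<open>One-sided limits of functions with a monotone majorant\<close>

lemma clip_mono: "x \<le> y \<Longrightarrow> clip a b x \<le> clip a b y"
  and clip_id: "a \<le> x \<Longrightarrow> x \<le> b \<Longrightarrow> clip a b x = x"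
  and clip_range: "a \<le> b \<Longrightarrow> clip a b x \<in> {a..b}"
  by (auto simp: clip_def)

lemma clip_cont: "isCont (clip a b) x"
  unfolding clip_def by (intro continuous_intros)

text \<open>The limit of the monotone \<open>g\<close> is an infimum. The majorization makes
  \<open>w\<close> Cauchy along one sequence, and the resulting bound against
  \<open>\<bar>g z - m\<bar>\<close> extends the convergence to the whole filter.\<close>

lemma right_limits_exist:
  fixes g :: "real \<Rightarrow> real" and w :: "real \<Rightarrow> 'a::banach"
  assumes mono: "\<And>x y. x \<le> y \<Longrightarrow> g x \<le> g y" and k: "k > 0"
    and maj: "\<And>x y. x \<le> y \<Longrightarrow> norm (w y - w x) \<le> k * (g y - g x)"
  shows "\<exists>m l. (g \<longlongrightarrow> m) (at_right x) \<and> (w \<longlongrightarrow> l) (at_right x)"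
proof -
  define m where "m = (INF y\<in>{x<..}. g y)"
  have bdd: "bdd_below (g ` {x<..})" by (rule bdd_belowI2[of _ "g x"]) (auto intro: mono)
  have m_le: "m \<le> g y" if "x < y" for y unfolding m_def using that bdd by (intro cINF_lower) auto
  have near: "\<exists>y>x. g y < m + e" if "e > 0" for e
  proof -
    have "\<exists>y\<in>{x<..}. g y < m + e"
      unfolding m_def using that bdd by (subst cINF_less_iff[symmetric]) auto
    then show ?thesis by auto
  qed
  have gm: "(g \<longlongrightarrow> m) (at_right x)"
  proof (rule tendstoI)
    fix e :: real assume "e > 0"
    then obtain y where y: "y > x" "g y < m + e" using near by blast
    have "dist (g z) m < e" if "x < z" "z < y" for z
      using m_le[OF that(1)] mono[of z y] that y by (simp add: dist_real_def)
    then show "\<forall>\<^sub>F z in at_right x. dist (g z) m < e"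
      unfolding eventually_at_right[OF y(1)] using y(1) by blast
  qed
  define y where "y n = x + inverse (real (Suc n))" for n
  have y_gt: "x < y n" for n by (simp add: y_def)
  have y_lim: "filterlim y (at_right x) sequentially"
  proof -
    have "(\<lambda>n. x + inverse (real (Suc n))) \<longlonglongrightarrow> x + 0" by (intro tendsto_intros LIMSEQ_inverse_real_of_nat)
    then show ?thesis unfolding filterlim_at by (auto simp: y_def[abs_def] intro!: always_eventually)
  qed
  have gy: "(\<lambda>n. g (y n)) \<longlonglongrightarrow> m" by (rule filterlim_compose[OF gm y_lim])
  have close: "norm (w z - w z') \<le> k * \<bar>g z - g z'\<bar>" for z z'
    using maj[of z z'] maj[of z' z] mono[of z z'] mono[of z' z]
    by (cases "z \<le> z'") (auto simp: norm_minus_commute)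
  have "Cauchy (\<lambda>n. w (y n))"
    unfolding Cauchy_def
  proof (intro allI impI)
    fix e :: real assume "e > 0"
    then have "e / k > 0" using k by simp
    then obtain M where M: "\<And>m n. m \<ge> M \<Longrightarrow> n \<ge> M \<Longrightarrow> dist (g (y m)) (g (y n)) < e / k"
      using LIMSEQ_imp_Cauchy[OF gy] unfolding Cauchy_def by meson
    have "dist (w (y m)) (w (y n)) < e" if "m \<ge> M" "n \<ge> M" for m n
    proof -
      have "dist (w (y m)) (w (y n)) \<le> k * \<bar>g (y m) - g (y n)\<bar>" unfolding dist_norm by (rule close)
      also have "\<dots> < k * (e / k)" using M[OF that] k by (intro mult_strict_left_mono) (auto simp: dist_real_def)
      finally show ?thesis using k by simp
    qed
    then show "\<exists>M. \<forall>m\<ge>M. \<forall>n\<ge>M. dist (w (y m)) (w (y n)) < e" by blast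
  qed
  then obtain l where l: "(\<lambda>n. w (y n)) \<longlonglongrightarrow> l" using Cauchy_convergent_iff convergent_def by blast
  have wl: "norm (w z - l) \<le> k * \<bar>g z - m\<bar>" for z
  proof (rule LIMSEQ_le)
    show "(\<lambda>n. norm (w z - w (y n))) \<longlonglongrightarrow> norm (w z - l)" by (intro tendsto_intros l)
    show "(\<lambda>n. k * \<bar>g z - g (y n)\<bar>) \<longlonglongrightarrow> k * \<bar>g z - m\<bar>" by (intro tendsto_intros gy)
  qed (use close in blast)
  have "((\<lambda>z. w z - l) \<longlongrightarrow> 0) (at_right x)"
  proof (rule Lim_null_comparison)
    show "\<forall>\<^sub>F z in at_right x. norm (w z - l) \<le> k * \<bar>g z - m\<bar>" using wl by simp
    have "((\<lambda>z. k * \<bar>g z - m\<bar>) \<longlongrightarrow> k * \<bar>m - m\<bar>) (at_right x)" by (intro tendsto_intros gm)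
    then show "((\<lambda>z. k * \<bar>g z - m\<bar>) \<longlongrightarrow> 0) (at_right x)" by simp
  qed
  then have "(w \<longlongrightarrow> l) (at_right x)" by (rule LIM_zero_cancel)
  with gm show ?thesis by blast
qed

lemma left_limits_exist:
  fixes g :: "real \<Rightarrow> real" and w :: "real \<Rightarrow> 'a::banach"
  assumes mono: "\<And>x y. x \<le> y \<Longrightarrow> g x \<le> g y" and k: "k > 0"
    and maj: "\<And>x y. x \<le> y \<Longrightarrow> norm (w y - w x) \<le> k * (g y - g x)"
  shows "\<exists>m l. (g \<longlongrightarrow> m) (at_left x) \<and> (w \<longlongrightarrow> l) (at_left x)"
proof -
  have "\<exists>m l. ((\<lambda>z. - g (- z)) \<longlongrightarrow> m) (at_right (- x)) \<and> ((\<lambda>z. w (- z)) \<longlongrightarrow> l) (at_right (- x))"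
  proof (rule right_limits_exist[OF _ k])
    fix x y :: real assume "x \<le> y"
    then show "- g (- x) \<le> - g (- y)" using mono[of "- y" "- x"] by simp
    show "norm (w (- y) - w (- x)) \<le> k * (- g (- y) - - g (- x))"
      using maj[of "- y" "- x"] \<open>x \<le> y\<close> by (simp add: norm_minus_commute)
  qed
  then obtain m l where ml: "((\<lambda>z. - g (- z)) \<longlongrightarrow> m) (at_right (- x))" "((\<lambda>z. w (- z)) \<longlongrightarrow> l) (at_right (- x))"
    by blast
  have "((\<lambda>z. g (- z)) \<longlongrightarrow> - m) (at_right (- x))" using tendsto_minus[OF ml(1)] by simp
  then have "(g \<longlongrightarrow> - m) (at_left x)" unfolding at_left_minus[of x] by (simp add: filterlim_filtermap)
  moreover have "(w \<longlongrightarrow> l) (at_left x)" using ml(2) unfolding at_left_minus[of x] by (simp add: filterlim_filtermap)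
  ultimately show ?thesis by blast
qed

text \<open>Each coordinate is a difference of two monotone functions: a multiple of
  \<open>v\<close> plus the coordinate, and that multiple of \<open>v\<close>.\<close>

lemma (in coordinates) monotone_majorant_measurable:
  fixes u :: "real \<Rightarrow> 'a"
  assumes maj: "\<And>x y. a \<le> x \<Longrightarrow> x \<le> y \<Longrightarrow> y \<le> b \<Longrightarrow> norm (u y - u x) \<le> v y - v x"
  shows "(\<lambda>y. indicator {a..b} y *\<^sub>R u y) \<in> borel_measurable borel"
proof -
  have v: "mono_on {a..b} v"
    unfolding mono_on_def using maj by (smt (verit) atLeastAtMost_iff norm_ge_zero)
  have vm: "(\<lambda>y. indicator {a..b} y *\<^sub>R v y) \<in> borel_measurable borel"
    using borel_measurable_mono_on_fnc[OF v] by (subst (asm) borel_measurable_restrict_space_iff) auto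
  have cm: "(\<lambda>y. indicator {a..b} y *\<^sub>R coord c (u y)) \<in> borel_measurable borel" if c: "c \<in> B" for c
  proof -
    interpret bounded_linear "coord c" by (rule bounded_linear_coord[OF c])
    obtain k where k: "k > 0" "\<And>x. norm (coord c x) \<le> norm x * k" using pos_bounded by blast
    have "mono_on {a..b} (\<lambda>y. k * v y + coord c (u y))"
      unfolding mono_on_def
    proof (intro allI impI)
      fix x y assume xy: "x \<in> {a..b} \<and> y \<in> {a..b} \<and> x \<le> y"
      have "\<bar>coord c (u y) - coord c (u x)\<bar> \<le> norm (u y - u x) * k" using k(2)[of "u y - u x"] by (simp add: diff)
      also have "\<dots> \<le> (v y - v x) * k" using maj[of x y] xy k(1) by (intro mult_right_mono) auto
      finally show "k * v x + coord c (u x) \<le> k * v y + coord c (u y)" by (simp add: algebra_simps abs_le_iff)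
    qed
    from borel_measurable_mono_on_fnc[OF this]
    have "(\<lambda>y. indicator {a..b} y *\<^sub>R (k * v y + coord c (u y))) \<in> borel_measurable borel"
      by (subst (asm) borel_measurable_restrict_space_iff) auto
    then have "(\<lambda>y. indicator {a..b} y *\<^sub>R (k * v y + coord c (u y)) - k * (indicator {a..b} y *\<^sub>R v y)) \<in> borel_measurable borel"
      using vm by (intro borel_measurable_diff borel_measurable_times borel_measurable_const)
    moreover have "(\<lambda>y. indicator {a..b} y *\<^sub>R (k * v y + coord c (u y)) - k * (indicator {a..b} y *\<^sub>R v y)) =
        (\<lambda>y. indicator {a..b} y *\<^sub>R coord c (u y))"
      by (auto simp: fun_eq_iff algebra_simps)
    ultimately show ?thesis by simp
  qed
  have "(\<lambda>y. \<Sum>c\<in>B. (indicator {a..b} y *\<^sub>R coord c (u y)) *\<^sub>R c) \<in> borel_measurable borel"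
    by (intro borel_measurable_sum borel_measurable_scaleR[OF cm borel_measurable_const])
  moreover have "(\<lambda>y. \<Sum>c\<in>B. (indicator {a..b} y *\<^sub>R coord c (u y)) *\<^sub>R c) = (\<lambda>y. indicator {a..b} y *\<^sub>R u y)"
  proof
    fix y
    have "(\<Sum>c\<in>B. (indicator {a..b} y *\<^sub>R coord c (u y)) *\<^sub>R c) = indicator {a..b} y *\<^sub>R (\<Sum>c\<in>B. coord c (u y) *\<^sub>R c)"
      by (simp add: scaleR_sum_right)
    then show "(\<Sum>c\<in>B. (indicator {a..b} y *\<^sub>R coord c (u y)) *\<^sub>R c) = indicator {a..b} y *\<^sub>R u y"
      by (simp add: sum_coord)
  qed
  ultimately show ?thesis by simp
qed

section \<open>Sums of extended nonnegative reals\<close>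

lemma ennreal_infsum_insert_le:
  fixes f :: "'b \<Rightarrow> ennreal"
  assumes "X \<subseteq> Y" "s \<in> Y" "s \<notin> X"
  shows "infsum f X + f s \<le> infsum f Y"
proof -
  have "infsum f X + f s = (SUP F\<in>{F. finite F \<and> F \<subseteq> X}. sum f F + f s)"
    by (subst nonneg_infsum_complete) (auto simp: ennreal_SUP_add_left[symmetric] intro!: ennreal_SUP_add_left[symmetric])
  also have "\<dots> \<le> (SUP F\<in>{F. finite F \<and> F \<subseteq> Y}. sum f F)"
  proof (rule SUP_least)
    fix F assume F: "F \<in> {F. finite F \<and> F \<subseteq> X}"
    have "sum f F + f s = sum f (insert s F)" using F assms by (subst sum.insert) (auto simp: add.commute)
    also have "\<dots> \<le> (SUP F\<in>{F. finite F \<and> F \<subseteq> Y}. sum f F)" using F assms by (intro SUP_upper) auto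
    finally show "sum f F + f s \<le> (SUP F\<in>{F. finite F \<and> F \<subseteq> Y}. sum f F)" .
  qed
  also have "\<dots> = infsum f Y" by (subst nonneg_infsum_complete) auto
  finally show ?thesis .
qed

lemma ennreal_infsum_mono_set:
  fixes f :: "'b \<Rightarrow> ennreal"
  assumes "X \<subseteq> Y"
  shows "infsum f X \<le> infsum f Y"
  by (subst (1 2) nonneg_infsum_complete) (use assms in \<open>auto intro!: SUP_subset_mono\<close>)

text \<open>Finite partial sums are measures of finite subsets; an enumeration exhausts an infinite
  \<open>X\<close> by an increasing sequence of them.\<close>

lemma infsum_emeasure_singletons:
  assumes X: "countable X" and s: "\<And>x. x \<in> X \<Longrightarrow> {x} \<in> sets M"
  shows "(\<Sum>\<^sub>\<infinity>x\<in>X. emeasure M {x}) = emeasure M X"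
proof (rule antisym)
  have XM: "X \<in> sets M" using sets.countable[OF s X] .
  have fin: "(\<Sum>x\<in>F. emeasure M {x}) = emeasure M F" if "finite F" "F \<subseteq> X" for F
    using that s by (intro emeasure_eq_sum_singleton[symmetric]) auto
  have IS: "(\<Sum>\<^sub>\<infinity>x\<in>X. emeasure M {x}) = (SUP F\<in>{F. finite F \<and> F \<subseteq> X}. \<Sum>x\<in>F. emeasure M {x})"
    by (subst nonneg_infsum_complete) auto
  show "(\<Sum>\<^sub>\<infinity>x\<in>X. emeasure M {x}) \<le> emeasure M X"
    unfolding IS using fin XM by (intro SUP_least) (auto intro: emeasure_mono)
  show "emeasure M X \<le> (\<Sum>\<^sub>\<infinity>x\<in>X. emeasure M {x})"
  proof (cases "finite X")
    case True
    then show ?thesis using fin[of X] by simp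
  next
    case False
    have bij: "bij_betw (from_nat_into X) UNIV X" using X False by (rule bij_betw_from_nat_into)
    define A where "A n = from_nat_into X ` {..<n}" for n
    have A: "finite (A n)" "A n \<subseteq> X" for n using bij by (auto simp: A_def bij_betw_def)
    have AM: "A n \<in> sets M" for n
      by (rule sets.countable[OF s countable_finite[OF A(1)]]) (use A(2) in blast)
    have "X = (\<Union>n. A n)"
    proof
      show "X \<subseteq> (\<Union>n. A n)"
      proof
        fix x assume "x \<in> X"
        then obtain n where "x = from_nat_into X n" using bij unfolding bij_betw_def by blast
        then show "x \<in> (\<Union>n. A n)" by (intro UN_I[of "Suc n"]) (auto simp: A_def)
      qed
    qed (use A in blast)
    moreover have "(SUP n. emeasure M (A n)) = emeasure M (\<Union>n. A n)"
      using AM by (intro SUP_emeasure_incseq) (auto simp: incseq_def A_def)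
    moreover have "(SUP n. emeasure M (A n)) \<le> (\<Sum>\<^sub>\<infinity>x\<in>X. emeasure M {x})"
    proof (rule SUP_least)
      fix n
      show "emeasure M (A n) \<le> (\<Sum>\<^sub>\<infinity>x\<in>X. emeasure M {x})"
        unfolding IS fin[OF A, symmetric] using A by (intro SUP_upper) auto
    qed
    ultimately show ?thesis by simp
  qed
qed

section \<open>Local solutions\<close>

lemma gauge_var_append:
  assumes ab: "0 \<le> a" "a < b"
  shows "gauge_var \<Psi>0 u 0 a + ennreal (\<Psi>0 (u b - u a)) \<le> gauge_var \<Psi>0 u 0 b"
proof -
  define S where "S a = {\<Sum>m<M. ennreal (\<Psi>0 (u (s (Suc m)) - u (s m))) | (s :: nat \<Rightarrow> real) M.
            s 0 = 0 \<and> s M = a \<and> (\<forall>m<M. s m < s (Suc m))}" for a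
  have gv: "gauge_var \<Psi>0 u 0 a = Sup (S a)" for a by (simp add: gauge_var_def S_def)
  have ne: "S a \<noteq> {}"
  proof -
    define s :: "nat \<Rightarrow> real" where "s n = (if n = 0 then 0 else a)" for n
    \<comment> \<open>Partitions are strictly increasing, so for \<open>a = 0\<close> the partition
      has no step.\<close>
    define M :: nat where "M = (if a = 0 then 0 else 1)"
    have "s 0 = 0 \<and> s M = a \<and> (\<forall>m<M. s m < s (Suc m))" using ab by (auto simp: s_def M_def)
    then have "(\<Sum>m<M. ennreal (\<Psi>0 (u (s (Suc m)) - u (s m)))) \<in> S a" unfolding S_def by blast
    then show ?thesis by blast
  qed
  have "x + ennreal (\<Psi>0 (u b - u a)) \<le> Sup (S b)" if "x \<in> S a" for x
  proof -
    from that obtain s M where s: "x = (\<Sum>m<M. ennreal (\<Psi>0 (u (s (Suc m)) - u (s m))))" "s 0 = 0" "s M = a" "\<forall>m<M. s m < s (Suc m)"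
      unfolding S_def by blast
    define s' where "s' = s(Suc M := b)"
    have e1: "(\<Sum>m<Suc M. ennreal (\<Psi>0 (u (s' (Suc m)) - u (s' m)))) = x + ennreal (\<Psi>0 (u b - u a))"
      using s by (simp add: s'_def)
    have e2: "s' 0 = 0 \<and> s' (Suc M) = b \<and> (\<forall>m<Suc M. s' m < s' (Suc m))"
      using s ab by (auto simp: s'_def less_Suc_eq)
    have "x + ennreal (\<Psi>0 (u b - u a)) \<in> S b"
      unfolding S_def mem_Collect_eq e1[symmetric] using e2 by blast
    then show ?thesis by (rule Sup_upper)
  qed
  then have "(SUP x\<in>S a. x + ennreal (\<Psi>0 (u b - u a))) \<le> Sup (S b)" by (intro SUP_least)
  then show ?thesis unfolding gv using ennreal_SUP_add_left[OF ne, of "\<lambda>x. x"] by simp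
qed

lemma gauge_var_increment:
  assumes "a < b"
  shows "ennreal (\<Psi>0 (u b - u a)) \<le> gauge_var \<Psi>0 u a b"
  unfolding gauge_var_def
proof (rule Sup_upper, rule CollectI, intro exI conjI)
  let ?s = "\<lambda>n::nat. if n = 0 then a else b"
  show "ennreal (\<Psi>0 (u b - u a)) = (\<Sum>m<1. ennreal (\<Psi>0 (u (?s (Suc m)) - u (?s m))))" by simp
  show "?s 0 = a" "?s 1 = b" "\<forall>m<1. ?s m < ?s (Suc m)" using assms by auto
qed

locale local_setting = potentials B coord \<Psi>0 \<Psi>
  for B :: "'a::{banach, heine_borel, second_countable_topology} set" and coord \<Psi>0 \<Psi> +
  fixes T :: real and E dtE :: "real \<Rightarrow> 'a \<Rightarrow> real" and DE :: "real \<Rightarrow> 'a \<Rightarrow> ('a \<Rightarrow>\<^sub>L real)" and u :: "real \<Rightarrow> 'a"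
  assumes T_pos: "T > 0" and C1: "C1_energy T E dtE DE" and local_sol: "local_solution T E dtE DE \<Psi>0 u"
begin

section \<open>Regularity of the energy and integrability of the power\<close>

lemma E_joint: "t \<in> {0..T} \<Longrightarrow> ((\<lambda>(s, y). E s y) has_derivative
         (\<lambda>(\<tau>, h). \<tau> * dtE t x + blinfun_apply (DE t x) h)) (at (t, x) within {0..T} \<times> UNIV)"
  using C1 by (auto simp: C1_energy_def)

lemma dtE_cont: "continuous_on ({0..T} \<times> UNIV) (\<lambda>(t, x). dtE t x)"
  and DE_joint_cont: "continuous_on ({0..T} \<times> UNIV) (\<lambda>(t, x). DE t x)"
  using C1 by (auto simp: C1_energy_def)

lemma E_joint_cont: "continuous_on ({0..T} \<times> UNIV) (\<lambda>(t, x). E t x)"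
  unfolding continuous_on_eq_continuous_within
  using E_joint has_derivative_continuous by fast

lemma energy_slice: "t \<in> {0..T} \<Longrightarrow> energy_slice B coord \<Psi>0 \<Psi> E DE t"
proof unfold_locales
  fix x :: 'a assume t: "t \<in> {0..T}"
  have 1: "((\<lambda>y. (t, y)) has_derivative (\<lambda>h. (0, h))) (at x within UNIV)"
    by (auto intro!: derivative_eq_intros)
  have "((\<lambda>(s, y). E s y) has_derivative (\<lambda>(\<tau>, h). \<tau> * dtE t x + blinfun_apply (DE t x) h))
      (at (t, x) within (\<lambda>y. (t, y)) ` UNIV)"
    by (rule has_derivative_subset[OF E_joint[OF t]]) (use t in auto)
  from diff_chain_within[OF 1 this]
  show "(E t has_derivative blinfun_apply (DE t x)) (at x)" by (simp add: comp_def)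
next
  assume t: "t \<in> {0..T}"
  have "continuous_on UNIV (\<lambda>x::'a. (t, x))" by (intro continuous_intros)
  moreover have "range (\<lambda>x::'a. (t, x)) \<subseteq> {0..T} \<times> UNIV" using t by auto
  ultimately show "continuous_on UNIV (DE t)" using continuous_on_compose2[OF DE_joint_cont] by fastforce
qed

lemma E_time_deriv:
  assumes t: "t \<in> {0..T}"
  shows "((\<lambda>s. E s x) has_real_derivative dtE t x) (at t within {0..T})"
proof -
  have 1: "((\<lambda>s. (s, x)) has_derivative (\<lambda>h. (h, 0))) (at t within {0..T})"
    by (auto intro!: derivative_eq_intros)
  have "((\<lambda>(s, y). E s y) has_derivative (\<lambda>(\<tau>, h). \<tau> * dtE t x + blinfun_apply (DE t x) h))
      (at (t, x) within (\<lambda>s. (s, x)) ` {0..T})"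
    by (rule has_derivative_subset[OF E_joint[OF t]]) auto
  from diff_chain_within[OF 1 this]
  show ?thesis by (simp add: comp_def has_field_derivative_def mult_commute_abs)
qed

lemma BV: "BV_fun T \<Psi>0 u"
  and stable: "t \<in> {0..T} \<Longrightarrow> t \<notin> jump_set T u \<Longrightarrow> - DE t (u t) \<in> stable_set \<Psi>0"
  and local_ineq: "0 \<le> t0 \<Longrightarrow> t0 < t1 \<Longrightarrow> t1 \<le> T \<Longrightarrow> ereal (E t1 (u t1)) + enn2ereal (gauge_var \<Psi>0 u t0 t1)
          \<le> ereal (E t0 (u t0) + (LINT t:{t0..t1}|lborel. dtE t (u t)))"
  using local_sol by (auto simp: local_solution_def)

text \<open>The released energy majorizes \<open>u\<close> too, but handling it presupposes an
  integrable power, which rests on measurability and boundedness of \<open>u\<close>; so the first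
  majorant is the variation function.\<close>

lemma u_majorant: "\<exists>v. \<forall>x y. 0 \<le> x \<longrightarrow> x \<le> y \<longrightarrow> y \<le> T \<longrightarrow> norm (u y - u x) \<le> v y - v x"
proof -
  obtain c where c: "c > 0" "\<And>v. c * norm v \<le> \<Psi>0 v" using gauge_bounds by auto
  define V where "V t = gauge_var \<Psi>0 u 0 t" for t
  have step: "V x + ennreal (\<Psi>0 (u y - u x)) \<le> V y" if "0 \<le> x" "x < y" for x y
    unfolding V_def by (rule gauge_var_append[OF that])
  have "V T < \<infinity>" using BV by (simp add: V_def BV_fun_def)
  moreover have "V x \<le> V T" if "0 \<le> x" "x \<le> T" for x
  proof (cases "x = T")
    case False
    have "V x \<le> V x + ennreal (\<Psi>0 (u T - u x))" by simp
    also have "\<dots> \<le> V T" using that False by (intro step) auto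
    finally show ?thesis .
  qed simp
  ultimately have fin: "V x < \<infinity>" if "0 \<le> x" "x \<le> T" for x using that le_less_trans by blast
  have "norm (u y - u x) \<le> enn2real (V y) / c - enn2real (V x) / c" if xy: "0 \<le> x" "x \<le> y" "y \<le> T" for x y
  proof (cases "x = y")
    case False
    obtain a b where ab: "V x = ennreal a" "a \<ge> 0" "V y = ennreal b" "b \<ge> 0"
      using fin[of x] fin[of y] xy by (metis ennreal_enn2real enn2real_nonneg infinity_ennreal_def order_trans)
    have p0: "0 \<le> \<Psi>0 (u y - u x)" by (rule sublinear_nonneg[OF gauge_sublinear])
    have "ennreal (a + \<Psi>0 (u y - u x)) \<le> ennreal b"
      using step[of x y] xy False ab p0 by simp
    then have "a + \<Psi>0 (u y - u x) \<le> b" using ab by simp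
    then have "c * norm (u y - u x) \<le> b - a" using c(2)[of "u y - u x"] by linarith
    then show ?thesis using c(1) ab by (simp add: field_simps)
  qed simp
  then show ?thesis by (intro exI[of _ "\<lambda>x. enn2real (V x) / c"]) blast
qed

lemma u_measurable: "(\<lambda>y. indicator {0..T} y *\<^sub>R u y) \<in> borel_measurable borel"
proof -
  obtain v where "\<And>x y. 0 \<le> x \<Longrightarrow> x \<le> y \<Longrightarrow> y \<le> T \<Longrightarrow> norm (u y - u x) \<le> v y - v x" using u_majorant by blast
  then show ?thesis by (rule monotone_majorant_measurable)
qed

lemma power_integrable: "set_integrable lborel {0..T} (\<lambda>s. dtE s (u s))"
proof -
  obtain v where v: "\<And>x y. 0 \<le> x \<Longrightarrow> x \<le> y \<Longrightarrow> y \<le> T \<Longrightarrow> norm (u y - u x) \<le> v y - v x" using u_majorant by blast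
  define R where "R = norm (u 0) + (v T - v 0)"
  have uR: "norm (u s) \<le> R" if "s \<in> {0..T}" for s
  proof -
    have "norm (u s - u 0) \<le> v s - v 0" using v[of 0 s] that by simp
    moreover have "0 \<le> v T - v s" using v[of s T] that norm_ge_zero[of "u T - u s"] by (simp del: norm_ge_zero)
    ultimately show ?thesis using norm_triangle_sub[of "u s" "u 0"] by (simp add: R_def)
  qed
  have "compact ({0..T} \<times> cball (0::'a) R)"
    by (intro compact_Times) (auto simp: compact_eq_bounded_closed)
  then have "compact ((\<lambda>(t, x). dtE t x) ` ({0..T} \<times> cball 0 R))"
    by (intro compact_continuous_image continuous_on_subset[OF dtE_cont]) auto
  from compact_imp_bounded[OF this] obtain K where "\<forall>y\<in>(\<lambda>(t, x). dtE t x) ` ({0..T} \<times> cball 0 R). norm y \<le> K"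
    unfolding bounded_iff by blast
  then have K: "\<bar>dtE s x\<bar> \<le> K" if "s \<in> {0..T}" "norm x \<le> R" for s x
    using that by force
  \<comment> \<open>Clipping the time yields a function that is continuous on the whole product, so
    measurability of the composition follows from that of \<open>u\<close>.\<close>
  have gc: "continuous_on UNIV (\<lambda>z. dtE (clip 0 T (fst z)) (snd z))"
  proof -
    have "continuous_on UNIV (\<lambda>z::real \<times> 'a. (clip 0 T (fst z), snd z))"
      unfolding clip_def by (intro continuous_intros)
    moreover have "range (\<lambda>z::real \<times> 'a. (clip 0 T (fst z), snd z)) \<subseteq> {0..T} \<times> UNIV"
      using clip_range[of 0 T] T_pos by auto
    ultimately show ?thesis using continuous_on_compose2[OF dtE_cont] by fastforce
  qed
  have "(\<lambda>s. dtE (clip 0 T s) (indicator {0..T} s *\<^sub>R u s)) \<in> borel_measurable borel"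
    using borel_measurable_continuous_Pair[OF _ u_measurable, where H="\<lambda>s x. dtE (clip 0 T s) x" and f="\<lambda>s. s"] gc
    by simp
  then have m: "(\<lambda>s. indicator {0..T} s *\<^sub>R dtE (clip 0 T s) (indicator {0..T} s *\<^sub>R u s)) \<in> borel_measurable lborel"
    by (intro borel_measurable_scaleR) auto
  have eq: "(\<lambda>s. indicator {0..T} s *\<^sub>R dtE (clip 0 T s) (indicator {0..T} s *\<^sub>R u s)) = (\<lambda>s. indicator {0..T} s *\<^sub>R dtE s (u s))"
    by (auto simp: fun_eq_iff indicator_def clip_id)
  show ?thesis
    unfolding set_integrable_def
  proof (rule Bochner_Integration.integrable_bound)
    show "integrable lborel (\<lambda>s. indicator {0..T} s * K)" 
      by (rule integrable_mult_left, rule integrable_real_indicator) (use T_pos in auto)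
    show "(\<lambda>s. indicator {0..T} s *\<^sub>R dtE s (u s)) \<in> borel_measurable lborel" using m unfolding eq .
    show "AE s in lborel. norm (indicator {0..T} s *\<^sub>R dtE s (u s)) \<le> norm (indicator {0..T} s * K)"
    proof (rule AE_I2)
      fix s :: real
      show "norm (indicator {0..T} s *\<^sub>R dtE s (u s)) \<le> norm (indicator {0..T} s * K)"
      proof (cases "s \<in> {0..T}")
        case True
        then have "\<bar>dtE s (u s)\<bar> \<le> K" using K uR by blast
        then show ?thesis using True by simp
      qed simp
    qed
  qed
qed

section \<open>Released energy and its extension to the line\<close>

definition work :: "real \<Rightarrow> real" where "work t = (LINT s:{0..t}|lborel. dtE s (u s))"

text \<open>\<^term>\<open>released t\<close> is the energy that has been dissipated up to time \<^term>\<open>t\<close>.\<close>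

definition released :: "real \<Rightarrow> real" where "released t = E 0 (u 0) + work t - E t (u t)"

lemma power_integrable_on: "(\<lambda>s. dtE s (u s)) integrable_on {0..T}"
  using set_borel_integral_eq_integral(1)[OF power_integrable] .

lemma power_subset: "0 \<le> a \<Longrightarrow> b \<le> T \<Longrightarrow> set_integrable lborel {a..b} (\<lambda>s. dtE s (u s))"
  by (rule set_integrable_subset[OF power_integrable]) auto

lemma work_integral: "0 \<le> t \<Longrightarrow> t \<le> T \<Longrightarrow> work t = integral {0..t} (\<lambda>s. dtE s (u s))"
  unfolding work_def by (rule set_borel_integral_eq_integral(2)[OF power_subset]) auto

lemma work_diff:
  assumes "0 \<le> a" "a \<le> b" "b \<le> T"
  shows "work b - work a = (LINT s:{a..b}|lborel. dtE s (u s))"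
proof -
  have "integral {0..a} (\<lambda>s. dtE s (u s)) + integral {a..b} (\<lambda>s. dtE s (u s)) = integral {0..b} (\<lambda>s. dtE s (u s))"
    using assms by (intro Henstock_Kurzweil_Integration.integral_combine
      set_borel_integral_eq_integral(1)[OF power_subset]) auto
  then show ?thesis
    using work_integral[of a] work_integral[of b] set_borel_integral_eq_integral(2)[OF power_subset[of a b]] assms
    by simp
qed

lemma work_cont: "continuous_on {0..T} work"
proof -
  have "continuous_on {0..T} (\<lambda>t. integral {0..t} (\<lambda>s. dtE s (u s)))"
    by (rule indefinite_integral_continuous_1[OF power_integrable_on])
  then show ?thesis by (rule continuous_on_eq) (simp add: work_integral)
qed

lemma released_0: "released 0 = 0"
  using work_diff[of 0 0] T_pos by (simp add: released_def work_integral)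

text \<open>The variation over an interval dominates the one-step partition, so the local energy
  inequality bounds the gauge of the increment. This one estimate yields both monotonicity of
  \<open>released\<close> and a majorant for \<open>u\<close>.\<close>

lemma released_increment:
  assumes ab: "0 \<le> a" "a \<le> b" "b \<le> T"
  shows "\<Psi>0 (u b - u a) \<le> released b - released a"
proof (cases "a = b")
  case True
  then show ?thesis by (simp add: sublinear_zero[OF gauge_sublinear])
next
  case False
  then have lt: "a < b" using ab by simp
  have p0: "0 \<le> \<Psi>0 (u b - u a)" by (rule sublinear_nonneg[OF gauge_sublinear])
  have "ereal (\<Psi>0 (u b - u a)) = enn2ereal (ennreal (\<Psi>0 (u b - u a)))" using p0 by (simp add: enn2ereal_ennreal)
  also have "\<dots> \<le> enn2ereal (gauge_var \<Psi>0 u a b)" using gauge_var_increment[OF lt] by (simp add: less_eq_ennreal.rep_eq)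
  finally have "ereal (E b (u b)) + ereal (\<Psi>0 (u b - u a)) \<le> ereal (E b (u b)) + enn2ereal (gauge_var \<Psi>0 u a b)"
    by (rule add_left_mono)
  also have "\<dots> \<le> ereal (E a (u a) + (LINT t:{a..b}|lborel. dtE t (u t)))" using ab lt by (intro local_ineq) auto
  finally show ?thesis using work_diff[OF ab] by (simp add: released_def)
qed

text \<open>Constant extension beyond 0 and \<open>T\<close> makes the left limit of
  \<open>w\<close> at 0 equal to \<open>u 0\<close> and its right limit at \<open>T\<close> equal to
  \<open>u T\<close>, which are exactly the conventions of \<open>left_lim\<close> and
  \<open>right_lim\<close>.\<close>

definition g :: "real \<Rightarrow> real" where "g t = released (clip 0 T t)"
definition w :: "real \<Rightarrow> 'a" where "w t = u (clip 0 T t)"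

lemma g_eq: "0 \<le> t \<Longrightarrow> t \<le> T \<Longrightarrow> g t = released t" and w_eq: "0 \<le> t \<Longrightarrow> t \<le> T \<Longrightarrow> w t = u t"
  by (simp_all add: g_def w_def clip_id)

lemma w_majorant: "x \<le> y \<Longrightarrow> \<Psi>0 (w y - w x) \<le> g y - g x"
  unfolding g_def w_def using clip_range[of 0 T x] clip_range[of 0 T y] T_pos
  by (intro released_increment clip_mono) auto

lemma g_mono: "x \<le> y \<Longrightarrow> g x \<le> g y"
  using w_majorant[of x y] sublinear_nonneg[OF gauge_sublinear, of "w y - w x"] by linarith

lemma g_bounds: "0 \<le> g x" "g x \<le> released T"
proof -
  have c: "0 \<le> clip 0 T x" "clip 0 T x \<le> T" using clip_range[of 0 T x] T_pos by auto
  show "0 \<le> g x"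
    using released_increment[of 0 "clip 0 T x"] c sublinear_nonneg[OF gauge_sublinear]
    by (smt (verit) g_def released_0 order_refl)
  show "g x \<le> released T"
    using released_increment[of "clip 0 T x" T] c sublinear_nonneg[OF gauge_sublinear]
    by (smt (verit) g_def order_refl)
qed

definition c0 :: real where "c0 = (SOME c. c > 0 \<and> (\<forall>v. c * norm v \<le> \<Psi>0 v))"

lemma c0: "c0 > 0" "c0 * norm v \<le> \<Psi>0 v"
proof -
  have "\<exists>c. c > 0 \<and> (\<forall>v. c * norm v \<le> \<Psi>0 v)" using gauge_bounds by blast
  from someI_ex[OF this] show "c0 > 0" "c0 * norm v \<le> \<Psi>0 v" unfolding c0_def by blast+
qed

lemma norm_le_gauge: "norm v \<le> \<Psi>0 v / c0"
  using c0(2)[of v] c0(1) by (simp add: field_simps)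

lemma w_norm: "x \<le> y \<Longrightarrow> norm (w y - w x) \<le> (1 / c0) * (g y - g x)"
  using norm_le_gauge[of "w y - w x"] divide_right_mono[OF w_majorant, of x y c0] c0(1) by simp

section \<open>One-sided limits of the released energy and of the state\<close>

definition F :: "real \<Rightarrow> real" where "F x = Lim (at_right x) g"
definition Fl :: "real \<Rightarrow> real" where "Fl x = Lim (at_left x) g"
definition U :: "real \<Rightarrow> 'a" where "U x = Lim (at_right x) w"
definition Ul :: "real \<Rightarrow> 'a" where "Ul x = Lim (at_left x) w"

lemma lim_right: "(g \<longlongrightarrow> F x) (at_right x)" "(w \<longlongrightarrow> U x) (at_right x)"
proof -
  obtain m l where ml: "(g \<longlongrightarrow> m) (at_right x)" "(w \<longlongrightarrow> l) (at_right x)"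
    using right_limits_exist[of g "1 / c0" w x] g_mono w_norm c0(1) by auto
  have "F x = m" "U x = l" unfolding F_def U_def by (rule tendsto_Lim; simp add: ml)+
  then show "(g \<longlongrightarrow> F x) (at_right x)" "(w \<longlongrightarrow> U x) (at_right x)" using ml by simp_all
qed

lemma lim_left: "(g \<longlongrightarrow> Fl x) (at_left x)" "(w \<longlongrightarrow> Ul x) (at_left x)"
proof -
  obtain m l where ml: "(g \<longlongrightarrow> m) (at_left x)" "(w \<longlongrightarrow> l) (at_left x)"
    using left_limits_exist[of g "1 / c0" w x] g_mono w_norm c0(1) by auto
  have "Fl x = m" "Ul x = l" unfolding Fl_def Ul_def by (rule tendsto_Lim; simp add: ml)+
  then show "(g \<longlongrightarrow> Fl x) (at_left x)" "(w \<longlongrightarrow> Ul x) (at_left x)" using ml by simp_all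
qed

lemma g_le_F: "g x \<le> F x"
proof (rule tendsto_lowerbound[OF lim_right(1)])
  show "\<forall>\<^sub>F z in at_right x. g x \<le> g z"
    using eventually_at_right_less[of x] by eventually_elim (simp add: g_mono)
qed simp

lemma F_le_g: "x < y \<Longrightarrow> F x \<le> g y"
proof (rule tendsto_upperbound[OF lim_right(1)])
  assume "x < y"
  then show "\<forall>\<^sub>F z in at_right x. g z \<le> g y"
    unfolding eventually_at_right[OF \<open>x < y\<close>] by (intro exI[of _ y]) (auto intro: g_mono)
qed simp

lemma Fl_le_g: "Fl x \<le> g x"
proof (rule tendsto_upperbound[OF lim_left(1)])
  have "\<forall>\<^sub>F z::real in at_left x. z < x" by (simp add: eventually_at_filter)
  then show "\<forall>\<^sub>F z in at_left x. g z \<le> g x" by eventually_elim (simp add: g_mono)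
qed simp

lemma g_le_Fl: "y < x \<Longrightarrow> g y \<le> Fl x"
proof (rule tendsto_lowerbound[OF lim_left(1)])
  assume "y < x"
  then show "\<forall>\<^sub>F z in at_left x. g y \<le> g z"
    unfolding eventually_at_left[OF \<open>y < x\<close>] by (intro exI[of _ y]) (auto intro: g_mono)
qed simp

lemma F_le_Fl: "x < y \<Longrightarrow> F x \<le> Fl y"
  using F_le_g[of x "(x + y) / 2"] g_le_Fl[of "(x + y) / 2" y] by simp

lemma F_mono: "x \<le> y \<Longrightarrow> F x \<le> F y"
  using F_le_g[of x y] g_le_F[of y] by (cases "x = y") auto

lemma F_bounds: "0 \<le> F x" "F x \<le> released T"
  using g_bounds(1)[of x] g_le_F[of x] F_le_g[of x "x + 1"] g_bounds(2)[of "x + 1"] by linarith+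

lemma F_right_cont: "continuous (at_right x) F"
  unfolding continuous_within
proof (rule tendstoI)
  fix e :: real assume "e > 0"
  then have "\<forall>\<^sub>F z in at_right x. g z < F x + e" using lim_right(1)[of x] by (simp add: order_tendsto_iff)
  then obtain b where b: "b > x" "\<And>z. x < z \<Longrightarrow> z < b \<Longrightarrow> g z < F x + e"
    unfolding eventually_at_right[OF less_add_one] by blast
  have "dist (F y) (F x) < e" if y: "x < y" "y < b" for y
  proof -
    have "F y \<le> g ((y + b) / 2)" using y by (intro F_le_g) simp
    also have "\<dots> < F x + e" using y by (intro b(2)) auto
    finally show ?thesis using F_mono[of x y] y by (simp add: dist_real_def)
  qed
  then show "\<forall>\<^sub>F y in at_right x. dist (F y) (F x) < e"
    unfolding eventually_at_right[OF b(1)] using b(1) by blast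
qed

lemma F_left_lim: "(F \<longlongrightarrow> Fl x) (at_left x)"
proof (rule tendsto_sandwich[OF _ _ lim_left(1) tendsto_const])
  have ev: "\<forall>\<^sub>F z::real in at_left x. z < x" by (simp add: eventually_at_filter)
  show "\<forall>\<^sub>F z in at_left x. g z \<le> F z" by (simp add: g_le_F)
  show "\<forall>\<^sub>F z in at_left x. F z \<le> Fl x" using ev by eventually_elim (rule F_le_Fl)
qed

lemma gauge_isCont: "isCont \<Psi>0 x"
proof -
  obtain C where "\<And>v. \<Psi>0 v \<le> C * norm v" using gauge_bounds by auto
  then show ?thesis by (rule sublinear_isCont[OF gauge_sublinear])
qed

text \<open>The two right limits, at \<open>x\<close> and at \<open>y\<close>, are taken along a
  common shift \<open>h\<close> that decreases to 0.\<close>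

lemma U_majorant: "x \<le> y \<Longrightarrow> \<Psi>0 (U y - U x) \<le> F y - F x"
proof (rule tendsto_le[where F="at_right (0::real)"])
  have sh: "((\<lambda>h. f (h + z)) \<longlongrightarrow> l) (at_right 0)" if "(f \<longlongrightarrow> l) (at_right z)" for f :: "real \<Rightarrow> 'x::topological_space" and l z
    using that by (subst (asm) filterlim_at_right_to_0) simp
  show "((\<lambda>h. g (h + y) - g (h + x)) \<longlongrightarrow> F y - F x) (at_right 0)"
    by (intro tendsto_diff sh lim_right)
  have "((\<lambda>h. w (h + y) - w (h + x)) \<longlongrightarrow> U y - U x) (at_right 0)"
    by (intro tendsto_diff sh lim_right)
  then show "((\<lambda>h. \<Psi>0 (w (h + y) - w (h + x))) \<longlongrightarrow> \<Psi>0 (U y - U x)) (at_right 0)"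
    by (rule isCont_tendsto_compose[OF gauge_isCont])
  assume "x \<le> y"
  then show "\<forall>\<^sub>F h in at_right 0. \<Psi>0 (w (h + y) - w (h + x)) \<le> g (h + y) - g (h + x)"
    by (intro always_eventually allI w_majorant) simp
qed simp

lemma right_lim_eq:
  assumes t: "t \<in> {0..T}"
  shows "right_lim T u t = U t"
proof (cases "t = T")
  case True
  have "(w \<longlongrightarrow> u T) (at_right T)"
  proof (rule Lim_transform_eventually[OF tendsto_const])
    show "\<forall>\<^sub>F z in at_right T. u T = w z"
      using eventually_at_right_less[of T] by eventually_elim (use T_pos in \<open>simp add: w_def clip_def\<close>)
  qed
  then have "U T = u T" by (rule tendsto_unique[OF trivial_limit_at_right_real lim_right(2)])
  then show ?thesis using True by (simp add: right_lim_def)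
next
  case False
  then have lt: "t < T" using t by simp
  have "(u \<longlongrightarrow> U t) (at_right t)"
  proof (rule Lim_transform_eventually[OF lim_right(2)])
    show "\<forall>\<^sub>F z in at_right t. w z = u z"
      unfolding eventually_at_right[OF lt] using t lt by (intro exI[of _ T]) (auto intro: w_eq)
  qed
  then have "Lim (at_right t) u = U t" by (intro tendsto_Lim) simp_all
  then show ?thesis using False by (simp add: right_lim_def)
qed

lemma left_lim_eq:
  assumes t: "t \<in> {0..T}"
  shows "left_lim u t = Ul t"
proof (cases "t = 0")
  case True
  have "(w \<longlongrightarrow> u 0) (at_left 0)"
  proof (rule Lim_transform_eventually[OF tendsto_const])
    have "\<forall>\<^sub>F z::real in at_left 0. z < 0" by (simp add: eventually_at_filter)
    then show "\<forall>\<^sub>F z in at_left 0. u 0 = w z"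
      by eventually_elim (use T_pos in \<open>simp add: w_def clip_def\<close>)
  qed
  then have "Ul 0 = u 0" by (rule tendsto_unique[OF trivial_limit_at_left_real lim_left(2)])
  then show ?thesis using True by (simp add: left_lim_def)
next
  case False
  then have lt: "0 < t" using t by simp
  have "(u \<longlongrightarrow> Ul t) (at_left t)"
  proof (rule Lim_transform_eventually[OF lim_left(2)])
    show "\<forall>\<^sub>F z in at_left t. w z = u z"
      unfolding eventually_at_left[OF lt] using t lt by (intro exI[of _ 0]) (auto intro: w_eq)
  qed
  then have "Lim (at_left t) u = Ul t" by (intro tendsto_Lim) simp_all
  then show ?thesis using False by (simp add: left_lim_def)
qed

lemma clip_tendsto:
  assumes "t \<in> {0..T}"
  shows "(clip 0 T \<longlongrightarrow> t) (at t within S)"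
proof -
  have "(clip 0 T \<longlongrightarrow> clip 0 T t) (at t)" using clip_cont unfolding isCont_def .
  then show ?thesis using assms tendsto_mono[OF at_le[OF subset_UNIV]] by (simp add: clip_id)
qed

text \<open>A limit of the state alone determines the limit of \<open>g\<close>, because work and
  energy are continuous. Hence the one-sided jumps of \<open>g\<close> are energy differences at a
  frozen time, the quantities to be compared with Finsler costs.\<close>

lemma energy_limit:
  assumes t: "t \<in> {0..T}" and l: "(w \<longlongrightarrow> l) (at t within S)"
  shows "(g \<longlongrightarrow> E 0 (u 0) + work t - E t l) (at t within S)"
proof -
  note cl = clip_tendsto[OF t]
  have r: "clip 0 T z \<in> {0..T}" for z using clip_range[of 0 T z] T_pos by simp
  have "((\<lambda>z. case (clip 0 T z, w z) of (t, x) \<Rightarrow> E t x) \<longlongrightarrow> (case (t, l) of (t, x) \<Rightarrow> E t x)) (at t within S)"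
    by (rule continuous_on_tendsto_compose[OF E_joint_cont]) (use t r in \<open>auto intro!: tendsto_Pair cl l\<close>)
  moreover have "((\<lambda>z. work (clip 0 T z)) \<longlongrightarrow> work t) (at t within S)"
    by (rule continuous_on_tendsto_compose[OF work_cont cl t]) (use r in simp)
  ultimately have "((\<lambda>z. E 0 (u 0) + work (clip 0 T z) - E (clip 0 T z) (w z)) \<longlongrightarrow> E 0 (u 0) + work t - E t l) (at t within S)"
    by (intro tendsto_intros) simp_all
  then show ?thesis by (simp add: g_def[abs_def] released_def w_def)
qed

lemma F_energy: "t \<in> {0..T} \<Longrightarrow> F t = E 0 (u 0) + work t - E t (U t)"
  by (rule tendsto_unique[OF _ lim_right(1) energy_limit[OF _ lim_right(2)]]) simp_all

lemma Fl_energy: "t \<in> {0..T} \<Longrightarrow> Fl t = E 0 (u 0) + work t - E t (Ul t)"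
  by (rule tendsto_unique[OF _ lim_left(1) energy_limit[OF _ lim_left(2)]]) simp_all

lemma g_energy: "t \<in> {0..T} \<Longrightarrow> g t = E 0 (u 0) + work t - E t (u t)"
  by (simp add: g_eq released_def)

text \<open>Discontinuities of \<open>g\<close> and not of \<open>u\<close>: monotonicity makes them
  countable, and off them \<open>u\<close> has no jump either, by the majorization.\<close>

definition disc :: "real set" where "disc = {x. \<not> isCont g x}"

lemma countable_disc: "countable disc"
  unfolding disc_def by (rule mono_ctble_discont) (simp add: mono_def g_mono)

lemma off_disc:
  assumes "x \<notin> disc"
  shows "U x = w x" "Ul x = w x" "F x = g x" "Fl x = g x"
proof -
  have gc: "(g \<longlongrightarrow> g x) (at x)" using assms by (simp add: disc_def isCont_def)
  have "((\<lambda>z. w z - w x) \<longlongrightarrow> 0) (at x)"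
  proof (rule Lim_null_comparison)
    have "norm (w z - w x) \<le> (1 / c0) * \<bar>g z - g x\<bar>" for z
      using w_norm[of z x] w_norm[of x z] g_mono[of x z] g_mono[of z x]
      by (cases "x \<le> z") (auto simp: norm_minus_commute)
    then show "\<forall>\<^sub>F z in at x. norm (w z - w x) \<le> (1 / c0) * \<bar>g z - g x\<bar>" by simp
    have "((\<lambda>z. (1 / c0) * \<bar>g z - g x\<bar>) \<longlongrightarrow> (1 / c0) * \<bar>g x - g x\<bar>) (at x)" by (intro tendsto_intros gc)
    then show "((\<lambda>z. (1 / c0) * \<bar>g z - g x\<bar>) \<longlongrightarrow> 0) (at x)" by simp
  qed
  then have wc: "(w \<longlongrightarrow> w x) (at x)" by (rule LIM_zero_cancel)
  have sub: "(f \<longlongrightarrow> l) (at_right x)" "(f \<longlongrightarrow> l) (at_left x)" if "(f \<longlongrightarrow> l) (at x)" for f :: "real \<Rightarrow> 'x::topological_space" and l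
    using that filterlim_at_split by blast+
  show "U x = w x" by (rule tendsto_unique[OF _ lim_right(2) sub(1)[OF wc]]) simp
  show "Ul x = w x" by (rule tendsto_unique[OF _ lim_left(2) sub(2)[OF wc]]) simp
  show "F x = g x" by (rule tendsto_unique[OF _ lim_right(1) sub(1)[OF gc]]) simp
  show "Fl x = g x" by (rule tendsto_unique[OF _ lim_left(1) sub(2)[OF gc]]) simp
qed

lemma jump_set_iff: "t \<in> {0..T} \<Longrightarrow> t \<in> jump_set T u \<longleftrightarrow> Ul t \<noteq> u t \<or> u t \<noteq> U t"
  by (simp add: jump_set_def left_lim_eq right_lim_eq)

lemma jump_subset_disc: "jump_set T u \<subseteq> disc"
proof
  fix t assume t: "t \<in> jump_set T u"
  then have t': "t \<in> {0..T}" by (simp add: jump_set_def)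
  show "t \<in> disc"
  proof (rule ccontr)
    assume "t \<notin> disc"
    then show False using off_disc[of t] t jump_set_iff[OF t'] w_eq[of t] t' by simp
  qed
qed

text \<open>Stability is assumed off the jump set, which is countable. If it failed for the right
  limit at \<open>t\<close>, it would by continuity fail on a whole right neighbourhood. At a jump
  time this is stability of the state after the jump.\<close>

lemma stable_right:
  assumes t: "0 \<le> t" "t < T"
  shows "blinfun_apply (- DE t (U t)) z \<le> \<Psi>0 z"
proof (rule ccontr)
  assume "\<not> ?thesis"
  then have gt: "\<Psi>0 z < blinfun_apply (- DE t (U t)) z" by simp
  have r: "clip 0 T y \<in> {0..T}" for y using clip_range[of 0 T y] T_pos by simp
  have cl: "(clip 0 T \<longlongrightarrow> t) (at_right t)" using t by (intro clip_tendsto) simp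
  have "((\<lambda>y. case (clip 0 T y, w y) of (t, x) \<Rightarrow> DE t x) \<longlongrightarrow> (case (t, U t) of (t, x) \<Rightarrow> DE t x)) (at_right t)"
    by (rule continuous_on_tendsto_compose[OF DE_joint_cont]) (use t r in \<open>auto intro!: tendsto_Pair cl lim_right\<close>)
  then have "((\<lambda>y. blinfun_apply (- DE (clip 0 T y) (w y)) z) \<longlongrightarrow> blinfun_apply (- DE t (U t)) z) (at_right t)"
    by (intro tendsto_intros) simp_all
  then have "\<forall>\<^sub>F y in at_right t. \<Psi>0 z < blinfun_apply (- DE (clip 0 T y) (w y)) z"
    using gt by (simp add: order_tendsto_iff)
  then obtain b where b: "b > t" "\<And>y. t < y \<Longrightarrow> y < b \<Longrightarrow> \<Psi>0 z < blinfun_apply (- DE (clip 0 T y) (w y)) z"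
    unfolding eventually_at_right[OF t(2)] by blast
  have "{t<..<min b T} \<subseteq> disc"
  proof
    fix y assume y: "y \<in> {t<..<min b T}"
    then have y': "y \<in> {0..T}" using t by auto
    have "\<Psi>0 z < blinfun_apply (- DE y (u y)) z" using b(2)[of y] y y' by (simp add: clip_id w_eq)
    then have "- DE y (u y) \<notin> stable_set \<Psi>0" unfolding stable_set_def by (auto simp: not_le)
    then have "y \<in> jump_set T u" using stable[OF y'] by blast
    then show "y \<in> disc" using jump_subset_disc by blast
  qed
  then have "countable {t<..<min b T}" using countable_disc countable_subset by blast
  then show False using uncountable_open_interval[of t "min b T"] b(1) t by simp
qed

subsection \<open>The measure of released energy\<close>

abbreviation V :: "real measure" where "V \<equiv> interval_measure F"

lemma V_finite: "finite_measure V"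
  by (rule finite_interval_measure[OF F_mono F_right_cont F_bounds])

lemma V_Ioc: "a \<le> b \<Longrightarrow> measure V {a<..b} = F b - F a"
  by (rule measure_interval_measure_Ioc[OF _ F_mono F_right_cont])

text \<open>Intervals closed on the right have measures given by increments; intervals open on the
  right are reached by exhausting them with such intervals.\<close>

lemma left_sequence:
  assumes "a < t"
  obtains s :: "nat \<Rightarrow> real" where "\<And>n. a \<le> s n" "\<And>n. s n < t" "filterlim s (at_left t) sequentially"
    "incseq (\<lambda>n. {a<..s n})" "(\<Union>n. {a<..s n}) = {a<..<t}"
proof -
  define s where "s n = t - (t - a) * inverse (real (Suc n))" for n
  have s_lt: "s n < t" and s_ge: "a \<le> s n" for n
  proof -
    have "0 < inverse (real (Suc n))" "inverse (real (Suc n)) \<le> 1" by (auto simp: inverse_le_1_iff)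
    then have "0 < (t - a) * inverse (real (Suc n))" "(t - a) * inverse (real (Suc n)) \<le> t - a"
      using assms by (auto simp del: of_nat_Suc simp: mult_left_le)
    then show "s n < t" "a \<le> s n" unfolding s_def by linarith+
  qed
  have s_lim: "filterlim s (at_left t) sequentially"
  proof -
    have "(\<lambda>n. t - (t - a) * inverse (real (Suc n))) \<longlonglongrightarrow> t - (t - a) * 0"
      by (intro tendsto_intros LIMSEQ_inverse_real_of_nat)
    then show ?thesis unfolding filterlim_at using s_lt
      by (auto simp: s_def[abs_def] less_imp_neq intro!: always_eventually)
  qed
  have s_inc: "s m \<le> s n" if "m \<le> n" for m n
    unfolding s_def using assms that by (intro diff_left_mono mult_left_mono le_imp_inverse_le) auto
  have U: "(\<Union>n. {a<..s n}) = {a<..<t}"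
  proof
    show "(\<Union>n. {a<..s n}) \<subseteq> {a<..<t}"
    proof
      fix x assume "x \<in> (\<Union>n. {a<..s n})"
      then obtain n where "a < x" "x \<le> s n" by auto
      then show "x \<in> {a<..<t}" using s_lt[of n] by simp
    qed
    show "{a<..<t} \<subseteq> (\<Union>n. {a<..s n})"
    proof
      fix x assume x: "x \<in> {a<..<t}"
      then have "\<forall>\<^sub>F n in sequentially. x < s n"
        using filterlim_compose[OF tendsto_ident_at s_lim] by (simp add: order_tendsto_iff comp_def)
      then obtain n where "x < s n" by (auto simp: eventually_sequentially)
      then show "x \<in> (\<Union>n. {a<..s n})" using x by (intro UN_I[of n]) auto
    qed
  qed
  have "incseq (\<lambda>n. {a<..s n})"
    unfolding incseq_def
  proof (intro allI impI subsetI)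
    fix m n x assume "m \<le> n" "x \<in> {a<..s m}"
    then show "x \<in> {a<..s n}" using s_inc[of m n] by simp
  qed
  then show thesis using that s_ge s_lt s_lim U by blast
qed

lemma V_Ioo:
  assumes "a < t"
  shows "measure V {a<..<t} = Fl t - F a"
proof -
  interpret V: finite_measure V by (rule V_finite)
  obtain s :: "nat \<Rightarrow> real" where s: "\<And>n. a \<le> s n" "\<And>n. s n < t" "filterlim s (at_left t) sequentially"
    "incseq (\<lambda>n. {a<..s n})" "(\<Union>n. {a<..s n}) = {a<..<t}"
    by (rule left_sequence[OF assms]) blast
  have "(\<lambda>n. measure V {a<..s n}) \<longlonglongrightarrow> measure V (\<Union>n. {a<..s n})"
    by (rule V.finite_Lim_measure_incseq) (use s(4) in auto)
  moreover have "(\<lambda>n. measure V {a<..s n}) \<longlonglongrightarrow> Fl t - F a"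
    unfolding V_Ioc[OF s(1)] by (intro tendsto_diff tendsto_const filterlim_compose[OF F_left_lim s(3)])
  ultimately show ?thesis unfolding s(5) using LIMSEQ_unique by blast
qed

lemma V_singleton: "measure V {t} = F t - Fl t"
proof -
  interpret V: finite_measure V by (rule V_finite)
  have "{t - 1<..<t} \<union> {t} = {t - 1<..t}" by auto
  then have "measure V {t - 1<..t} = measure V {t - 1<..<t} + measure V {t}"
    using V.finite_measure_Union[of "{t - 1<..<t}" "{t}"] by simp
  then show ?thesis using V_Ioc[of "t - 1" t] V_Ioo[of "t - 1" t] by simp
qed

lemma V_off_disc: "t \<notin> disc \<Longrightarrow> measure V {t} = 0"
  by (simp add: V_singleton off_disc)

subsection \<open>The derivative of a local solution\<close>

text \<open>The derivative of the extended function on the whole line, which sees jumps of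
  \<open>u\<close> at 0 and at \<open>T\<close>; restriction to the open interval in
  \<open>deriv_meas\<close> removes them.\<close>

definition deriv_line :: "real set \<Rightarrow> 'a" where
  "deriv_line = (SOME \<nu>. vector_measure \<nu> \<and> (\<forall>a b. a \<le> b \<longrightarrow> \<nu> {a<..b} = U b - U a))"

abbreviation deriv_meas :: "real set \<Rightarrow> 'a" where "deriv_meas \<equiv> vm_restrict {0<..<T} deriv_line"

lemma deriv_line: "vector_measure deriv_line" "a \<le> b \<Longrightarrow> deriv_line {a<..b} = U b - U a"
proof -
  have "\<exists>\<nu>. vector_measure \<nu> \<and> (\<forall>a b. a \<le> b \<longrightarrow> \<nu> {a<..b} = U b - U a)"
  proof (rule stieltjes_vector_measure)
    show "F x / c0 \<le> F y / c0" if "x \<le> y" for x y using F_mono[OF that] c0(1) by (simp add: divide_right_mono)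
    show "continuous (at_right x) (\<lambda>x. F x / c0)" for x
      using F_right_cont[of x] c0(1) by (intro continuous_intros) auto
    show "0 \<le> F x / c0" "F x / c0 \<le> released T / c0" for x
      using F_bounds[of x] c0(1) by (auto simp: divide_right_mono)
    show "norm (U y - U x) \<le> F y / c0 - F x / c0" if "x \<le> y" for x y
      using norm_le_gauge[of "U y - U x"] divide_right_mono[OF U_majorant[OF that], of c0] c0(1)
      by (simp add: diff_divide_distrib)
  qed
  from someI_ex[OF this] show "vector_measure deriv_line" "a \<le> b \<Longrightarrow> deriv_line {a<..b} = U b - U a"
    unfolding deriv_line_def by blast+
qed

lemma deriv_meas_vm: "vector_measure deriv_meas"
  by (rule vm_restrict[OF deriv_line(1)]) simp

lemma deriv_meas_dd: "distributional_derivative T u deriv_meas"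
proof (rule distributional_derivative_exists[OF deriv_line _ u_measurable])
  have "AE y in lborel. y \<notin> disc" by (rule AE_not_in) (rule countable_imp_null_set_lborel[OF countable_disc])
  then show "AE y in lborel. y \<in> {0<..<T} \<longrightarrow> u y = U y"
    by eventually_elim (auto simp: off_disc w_eq)
qed

lemma deriv_meas_Ioc:
  assumes "0 \<le> a" "a \<le> b" "b < T"
  shows "deriv_meas {a<..b} = U b - U a"
proof -
  have "{a<..b} \<inter> {0<..<T} = {a<..b}" using assms by auto
  then show ?thesis using deriv_line(2)[OF assms(2)] by (simp add: vm_restrict_def)
qed

lemma gauge_deriv_meas:
  assumes "A \<in> sets borel"
  shows "\<Psi>0 (deriv_meas A) \<le> measure V (A \<inter> {0<..<T})"
proof -
  obtain C where C: "\<And>v. \<Psi>0 v \<le> C * norm v" using gauge_bounds by auto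
  have "\<Psi>0 (deriv_line (A \<inter> {0<..<T})) \<le> measure V (A \<inter> {0<..<T})"
  proof (rule sublinear_vm_le_interval_measure[OF deriv_line(1) F_mono F_right_cont F_bounds gauge_sublinear C])
    show "\<Psi>0 (deriv_line {a<..b}) \<le> F b - F a" if "a \<le> b" for a b
      using U_majorant[OF that] deriv_line(2)[OF that] by simp
  qed (use assms in auto)
  then show ?thesis using assms by (simp add: vm_restrict_def)
qed

abbreviation diffuse :: "real measure" where "diffuse \<equiv> diffuse_measure T u"
abbreviation dens :: "real \<Rightarrow> 'a" where "dens \<equiv> vector_density (continuous_part T u) (diffuse_measure T u)"

text \<open>Extracts from the chosen splitting what the dissipation needs: off a countable set the
  derivative is its continuous part, with an integrable density with respect to a measure without
  atoms.\<close>

lemma diffuse_structure: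
  obtains S where "countable S" "disc \<subseteq> S" "sets diffuse = sets borel" "\<And>x. emeasure diffuse {x} = 0"
    "integrable diffuse dens" "\<And>A. A \<in> sets borel \<Longrightarrow> deriv_meas (A - S) = (LINT x:A|diffuse. dens x)"
proof -
  obtain \<nu>L \<nu>C \<nu>J where dp: "derivative_parts T u \<nu>L \<nu>C \<nu>J" and cC: "cantor_part T u = \<nu>C"
    and cc: "continuous_part T u = (\<lambda>A. \<nu>L A + \<nu>C A)" and total: "\<And>A. \<nu>L A + \<nu>C A + \<nu>J A = deriv_meas A"
    using deriv_parts[OF deriv_meas_dd] by blast
  have vL: "vector_measure \<nu>L" and vC: "vector_measure \<nu>C" and vJ: "vector_measure \<nu>J"
    using dp by (auto simp: derivative_parts_def)
  have L0: "\<nu>L A = 0" if "A \<in> null_sets lborel" for A using dp that by (auto simp: derivative_parts_def)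
  have Cx: "\<nu>C {x} = 0" for x using dp by (auto simp: derivative_parts_def)
  obtain SJ where SJ: "countable SJ" "\<And>A. A \<in> sets borel \<Longrightarrow> \<nu>J A = \<nu>J (A \<inter> SJ)"
    using dp unfolding derivative_parts_def by blast
  \<comment> \<open>\<open>S\<close> contains all atoms of \<open>V\<close> and carries the jump
    part; being countable, it is null for the absolutely continuous and for the Cantor part.\<close>
  define S where "S = disc \<union> SJ"
  have S: "countable S" using countable_disc SJ(1) by (simp add: S_def)
  have SB: "A \<in> sets borel" if "A \<subseteq> S" for A
    by (rule sets.countable[OF _ countable_subset[OF that S]]) simp
  let ?N = "variation_measure \<nu>C"
  interpret N: finite_measure ?N by (rule variation_finite[OF vC])
  have sN: "sets ?N = sets borel" using vC by simp
  have Nx: "emeasure ?N {x} = 0" for x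
  proof -
    have "total_variation \<nu>C {x} = 0"
    proof (rule variation_null[OF vC])
      fix C assume "C \<subseteq> {x}"
      then have "C = {} \<or> C = {x}" by blast
      then show "\<nu>C C = 0" using Cx vm_empty[OF vC] by blast
    qed
    then show ?thesis by (simp add: emeasure_variation_measure[OF vC])
  qed
  have NS: "emeasure ?N A = 0" if "A \<subseteq> S" for A
  proof -
    have "A \<in> null_sets ?N"
      using null_sets_UN'[OF countable_subset[OF that S], of "\<lambda>x. {x}" ?N] Nx sN by (auto simp: null_sets_def)
    then show ?thesis by (simp add: null_sets_def)
  qed
  have de: "emeasure diffuse A = emeasure lborel A + emeasure ?N A" if A: "A \<in> sets borel" for A
  proof (rule emeasure_measure_of[OF diffuse_measure_def[of T u, unfolded cC]])
    show "A \<in> sets diffuse" using A by (simp add: diffuse_measure_def sets.sigma_sets_eq[of borel, simplified])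
    show "positive (sets diffuse) (\<lambda>A. emeasure lborel A + emeasure ?N A)" by (simp add: positive_def)
    show "countably_additive (sets diffuse) (\<lambda>A. emeasure lborel A + emeasure ?N A)"
    proof (rule countably_additiveI)
      fix F :: "nat \<Rightarrow> real set" assume F: "range F \<subseteq> sets diffuse" "disjoint_family F"
      have r: "range F \<subseteq> sets borel" using F(1) by (simp add: diffuse_measure_def sets.sigma_sets_eq[of borel, simplified])
      then have "(\<Sum>i. emeasure lborel (F i)) = emeasure lborel (\<Union>i. F i)" "(\<Sum>i. emeasure ?N (F i)) = emeasure ?N (\<Union>i. F i)"
        using F(2) sN by (auto intro!: suminf_emeasure)
      then show "(\<Sum>i. emeasure lborel (F i) + emeasure ?N (F i)) = emeasure lborel (\<Union>i. F i) + emeasure ?N (\<Union>i. F i)"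
        by (simp add: suminf_add[symmetric])
    qed
  qed simp
  have sd: "sets diffuse = sets borel" by (simp add: diffuse_measure_def sets.sigma_sets_eq[of borel, simplified])
  have spd: "space diffuse = UNIV" by (simp add: diffuse_measure_def)
  have sf: "sigma_finite_measure diffuse"
  proof
    show "\<exists>A. countable A \<and> A \<subseteq> sets diffuse \<and> \<Union>A = space diffuse \<and> (\<forall>a\<in>A. emeasure diffuse a \<noteq> \<infinity>)"
    proof (intro exI[of _ "range (\<lambda>n::nat. {- real n..real n})"] conjI ballI)
      show "\<Union>(range (\<lambda>n::nat. {- real n..real n})) = space diffuse"
      proof -
        have "\<exists>n::nat. - real n \<le> x \<and> x \<le> real n" for x
          using reals_Archimedean2[of "\<bar>x\<bar>"] by (metis abs_le_iff less_imp_le minus_le_iff)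
        then show ?thesis unfolding spd by auto
      qed
      fix a assume "a \<in> range (\<lambda>n::nat. {- real n..real n})"
      then obtain n :: nat where "a = {- real n..real n}" by blast
      then show "emeasure diffuse a \<noteq> \<infinity>" by (simp add: de)
    qed (auto simp: sd)
  qed
  have vco: "vector_measure (\<lambda>A. \<nu>L A + \<nu>C A)" by (rule vm_add[OF vL vC])
  have ac: "\<nu>L A + \<nu>C A = 0" if A: "A \<in> sets borel" "emeasure diffuse A = 0" for A
  proof -
    have "emeasure lborel A = 0" "emeasure ?N A = 0" using de[OF A(1)] A(2) by auto
    then show ?thesis using L0[of A] A(1) variation_measure_null[OF vC A(1)] by (auto simp: null_sets_def)
  qed
  have vd1: "integrable diffuse (vector_density (\<lambda>A. \<nu>L A + \<nu>C A) diffuse)"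
    by (rule vector_measure_density(1)[OF vco sf sd]) (rule ac)
  have vd2: "\<nu>L A + \<nu>C A = (LINT x:A|diffuse. vector_density (\<lambda>A. \<nu>L A + \<nu>C A) diffuse x)" if "A \<in> sets borel" for A
    by (rule vector_measure_density(2)[OF vco sf sd _ that]) (rule ac)
  have co: "deriv_meas (A - S) = \<nu>L A + \<nu>C A" if A: "A \<in> sets borel" for A
  proof -
    have AS: "A - S \<in> sets borel" "A \<inter> S \<in> sets borel" using A SB by auto
    have split: "A = (A - S) \<union> (A \<inter> S)" "(A - S) \<inter> (A \<inter> S) = {}" by auto
    have "\<nu>J (A - S) = \<nu>J ((A - S) \<inter> SJ)" by (rule SJ(2)[OF AS(1)])
    also have "(A - S) \<inter> SJ = {}" by (auto simp: S_def)
    finally have "\<nu>J (A - S) = 0" by (simp add: vm_empty[OF vJ])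
    moreover have "\<nu>L A = \<nu>L (A - S) + \<nu>L (A \<inter> S)" using vm_Un[OF vL AS split(2)] split(1) by simp
    moreover have "\<nu>L (A \<inter> S) = 0"
      by (rule L0) (rule countable_imp_null_set_lborel[OF countable_subset[OF _ S]], simp)
    moreover have "\<nu>C A = \<nu>C (A - S) + \<nu>C (A \<inter> S)" using vm_Un[OF vC AS split(2)] split(1) by simp
    moreover have "\<nu>C (A \<inter> S) = 0" by (rule variation_measure_null[OF vC AS(2) NS]) simp
    ultimately show ?thesis using total[of "A - S"] by simp
  qed
  show thesis
  proof (rule that[OF S _ sd])
    show "disc \<subseteq> S" by (simp add: S_def)
    show "emeasure diffuse {x} = 0" for x by (simp add: de Nx)
    show "integrable diffuse dens" unfolding cc by (rule vd1)
    show "deriv_meas (A - S) = (LINT x:A|diffuse. dens x)" if "A \<in> sets borel" for A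
      unfolding cc using vd2[OF that] co[OF that] by simp
  qed
qed

text \<open>Between two nearby times the released energy exceeds the gauge of the increment by an
  arbitrarily small amount only; this is the chain rule, combined with stability at the left end.\<close>

lemma increment_estimate:
  assumes ab: "0 \<le> a" "a < b" "b < T" and \<kappa>: "\<kappa> > 0"
    and near: "\<And>s v. s \<in> {a..b} \<Longrightarrow> norm (v - y) < \<eta> \<Longrightarrow> norm (DE s v - A) < \<kappa> / 2 \<and> \<bar>dtE s v - q\<bar> < \<kappa> / 2"
    and Ua: "norm (U a - y) < \<eta>" and Ub: "norm (U b - y) < \<eta>"
    and us: "\<And>s. s \<in> {a<..<b} \<Longrightarrow> norm (u s - y) < \<eta>"
  shows "F b - F a \<le> \<Psi>0 (U b - U a) + \<kappa> * (norm (U b - U a) + (b - a))"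
proof -
  let ?d = "U b - U a"
  \<comment> \<open>\<open>F b - F a\<close> is the sum of the work, of the drop from time
    \<open>a\<close> to time \<open>b\<close> at the fixed state \<open>U b\<close>, and of the drop
    from \<open>U a\<close> to \<open>U b\<close> at the fixed time \<open>a\<close>. In the first
    two the power is within \<open>\<kappa> / 2\<close> of \<open>q\<close>, so \<open>q\<close>
    cancels; stability governs the third.\<close>
  have "work b - work a \<le> (b - a) * (q + \<kappa> / 2)"
  proof -
    have i: "integrable lborel (\<lambda>s. indicator {a..b} s * (q + \<kappa> / 2))"
      by (rule integrable_mult_left, rule integrable_real_indicator) (use ab in auto)
    have "work b - work a = (LINT s|lborel. indicator {a..b} s *\<^sub>R dtE s (u s))"
      using work_diff[of a b] ab by (simp add: set_lebesgue_integral_def)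
    also have "\<dots> \<le> (LINT s|lborel. indicator {a..b} s * (q + \<kappa> / 2))"
    proof (rule integral_mono_AE[OF _ i])
      show "integrable lborel (\<lambda>s. indicator {a..b} s *\<^sub>R dtE s (u s))"
        using power_subset[of a b] ab by (simp add: set_integrable_def)
      have "AE s in lborel. s \<noteq> a \<and> s \<noteq> b" using AE_lborel_singleton by auto
      then show "AE s in lborel. indicator {a..b} s *\<^sub>R dtE s (u s) \<le> indicator {a..b} s * (q + \<kappa> / 2)"
      proof eventually_elim
        case (elim s)
        show ?case
        proof (cases "s \<in> {a..b}")
          case True
          then have "\<bar>dtE s (u s) - q\<bar> < \<kappa> / 2" using near[OF True us] elim by auto
          then have "dtE s (u s) \<le> q + \<kappa> / 2" by linarith
          then show ?thesis using True by simp
        qed simp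
      qed
    qed
    also have "\<dots> = (b - a) * (q + \<kappa> / 2)" using ab by simp
    finally show ?thesis .
  qed
  moreover have "E a (U b) - E b (U b) \<le> (b - a) * (\<kappa> / 2 - q)"
  proof -
    have "\<exists>x\<in>{a<..<b}. E b (U b) - E a (U b) = (\<lambda>h. h * dtE x (U b)) (b - a)"
    proof (rule mvt_simple[OF ab(2)])
      fix x assume x: "a \<le> x" "x \<le> b"
      have "((\<lambda>s. E s (U b)) has_derivative (*) (dtE x (U b))) (at x within {0..T})"
        using E_time_deriv[of x "U b"] x ab by (simp add: has_field_derivative_def)
      then have "((\<lambda>s. E s (U b)) has_derivative (*) (dtE x (U b))) (at x within {a..b})"
        by (rule has_derivative_subset) (use ab in auto)
      then show "((\<lambda>s. E s (U b)) has_derivative (\<lambda>h. h * dtE x (U b))) (at x within {a..b})"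
        by (simp add: mult_commute_abs)
    qed
    then obtain x where x: "x \<in> {a<..<b}" "E b (U b) - E a (U b) = (b - a) * dtE x (U b)" by blast
    have "\<bar>dtE x (U b) - q\<bar> < \<kappa> / 2" using near[of x "U b"] x(1) Ub by auto
    then have "q - \<kappa> / 2 < dtE x (U b)" by linarith
    then have "(b - a) * (q - \<kappa> / 2) \<le> (b - a) * dtE x (U b)" using ab by (intro mult_left_mono) auto
    then show ?thesis using x(2) by (simp add: algebra_simps)
  qed
  moreover have "E a (U a) - E a (U b) \<le> \<Psi>0 ?d + \<kappa> * norm ?d"
  proof -
    interpret S: energy_slice B coord \<Psi>0 \<Psi> E DE a by (rule energy_slice) (use ab in auto)
    have "\<exists>r\<in>{0<..<1}. E a (U a + 1 *\<^sub>R ?d) - E a (U a + 0 *\<^sub>R ?d)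
        = (\<lambda>h. blinfun_apply (DE a (U a + r *\<^sub>R ?d)) (h *\<^sub>R ?d)) (1 - 0)"
    proof (rule mvt_simple[OF zero_less_one])
      fix r :: real
      have "((\<lambda>r. U a + r *\<^sub>R ?d) has_derivative (\<lambda>h. h *\<^sub>R ?d)) (at r within {0..1})"
        by (auto intro!: derivative_eq_intros)
      from diff_chain_within[OF this has_derivative_at_withinI[OF S.E_deriv]]
      show "((\<lambda>r. E a (U a + r *\<^sub>R ?d)) has_derivative (\<lambda>h. blinfun_apply (DE a (U a + r *\<^sub>R ?d)) (h *\<^sub>R ?d))) (at r within {0..1})"
        by (simp add: comp_def)
    qed
    then obtain r where r: "r \<in> {0<..<1}" and eq: "E a (U b) - E a (U a) = blinfun_apply (DE a (U a + r *\<^sub>R ?d)) ?d"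
      by auto
    let ?z = "U a + r *\<^sub>R ?d"
    have "norm (?z - y) < \<eta>"
    proof -
      have "?z - y = (1 - r) *\<^sub>R (U a - y) + r *\<^sub>R (U b - y)" by (simp add: algebra_simps)
      then have "norm (?z - y) \<le> (1 - r) * norm (U a - y) + r * norm (U b - y)"
        using norm_triangle_ineq[of "(1 - r) *\<^sub>R (U a - y)" "r *\<^sub>R (U b - y)"] r by simp
      also have "\<dots> < (1 - r) * \<eta> + r * \<eta>"
        using r Ua Ub by (intro add_strict_mono mult_strict_left_mono) auto
      finally show ?thesis by (simp add: algebra_simps)
    qed
    then have "norm (DE a ?z - A) < \<kappa> / 2" "norm (DE a (U a) - A) < \<kappa> / 2" using near[of a] Ua ab by auto
    then have "norm (DE a (U a) - DE a ?z) < \<kappa>"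
      using norm_triangle_ineq4[of "DE a (U a) - A" "DE a ?z - A"] by simp
    have "E a (U a) - E a (U b) = blinfun_apply (- DE a (U a)) ?d + blinfun_apply (DE a (U a) - DE a ?z) ?d"
      using eq by (simp add: blinfun.minus_left blinfun.diff_left)
    also have "blinfun_apply (- DE a (U a)) ?d \<le> \<Psi>0 ?d" using ab by (intro stable_right) auto
    also have "blinfun_apply (DE a (U a) - DE a ?z) ?d \<le> norm (DE a (U a) - DE a ?z) * norm ?d"
      using norm_blinfun[of "DE a (U a) - DE a ?z" ?d] by simp
    also have "\<dots> \<le> \<kappa> * norm ?d" using \<open>norm (DE a (U a) - DE a ?z) < \<kappa>\<close> by (intro mult_right_mono) auto
    finally show ?thesis by simp
  qed
  ultimately have "F b - F a \<le> (b - a) * (q + \<kappa> / 2) + (b - a) * (\<kappa> / 2 - q) + (\<Psi>0 ?d + \<kappa> * norm ?d)"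
    using F_energy[of a] F_energy[of b] ab by auto
  also have "(b - a) * (q + \<kappa> / 2) + (b - a) * (\<kappa> / 2 - q) = (b - a) * \<kappa>" by (simp add: algebra_simps)
  finally show ?thesis by (simp add: algebra_simps)
qed

lemma joint_neighbourhood:
  assumes x: "x \<in> {0..T}" and \<kappa>: "\<kappa> > 0"
  shows "\<exists>\<eta>>0. \<forall>s\<in>{0..T}. \<forall>v. \<bar>s - x\<bar> < \<eta> \<longrightarrow> norm (v - y) < \<eta> \<longrightarrow>
    norm (DE s v - DE x y) < \<kappa> / 2 \<and> \<bar>dtE s v - dtE x y\<bar> < \<kappa> / 2"
proof -
  have k: "\<kappa> / 2 > 0" using \<kappa> by simp
  have xy: "(x, y) \<in> {0..T} \<times> UNIV" using x by simp
  obtain d1 where d1: "d1 > 0" "\<And>z. z \<in> {0..T} \<times> UNIV \<Longrightarrow> dist z (x, y) < d1 \<Longrightarrow>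
      dist (case z of (t, x) \<Rightarrow> DE t x) (DE x y) < \<kappa> / 2"
    using DE_joint_cont xy k unfolding continuous_on_iff by (metis (no_types, lifting) case_prod_conv)
  obtain d2 where d2: "d2 > 0" "\<And>z. z \<in> {0..T} \<times> UNIV \<Longrightarrow> dist z (x, y) < d2 \<Longrightarrow>
      dist (case z of (t, x) \<Rightarrow> dtE t x) (dtE x y) < \<kappa> / 2"
    using dtE_cont xy k unfolding continuous_on_iff by (metis (no_types, lifting) case_prod_conv)
  define \<eta> where "\<eta> = min d1 d2 / 2"
  have \<eta>: "\<eta> > 0" "2 * \<eta> \<le> d1" "2 * \<eta> \<le> d2" using d1(1) d2(1) by (auto simp: \<eta>_def)
  have "norm (DE s v - DE x y) < \<kappa> / 2 \<and> \<bar>dtE s v - dtE x y\<bar> < \<kappa> / 2"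
    if s: "s \<in> {0..T}" "\<bar>s - x\<bar> < \<eta>" "norm (v - y) < \<eta>" for s v
  proof -
    have "dist (s, v) (x, y) \<le> dist s x + dist v y"
      by (simp add: dist_prod_def sqrt_sum_squares_le_sum)
    also have "\<dots> < 2 * \<eta>" using s by (simp add: dist_norm)
    finally have "dist (s, v) (x, y) < d1" "dist (s, v) (x, y) < d2" using \<eta> by linarith+
    then show ?thesis using d1(2)[of "(s, v)"] d2(2)[of "(s, v)"] s(1) by (simp add: dist_norm)
  qed
  then show ?thesis using \<eta>(1) by blast
qed

lemma U_near:
  assumes "\<And>z. a < z \<Longrightarrow> z < b \<Longrightarrow> norm (w z - y) < e" "a \<le> x" "x < b"
  shows "norm (U x - y) \<le> e"
proof (rule tendsto_upperbound)
  show "((\<lambda>z. norm (w z - y)) \<longlongrightarrow> norm (U x - y)) (at_right x)" by (intro tendsto_intros lim_right)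
  show "\<forall>\<^sub>F z in at_right x. norm (w z - y) \<le> e"
    unfolding eventually_at_right[OF assms(3)] using assms by (intro exI[of _ b]) (auto intro: less_imp_le)
qed simp

text \<open>Just after \<open>x\<close> all states are near \<open>U x\<close>, just before it near
  \<open>Ul x\<close>; across a jump there is no common reference state, hence two separate
  estimates. This one may start at \<open>a = x\<close>, where the right-continuous \<open>U\<close>
  already has the value after the jump.\<close>

lemma right_estimate:
  assumes x: "0 \<le> x" "x < T" and \<kappa>: "\<kappa> > 0"
  shows "\<exists>d>0. \<forall>a b. x \<le> a \<longrightarrow> a < b \<longrightarrow> b < x + d \<longrightarrow> b < T \<longrightarrow>
    F b - F a \<le> \<Psi>0 (U b - U a) + \<kappa> * (norm (U b - U a) + (b - a))"
proof -
  obtain \<eta> where \<eta>: "\<eta> > 0" "\<And>s v. s \<in> {0..T} \<Longrightarrow> \<bar>s - x\<bar> < \<eta> \<Longrightarrow> norm (v - U x) < \<eta> \<Longrightarrow>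
    norm (DE s v - DE x (U x)) < \<kappa> / 2 \<and> \<bar>dtE s v - dtE x (U x)\<bar> < \<kappa> / 2"
    using joint_neighbourhood[of x \<kappa> "U x"] x \<kappa> by auto
  have "\<forall>\<^sub>F z in at_right x. dist (w z) (U x) < \<eta> / 2"
    using lim_right(2)[of x] \<eta>(1) by (intro tendstoD) auto
  then obtain c where c: "c > x" "\<And>z. x < z \<Longrightarrow> z < c \<Longrightarrow> norm (w z - U x) < \<eta> / 2"
    unfolding eventually_at_right[OF less_add_one] dist_norm by blast
  define d where "d = min (c - x) \<eta>"
  have d: "d > 0" using c(1) \<eta>(1) by (simp add: d_def)
  have "F b - F a \<le> \<Psi>0 (U b - U a) + \<kappa> * (norm (U b - U a) + (b - a))"
    if ab: "x \<le> a" "a < b" "b < x + d" "b < T" for a b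
  proof (rule increment_estimate[where y="U x" and \<eta>=\<eta> and A="DE x (U x)" and q="dtE x (U x)"])
    have bc: "b < c" "b < x + \<eta>" using ab(3) by (auto simp: d_def)
    show "norm (DE s v - DE x (U x)) < \<kappa> / 2 \<and> \<bar>dtE s v - dtE x (U x)\<bar> < \<kappa> / 2"
      if "s \<in> {a..b}" "norm (v - U x) < \<eta>" for s v
      using that ab x bc by (intro \<eta>(2)) auto
    have "norm (U a - U x) \<le> \<eta> / 2" "norm (U b - U x) \<le> \<eta> / 2"
      using U_near[OF c(2), where x=a] U_near[OF c(2), where x=b] ab bc by auto
    then show "norm (U a - U x) < \<eta>" "norm (U b - U x) < \<eta>" using \<eta>(1) by linarith+
    show "norm (u s - U x) < \<eta>" if "s \<in> {a<..<b}" for s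
    proof -
      have "norm (w s - U x) < \<eta> / 2" using that ab bc by (intro c(2)) auto
      moreover have "w s = u s" using that ab x by (intro w_eq) auto
      ultimately show ?thesis using \<eta>(1) by simp
    qed
  qed (use ab x \<kappa> in auto)
  then show ?thesis using d by blast
qed

text \<open>The interval has to end strictly before \<open>x\<close>, since \<open>U x\<close> and
  \<open>F x\<close> belong to the other side of a possible jump at \<open>x\<close>.\<close>

lemma left_estimate:
  assumes x: "0 < x" "x < T" and \<kappa>: "\<kappa> > 0"
  shows "\<exists>d>0. \<forall>a b. x - d < a \<longrightarrow> 0 \<le> a \<longrightarrow> a < b \<longrightarrow> b < x \<longrightarrow>
    F b - F a \<le> \<Psi>0 (U b - U a) + \<kappa> * (norm (U b - U a) + (b - a))"
proof -
  obtain \<eta> where \<eta>: "\<eta> > 0" "\<And>s v. s \<in> {0..T} \<Longrightarrow> \<bar>s - x\<bar> < \<eta> \<Longrightarrow> norm (v - Ul x) < \<eta> \<Longrightarrow>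
    norm (DE s v - DE x (Ul x)) < \<kappa> / 2 \<and> \<bar>dtE s v - dtE x (Ul x)\<bar> < \<kappa> / 2"
    using joint_neighbourhood[of x \<kappa> "Ul x"] x \<kappa> by auto
  have "\<forall>\<^sub>F z in at_left x. dist (w z) (Ul x) < \<eta> / 2"
    using lim_left(2)[of x] \<eta>(1) by (intro tendstoD) auto
  then obtain c where c: "c < x" "\<And>z. c < z \<Longrightarrow> z < x \<Longrightarrow> norm (w z - Ul x) < \<eta> / 2"
    unfolding eventually_at_left[OF x(1)] dist_norm by blast
  define d where "d = min (x - c) \<eta>"
  have d: "d > 0" using c(1) \<eta>(1) by (simp add: d_def)
  have "F b - F a \<le> \<Psi>0 (U b - U a) + \<kappa> * (norm (U b - U a) + (b - a))"
    if ab: "x - d < a" "0 \<le> a" "a < b" "b < x" for a b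
  proof (rule increment_estimate[where y="Ul x" and \<eta>=\<eta> and A="DE x (Ul x)" and q="dtE x (Ul x)"])
    have ac: "c < a" "x - \<eta> < a" using ab(1) by (auto simp: d_def)
    show "norm (DE s v - DE x (Ul x)) < \<kappa> / 2 \<and> \<bar>dtE s v - dtE x (Ul x)\<bar> < \<kappa> / 2"
      if "s \<in> {a..b}" "norm (v - Ul x) < \<eta>" for s v
      using that ab x ac by (intro \<eta>(2)) auto
    have "norm (U a - Ul x) \<le> \<eta> / 2" "norm (U b - Ul x) \<le> \<eta> / 2"
      using U_near[OF c(2), where x=a] U_near[OF c(2), where x=b] ab ac by auto
    then show "norm (U a - Ul x) < \<eta>" "norm (U b - Ul x) < \<eta>" using \<eta>(1) by linarith+
    show "norm (u s - Ul x) < \<eta>" if "s \<in> {a<..<b}" for s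
    proof -
      have "norm (w s - Ul x) < \<eta> / 2" using that ab ac by (intro c(2)) auto
      moreover have "w s = u s" using that ab x by (intro w_eq) auto
      ultimately show ?thesis using \<eta>(1) by simp
    qed
  qed (use ab x \<kappa> in auto)
  then show ?thesis using d by blast
qed

text \<open>The bound from above for the density integral is measure-theoretic, because
  \<open>V\<close> dominates the gauge of the derivative. The bound from below is where stability
  enters, through the local estimates with an error \<open>\<kappa>\<close> that is finally sent to
  0.\<close>

lemma dissipation:
  obtains S where "countable S" "disc \<subseteq> S"
    "\<And>t. 0 < t \<Longrightarrow> t \<le> T \<Longrightarrow> (\<integral>\<^sup>+s\<in>{0..t}. ennreal (\<Psi>0 (dens s)) \<partial>diffuse) = ennreal (measure V ({0<..<t} - S))"
proof -
  obtain S where S: "countable S" "disc \<subseteq> S" and sd: "sets diffuse = sets borel" and atom: "\<And>x. emeasure diffuse {x} = 0"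
    and di: "integrable diffuse dens" and dS: "\<And>A. A \<in> sets borel \<Longrightarrow> deriv_meas (A - S) = (LINT x:A|diffuse. dens x)"
    using diffuse_structure by blast
  interpret V: finite_measure V by (rule V_finite)
  obtain C where C: "\<And>v. \<Psi>0 v \<le> C * norm v" using gauge_bounds by auto
  have SB[measurable]: "S \<in> sets borel" by (rule sets.countable[OF _ S(1)]) simp
  have spd: "space diffuse = UNIV" by (simp add: diffuse_measure_def)
  define D where "D A = (LINT x:A|diffuse. \<Psi>0 (dens x))" for A
  have gi: "integrable diffuse (\<lambda>x. \<Psi>0 (dens x))" by (rule sublinear_integrable[OF gauge_sublinear C di])
  have gs: "set_integrable diffuse A (\<lambda>x. \<Psi>0 (dens x))" if "A \<in> sets borel" for A
    using that sd by (intro integrable_imp_set_integrable gi) simp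
  have ind: "\<Psi>0 (indicator A x *\<^sub>R dens x) = indicator A x *\<^sub>R \<Psi>0 (dens x)" for A x
    by (auto simp: indicator_def sublinear_zero[OF gauge_sublinear])
  have D_Un: "D (A \<union> A') = D A + D A'" if "A \<in> sets borel" "A' \<in> sets borel" "A \<inter> A' = {}" for A A'
    unfolding D_def using that by (intro set_integral_Un gs) auto
  have D_nonneg: "0 \<le> D A" for A
    unfolding D_def set_lebesgue_integral_def
    by (intro integral_nonneg_AE) (simp add: sublinear_nonneg[OF gauge_sublinear])
  have D_mono: "D A \<le> D A'" if "A \<in> sets borel" "A' \<in> sets borel" "A \<subseteq> A'" for A A'
  proof -
    have "A \<union> (A' - A) = A'" using that(3) by blast
    then show ?thesis using D_Un[of A "A' - A"] D_nonneg[of "A' - A"] that by simp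
  qed
  have Jensen: "\<Psi>0 (deriv_meas (A - S)) \<le> D A" if A: "A \<in> sets borel" for A
  proof -
    have i: "integrable diffuse (\<lambda>x. indicator A x *\<^sub>R dens x)" using A sd by (intro integrable_mult_indicator di) simp
    show ?thesis
      unfolding dS[OF A] D_def set_lebesgue_integral_def ind[symmetric]
      by (rule sublinear_Jensen[OF gauge_sublinear C i])
  qed
  \<comment> \<open>\<open>V\<close> dominates the gauge of the derivative on all Borel sets; its
    restriction to \<open>R\<close> takes the role of \<open>N\<close> in
    \<open>sublinear_integral_le_measure\<close>.\<close>
  have upper: "D A \<le> measure V (A \<inter> {0<..<T} - S)" if A: "A \<in> sets borel" for A
  proof -
    define R where "R = A \<inter> {0<..<T} - S"
    have R: "R \<in> sets borel" using A by (simp add: R_def)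
    define N where "N = density V (indicator R)"
    have sN: "sets N = sets borel" by (simp add: N_def)
    have eN: "emeasure N X = emeasure V (R \<inter> X)" if "X \<in> sets borel" for X
      unfolding N_def using that R by (intro emeasure_restricted) auto
    have mN: "measure N X = measure V (R \<inter> X)" if "X \<in> sets borel" for X
      using eN[OF that] by (simp add: measure_def)
    have i: "integrable diffuse (\<lambda>x. indicator A x *\<^sub>R dens x)" using A sd by (intro integrable_mult_indicator di) simp
    have "(LINT x|diffuse. \<Psi>0 (indicator A x *\<^sub>R dens x)) \<le> measure N (space N)"
    proof (rule sublinear_integral_le_measure[OF gauge_sublinear C i])
      have "space N = UNIV" by (simp add: N_def)
      then show "finite_measure N"
        by (intro finite_measureI) (use eN[of UNIV] in \<open>simp add: V.emeasure_eq_measure\<close>)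
      show "sets N = sets diffuse" using sN sd by simp
      fix X assume "X \<in> sets diffuse"
      then have X: "X \<in> sets borel" using sd by simp
      have "(LINT x:X|diffuse. indicator A x *\<^sub>R dens x) = (LINT x:X \<inter> A|diffuse. dens x)"
        unfolding set_lebesgue_integral_def by (simp add: indicator_inter_arith)
      also have "\<dots> = deriv_meas (X \<inter> A - S)" using X A by (intro dS[symmetric]) auto
      finally have "\<Psi>0 (LINT x:X|diffuse. indicator A x *\<^sub>R dens x) \<le> measure V ((X \<inter> A - S) \<inter> {0<..<T})"
        using gauge_deriv_meas[of "X \<inter> A - S"] X A by simp
      also have "(X \<inter> A - S) \<inter> {0<..<T} = R \<inter> X" by (auto simp: R_def)
      finally show "\<Psi>0 (LINT x:X|diffuse. indicator A x *\<^sub>R dens x) \<le> measure N X" using mN[OF X] by simp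
    qed
    also have "measure N (space N) = measure V R" using mN[of UNIV] by (simp add: N_def)
    finally show ?thesis unfolding ind D_def set_lebesgue_integral_def R_def .
  qed
  have V_diff_Un: "measure V ((A \<union> A') - S) = measure V (A - S) + measure V (A' - S)"
    if "A \<in> sets borel" "A' \<in> sets borel" "A \<inter> A' = {}" for A A'
  proof -
    have "(A \<union> A') - S = (A - S) \<union> (A' - S)" by blast
    then show ?thesis using that by (simp add: V.finite_measure_Union[of "A - S" "A' - S"] disjoint_iff)
  qed
  have V_point: "measure V ({x} - S) = 0" for x
  proof (cases "x \<in> S")
    case False
    then have "{x} - S = {x}" by blast
    then show ?thesis using False S(2) V_off_disc[of x] by auto
  qed simp
  \<comment> \<open>\<open>W\<close> bounds the error of a local estimate by replacing the norm of
    the increment with released energy over \<open>c0\<close>. It is additive over adjacent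
    intervals, so errors do not accumulate beyond \<open>\<kappa> * W\<close>.\<close>
  define W where "W a b = (F b - F a) / c0 + (b - a)" for a b
  have from_estimate: "measure V ({a<..b} - S) \<le> D {a<..b} + \<kappa> * W a b"
    if ab: "0 \<le> a" "a \<le> b" "b < T" and \<kappa>: "\<kappa> > 0"
      and est: "a < b \<Longrightarrow> F b - F a \<le> \<Psi>0 (U b - U a) + \<kappa> * (norm (U b - U a) + (b - a))" for a b \<kappa>
  proof (cases "a = b")
    case True
    then show ?thesis using D_nonneg[of "{}"] by (simp add: W_def)
  next
    case False
    then have lt: "a < b" using ab by simp
    \<comment> \<open>The increment also contains jumps at points of \<open>S\<close>. Their gauge
      is at most \<open>measure V (?I \<inter> S)\<close>, which is part of \<open>F b - F a\<close>
      as well; it cancels and leaves the part off \<open>S\<close>.\<close>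
    let ?I = "{a<..b}"
    have split: "(?I - S) \<union> (?I \<inter> S) = ?I" "(?I - S) \<inter> (?I \<inter> S) = {}" by auto
    have "\<Psi>0 (U b - U a) = \<Psi>0 (deriv_meas (?I - S) + deriv_meas (?I \<inter> S))"
      using vm_Un[OF deriv_meas_vm _ _ split(2)] deriv_meas_Ioc[OF ab] split(1) by simp
    also have "\<dots> \<le> \<Psi>0 (deriv_meas (?I - S)) + \<Psi>0 (deriv_meas (?I \<inter> S))" by (rule sublinear_add[OF gauge_sublinear])
    also have "\<dots> \<le> D ?I + measure V (?I \<inter> S)"
    proof (rule add_mono)
      show "\<Psi>0 (deriv_meas (?I - S)) \<le> D ?I" by (rule Jensen) simp
      have "\<Psi>0 (deriv_meas (?I \<inter> S)) \<le> measure V (?I \<inter> S \<inter> {0<..<T})" by (rule gauge_deriv_meas) simp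
      also have "\<dots> \<le> measure V (?I \<inter> S)" by (rule V.finite_measure_mono) auto
      finally show "\<Psi>0 (deriv_meas (?I \<inter> S)) \<le> measure V (?I \<inter> S)" .
    qed
    finally have 1: "\<Psi>0 (U b - U a) \<le> D ?I + measure V (?I \<inter> S)" .
    have "norm (U b - U a) \<le> (F b - F a) / c0"
      using norm_le_gauge[of "U b - U a"] divide_right_mono[OF U_majorant[OF ab(2)], of c0] c0(1) by simp
    then have 2: "\<kappa> * (norm (U b - U a) + (b - a)) \<le> \<kappa> * W a b"
      using \<kappa> unfolding W_def by (intro mult_left_mono) auto
    have 3: "F b - F a = measure V (?I - S) + measure V (?I \<inter> S)"
      using V_Ioc[OF ab(2)] V.finite_measure_Union[of "?I - S" "?I \<inter> S"] split by simp
    show ?thesis using est[OF lt] 1 2 3 by linarith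
  qed
  have W_add: "W a b + W b c = W a c" for a b c by (simp add: W_def add_divide_distrib[symmetric])
  have W_mono: "W a b \<le> W a c" if "b \<le> c" for a b c
    using F_mono[OF that] that c0(1) by (simp add: W_def divide_right_mono add_mono)
  \<comment> \<open>The local estimates are glued over \<open>{0<..b}\<close> by the Bolzano
    induction; the two sides of a point are joined by additivity.\<close>
  have glob: "measure V ({0<..b} - S) \<le> D {0<..b} + \<kappa> * W 0 b" if b: "0 \<le> b" "b < T" and \<kappa>: "\<kappa> > 0" for b \<kappa>
  proof -
    define P where "P a b \<longleftrightarrow> (0 \<le> a \<longrightarrow> b < T \<longrightarrow> measure V ({a<..b} - S) \<le> D {a<..b} + \<kappa> * W a b)" for a b
    have P_trans: "P a c" if "P a b" "P b c" "a \<le> b" "b \<le> c" for a b c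
      unfolding P_def
    proof (intro impI)
      assume ac: "0 \<le> a" "c < T"
      have I: "{a<..c} = {a<..b} \<union> {b<..c}" "{a<..b} \<inter> {b<..c} = {}" using that by auto
      have "measure V ({a<..c} - S) = measure V ({a<..b} - S) + measure V ({b<..c} - S)"
        unfolding I(1) by (rule V_diff_Un) (use I in auto)
      also have "\<dots> \<le> (D {a<..b} + \<kappa> * W a b) + (D {b<..c} + \<kappa> * W b c)"
        using that ac unfolding P_def by (intro add_mono) auto
      also have "\<dots> = D {a<..c} + \<kappa> * W a c"
        using D_Un[of "{a<..b}" "{b<..c}"] I W_add[of a b c, symmetric] by (simp add: distrib_left)
      finally show "measure V ({a<..c} - S) \<le> D {a<..c} + \<kappa> * W a c" .
    qed
    have "P 0 b"
      using b(1)
    proof (induction rule: Bolzano)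
      case (trans a b c)
      then show ?case using P_trans by blast
    next
      case (local x)
      then have x: "0 \<le> x" "x < T" using b by auto
      obtain d1 where d1: "d1 > 0" "\<And>a b. x \<le> a \<Longrightarrow> a < b \<Longrightarrow> b < x + d1 \<Longrightarrow> b < T \<Longrightarrow>
          F b - F a \<le> \<Psi>0 (U b - U a) + \<kappa> * (norm (U b - U a) + (b - a))"
        using right_estimate[OF x \<kappa>] by blast
      have right: "P x b" if "x \<le> b" "b < x + d1" for b
        unfolding P_def using that x \<kappa> d1(2)[of x b] by (intro impI from_estimate) auto
      have "\<exists>d>0. \<forall>a. x - d < a \<longrightarrow> a \<le> x \<longrightarrow> P a x"
      proof (cases "x = 0")
        \<comment> \<open>For \<open>a < 0\<close> the predicate \<open>P\<close> holds vacuously,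
          by its premise \<open>0 \<le> a\<close>.\<close>
        case True
        then have "P a x" if "a \<le> x" for a
          using that right[of x] d1(1) by (cases "a = x") (auto simp: P_def)
        then show ?thesis using zero_less_one by blast
      next
        case False
        then have x0: "0 < x" using x by simp
        obtain d2 where d2: "d2 > 0" "\<And>a b. x - d2 < a \<Longrightarrow> 0 \<le> a \<Longrightarrow> a < b \<Longrightarrow> b < x \<Longrightarrow>
            F b - F a \<le> \<Psi>0 (U b - U a) + \<kappa> * (norm (U b - U a) + (b - a))"
          using left_estimate[OF x0 x(2) \<kappa>] by blast
        have "P a x" if a: "x - d2 < a" "a \<le> x" for a
        proof (cases "a = x")
          case True
          then show ?thesis using right[of x] d1(1) by simp
        next
          case False
          then have ax: "a < x" using a by simp
          show ?thesis
            unfolding P_def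
          proof (intro impI)
            assume a0: "0 \<le> a"
            \<comment> \<open>The left estimate stops short of \<open>x\<close>, so
              \<open>{a<..<x}\<close> is exhausted from inside. The point \<open>x\<close> adds
              nothing, since \<open>V\<close> has no atoms off \<open>S\<close>.\<close>
            obtain s :: "nat \<Rightarrow> real" where s: "\<And>n. a \<le> s n" "\<And>n. s n < x" "filterlim s (at_left x) sequentially"
              "incseq (\<lambda>n. {a<..s n})" "(\<Union>n. {a<..s n}) = {a<..<x}"
              by (rule left_sequence[OF ax]) blast
            have "(\<lambda>n. measure V ({a<..s n} - S)) \<longlonglongrightarrow> measure V (\<Union>n. {a<..s n} - S)"
              by (rule V.finite_Lim_measure_incseq) (use s(4) in \<open>auto simp: incseq_def\<close>)
            moreover have "(\<Union>n. {a<..s n} - S) = {a<..<x} - S" using s(5) by blast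
            ultimately have lim: "(\<lambda>n. measure V ({a<..s n} - S)) \<longlonglongrightarrow> measure V ({a<..<x} - S)" by simp
            have "measure V ({a<..s n} - S) \<le> D {a<..x} + \<kappa> * W a x" for n
            proof -
              have "measure V ({a<..s n} - S) \<le> D {a<..s n} + \<kappa> * W a (s n)"
                using s(1,2)[of n] a a0 x \<kappa> by (intro from_estimate d2(2)) auto
              also have "\<dots> \<le> D {a<..x} + \<kappa> * W a x"
                using s(2)[of n] \<kappa> by (intro add_mono D_mono mult_left_mono W_mono) auto
              finally show ?thesis .
            qed
            then have "measure V ({a<..<x} - S) \<le> D {a<..x} + \<kappa> * W a x"
              using LIMSEQ_le_const2[OF lim] by blast
            moreover have "{a<..x} = {a<..<x} \<union> {x}" using ax by auto
            ultimately show "measure V ({a<..x} - S) \<le> D {a<..x} + \<kappa> * W a x"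
              using V_diff_Un[of "{a<..<x}" "{x}"] V_point[of x] by simp
          qed
        qed
        then show ?thesis using d2(1) by blast
      qed
      then obtain d2 where d2: "d2 > 0" "\<And>a. x - d2 < a \<Longrightarrow> a \<le> x \<Longrightarrow> P a x" by blast
      show ?case
      proof (intro exI[of _ "min d1 d2"] conjI allI impI)
        show "min d1 d2 > 0" using d1 d2 by simp
        fix a b assume "a \<le> x \<and> x \<le> b \<and> b - a < min d1 d2"
        then show "P a b" using right[of b] d2(2)[of a] by (intro P_trans[of a x b]) auto
      qed
    qed
    then show ?thesis using b by (simp add: P_def)
  qed
  have eq: "measure V ({0<..<t} - S) = D {0<..<t}" if t: "0 < t" "t \<le> T" for t
  proof (rule antisym)
    have "{0<..<t} \<inter> {0<..<T} = {0<..<t}" using t by auto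
    then show "D {0<..<t} \<le> measure V ({0<..<t} - S)" using upper[of "{0<..<t}"] by simp
    show "measure V ({0<..<t} - S) \<le> D {0<..<t}"
    proof (rule field_le_epsilon)
      fix e :: real assume e: "e > 0"
      have K: "0 \<le> W 0 t" using F_mono[of 0 t] t c0(1) by (simp add: W_def)
      define \<kappa> where "\<kappa> = e / (W 0 t + 1)"
      have \<kappa>: "\<kappa> > 0" using e K by (simp add: \<kappa>_def)
      obtain s :: "nat \<Rightarrow> real" where s: "\<And>n. 0 \<le> s n" "\<And>n. s n < t" "filterlim s (at_left t) sequentially"
        "incseq (\<lambda>n. {0<..s n})" "(\<Union>n. {0<..s n}) = {0<..<t}"
        by (rule left_sequence[OF t(1)]) blast
      have "(\<lambda>n. measure V ({0<..s n} - S)) \<longlonglongrightarrow> measure V (\<Union>n. {0<..s n} - S)"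
        by (rule V.finite_Lim_measure_incseq) (use s(4) in \<open>auto simp: incseq_def\<close>)
      moreover have "(\<Union>n. {0<..s n} - S) = {0<..<t} - S" using s(5) by blast
      ultimately have lim: "(\<lambda>n. measure V ({0<..s n} - S)) \<longlonglongrightarrow> measure V ({0<..<t} - S)" by simp
      have "measure V ({0<..s n} - S) \<le> D {0<..<t} + e" for n
      proof -
        have "measure V ({0<..s n} - S) \<le> D {0<..s n} + \<kappa> * W 0 (s n)"
          using s(1,2)[of n] t \<kappa> by (intro glob) auto
        also have "\<dots> \<le> D {0<..<t} + \<kappa> * W 0 t"
          using s(2)[of n] \<kappa> by (intro add_mono D_mono mult_left_mono W_mono) auto
        also have "\<kappa> * W 0 t \<le> \<kappa> * (W 0 t + 1)" using \<kappa> by (intro mult_left_mono) auto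
        also have "\<kappa> * (W 0 t + 1) = e" using K by (simp add: \<kappa>_def)
        finally show ?thesis by simp
      qed
      then show "measure V ({0<..<t} - S) \<le> D {0<..<t} + e" using LIMSEQ_le_const2[OF lim] by blast
    qed
  qed
  have "(\<integral>\<^sup>+s\<in>{0..t}. ennreal (\<Psi>0 (dens s)) \<partial>diffuse) = ennreal (measure V ({0<..<t} - S))" if t: "0 < t" "t \<le> T" for t
  proof -
    \<comment> \<open>The closed interval may be replaced by the open one here because the diffuse
      measure has no atoms; \<open>V\<close> may well charge the end points.\<close>
    have "AE s in diffuse. s \<notin> {0, t}"
    proof (rule AE_not_in)
      have "{0, t} = {0} \<union> {t}" by auto
      moreover have "{x} \<in> null_sets diffuse" for x using atom[of x] sd by (simp add: null_sets_def)
      ultimately show "{0, t} \<in> null_sets diffuse" by (metis null_sets.Un)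
    qed
    then have "AE s in diffuse. ennreal (\<Psi>0 (dens s)) * indicator {0..t} s = ennreal (indicator {0<..<t} s *\<^sub>R \<Psi>0 (dens s))"
      by eventually_elim (auto simp: indicator_def)
    then have "(\<integral>\<^sup>+s\<in>{0..t}. ennreal (\<Psi>0 (dens s)) \<partial>diffuse) = (\<integral>\<^sup>+s. ennreal (indicator {0<..<t} s *\<^sub>R \<Psi>0 (dens s)) \<partial>diffuse)"
      by (rule nn_integral_cong_AE)
    also have "\<dots> = ennreal (D {0<..<t})"
      unfolding D_def set_lebesgue_integral_def
      using gs[of "{0<..<t}"] unfolding set_integrable_def
      by (intro nn_integral_eq_integral) (auto simp: sublinear_nonneg[OF gauge_sublinear])
    finally show ?thesis by (simp add: eq[OF t])
  qed
  then show thesis using that S by blast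
qed

section \<open>The energy balance of BV solutions\<close>

abbreviation cost_in :: "real \<Rightarrow> ennreal" where "cost_in t \<equiv> finsler_cost p DE t (Ul t) (u t)"
abbreviation cost_out :: "real \<Rightarrow> ennreal" where "cost_out t \<equiv> finsler_cost p DE t (u t) (U t)"

definition diss :: "real \<Rightarrow> ennreal" where
  "diss t = (\<integral>\<^sup>+s\<in>{0..t}. ennreal (\<Psi>0 (dens s)) \<partial>diffuse)"

definition jump_cost :: "real \<Rightarrow> ennreal" where
  "jump_cost t = (\<Sum>\<^sub>\<infinity>s\<in>jump_set T u \<inter> {0<..<t}. cost_in s + cost_out s)"

lemma g_0: "g 0 = 0"
  using T_pos by (simp add: g_eq released_0)

lemma pseudo_var_0: "pseudo_var \<Psi>0 p DE T u 0 0 = 0"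
  by (simp add: pseudo_var_def)

lemma pseudo_var_eq:
  assumes t: "0 < t" "t \<le> T"
  shows "pseudo_var \<Psi>0 p DE T u 0 t = diss t + cost_out 0 + cost_in t + jump_cost t"
proof -
  have "(\<Sum>\<^sub>\<infinity>s\<in>jump_set T u \<inter> {0<..<t}.
      finsler_cost p DE s (left_lim u s) (u s) + finsler_cost p DE s (u s) (right_lim T u s)) = jump_cost t"
    unfolding jump_cost_def using t by (intro infsum_cong) (auto simp: left_lim_eq right_lim_eq)
  then show ?thesis
    using t T_pos by (simp add: pseudo_var_def diss_def left_lim_eq right_lim_eq)
qed

lemma diss_mono: "s \<le> t \<Longrightarrow> diss s \<le> diss t"
  unfolding diss_def by (intro nn_integral_mono mult_left_mono) (auto simp: indicator_def)

lemma off_jump_set: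
  assumes t: "t \<in> {0..T}" "t \<notin> jump_set T u"
  shows "cost_in t = 0" "cost_out t = 0" "Fl t = g t" "F t = g t"
proof -
  have e: "Ul t = u t" "U t = u t" using t jump_set_iff by metis+
  show "cost_in t = 0" "cost_out t = 0" unfolding e using energy_slice.cost_refl[OF energy_slice[OF t(1)]] by auto
  show "Fl t = g t" "F t = g t" using Fl_energy F_energy g_energy t(1) e by simp_all
qed

lemma jump_cost_step:
  assumes s: "0 < s" "s < t" "s \<le> T"
  shows "jump_cost s + (cost_in s + cost_out s) \<le> jump_cost t"
proof (cases "s \<in> jump_set T u")
  case True
  then show ?thesis
    unfolding jump_cost_def using s by (intro ennreal_infsum_insert_le) auto
next
  case False
  then have "cost_in s + cost_out s = 0" using off_jump_set[of s] s by simp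
  moreover have "jump_cost s \<le> jump_cost t"
    unfolding jump_cost_def using s by (intro ennreal_infsum_mono_set) auto
  ultimately show ?thesis by simp
qed

text \<open>Stability at almost every time is automatic for a local solution, and solving the
  balance for the pseudo-variation leaves exactly the released energy.\<close>

lemma BV_solution_iff:
  "BV_solution T E dtE DE \<Psi>0 p u \<longleftrightarrow> (\<forall>t\<in>{0..T}. pseudo_var \<Psi>0 p DE T u 0 t = ennreal (g t))"
proof -
  have "enn2ereal P + ereal (E t (u t)) = ereal (E 0 (u 0) + (LINT s:{0..t}|lborel. dtE s (u s))) \<longleftrightarrow> P = ennreal (g t)"
    if "t \<in> {0..T}" for P t
    using that g_bounds(1)[of t]
    by (cases P) (auto simp: g_energy work_def enn2ereal_ennreal)
  moreover have "AE t in lborel. t \<in> {0..T} - jump_set T u \<longrightarrow> - DE t (u t) \<in> stable_set \<Psi>0"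
    using stable by auto
  ultimately show ?thesis using BV by (simp add: BV_solution_def)
qed

text \<open>Balances at two times are compared. Letting \<open>s\<close> increase to
  \<open>t\<close> isolates the incoming cost, which is absent before \<open>t\<close>; letting
  \<open>b\<close> decrease to \<open>t\<close> isolates the outgoing cost, which enters the balance
  only after \<open>t\<close>.\<close>

lemma jump_costs_of_balance:
  assumes bal: "\<forall>t\<in>{0..T}. pseudo_var \<Psi>0 p DE T u 0 t = ennreal (g t)" and t: "t \<in> {0..T}"
  shows "cost_in t \<le> ennreal (g t - Fl t)" "cost_out t \<le> ennreal (F t - g t)"
proof -
  have pv: "diss s + cost_out 0 + cost_in s + jump_cost s = ennreal (g s)" if "0 < s" "s \<le> T" for s
    using bal pseudo_var_eq[OF that] that by auto
  have diff: "x \<le> g b - g a" if "ennreal (g a) + ennreal x \<le> ennreal (g b)" "0 \<le> x" for a b x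
    using that g_bounds(1)[of a] g_bounds(1)[of b] by (simp add: ennreal_plus[symmetric] del: ennreal_plus)
  have fin: "\<exists>x\<ge>0. c = ennreal x" if "c \<le> ennreal y" for c y
    using that by (cases c) (auto simp: top_unique)
  show "cost_in t \<le> ennreal (g t - Fl t)"
  proof (cases "t = 0")
    case True
    then have "Ul t = u t" using left_lim_eq[OF t] by (simp add: left_lim_def)
    then show ?thesis using energy_slice.cost_refl[OF energy_slice[OF t]] by simp
  next
    case False
    then have t0: "0 < t" "t \<le> T" using t by auto
    have "cost_in t \<le> ennreal (g t)" unfolding pv[OF t0, symmetric] by (simp add: add_increasing add_increasing2)
    then obtain x where x: "x \<ge> 0" "cost_in t = ennreal x" using fin by blast
    have "g s \<le> g t - x" if s: "0 < s" "s < t" for s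
    proof -
      \<comment> \<open>In the balance at \<open>t\<close> the incoming cost at \<open>s\<close> is
        absorbed in \<open>jump_cost t\<close>, while the incoming cost at \<open>t\<close> is new;
        the remaining terms have not decreased.\<close>
      have "ennreal (g s) + cost_in t = (diss s + cost_out 0 + cost_in t) + (jump_cost s + cost_in s)"
        using pv[of s] s t0 by (simp add: ac_simps)
      also have "\<dots> \<le> (diss t + cost_out 0 + cost_in t) + jump_cost t"
      proof (intro add_mono order_refl)
        have "jump_cost s + cost_in s \<le> jump_cost s + (cost_in s + cost_out s)" by (simp add: add_left_mono add_increasing2)
        also have "\<dots> \<le> jump_cost t" using s t0 by (intro jump_cost_step) auto
        finally show "jump_cost s + cost_in s \<le> jump_cost t" .
      qed (use s diss_mono in auto)
      also have "\<dots> = ennreal (g t)" by (rule pv[OF t0])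
      finally show ?thesis using diff[of s x t] x by simp
    qed
    then have "\<forall>\<^sub>F s in at_left t. g s \<le> g t - x"
      unfolding eventually_at_left[OF t0(1)] using t0 by blast
    then have "Fl t \<le> g t - x" using tendsto_upperbound[OF lim_left(1)] by fastforce
    then show ?thesis unfolding x(2) by (intro ennreal_leI) simp
  qed
  show "cost_out t \<le> ennreal (F t - g t)"
  proof (cases "t = T")
    case True
    then have "U t = u t" using right_lim_eq[OF t] by (simp add: right_lim_def)
    then show ?thesis using energy_slice.cost_refl[OF energy_slice[OF t]] by simp
  next
    case False
    then have t1: "0 \<le> t" "t < T" using t by auto
    have step: "ennreal (g t) + cost_out t \<le> ennreal (g b)" if b: "t < b" "b \<le> T" for b
    \<comment> \<open>At 0 the pseudo-variation is 0 by its convention for degenerate intervals, and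
      \<open>cost_out 0\<close> stands as a term of its own in every later balance.\<close>
    proof (cases "t = 0")
      case True
      have "cost_out 0 \<le> ennreal (g b)" using pv[of b, symmetric] b t1 by (simp add: add_increasing add_increasing2)
      then show ?thesis using True by (simp add: g_0)
    next
      case False
      then have t0: "0 < t" using t1 by simp
      have "ennreal (g t) + cost_out t = (diss t + cost_out 0) + (jump_cost t + (cost_in t + cost_out t))"
        using pv[of t] t0 t1 by (simp add: ac_simps)
      also have "\<dots> \<le> (diss b + cost_out 0 + cost_in b) + jump_cost b"
        using b t0 t1 by (intro add_mono jump_cost_step add_increasing2 diss_mono) auto
      also have "\<dots> = ennreal (g b)" using b t0 by (intro pv) auto
      finally show ?thesis .
    qed
    have "cost_out t \<le> ennreal (g T)"
      using step[of T] t1 by (meson add_increasing order_trans order_refl zero_le)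
    then obtain x where x: "x \<ge> 0" "cost_out t = ennreal x" using fin by blast
    have "g t + x \<le> g b" if "t < b" "b < T" for b
      using diff[of t x b] step[of b] that x by simp
    then have "\<forall>\<^sub>F b in at_right t. g t + x \<le> g b"
      unfolding eventually_at_right[OF t1(2)] using t1 by blast
    then have "g t + x \<le> F t" using tendsto_lowerbound[OF lim_right(1)] by fastforce
    then show ?thesis unfolding x(2) by (intro ennreal_leI) simp
  qed
qed

text \<open>The interval \<open>{0<..<t}\<close> splits into its part off \<open>S\<close>, the
  jumps, and the rest of \<open>S\<close>, which \<open>V\<close> does not charge because
  \<open>g\<close> is continuous where \<open>u\<close> does not jump.\<close>

lemma balance_of_jump_costs:
  assumes costs: "\<And>t. t \<in> jump_set T u \<Longrightarrow> cost_in t = ennreal (g t - Fl t) \<and> cost_out t = ennreal (F t - g t)"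
    and t: "t \<in> {0..T}"
  shows "pseudo_var \<Psi>0 p DE T u 0 t = ennreal (g t)"
proof (cases "t = 0")
  case True
  then show ?thesis by (simp add: pseudo_var_0 g_0)
next
  case False
  then have t0: "0 < t" "t \<le> T" using t by auto
  interpret V: finite_measure V by (rule V_finite)
  obtain S where S: "countable S" "disc \<subseteq> S" and diss: "diss t = ennreal (measure V ({0<..<t} - S))"
    using dissipation t0 unfolding diss_def by metis
  define J where "J = jump_set T u \<inter> {0<..<t}"
  have JS: "J \<subseteq> S" using jump_subset_disc S(2) by (auto simp: J_def)
  have cJ: "countable J" using JS S(1) countable_subset by blast
  have borel: "X \<in> sets V" if "countable X" for X
    by (rule sets.countable[OF _ that]) simp
  have single: "cost_in s + cost_out s = emeasure V {s}" if "s \<in> jump_set T u" for s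
    using costs[OF that] g_le_F[of s] Fl_le_g[of s]
    by (simp add: V.emeasure_eq_measure V_singleton ennreal_plus[symmetric] del: ennreal_plus)
  have "jump_cost t = (\<Sum>\<^sub>\<infinity>s\<in>J. emeasure V {s})"
    unfolding jump_cost_def J_def using single by (intro infsum_cong) auto
  also have "\<dots> = ennreal (measure V J)"
    using infsum_emeasure_singletons[OF cJ, of V] by (simp add: V.emeasure_eq_measure)
  finally have jc: "jump_cost t = ennreal (measure V J)" .
  \<comment> \<open>Only half of the atom at each end enters: the outgoing part at 0 and the
    incoming part at \<open>t\<close>. They complete \<open>Fl t - F 0\<close> to
    \<open>g t - g 0\<close>.\<close>
  have ends: "cost_out 0 = ennreal (F 0 - g 0)" "cost_in t = ennreal (g t - Fl t)"
    using costs[of 0] off_jump_set[of 0] costs[of t] off_jump_set[of t] t T_pos by fastforce+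
  have null: "measure V ({0<..<t} \<inter> S - J) = 0"
  proof -
    let ?N = "{0<..<t} \<inter> S - J"
    have cN: "countable ?N" using S(1) by (auto intro: countable_subset)
    have "emeasure V {x} = 0" if "x \<in> ?N" for x
      using that t0 off_jump_set[of x] by (auto simp: J_def V.emeasure_eq_measure V_singleton)
    then have "(\<Sum>\<^sub>\<infinity>x\<in>?N. emeasure V {x}) = (\<Sum>\<^sub>\<infinity>x\<in>?N. 0)" by (rule infsum_cong)
    then show ?thesis using infsum_emeasure_singletons[OF cN, of V] by (simp add: V.emeasure_eq_measure)
  qed
  have "Fl t - F 0 = measure V (({0<..<t} - S) \<union> (J \<union> ({0<..<t} \<inter> S - J)))"
  proof -
    have "({0<..<t} - S) \<union> (J \<union> ({0<..<t} \<inter> S - J)) = {0<..<t}" using JS by (auto simp: J_def)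
    then show ?thesis using V_Ioo[OF t0(1)] by simp
  qed
  also have "\<dots> = measure V ({0<..<t} - S) + measure V (J \<union> ({0<..<t} \<inter> S - J))"
    using borel[OF S(1)] borel[OF cJ] JS by (intro V.finite_measure_Union) auto
  also have "measure V (J \<union> ({0<..<t} \<inter> S - J)) = measure V J + measure V ({0<..<t} \<inter> S - J)"
    using borel[OF S(1)] borel[OF cJ] by (intro V.finite_measure_Union) auto
  finally have total: "measure V ({0<..<t} - S) + measure V J = Fl t - F 0" using null by simp
  have "pseudo_var \<Psi>0 p DE T u 0 t
      = ennreal (measure V ({0<..<t} - S)) + ennreal (F 0 - g 0) + ennreal (g t - Fl t) + ennreal (measure V J)"
    unfolding pseudo_var_eq[OF t0] diss jc ends ..
  also have "\<dots> = ennreal (measure V ({0<..<t} - S) + (F 0 - g 0) + (g t - Fl t) + measure V J)"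
    using g_le_F[of 0] Fl_le_g[of t] by (simp add: ennreal_plus[symmetric] del: ennreal_plus)
  also have "measure V ({0<..<t} - S) + (F 0 - g 0) + (g t - Fl t) + measure V J = g t"
    using total g_0 by simp
  finally show ?thesis .
qed

lemma jump_energies:
  assumes "t \<in> {0..T}"
  shows "E t (Ul t) - E t (u t) = g t - Fl t" "E t (u t) - E t (U t) = F t - g t"
  using assms by (simp_all add: g_energy F_energy Fl_energy)

text \<open>Exactness of both one-sided costs is converted by
  \<open>transition_through_point\<close> into one curve through \<open>u t\<close>; conversely, a
  transition through \<open>u t\<close> splits there into two exact costs by
  \<open>cost_through_point\<close>.\<close>

lemma BV_solution_iff_transitions:
  "BV_solution T E dtE DE \<Psi>0 p u \<longleftrightarrow>
    (\<forall>t\<in>jump_set T u. \<exists>\<theta>\<in>normalized_transitions E DE \<Psi>0 p t (left_lim u t) (right_lim T u t).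
      \<exists>r\<in>{0..1}. u t = \<theta> r)"
  unfolding BV_solution_iff
proof (intro iffI ballI)
  fix t assume bal: "\<forall>t\<in>{0..T}. pseudo_var \<Psi>0 p DE T u 0 t = ennreal (g t)" and J: "t \<in> jump_set T u"
  then have t: "t \<in> {0..T}" by (simp add: jump_set_def)
  have "\<exists>\<theta>\<in>normalized_transitions E DE \<Psi>0 p t (Ul t) (U t). \<exists>r\<in>{0..1}. u t = \<theta> r"
    using jump_costs_of_balance[OF bal t] jump_energies[OF t] jump_set_iff[OF t] J
    by (intro energy_slice.transition_through_point[OF energy_slice[OF t]]) auto
  then show "\<exists>\<theta>\<in>normalized_transitions E DE \<Psi>0 p t (left_lim u t) (right_lim T u t). \<exists>r\<in>{0..1}. u t = \<theta> r"
    using left_lim_eq[OF t] right_lim_eq[OF t] by simp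
next
  fix t assume tr: "\<forall>t\<in>jump_set T u. \<exists>\<theta>\<in>normalized_transitions E DE \<Psi>0 p t (left_lim u t) (right_lim T u t).
      \<exists>r\<in>{0..1}. u t = \<theta> r" and t: "t \<in> {0..T}"
  show "pseudo_var \<Psi>0 p DE T u 0 t = ennreal (g t)"
  proof (rule balance_of_jump_costs[OF _ t])
    fix s assume J: "s \<in> jump_set T u"
    then have s: "s \<in> {0..T}" by (simp add: jump_set_def)
    obtain \<theta> r where \<theta>: "optimal_transition E DE \<Psi>0 p s (Ul s) (U s) 0 1 \<theta>" and r: "r \<in> {0..1}" "u s = \<theta> r"
      using tr[rule_format, OF J] unfolding left_lim_eq[OF s] right_lim_eq[OF s] normalized_transitions_def by blast
    have ac: "abs_cont_on 0 1 \<theta>" and ends: "\<theta> 0 = Ul s" "\<theta> 1 = U s"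
      and eq: "ereal (E s (\<theta> 0) - E s (\<theta> 1)) = enn2ereal (finsler_length p DE s 0 1 \<theta>)"
      using \<theta> by (auto simp: optimal_transition_def)
    show "cost_in s = ennreal (g s - Fl s) \<and> cost_out s = ennreal (F s - g s)"
      using energy_slice.cost_through_point(1,2)[OF energy_slice[OF s] eq ac r(1)]
        jump_energies[OF s] ends r(2) by simp
  qed
qed

end

theorem theorem4p6:
  fixes T :: real
    and \<Psi>0 \<Psi> :: "'a::{banach, heine_borel, second_countable_topology} \<Rightarrow> real"
    and E dtE :: "real \<Rightarrow> 'a \<Rightarrow> real"
    and DE :: "real \<Rightarrow> 'a \<Rightarrow> ('a \<Rightarrow>\<^sub>L real)"
    and u :: "real \<Rightarrow> 'a"
  assumes finite_dimensional: "\<exists>B :: 'a set. finite B \<and> span B = UNIV"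
    and T_pos: "T > 0"
    and gauge: "gauge_potential \<Psi>0"
    and viscous: "viscous_potential \<Psi>"
    and vanishing_viscosity: "\<And>v. ((\<lambda>\<epsilon>. rescaled \<Psi> \<epsilon> v) \<longlongrightarrow> \<Psi>0 v) (at_right 0)"
    and C1: "C1_energy T E dtE DE"
    and bounds: "energy_bounds T E dtE"
    and local_sol: "local_solution T E dtE DE \<Psi>0 u"
  shows "(BV_solution T E dtE DE \<Psi>0 (contact_potential \<Psi>) u \<longleftrightarrow>
            (\<forall>t\<in>jump_set T u.
               \<exists>\<theta>\<in>normalized_transitions E DE \<Psi>0 (contact_potential \<Psi>) t
                     (left_lim u t) (right_lim T u t).
                 \<exists>r\<in>{0..1}. u t = \<theta> r)) \<and>
         (\<forall>t\<in>{0..T}. \<forall>um up \<theta>.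
            optimal_transition E DE \<Psi>0 (contact_potential \<Psi>) t um up 0 1 \<theta> \<longrightarrow>
            (AE r in lborel. r \<in> {0<..<1} \<longrightarrow>
               (vector_derivative \<theta> (at r), - DE t (\<theta> r)) \<in> contact_set (contact_potential \<Psi>)))"
proof -
  obtain B :: "'a set" and coord where c: "coordinates B coord"
    using coordinates_exist[OF finite_dimensional] by blast
  interpret local_setting B coord \<Psi>0 \<Psi> T E dtE DE u
    by (intro local_setting.intro potentials.intro c potentials_axioms.intro local_setting_axioms.intro)
      (fact gauge viscous vanishing_viscosity T_pos C1 local_sol)+
  show ?thesis
    using BV_solution_iff_transitions energy_slice.optimal_transition_contact[OF energy_slice] by blast
qed

end
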